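(* The sequence $(Y_n)_{n\geq1}$ defined in the context converges weakly to $Y$ in $(\mathcal{C}^\lambda(\mathbb{I}),\|\cdot\|_\lambda)$ for every $\lambda<\frac12$.
   Context: $\mathbb{I}:=[0,1]$; $\mathcal{C}^\lambda(\mathbb{I})$ is the $\lambda$-Hölder space with norm $\|f\|_\lambda:=\sup_{s\neq t}\frac{|f(t)-f(s)|}{|t-s|^\lambda}+\max_{t}|f(t)|$. $Y$ is the strong solution of $\mathrm{d}Y_t=b(Y_t)\mathrm{d}t+a(Y_t)\mathrm{d}W_t$, $Y_0\in\mathcal{D}_Y$ (state space, $\mathbb{R}$ or $\mathbb{R}_+$), $W$ a standard Brownian motion, where there are $C_b,C_a>0$ with $|b(x)-b(y)|\leq C_b|x-y|$ and $|a(x)-a(y)|\leq C_a\sqrt{|x-y|}$ for all $x,y\in\mathcal{D}_Y$. $(\zeta_i)_{i\geq1}$ is an iid sequence of centred random variables with finite moments of all orders and $\mathbb{E}[\zeta_1^2]=\sigma^2>0$. With $t_k:=k/n$, $Y_n(0)=Y_0$, $Y_n^k:=Y_n(t_k)$, define $Y_n(t):=Y_0+\frac1n\sum_{k=1}^{\lfloor nt\rfloor}b(Y_n^{k-1})+\frac{nt-\lfloor nt\rfloor}{n}b(Y_n^{\lfloor nt\rfloor})+\frac{1}{\sigma\sqrt n}\sum_{k=1}^{\lfloor nt\rfloor}a(Y_n^{k-1})\zeta_k+\frac{nt-\lfloor nt\rfloor}{\sigma\sqrt n}a(Y_n^{\lfloor nt\rfloor})\zeta_{\lfloor nt\rfloor+1}$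 for $t\in\mathbb{I}$.
   Formalization: The bounds on b and a are assumed on all of the real line rather than only on the state space, since for state space R_+ the scheme can leave R_+ where the coefficients are undefined (they are then extended, e.g. by a(max(x,0))); λ is taken positive. *)

theory Defs
  imports "HOL-Probability.Probability"
begin

definition hoelder_ratios :: "real \<Rightarrow> (real \<Rightarrow> real) \<Rightarrow> real set" where
  "hoelder_ratios l f =
     {\<bar>f t - f s\<bar> / \<bar>t - s\<bar> powr l | s t. s \<in> {0..1} \<and> t \<in> {0..1} \<and> s \<noteq> t}"

definition hoelder_norm :: "real \<Rightarrow> (real \<Rightarrow> real) \<Rightarrow> real" where
  "hoelder_norm l f = Sup (hoelder_ratios l f) + Sup ((\<lambda>t. \<bar>f t\<bar>) ` {0..1})"

definition hoelder_space :: "real \<Rightarrow> (real \<Rightarrow> real) set" where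
  "hoelder_space l = {f. continuous_on {0..1} f \<and> bdd_above (hoelder_ratios l f)}"

definition brownian_motion ::
  "'a measure \<Rightarrow> (real \<Rightarrow> 'a set set) \<Rightarrow> (real \<Rightarrow> 'a \<Rightarrow> real) \<Rightarrow> bool" where
  "brownian_motion M F W \<longleftrightarrow>
     (\<forall>t\<in>{0..1}. sigma_algebra (space M) (F t) \<and> F t \<subseteq> sets M) \<and>
     (\<forall>s t. 0 \<le> s \<longrightarrow> s \<le> t \<longrightarrow> t \<le> 1 \<longrightarrow> F s \<subseteq> F t) \<and>
     (\<forall>t\<in>{0..1}. \<forall>B\<in>sets borel. {\<omega>\<in>space M. W t \<omega> \<in> B} \<in> F t) \<and>
     (\<forall>\<omega>\<in>space M. W 0 \<omega> = 0 \<and> continuous_on {0..1} (\<lambda>t. W t \<omega>)) \<and>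
     (\<forall>s t. 0 \<le> s \<longrightarrow> s < t \<longrightarrow> t \<le> 1 \<longrightarrow>
        distributed M lborel (\<lambda>\<omega>. W t \<omega> - W s \<omega>)
          (\<lambda>x. ennreal (normal_density 0 (sqrt (t - s)) x)) \<and>
        (\<forall>A\<in>F s. \<forall>B\<in>sets borel.
           measure M (A \<inter> {\<omega>\<in>space M. W t \<omega> - W s \<omega> \<in> B})
             = measure M A * measure M {\<omega>\<in>space M. W t \<omega> - W s \<omega> \<in> B}))"

text \<open>Ito integral of a continuous adapted integrand H over [0,t]: limit in probability of
  left-point Riemann sums along dyadic partitions of [0,t].\<close>

definition ito_riemann_sum ::
  "(real \<Rightarrow> 'a \<Rightarrow> real) \<Rightarrow> (real \<Rightarrow> 'a \<Rightarrow> real) \<Rightarrow> real \<Rightarrow> nat \<Rightarrow> 'a \<Rightarrow> real" where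
  "ito_riemann_sum W H t m \<omega> =
     (\<Sum>k<2^m. H (t * real k / 2^m) \<omega> *
                (W (t * real (Suc k) / 2^m) \<omega> - W (t * real k / 2^m) \<omega>))"

definition ito_integral ::
  "'a measure \<Rightarrow> (real \<Rightarrow> 'a \<Rightarrow> real) \<Rightarrow> (real \<Rightarrow> 'a \<Rightarrow> real) \<Rightarrow> real \<Rightarrow> ('a \<Rightarrow> real) \<Rightarrow> bool" where
  "ito_integral M W H t I \<longleftrightarrow> I \<in> borel_measurable M \<and>
     (\<forall>\<epsilon>>0. (\<lambda>m. measure M {\<omega>\<in>space M. \<bar>ito_riemann_sum W H t m \<omega> - I \<omega>\<bar> > \<epsilon>})
               \<longlonglongrightarrow> 0)"

definition strong_solution ::
  "'a measure \<Rightarrow> (real \<Rightarrow> 'a set set) \<Rightarrow> (real \<Rightarrow> 'a \<Rightarrow> real) \<Rightarrow> (real \<Rightarrow> real) \<Rightarrow>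
   (real \<Rightarrow> real) \<Rightarrow> real \<Rightarrow> (real \<Rightarrow> 'a \<Rightarrow> real) \<Rightarrow> bool" where
  "strong_solution M F W a b y0 Y \<longleftrightarrow>
     (\<forall>t\<in>{0..1}. \<forall>B\<in>sets borel. {\<omega>\<in>space M. Y t \<omega> \<in> B} \<in> F t) \<and>
     (\<forall>\<omega>\<in>space M. continuous_on {0..1} (\<lambda>t. Y t \<omega>)) \<and>
     (\<forall>t\<in>{0..1}. \<exists>I. ito_integral M W (\<lambda>s \<omega>. a (Y s \<omega>)) t I \<and>
        (AE \<omega> in M. Y t \<omega> = y0 + integral {0..t} (\<lambda>s. b (Y s \<omega>)) + I \<omega>))"

fun euler_pts ::
  "(real \<Rightarrow> real) \<Rightarrow> (real \<Rightarrow> real) \<Rightarrow> real \<Rightarrow> (nat \<Rightarrow> 'b \<Rightarrow> real) \<Rightarrow> real \<Rightarrow> nat \<Rightarrow> nat \<Rightarrow> 'b \<Rightarrow> real" where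
  "euler_pts a b \<sigma> \<zeta> y0 n 0 \<omega> = y0"
| "euler_pts a b \<sigma> \<zeta> y0 n (Suc k) \<omega> =
     euler_pts a b \<sigma> \<zeta> y0 n k \<omega> + b (euler_pts a b \<sigma> \<zeta> y0 n k \<omega>) / real n
       + a (euler_pts a b \<sigma> \<zeta> y0 n k \<omega>) * \<zeta> (Suc k) \<omega> / (\<sigma> * sqrt (real n))"

definition euler_proc ::
  "(real \<Rightarrow> real) \<Rightarrow> (real \<Rightarrow> real) \<Rightarrow> real \<Rightarrow> (nat \<Rightarrow> 'b \<Rightarrow> real) \<Rightarrow> real \<Rightarrow> nat \<Rightarrow> 'b \<Rightarrow> real \<Rightarrow> real" where
  "euler_proc a b \<sigma> \<zeta> y0 n \<omega> t =
     (let m = nat \<lfloor>real n * t\<rfloor>; r = real n * t - of_int \<lfloor>real n * t\<rfloor>;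
          Yk = (\<lambda>k. euler_pts a b \<sigma> \<zeta> y0 n k \<omega>)
      in y0 + (1 / real n) * (\<Sum>k=1..m. b (Yk (k - 1))) + r / real n * b (Yk m)
         + 1 / (\<sigma> * sqrt (real n)) * (\<Sum>k=1..m. a (Yk (k - 1)) * \<zeta> k \<omega>)
         + r / (\<sigma> * sqrt (real n)) * a (Yk m) * \<zeta> (Suc m) \<omega>)"

end

(* The Yamada-Watanabe functions x arsinh(x/d) - sqrt(x^2 + d^2) + d have second derivative
   1/sqrt(x^2 + d^2), which compensates the square-root modulus of the diffusion coefficient: their
   expectation at the difference of two nearby schemes driven by the same noise stays bounded as d -> 0,
   while at every fixed nonzero point they tend to infinity. Hence the fine Euler scheme and Y are both
   uniformly close in probability, at grid points, to Euler schemes whose coefficients are frozen on m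
   coarse blocks. The coarse scheme is a continuous function of m block sums of the noise, to which the
   central limit theorem applies; this gives convergence of the finite-dimensional distributions.
   Increment moments of all orders and dyadic chaining confine the paths to Hoelder balls, on which, by
   Arzela-Ascoli, a Hoelder-continuous functional is uniformly approximated by its values at piecewise
   linear interpolations. *)

theory Submission
  imports Defs "HOL-Complex_Analysis.Great_Picard"
begin

section \<open>Moments of noise-driven recursions\<close>

text \<open>The square-root modulus rules out a Gronwall argument for second moments of differences:
  the squared difference of the diffusion terms is only of the order of the absolute difference. In
  the argument used instead, the source term does not vanish as \<delta> -> 0; it is beaten only
  because \<open>yw \<delta> \<theta>\<close> diverges, logarithmically, for fixed \<theta>. Hence
  convergence in probability without a rate, and residuals that have to be of order \<delta> in L2,
  because they enter divided by \<delta>. The solution and the schemes live on different probability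
  spaces and are never coupled. Brownian increments and the iid sequence are two instances of
  \<open>noise\<close>, whose constants depend on the moment bounds \<open>c\<close> and not on n;
  the two sides meet only in the law of a coarse scheme driven by m independent normal variables.
  The solution is known only through limits in probability of Riemann sums, without moment bounds.
  It is localised to events where it is bounded, and the tail bounds of its increments are inherited
  from the schemes through the finite-dimensional limit.\<close>

locale noise = prob_space P for P :: "'a measure" +
  fixes G :: "nat \<Rightarrow> 'a measure" and \<xi> :: "nat \<Rightarrow> 'a \<Rightarrow> real" and c :: "nat \<Rightarrow> real" and n :: nat
  assumes n_pos: "0 < n"
    and subalg: "\<And>k. k \<le> n \<Longrightarrow> subalgebra P (G k)"
    and filt_mono: "\<And>j k. j \<le> k \<Longrightarrow> k \<le> n \<Longrightarrow> sets (G j) \<subseteq> sets (G k)"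
    and noise_meas: "\<And>k. k < n \<Longrightarrow> \<xi> k \<in> borel_measurable (G (Suc k))"
    and noise_indep: "\<And>k A B. k < n \<Longrightarrow> A \<in> sets (G k) \<Longrightarrow> B \<in> sets borel \<Longrightarrow>
        prob (A \<inter> (\<xi> k -` B \<inter> space P)) = prob A * prob (\<xi> k -` B \<inter> space P)"
    and noise_int: "\<And>k q. k < n \<Longrightarrow> integrable P (\<lambda>\<omega>. \<bar>\<xi> k \<omega>\<bar> ^ q)"
    and noise_moment: "\<And>k q. k < n \<Longrightarrow> expectation (\<lambda>\<omega>. \<bar>\<xi> k \<omega>\<bar> ^ q) \<le> c q"
    and noise_mean: "\<And>k. k < n \<Longrightarrow> expectation (\<xi> k) = 0"
    and noise_var: "\<And>k. k < n \<Longrightarrow> expectation (\<lambda>\<omega>. (\<xi> k \<omega>)\<^sup>2) = 1"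
begin

lemma space_G: "k \<le> n \<Longrightarrow> space (G k) = space P"
  using subalg by (simp add: subalgebra_def)

lemma meas_P: "k \<le> n \<Longrightarrow> X \<in> borel_measurable (G k) \<Longrightarrow> X \<in> borel_measurable P"
  using measurable_from_subalg[OF subalg] by blast

lemma meas_mono: "j \<le> k \<Longrightarrow> k \<le> n \<Longrightarrow> X \<in> borel_measurable (G j) \<Longrightarrow> X \<in> borel_measurable (G k)"
  using filt_mono[of j k] space_G[of j] space_G[of k] unfolding measurable_def by auto

lemma noise_meas_P: "k < n \<Longrightarrow> \<xi> k \<in> borel_measurable P"
  by (meson noise_meas meas_P Suc_leI)

text \<open>The preimages of Borel sets under \<open>\<xi> k\<close> already form a sigma-algebra,
  and the one generated by \<open>X\<close> lies inside \<open>G k\<close>, so the product formula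
  for events assumed in the locale is independence of random variables.\<close>

lemma indep_past:
  fixes X :: "'a \<Rightarrow> real"
  assumes k: "k < n" and X: "X \<in> borel_measurable (G k)"
  shows "indep_var borel X borel (\<xi> k)"
proof -
  have 1: "sigma_sets (space P) {X -` A \<inter> space P |A. A \<in> sets borel} \<subseteq> sets (G k)"
  proof -
    have "{X -` A \<inter> space P |A. A \<in> sets borel} \<subseteq> sets (G k)"
      using X k measurable_sets[OF X] by (auto simp: space_G)
    then show ?thesis using sets.sigma_sets_subset[of _ "G k"] k by (simp add: space_G)
  qed
  have 2: "sigma_sets (space P) {\<xi> k -` A \<inter> space P |A. A \<in> sets borel}
      = {\<xi> k -` A \<inter> space P |A. A \<in> sets borel}"
    using sets.sigma_sets_eq[of "vimage_algebra (space P) (\<xi> k) borel"]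
    by (simp add: sets_vimage_algebra2)
  show ?thesis
    unfolding indep_var_eq indep_sets2_eq 2
    using 1 k subalg[of k] meas_P[OF _ X] noise_meas_P[OF k] noise_indep[OF k]
    by (auto simp: subalgebra_def)
qed

text \<open>Replaces conditional expectations: a factor known at time k is integrated separately
  from a function of the next noise variable. The identity as \<open>f\<close> removes martingale
  terms, the square replaces the squared noise by 1.\<close>

lemma expectation_past_mult:
  fixes X :: "'a \<Rightarrow> real" and f :: "real \<Rightarrow> real"
  assumes k: "k < n" and X: "X \<in> borel_measurable (G k)" and f: "f \<in> borel_measurable borel"
    and iX: "integrable P X" and iF: "integrable P (\<lambda>\<omega>. f (\<xi> k \<omega>))"
  shows "integrable P (\<lambda>\<omega>. X \<omega> * f (\<xi> k \<omega>))"
    "expectation (\<lambda>\<omega>. X \<omega> * f (\<xi> k \<omega>)) = expectation X * expectation (\<lambda>\<omega>. f (\<xi> k \<omega>))"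
proof -
  have "indep_var borel (id \<circ> X) borel (f \<circ> \<xi> k)"
    by (rule indep_var_compose[OF indep_past[OF k X]]) (use f in auto)
  then have i: "indep_var borel X borel (\<lambda>\<omega>. f (\<xi> k \<omega>))" by (simp add: comp_def)
  show "integrable P (\<lambda>\<omega>. X \<omega> * f (\<xi> k \<omega>))"
    by (rule indep_var_integrable[OF i iX iF])
  show "expectation (\<lambda>\<omega>. X \<omega> * f (\<xi> k \<omega>)) = expectation X * expectation (\<lambda>\<omega>. f (\<xi> k \<omega>))"
    by (rule indep_var_lebesgue_integral[OF i iX iF])
qed

end

section \<open>Power inequalities and the moment estimate for one step\<close>

lemma power_add_le_split:
  fixes a b :: real
  assumes "0 \<le> a" "0 \<le> b"
  shows "(a + b) ^ q \<le> 2 ^ q * (a ^ q + b ^ q)"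
proof -
  have "(a + b) ^ q \<le> (2 * max a b) ^ q" using assms by (intro power_mono) auto
  also have "\<dots> = 2 ^ q * max a b ^ q" by (simp add: power_mult_distrib)
  also have "max a b ^ q \<le> a ^ q + b ^ q" using assms by (auto simp: max_def)
  finally show ?thesis by simp
qed

lemma mult_powers_le:
  fixes d u :: real
  assumes "0 \<le> d" "0 \<le> u" "i \<le> q"
  shows "d ^ (q - i) * u ^ i \<le> d ^ q + u ^ q"
proof -
  have "d ^ (q - i) * u ^ i \<le> max d u ^ (q - i) * max d u ^ i"
    using assms by (intro mult_mono power_mono) auto
  also have "\<dots> = max d u ^ q" using assms by (simp flip: power_add)
  also have "\<dots> \<le> d ^ q + u ^ q" using assms by (auto simp: max_def)
  finally show ?thesis .
qed

text \<open>Binomial expansion in which the terms of order 0 and 1 are kept exactly, so that the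
  martingale part of \<open>h\<close> can be averaged out later. Each term of order i \<ge> 2
  carries a factor (sqrt L)^(-i) \<le> 1/L, and the binomial coefficients add up to 2^q.\<close>

lemma power_increment_le:
  fixes d h u v L :: real
  assumes q: "1 \<le> q" and u: "0 \<le> u" and v: "1 \<le> v" and L: "1 \<le> L" and h: "\<bar>h\<bar> \<le> u * v / sqrt L"
  shows "(d + h) ^ q \<le> d ^ q + real q * d ^ (q - 1) * h + 2 ^ q * (\<bar>d\<bar> ^ q + u ^ q) * v ^ q / L"
proof -
  have split: "{..q} = {0, 1} \<union> {2..q}" using q by auto
  have summand: "of_nat (q choose i) * h ^ i * d ^ (q - i) \<le> real (q choose i) * ((\<bar>d\<bar> ^ q + u ^ q) * v ^ q / L)"
    if i: "i \<in> {2..q}" for i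
  proof -
    have "h ^ i * d ^ (q - i) \<le> \<bar>h\<bar> ^ i * \<bar>d\<bar> ^ (q - i)"
      by (metis abs_ge_self abs_mult power_abs)
    also have "\<dots> \<le> (u * v / sqrt L) ^ i * \<bar>d\<bar> ^ (q - i)"
      using h by (intro mult_right_mono power_mono) auto
    also have "\<dots> = (\<bar>d\<bar> ^ (q - i) * u ^ i) * v ^ i * (1 / sqrt L ^ i)"
      by (simp add: power_mult_distrib power_divide)
    also have "\<dots> \<le> (\<bar>d\<bar> ^ q + u ^ q) * v ^ q * (1 / L)"
    proof (intro mult_mono)
      show "\<bar>d\<bar> ^ (q - i) * u ^ i \<le> \<bar>d\<bar> ^ q + u ^ q" using i u by (intro mult_powers_le) auto
      show "v ^ i \<le> v ^ q" using i v by (intro power_increasing) auto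
      have "sqrt L ^ 2 \<le> sqrt L ^ i" using i L by (intro power_increasing) auto
      then show "1 / sqrt L ^ i \<le> 1 / L" using L by (simp add: frac_le)
    qed (use u v L in auto)
    finally have "h ^ i * d ^ (q - i) \<le> (\<bar>d\<bar> ^ q + u ^ q) * v ^ q * (1 / L)" .
    then have "real (q choose i) * (h ^ i * d ^ (q - i)) \<le> real (q choose i) * ((\<bar>d\<bar> ^ q + u ^ q) * v ^ q * (1 / L))"
      by (intro mult_left_mono) auto
    then show ?thesis by (simp add: mult.assoc)
  qed
  have "(d + h) ^ q = (h + d) ^ q" by (simp add: add.commute)
  also have "\<dots> = (\<Sum>i\<le>q. of_nat (q choose i) * h ^ i * d ^ (q - i))" by (rule binomial_ring)
  also have "\<dots> = d ^ q + real q * d ^ (q - 1) * h + (\<Sum>i\<in>{2..q}. of_nat (q choose i) * h ^ i * d ^ (q - i))"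
    unfolding split by (subst sum.union_disjoint) auto
  also have "(\<Sum>i\<in>{2..q}. of_nat (q choose i) * h ^ i * d ^ (q - i))
     \<le> (\<Sum>i\<in>{2..q}. real (q choose i) * ((\<bar>d\<bar> ^ q + u ^ q) * v ^ q / L))"
    by (intro sum_mono summand)
  also have "\<dots> \<le> (\<Sum>i\<le>q. real (q choose i) * ((\<bar>d\<bar> ^ q + u ^ q) * v ^ q / L))"
    using u v L by (intro sum_mono2) auto
  also have "\<dots> = (\<Sum>i\<le>q. real (q choose i)) * ((\<bar>d\<bar> ^ q + u ^ q) * v ^ q / L)"
    by (rule sum_distrib_right[symmetric])
  also have "(\<Sum>i\<le>q. real (q choose i)) = 2 ^ q"
    using choose_row_sum[of q] by (metis of_nat_numeral of_nat_power of_nat_sum)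
  finally show ?thesis by (simp add: mult.assoc)
qed

text \<open>The summand 2p pays for the first-order drift term. The other is the sum 2^(2p) of the
  binomial coefficients times the bound 2^(2p) (1 + c (2p)) for the moment of 1 + |noise|.\<close>

definition step_const :: "(nat \<Rightarrow> real) \<Rightarrow> nat \<Rightarrow> real" where
  "step_const c p = real (2 * p) + 2 ^ (2 * p) * (2 ^ (2 * p) * (1 + c (2 * p)))"

context noise begin

lemma c_nonneg: "0 \<le> c q"
proof -
  have "0 \<le> expectation (\<lambda>\<omega>. \<bar>\<xi> 0 \<omega>\<bar> ^ q)" by simp
  then show ?thesis using noise_moment[of 0 q] n_pos by linarith
qed

lemma step_const_nonneg: "0 \<le> step_const c p"
  unfolding step_const_def using c_nonneg by auto

lemma integrable_one_plus_noise: "k < n \<Longrightarrow> integrable P (\<lambda>\<omega>. (1 + \<bar>\<xi> k \<omega>\<bar>) ^ q)"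
proof (rule Bochner_Integration.integrable_bound)
  assume k: "k < n"
  show "integrable P (\<lambda>\<omega>. 2 ^ q * (1 + \<bar>\<xi> k \<omega>\<bar> ^ q))" using noise_int[OF k] by auto
  show "(\<lambda>\<omega>. (1 + \<bar>\<xi> k \<omega>\<bar>) ^ q) \<in> borel_measurable P" using noise_meas_P[OF k] by measurable
  show "AE \<omega> in P. norm ((1 + \<bar>\<xi> k \<omega>\<bar>) ^ q) \<le> norm (2 ^ q * (1 + \<bar>\<xi> k \<omega>\<bar> ^ q))"
    using power_add_le_split[of 1 "\<bar>\<xi> k _\<bar>" q] by (intro AE_I2) (simp add: abs_mult)
qed

lemma expectation_one_plus_noise: "k < n \<Longrightarrow> expectation (\<lambda>\<omega>. (1 + \<bar>\<xi> k \<omega>\<bar>) ^ q) \<le> 2 ^ q * (1 + c q)"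
proof -
  assume k: "k < n"
  have "expectation (\<lambda>\<omega>. (1 + \<bar>\<xi> k \<omega>\<bar>) ^ q) \<le> expectation (\<lambda>\<omega>. 2 ^ q * (1 + \<bar>\<xi> k \<omega>\<bar> ^ q))"
    using power_add_le_split[of 1 "\<bar>\<xi> k _\<bar>" q] noise_int[OF k]
    by (intro integral_mono integrable_one_plus_noise k) auto
  also have "\<dots> = 2 ^ q * (1 + expectation (\<lambda>\<omega>. \<bar>\<xi> k \<omega>\<bar> ^ q))"
    using noise_int[OF k] by (simp add: prob_space)
  also have "\<dots> \<le> 2 ^ q * (1 + c q)" using noise_moment[OF k, of q] by simp
  finally show ?thesis .
qed

text \<open>The free scale \<open>L\<close> interpolates between the moment bound (\<open>L = n\<close>) and the increment
  bound over \<open>L\<close> steps, where the factor \<open>(L/n)^p\<close> is gained.\<close>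

lemma moment_step:
  fixes d \<alpha> \<beta> w :: "'a \<Rightarrow> real"
  assumes k: "k < n"
    and [measurable]: "d \<in> borel_measurable (G k)" "\<alpha> \<in> borel_measurable (G k)"
      "\<beta> \<in> borel_measurable (G k)" "w \<in> borel_measurable (G k)"
    and bd: "\<And>\<omega>. \<omega> \<in> space P \<Longrightarrow> \<bar>\<alpha> \<omega>\<bar> \<le> w \<omega>" "\<And>\<omega>. \<omega> \<in> space P \<Longrightarrow> \<bar>\<beta> \<omega>\<bar> \<le> w \<omega>"
    and id: "integrable P (\<lambda>\<omega>. d \<omega> ^ (2 * p))" and iw: "integrable P (\<lambda>\<omega>. w \<omega> ^ (2 * p))"
    and p: "1 \<le> p" and L: "1 \<le> L" "L \<le> real n"
  defines "e \<equiv> \<lambda>\<omega>. d \<omega> + \<beta> \<omega> / n + \<alpha> \<omega> * \<xi> k \<omega> / sqrt n"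
  shows "integrable P (\<lambda>\<omega>. e \<omega> ^ (2 * p))"
    and "expectation (\<lambda>\<omega>. e \<omega> ^ (2 * p)) \<le> expectation (\<lambda>\<omega>. d \<omega> ^ (2 * p)) +
      step_const c p / L * (expectation (\<lambda>\<omega>. d \<omega> ^ (2 * p)) + (L / n) ^ p * expectation (\<lambda>\<omega>. w \<omega> ^ (2 * p)))"
proof -
  define q where "q = 2 * p"
  have q: "1 \<le> q" "even q" using p by (auto simp: q_def)
  note [simp] = n_pos
  have np: "real n > 0" "L > 0" using L by auto
  \<comment> \<open>Rescales the weight: |h| \<le> w (1 + |\<xi>|) / sqrt n becomes (\<mu> w) (1 +
    |\<xi>|) / sqrt L, the form wanted by \<open>power_increment_le\<close>, and the power 2p of
    \<mu> is the gain (L/n)^p.\<close>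
  define \<mu> where "\<mu> = sqrt (L / n)"
  have \<mu>: "0 < \<mu>" "\<mu> \<le> 1" "\<mu> ^ q = (L / n) ^ p" "\<mu> / sqrt L = 1 / sqrt n" "1 / n \<le> \<mu> / L"
  proof -
    show "0 < \<mu>" "\<mu> \<le> 1" using L np by (auto simp: \<mu>_def)
    show "\<mu> ^ q = (L / n) ^ p" using L np by (simp add: \<mu>_def q_def power_mult)
    show *: "\<mu> / sqrt L = 1 / sqrt n" using L np by (simp add: \<mu>_def real_sqrt_divide)
    have "1 / n = (1 / sqrt n) * (1 / sqrt n)" by simp
    also have "\<dots> \<le> (\<mu> / sqrt L) * (1 / sqrt L)" unfolding * using L np by (intro mult_left_mono frac_le) auto
    also have "\<dots> = \<mu> / L" using L np by simp
    finally show "1 / n \<le> \<mu> / L" .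
  qed
  have wn: "0 \<le> w \<omega>" if "\<omega> \<in> space P" for \<omega> using bd(1)[OF that] by auto
  define D where "D \<omega> = d \<omega> ^ q + (\<mu> * w \<omega>) ^ q" for \<omega>
  have Dn: "0 \<le> D \<omega>" if "\<omega> \<in> space P" for \<omega>
    unfolding D_def using q wn[OF that] \<mu> by (intro add_nonneg_nonneg zero_le_power_eq[THEN iffD2]) auto
  have Dm [measurable]: "D \<in> borel_measurable (G k)" unfolding D_def by measurable
  have iD: "integrable P D" unfolding D_def power_mult_distrib using id iw by (auto simp: q_def)
  have ED: "expectation D = expectation (\<lambda>\<omega>. d \<omega> ^ q) + (L / n) ^ p * expectation (\<lambda>\<omega>. w \<omega> ^ q)"
    unfolding D_def power_mult_distrib \<mu>(3) using id iw by (simp add: q_def)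
  define V where "V \<omega> = (1 + \<bar>\<xi> k \<omega>\<bar>) ^ q" for \<omega>
  have iV: "integrable P V" unfolding V_def using integrable_one_plus_noise[OF k] .
  have DV: "integrable P (\<lambda>\<omega>. D \<omega> * V \<omega>)"
    "expectation (\<lambda>\<omega>. D \<omega> * V \<omega>) = expectation D * expectation V"
    using expectation_past_mult[OF k Dm, of "\<lambda>x. (1 + \<bar>x\<bar>) ^ q"] iD iV unfolding V_def by auto
  have EV: "expectation V \<le> 2 ^ q * (1 + c q)"
    unfolding V_def using expectation_one_plus_noise[OF k] .
  define T where "T \<omega> = d \<omega> ^ (q - 1) * w \<omega>" for \<omega>
  have Tb: "\<bar>d \<omega>\<bar> ^ (q - 1) * (\<mu> * w \<omega>) \<le> D \<omega>" if "\<omega> \<in> space P" for \<omega>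
    using mult_powers_le[of "\<bar>d \<omega>\<bar>" "\<mu> * w \<omega>" 1 q] q wn[OF that] \<mu> by (auto simp: D_def power_even_abs)
  have ddw: "\<bar>d \<omega> ^ (q - 1) * \<gamma> \<omega>\<bar> \<le> D \<omega> / \<mu>" if "\<omega> \<in> space P" "\<bar>\<gamma> \<omega>\<bar> \<le> w \<omega>" for \<omega> \<gamma>
  proof -
    have "\<bar>d \<omega> ^ (q - 1) * \<gamma> \<omega>\<bar> \<le> \<bar>d \<omega>\<bar> ^ (q - 1) * w \<omega>"
      using that by (auto simp: abs_mult power_abs intro!: mult_left_mono)
    also have "\<dots> = \<bar>d \<omega>\<bar> ^ (q - 1) * (\<mu> * w \<omega>) / \<mu>" using \<mu> by simp
    also have "\<dots> \<le> D \<omega> / \<mu>" using Tb[OF that(1)] \<mu> by (intro divide_right_mono) auto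
    finally show ?thesis .
  qed
  have idw: "integrable P (\<lambda>\<omega>. d \<omega> ^ (q - 1) * \<gamma> \<omega>)"
    if \<gamma>: "\<gamma> \<in> borel_measurable (G k)" "\<And>\<omega>. \<omega> \<in> space P \<Longrightarrow> \<bar>\<gamma> \<omega>\<bar> \<le> w \<omega>" for \<gamma>
  proof (rule Bochner_Integration.integrable_bound)
    show "integrable P (\<lambda>\<omega>. D \<omega> / \<mu>)" using iD by simp
    have [measurable]: "d \<in> borel_measurable P" "\<gamma> \<in> borel_measurable P"
      using meas_P[OF _ assms(2)] meas_P[OF _ \<gamma>(1)] k by simp_all
    show "(\<lambda>\<omega>. d \<omega> ^ (q - 1) * \<gamma> \<omega>) \<in> borel_measurable P" by measurable
    show "AE \<omega> in P. norm (d \<omega> ^ (q - 1) * \<gamma> \<omega>) \<le> norm (D \<omega> / \<mu>)"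
    proof (rule AE_I2)
      fix \<omega> assume \<omega>: "\<omega> \<in> space P"
      show "norm (d \<omega> ^ (q - 1) * \<gamma> \<omega>) \<le> norm (D \<omega> / \<mu>)"
        using ddw[of \<omega> \<gamma>, OF \<omega> \<gamma>(2)[OF \<omega>]] Dn[OF \<omega>] \<mu>(1) by simp
    qed
  qed
  have i\<alpha>: "integrable P (\<lambda>\<omega>. d \<omega> ^ (q - 1) * \<alpha> \<omega>)" by (rule idw[OF assms(3) bd(1)])
  have i\<beta>: "integrable P (\<lambda>\<omega>. d \<omega> ^ (q - 1) * \<beta> \<omega>)" by (rule idw[OF assms(4) bd(2)])
  have n1: "integrable P (\<xi> k)" using noise_int[OF k, of 1] integrable_abs_iff[OF noise_meas_P[OF k]] by simp
  have dm: "(\<lambda>\<omega>. d \<omega> ^ (q - 1) * \<alpha> \<omega>) \<in> borel_measurable (G k)" by measurable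
  have mart: "integrable P (\<lambda>\<omega>. d \<omega> ^ (q - 1) * \<alpha> \<omega> * \<xi> k \<omega>)"
     "expectation (\<lambda>\<omega>. d \<omega> ^ (q - 1) * \<alpha> \<omega> * \<xi> k \<omega>) = 0"
    using expectation_past_mult[OF k dm, of "\<lambda>x. x"] i\<alpha> n1 noise_mean[OF k] by auto
  define U where "U \<omega> = d \<omega> ^ q + (q / n) * (d \<omega> ^ (q - 1) * \<beta> \<omega>) + (q / sqrt n) * (d \<omega> ^ (q - 1) * \<alpha> \<omega> * \<xi> k \<omega>)
     + (2 ^ q / L) * (D \<omega> * V \<omega>)" for \<omega>
  have eU: "e \<omega> ^ q \<le> U \<omega>" if \<omega>: "\<omega> \<in> space P" for \<omega>
  proof -
    define h where "h = \<beta> \<omega> / n + \<alpha> \<omega> * \<xi> k \<omega> / sqrt n"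
    have sn: "sqrt n \<le> n" using L by (simp add: sqrt_le_D real_le_lsqrt power2_eq_square)
    have "\<bar>h\<bar> \<le> \<bar>\<beta> \<omega>\<bar> / n + \<bar>\<alpha> \<omega>\<bar> * \<bar>\<xi> k \<omega>\<bar> / sqrt n"
      unfolding h_def by (intro order_trans[OF abs_triangle_ineq]) (simp add: abs_mult)
    also have "\<dots> \<le> w \<omega> / sqrt n + w \<omega> * \<bar>\<xi> k \<omega>\<bar> / sqrt n"
      using bd[OF \<omega>] wn[OF \<omega>] sn np by (intro add_mono frac_le divide_right_mono mult_right_mono) auto
    also have "\<dots> = w \<omega> * (1 + \<bar>\<xi> k \<omega>\<bar>) * (1 / sqrt n)" by (simp add: field_simps)
    also have "\<dots> = (\<mu> * w \<omega>) * (1 + \<bar>\<xi> k \<omega>\<bar>) / sqrt L" unfolding \<mu>(4)[symmetric] by simp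
    finally have "(d \<omega> + h) ^ q \<le> d \<omega> ^ q + real q * d \<omega> ^ (q - 1) * h
        + 2 ^ q * (\<bar>d \<omega>\<bar> ^ q + (\<mu> * w \<omega>) ^ q) * (1 + \<bar>\<xi> k \<omega>\<bar>) ^ q / L"
      using q L wn[OF \<omega>] \<mu> by (intro power_increment_le) auto
    also have "\<bar>d \<omega>\<bar> ^ q = d \<omega> ^ q" using q by (simp add: power_even_abs)
    also have "d \<omega> ^ q + real q * d \<omega> ^ (q - 1) * h
        + 2 ^ q * (d \<omega> ^ q + (\<mu> * w \<omega>) ^ q) * (1 + \<bar>\<xi> k \<omega>\<bar>) ^ q / L = U \<omega>"
      unfolding U_def h_def D_def V_def by (simp add: algebra_simps add_divide_distrib)
    finally show ?thesis unfolding h_def e_def by (simp add: add.assoc)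
  qed
  have iU: "integrable P U" unfolding U_def using id i\<beta> mart DV by (auto simp: q_def)
  have em: "e \<in> borel_measurable P"
    unfolding e_def using meas_P[of k d] meas_P[of k \<beta>] meas_P[of k \<alpha>] k noise_meas_P[OF k] by auto
  have en: "0 \<le> e \<omega> ^ q" for \<omega> using q by (simp add: zero_le_power_eq)
  show ie: "integrable P (\<lambda>\<omega>. e \<omega> ^ (2 * p))"
    unfolding q_def[symmetric]
    by (rule Bochner_Integration.integrable_bound[OF iU]) (use em en eU in \<open>auto intro!: order_trans[OF _ abs_ge_self]\<close>)
  have "expectation (\<lambda>\<omega>. e \<omega> ^ q) \<le> expectation U"
    using ie iU eU by (intro integral_mono) (auto simp: q_def)
  also have "\<dots> = expectation (\<lambda>\<omega>. d \<omega> ^ q) + (q / n) * expectation (\<lambda>\<omega>. d \<omega> ^ (q - 1) * \<beta> \<omega>)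
      + (2 ^ q / L) * (expectation D * expectation V)"
    unfolding U_def using id i\<beta> mart DV by (simp add: q_def)
  \<comment> \<open>The drift is of order 1/n, and 1/n \<le> \<mu>/L brings it to the size D/L of
    the second-order terms.\<close>
  also have "(q / n) * expectation (\<lambda>\<omega>. d \<omega> ^ (q - 1) * \<beta> \<omega>) \<le> q * (\<mu> / L) * (expectation D / \<mu>)"
  proof -
    have "expectation (\<lambda>\<omega>. d \<omega> ^ (q - 1) * \<beta> \<omega>) \<le> expectation (\<lambda>\<omega>. D \<omega> / \<mu>)"
      using ddw[of _ \<beta>, OF _ bd(2)] by (intro integral_mono i\<beta>) (use iD in \<open>auto simp: abs_le_iff\<close>)
    then have "expectation (\<lambda>\<omega>. d \<omega> ^ (q - 1) * \<beta> \<omega>) \<le> expectation D / \<mu>" using iD by simp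
    moreover have "0 \<le> expectation D / \<mu>" using Dn \<mu> by (auto intro!: integral_nonneg_AE divide_nonneg_nonneg)
    ultimately have "(q / n) * expectation (\<lambda>\<omega>. d \<omega> ^ (q - 1) * \<beta> \<omega>) \<le> (q / n) * (expectation D / \<mu>)"
      by (intro mult_left_mono) auto
    also have "\<dots> = q * (1 / n) * (expectation D / \<mu>)" by simp
    also have "\<dots> \<le> q * (\<mu> / L) * (expectation D / \<mu>)"
      using \<mu>(5) \<open>0 \<le> expectation D / \<mu>\<close> by (intro mult_right_mono mult_left_mono) auto
    finally show ?thesis .
  qed
  also have "q * (\<mu> / L) * (expectation D / \<mu>) = q / L * expectation D" using \<mu> by simp
  also have "(2 ^ q / L) * (expectation D * expectation V) \<le> (2 ^ q / L) * (expectation D * (2 ^ q * (1 + c q)))"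
    using EV Dn L by (intro mult_left_mono integral_nonneg_AE) auto
  also have "expectation (\<lambda>\<omega>. d \<omega> ^ q) + q / L * expectation D + (2 ^ q / L) * (expectation D * (2 ^ q * (1 + c q)))
     = expectation (\<lambda>\<omega>. d \<omega> ^ q) + step_const c p / L * expectation D"
    using np unfolding step_const_def q_def[symmetric] by (simp add: field_simps)
  finally show "expectation (\<lambda>\<omega>. e \<omega> ^ (2 * p)) \<le> expectation (\<lambda>\<omega>. d \<omega> ^ (2 * p)) +
      step_const c p / L * (expectation (\<lambda>\<omega>. d \<omega> ^ (2 * p)) + (L / n) ^ p * expectation (\<lambda>\<omega>. w \<omega> ^ (2 * p)))"
    unfolding ED unfolding q_def by simp
qed

end

context noise begin

text \<open>A recursion of Euler type with arbitrary adapted coefficients and a common pathwise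
  bound \<open>w\<close> for both. Schemes, differences of schemes and stopped stochastic sums are
  instances, so one increment estimate serves them all.\<close>

definition driven :: "(nat \<Rightarrow> 'a \<Rightarrow> real) \<Rightarrow> (nat \<Rightarrow> 'a \<Rightarrow> real) \<Rightarrow> (nat \<Rightarrow> 'a \<Rightarrow> real) \<Rightarrow> (nat \<Rightarrow> 'a \<Rightarrow> real) \<Rightarrow> bool" where
  "driven x \<alpha> \<beta> w \<longleftrightarrow> x 0 \<in> borel_measurable (G 0) \<and>
     (\<forall>k<n. (\<forall>\<omega>. x (Suc k) \<omega> = x k \<omega> + \<beta> k \<omega> / n + \<alpha> k \<omega> * \<xi> k \<omega> / sqrt n) \<and>
        \<alpha> k \<in> borel_measurable (G k) \<and> \<beta> k \<in> borel_measurable (G k) \<and> w k \<in> borel_measurable (G k) \<and>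
        (\<forall>\<omega>\<in>space P. \<bar>\<alpha> k \<omega>\<bar> \<le> w k \<omega> \<and> \<bar>\<beta> k \<omega>\<bar> \<le> w k \<omega>))"

lemma drivenD:
  assumes "driven x \<alpha> \<beta> w" "k < n"
  shows "x (Suc k) = (\<lambda>\<omega>. x k \<omega> + \<beta> k \<omega> / n + \<alpha> k \<omega> * \<xi> k \<omega> / sqrt n)"
    "\<alpha> k \<in> borel_measurable (G k)" "\<beta> k \<in> borel_measurable (G k)" "w k \<in> borel_measurable (G k)"
    "\<And>\<omega>. \<omega> \<in> space P \<Longrightarrow> \<bar>\<alpha> k \<omega>\<bar> \<le> w k \<omega>" "\<And>\<omega>. \<omega> \<in> space P \<Longrightarrow> \<bar>\<beta> k \<omega>\<bar> \<le> w k \<omega>"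
  using assms unfolding driven_def by auto

lemma driven_adapted:
  assumes "driven x \<alpha> \<beta> w" "k \<le> n"
  shows "x k \<in> borel_measurable (G k)"
  using assms(2)
proof (induction k)
  case 0
  then show ?case using assms(1) by (simp add: driven_def)
next
  case (Suc k)
  then have k: "k < n" by simp
  note d = drivenD[OF assms(1) k]
  have m: "X \<in> borel_measurable (G (Suc k))" if "X \<in> borel_measurable (G k)" for X :: "'a \<Rightarrow> real"
    using meas_mono[OF _ Suc.prems that] by simp
  have [measurable]: "x k \<in> borel_measurable (G (Suc k))" "\<alpha> k \<in> borel_measurable (G (Suc k))"
    "\<beta> k \<in> borel_measurable (G (Suc k))" "\<xi> k \<in> borel_measurable (G (Suc k))"
    using m[OF Suc.IH] m[OF d(2)] m[OF d(3)] noise_meas[OF k] k by simp_all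
  show ?case unfolding d(1) by measurable
qed

text \<open>With the scale L = m - j each of the L steps multiplies the moment by 1 + \<kappa>/L.
  The total factor stays below exp \<kappa> whatever the number of steps, and the weight enters with
  the gain (L/n)^p.\<close>

lemma driven_increment_moment:
  assumes x: "driven x \<alpha> \<beta> w" and jm: "j < m" "m \<le> n" and p: "1 \<le> p"
    and iw: "\<And>k. k < n \<Longrightarrow> integrable P (\<lambda>\<omega>. w k \<omega> ^ (2 * p))"
    and B: "\<And>k. k < n \<Longrightarrow> expectation (\<lambda>\<omega>. w k \<omega> ^ (2 * p)) \<le> B"
  shows "integrable P (\<lambda>\<omega>. (x m \<omega> - x j \<omega>) ^ (2 * p))"
    and "expectation (\<lambda>\<omega>. (x m \<omega> - x j \<omega>) ^ (2 * p)) \<le> exp (step_const c p) * B * ((real m - real j) / n) ^ p"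
proof -
  define L where "L = real (m - j)"
  have L: "1 \<le> L" "L \<le> n" "L = real m - real j" using jm by (auto simp: L_def)
  define \<kappa> where "\<kappa> = step_const c p"
  have \<kappa>: "0 \<le> \<kappa>" using step_const_nonneg by (simp add: \<kappa>_def)
  have B0: "0 \<le> B"
  proof -
    have "0 \<le> expectation (\<lambda>\<omega>. w 0 \<omega> ^ (2 * p))" by (simp add: zero_le_power_eq)
    then show ?thesis using B[OF n_pos] by linarith
  qed
  define A where "A = (L / n) ^ p * B"
  have A: "0 \<le> A" using B0 L by (simp add: A_def)
  \<comment> \<open>The majorant ((1 + \<kappa>/L)^i - 1) A is the exact solution, started at 0, of
    the recursion that \<open>moment_step\<close> gives as an inequality.\<close>
  have *: "integrable P (\<lambda>\<omega>. (x (j + i) \<omega> - x j \<omega>) ^ (2 * p)) \<and>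
     expectation (\<lambda>\<omega>. (x (j + i) \<omega> - x j \<omega>) ^ (2 * p)) \<le> ((1 + \<kappa> / L) ^ i - 1) * A" if "j + i \<le> n" for i
    using that
  proof (induction i)
    case 0
    then show ?case using p by (simp add: power_0_left)
  next
    case (Suc i)
    then have k: "j + i < n" by simp
    note d = drivenD[OF x k]
    define \<Delta> where "\<Delta> \<omega> = x (j + i) \<omega> - x j \<omega>" for \<omega>
    have IH: "integrable P (\<lambda>\<omega>. \<Delta> \<omega> ^ (2 * p))" "expectation (\<lambda>\<omega>. \<Delta> \<omega> ^ (2 * p)) \<le> ((1 + \<kappa> / L) ^ i - 1) * A"
      using Suc by (auto simp: \<Delta>_def)
    have "x j \<in> borel_measurable (G (j + i))" "x (j + i) \<in> borel_measurable (G (j + i))"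
      using driven_adapted[OF x] k meas_mono[of j "j + i" "x j"] by auto
    then have "\<Delta> \<in> borel_measurable (G (j + i))" unfolding \<Delta>_def by measurable
    note s = moment_step[OF k this d(2,3,4) d(5,6) IH(1) iw[OF k] p L(1,2), folded \<kappa>_def]
    have e: "\<Delta> \<omega> + \<beta> (j + i) \<omega> / n + \<alpha> (j + i) \<omega> * \<xi> (j + i) \<omega> / sqrt n = x (j + Suc i) \<omega> - x j \<omega>" for \<omega>
      using d(1) by (simp add: \<Delta>_def)
    have "expectation (\<lambda>\<omega>. (x (j + Suc i) \<omega> - x j \<omega>) ^ (2 * p))
      \<le> expectation (\<lambda>\<omega>. \<Delta> \<omega> ^ (2 * p)) + \<kappa> / L * (expectation (\<lambda>\<omega>. \<Delta> \<omega> ^ (2 * p)) + (L / n) ^ p * expectation (\<lambda>\<omega>. w (j + i) \<omega> ^ (2 * p)))"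
      using s(2) unfolding e .
    also have "\<dots> \<le> ((1 + \<kappa> / L) ^ i - 1) * A + \<kappa> / L * (((1 + \<kappa> / L) ^ i - 1) * A + (L / n) ^ p * B)"
      using IH(2) B[OF k] \<kappa> L by (intro add_mono mult_left_mono) auto
    also have "\<dots> = ((1 + \<kappa> / L) ^ Suc i - 1) * A" unfolding A_def by (simp add: algebra_simps)
    finally show ?case using s(1) unfolding e by blast
  qed
  have "(1 + \<kappa> / L) ^ (m - j) \<le> exp (\<kappa> / L) ^ (m - j)"
    using exp_ge_add_one_self[of "\<kappa> / L"] \<kappa> L by (intro power_mono) auto
  also have "\<dots> = exp \<kappa>" using L by (simp flip: exp_of_nat_mult L_def)
  finally have "((1 + \<kappa> / L) ^ (m - j) - 1) * A \<le> exp \<kappa> * A" using A by (intro mult_right_mono) auto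
  then show "integrable P (\<lambda>\<omega>. (x m \<omega> - x j \<omega>) ^ (2 * p))"
     "expectation (\<lambda>\<omega>. (x m \<omega> - x j \<omega>) ^ (2 * p)) \<le> exp (step_const c p) * B * ((real m - real j) / n) ^ p"
    using *[of "m - j"] jm unfolding A_def \<kappa>_def L(3) by (auto simp: mult_ac)
qed

definition growth_const :: "nat \<Rightarrow> real \<Rightarrow> real \<Rightarrow> real" where
  "growth_const p K y0 = (1 + y0 ^ (2 * p)) * exp (step_const c p * (1 + 2 * (2 * K) ^ (2 * p)))"

text \<open>Here the scale is L = n. The weight contains the process itself at a delayed index, so
  the induction runs over all earlier times, and the majorant \<open>g\<close> is nondecreasing in
  order to absorb the delay.\<close>

lemma driven_moment:
  assumes x: "driven x \<alpha> \<beta> (\<lambda>k \<omega>. K * (1 + \<bar>x (\<kappa> k) \<omega>\<bar>))" and x0: "\<And>\<omega>. x 0 \<omega> = y0"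
    and \<kappa>: "\<And>k. \<kappa> k \<le> k" and K: "0 \<le> K" and k: "k \<le> n" and p: "1 \<le> p"
  shows "integrable P (\<lambda>\<omega>. x k \<omega> ^ (2 * p))"
    and "expectation (\<lambda>\<omega>. x k \<omega> ^ (2 * p)) \<le> growth_const p K y0"
proof -
  define s where "s = step_const c p"
  have s: "0 \<le> s" using step_const_nonneg by (simp add: s_def)
  define A where "A = s * (1 + 2 * (2 * K) ^ (2 * p))"
  have A: "0 \<le> A" using s K by (simp add: A_def)
  define g where "g k = (1 + y0 ^ (2 * p)) * (1 + A / n) ^ k" for k
  have g1: "1 \<le> g k" for k
    unfolding g_def using A by (intro mult_ge1_I one_le_power) (auto simp: zero_le_power_eq)
  have gm: "g j \<le> g k" if "j \<le> k" for j k
    unfolding g_def using A that by (intro mult_left_mono power_increasing) (auto simp: zero_le_power_eq)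
  have *: "integrable P (\<lambda>\<omega>. x k \<omega> ^ (2 * p)) \<and> expectation (\<lambda>\<omega>. x k \<omega> ^ (2 * p)) \<le> g k" if "k \<le> n" for k
    using that
  proof (induction k rule: less_induct)
    case (less k)
    show ?case
    proof (cases k)
      case 0
      then show ?thesis by (simp add: x0 g_def prob_space)
    next
      case (Suc i)
      then have i: "i < n" using less by simp
      note d = drivenD[OF x i]
      let ?w = "\<lambda>\<omega>. K * (1 + \<bar>x (\<kappa> i) \<omega>\<bar>)"
      have ki: "\<kappa> i \<le> i" "\<kappa> i < k" "i < k" using \<kappa>[of i] Suc by auto
      have IH: "integrable P (\<lambda>\<omega>. x i \<omega> ^ (2 * p))" "expectation (\<lambda>\<omega>. x i \<omega> ^ (2 * p)) \<le> g i"
        "integrable P (\<lambda>\<omega>. x (\<kappa> i) \<omega> ^ (2 * p))" "expectation (\<lambda>\<omega>. x (\<kappa> i) \<omega> ^ (2 * p)) \<le> g (\<kappa> i)"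
        using less.IH[of i] less.IH[of "\<kappa> i"] ki i by auto
      have wb: "?w \<omega> ^ (2 * p) \<le> (2 * K) ^ (2 * p) * (1 + x (\<kappa> i) \<omega> ^ (2 * p))" for \<omega>
      proof -
        have "?w \<omega> ^ (2 * p) \<le> K ^ (2 * p) * (2 ^ (2 * p) * (1 + \<bar>x (\<kappa> i) \<omega>\<bar> ^ (2 * p)))"
          unfolding power_mult_distrib using power_add_le_split[of 1 "\<bar>x (\<kappa> i) \<omega>\<bar>" "2 * p"] K
          by (intro mult_left_mono) auto
        then show ?thesis by (simp add: power_mult_distrib power_even_abs mult_ac)
      qed
      have wm: "?w \<in> borel_measurable P" using meas_P[OF _ d(4)] i by simp
      have iw: "integrable P (\<lambda>\<omega>. ?w \<omega> ^ (2 * p))"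
      proof (rule Bochner_Integration.integrable_bound)
        show "integrable P (\<lambda>\<omega>. (2 * K) ^ (2 * p) * (1 + x (\<kappa> i) \<omega> ^ (2 * p)))" using IH by auto
        show "(\<lambda>\<omega>. ?w \<omega> ^ (2 * p)) \<in> borel_measurable P" using wm by measurable
        show "AE \<omega> in P. norm (?w \<omega> ^ (2 * p)) \<le> norm ((2 * K) ^ (2 * p) * (1 + x (\<kappa> i) \<omega> ^ (2 * p)))"
          by (rule AE_I2) (smt (verit) wb real_norm_def even_mult_iff even_numeral zero_le_even_power)
      qed
      have "expectation (\<lambda>\<omega>. ?w \<omega> ^ (2 * p)) \<le> expectation (\<lambda>\<omega>. (2 * K) ^ (2 * p) * (1 + x (\<kappa> i) \<omega> ^ (2 * p)))"
        using wb IH iw by (intro integral_mono) auto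
      also have "\<dots> = (2 * K) ^ (2 * p) * (1 + expectation (\<lambda>\<omega>. x (\<kappa> i) \<omega> ^ (2 * p)))"
        using IH by (simp add: prob_space)
      also have "\<dots> \<le> (2 * K) ^ (2 * p) * (g i + g i)"
        using IH gm[of "\<kappa> i" i] ki g1[of i] K by (intro mult_left_mono add_mono) auto
      finally have Ew: "expectation (\<lambda>\<omega>. ?w \<omega> ^ (2 * p)) \<le> (2 * K) ^ (2 * p) * (2 * g i)" by simp
      have "1 \<le> real n" using n_pos by simp
      note st = moment_step[OF i driven_adapted[OF x] d(2,3,4) d(5,6) IH(1) iw p this order.refl, folded s_def d(1)]
      have "expectation (\<lambda>\<omega>. x (Suc i) \<omega> ^ (2 * p)) \<le> g i + s / n * (g i + (2 * K) ^ (2 * p) * (2 * g i))"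
      proof -
        have "expectation (\<lambda>\<omega>. x (Suc i) \<omega> ^ (2 * p)) \<le> expectation (\<lambda>\<omega>. x i \<omega> ^ (2 * p)) +
           s / n * (expectation (\<lambda>\<omega>. x i \<omega> ^ (2 * p)) + (real n / n) ^ p * expectation (\<lambda>\<omega>. ?w \<omega> ^ (2 * p)))"
          using st(2) i d(1) by simp
        also have "\<dots> \<le> g i + s / n * (g i + (2 * K) ^ (2 * p) * (2 * g i))"
          using IH Ew s n_pos by (intro add_mono mult_left_mono) auto
        finally show ?thesis .
      qed
      also have "\<dots> = g (Suc i)" unfolding g_def A_def by (simp add: algebra_simps add_divide_distrib)
      finally show ?thesis using st(1) i d(1) Suc by simp
    qed
  qed
  have "(1 + A / n) ^ k \<le> (1 + A / n) ^ n" using A k by (intro power_increasing) auto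
  also have "\<dots> \<le> exp (A / n) ^ n" using A exp_ge_add_one_self[of "A / n"] by (intro power_mono) auto
  also have "\<dots> = exp A" using n_pos by (simp flip: exp_of_nat_mult)
  finally have "g k \<le> growth_const p K y0" unfolding g_def growth_const_def A_def s_def
    by (intro mult_left_mono) (auto simp: zero_le_power_eq)
  then show "expectation (\<lambda>\<omega>. x k \<omega> ^ (2 * p)) \<le> growth_const p K y0"
    using conjunct2[OF *[OF k]] by linarith
  show "integrable P (\<lambda>\<omega>. x k \<omega> ^ (2 * p))"
    by (rule conjunct1[OF *[OF k]])
qed

end

section \<open>Calculus of the Yamada-Watanabe functions\<close>

definition yw :: "real \<Rightarrow> real \<Rightarrow> real" where
  "yw \<delta> x = x * arsinh (x / \<delta>) - sqrt (x\<^sup>2 + \<delta>\<^sup>2) + \<delta>"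

lemma arsinh_scaled_deriv:
  fixes \<delta> x :: real
  assumes "0 < \<delta>"
  shows "((\<lambda>x. arsinh (x / \<delta>)) has_real_derivative 1 / sqrt (x\<^sup>2 + \<delta>\<^sup>2)) (at x)"
proof -
  have "((\<lambda>x. arsinh (x / \<delta>)) has_real_derivative (1 / sqrt ((x / \<delta>)\<^sup>2 + 1)) * (1 / \<delta>)) (at x)"
    by (rule DERIV_chain2[OF arsinh_real_has_field_derivative]) (use assms in \<open>auto intro!: derivative_eq_intros\<close>)
  also have "(1 / sqrt ((x / \<delta>)\<^sup>2 + 1)) * (1 / \<delta>) = 1 / (sqrt ((x / \<delta>)\<^sup>2 + 1) * sqrt (\<delta>\<^sup>2))"
    using assms by (simp add: less_imp_le)
  also have "\<dots> = 1 / sqrt (x\<^sup>2 + \<delta>\<^sup>2)"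
    unfolding real_sqrt_mult[symmetric] using assms by (simp add: power_divide distrib_right)
  finally show ?thesis .
qed

lemma sum_sq_pos: "0 < \<delta> \<Longrightarrow> 0 < x\<^sup>2 + (\<delta>::real)\<^sup>2"
  by (simp add: add_nonneg_pos)

lemma yw_deriv:
  assumes "0 < \<delta>"
  shows "(yw \<delta> has_real_derivative arsinh (x / \<delta>)) (at x)"
proof -
  have s: "((\<lambda>x. sqrt (x\<^sup>2 + \<delta>\<^sup>2)) has_real_derivative x / sqrt (x\<^sup>2 + \<delta>\<^sup>2)) (at x)"
    using sum_sq_pos[OF assms, of x] by (auto intro!: derivative_eq_intros simp: field_simps)
  have "((\<lambda>x. x * arsinh (x / \<delta>) - sqrt (x\<^sup>2 + \<delta>\<^sup>2) + \<delta>) has_real_derivative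
      (1 * arsinh (x / \<delta>) + 1 / sqrt (x\<^sup>2 + \<delta>\<^sup>2) * x) - x / sqrt (x\<^sup>2 + \<delta>\<^sup>2) + 0) (at x)"
    by (intro DERIV_add DERIV_diff DERIV_mult DERIV_ident DERIV_const s arsinh_scaled_deriv assms)
  then show ?thesis by (simp add: yw_def[abs_def])
qed

lemma inverse_sqrt_deriv:
  fixes \<delta> x :: real
  assumes "0 < \<delta>"
  shows "((\<lambda>x. 1 / sqrt (x\<^sup>2 + \<delta>\<^sup>2)) has_real_derivative - x / (sqrt (x\<^sup>2 + \<delta>\<^sup>2) * (x\<^sup>2 + \<delta>\<^sup>2))) (at x)"
  using sum_sq_pos[OF assms, of x]
  by (auto intro!: derivative_eq_intros simp: field_simps power2_eq_square)

lemma abs_le_sqrt_sum: "\<bar>x\<bar> \<le> sqrt (x\<^sup>2 + (\<delta>::real)\<^sup>2)"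
  by (rule real_le_rsqrt) simp

text \<open>Taylor expansion with a remainder of order three: the third derivative -x / (x^2 +
  \<delta>^2)^(3/2) is at most 1/\<delta>^2 in modulus. The increment 0 is treated apart because the
  expansion is between two distinct points.\<close>

lemma yw_taylor:
  assumes \<delta>: "0 < \<delta>"
  shows "yw \<delta> (x + h) \<le> yw \<delta> x + arsinh (x / \<delta>) * h + 1 / sqrt (x\<^sup>2 + \<delta>\<^sup>2) * h\<^sup>2 / 2 + \<bar>h\<bar> ^ 3 / \<delta>\<^sup>2"
proof (cases "h = 0")
  case False
  \<comment> \<open>The successive derivatives; the default branch is the third one, the highest
    that occurs.\<close>
  define diff where "diff m = (case m of 0 \<Rightarrow> yw \<delta> | Suc 0 \<Rightarrow> (\<lambda>x. arsinh (x / \<delta>)) |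
     Suc (Suc 0) \<Rightarrow> (\<lambda>x. 1 / sqrt (x\<^sup>2 + \<delta>\<^sup>2)) | _ \<Rightarrow> (\<lambda>x. - x / (sqrt (x\<^sup>2 + \<delta>\<^sup>2) * (x\<^sup>2 + \<delta>\<^sup>2))))" for m :: nat
  have D: "\<forall>m t. m < 3 \<and> min x (x + h) \<le> t \<and> t \<le> max x (x + h) \<longrightarrow> DERIV (diff m) t :> diff (Suc m) t"
    using yw_deriv[OF \<delta>] arsinh_scaled_deriv[OF \<delta>] inverse_sqrt_deriv[OF \<delta>]
    by (auto simp: diff_def less_Suc_eq numeral_3_eq_3)
  have "\<exists>t. (if x + h < x then x + h < t \<and> t < x else x < t \<and> t < x + h) \<and>
     yw \<delta> (x + h) = (\<Sum>m<3. diff m x / fact m * (x + h - x) ^ m) + diff 3 t / fact 3 * (x + h - x) ^ 3"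
    by (rule Taylor[OF _ _ D]) (use False in \<open>auto simp: diff_def\<close>)
  then obtain t where t: "yw \<delta> (x + h) = (\<Sum>m<3. diff m x / fact m * h ^ m) + diff 3 t / fact 3 * h ^ 3"
    by auto
  have "\<bar>diff 3 t\<bar> \<le> 1 / \<delta>\<^sup>2"
  proof -
    have p: "0 < t\<^sup>2 + \<delta>\<^sup>2" using sum_sq_pos[OF \<delta>] .
    have "\<bar>diff 3 t\<bar> = (\<bar>t\<bar> / sqrt (t\<^sup>2 + \<delta>\<^sup>2)) * (1 / (t\<^sup>2 + \<delta>\<^sup>2))"
      using p by (simp add: diff_def numeral_3_eq_3 abs_mult)
    also have "\<dots> \<le> 1 * (1 / \<delta>\<^sup>2)"
      using p abs_le_sqrt_sum[of t \<delta>] \<delta> by (intro mult_mono frac_le) auto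
    finally show ?thesis by simp
  qed
  then have "\<bar>diff 3 t\<bar> * \<bar>h\<bar> ^ 3 \<le> 1 / \<delta>\<^sup>2 * \<bar>h\<bar> ^ 3" by (intro mult_right_mono) auto
  moreover have "diff 3 t / fact 3 * h ^ 3 \<le> \<bar>diff 3 t\<bar> * \<bar>h\<bar> ^ 3"
  proof -
    have "diff 3 t / fact 3 * h ^ 3 \<le> \<bar>diff 3 t / fact 3 * h ^ 3\<bar>" by (rule abs_ge_self)
    also have "\<dots> = \<bar>diff 3 t\<bar> * \<bar>h\<bar> ^ 3 / 6" by (simp add: abs_mult power_abs fact_numeral)
    also have "\<dots> \<le> \<bar>diff 3 t\<bar> * \<bar>h\<bar> ^ 3" by (simp add: mult_nonneg_nonneg)
    finally show ?thesis .
  qed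
  ultimately have "diff 3 t / fact 3 * h ^ 3 \<le> \<bar>h\<bar> ^ 3 / \<delta>\<^sup>2" by simp
  moreover have "(\<Sum>m<3. diff m x / fact m * h ^ m) = yw \<delta> x + arsinh (x / \<delta>) * h + 1 / sqrt (x\<^sup>2 + \<delta>\<^sup>2) * h\<^sup>2 / 2"
    by (simp add: numeral_3_eq_3 diff_def power2_eq_square)
  ultimately show ?thesis using t by linarith
qed auto

lemma arsinh_real_le: "0 \<le> x \<Longrightarrow> arsinh (x::real) \<le> x"
proof -
  assume x: "0 \<le> x"
  have "arsinh x - x \<le> arsinh 0 - 0"
  proof (rule DERIV_nonpos_imp_nonincreasing[OF x])
    fix y :: real
    have "((\<lambda>y. arsinh y - y) has_real_derivative 1 / sqrt (y\<^sup>2 + 1) - 1) (at y)"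
      by (auto intro!: derivative_eq_intros)
    moreover have "1 / sqrt (y\<^sup>2 + 1) - 1 \<le> 0" by (simp add: divide_le_eq_1 add_nonneg_pos)
    ultimately show "\<exists>D. ((\<lambda>y. arsinh y - y) has_real_derivative D) (at y) \<and> D \<le> 0" by blast
  qed
  then show ?thesis by simp
qed

lemma arsinh_real_nonneg: "0 \<le> x \<Longrightarrow> 0 \<le> arsinh (x::real)"
  using arsinh_real_neg_iff[of x] by linarith

lemma arsinh_real_abs: "\<bar>arsinh (x::real)\<bar> = arsinh \<bar>x\<bar>"
  using arsinh_real_nonneg[of x] arsinh_real_nonneg[of "- x"] by (auto simp: abs_if arsinh_minus_real)

lemma arsinh_real_abs_le: "\<bar>arsinh (x::real)\<bar> \<le> \<bar>x\<bar>"
  using arsinh_real_le[of "\<bar>x\<bar>"] by (simp add: arsinh_real_abs)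

lemma yw_abs: "0 < \<delta> \<Longrightarrow> yw \<delta> \<bar>x\<bar> = yw \<delta> x"
proof -
  assume d: "0 < \<delta>"
  have "yw \<delta> (- x) = yw \<delta> x" by (simp add: yw_def arsinh_minus_real)
  then show ?thesis by (simp add: abs_if)
qed

lemma yw_mono:
  assumes "0 < \<delta>" "0 \<le> x" "x \<le> y"
  shows "yw \<delta> x \<le> yw \<delta> y"
proof (rule DERIV_nonneg_imp_nondecreasing[OF assms(3)])
  fix z assume "x \<le> z" "z \<le> y"
  then show "\<exists>D. (yw \<delta> has_real_derivative D) (at z) \<and> 0 \<le> D"
    using assms by (intro exI[of _ "arsinh (z / \<delta>)"] conjI yw_deriv arsinh_real_nonneg) auto
qed

text \<open>The summand \<delta> in \<open>yw\<close> normalises the value at 0 to 0; evenness and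
  monotonicity on the positive axis do the rest.\<close>

lemma yw_nonneg: "0 < \<delta> \<Longrightarrow> 0 \<le> yw \<delta> x"
proof -
  assume d: "0 < \<delta>"
  have "yw \<delta> 0 = 0" using d by (simp add: yw_def)
  then show ?thesis using yw_mono[of \<delta> 0 "\<bar>x\<bar>"] yw_abs[of \<delta> x] d by simp
qed

lemma sqrt_sum_sq_le: "0 < \<delta> \<Longrightarrow> sqrt (x\<^sup>2 + \<delta>\<^sup>2) \<le> \<bar>x\<bar> + (\<delta>::real)"
  using sqrt_sum_squares_le_sum_abs[of x \<delta>] by simp

text \<open>Follows from sqrt (\<theta>^2 + \<delta>^2) \<le> \<theta> + \<delta>. For fixed
  \<theta> > 0 the left side grows like \<theta> log (1/\<delta>) as \<delta> -> 0; it is the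
  quantity by which Markov's inequality will divide.\<close>

lemma yw_lower:
  assumes "0 < \<delta>" "0 \<le> \<theta>"
  shows "\<theta> * (arsinh (\<theta> / \<delta>) - 1) \<le> yw \<delta> \<theta>"
  using sqrt_sum_sq_le[OF assms(1), of \<theta>] assms unfolding yw_def by (simp add: algebra_simps)

text \<open>Far from sharp near \<delta> = 0; its purpose is integrability of
  \<open>yw \<delta>\<close> along square-integrable variables.\<close>

lemma yw_upper:
  assumes "0 < \<delta>"
  shows "yw \<delta> x \<le> x\<^sup>2 / \<delta>"
proof -
  have "x * arsinh (x / \<delta>) \<le> \<bar>x\<bar> * \<bar>arsinh (x / \<delta>)\<bar>"
    using abs_ge_self[of "x * arsinh (x / \<delta>)"] unfolding abs_mult .
  also have "\<dots> \<le> \<bar>x\<bar> * \<bar>x / \<delta>\<bar>"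
    using arsinh_real_abs_le[of "x / \<delta>"] by (rule mult_left_mono) simp
  also have "\<dots> = x\<^sup>2 / \<delta>" using assms by (simp add: abs_divide power2_eq_square abs_mult_self_eq)
  finally have "x * arsinh (x / \<delta>) \<le> x\<^sup>2 / \<delta>" .
  moreover have "\<delta> \<le> sqrt (x\<^sup>2 + \<delta>\<^sup>2)" by (rule real_le_rsqrt) simp
  ultimately show ?thesis unfolding yw_def by linarith
qed

text \<open>The first derivative times a Lipschitz drift is bounded by the function itself plus |x|,
  which is what lets a Gronwall argument close.\<close>

lemma yw_drift:
  assumes "0 < \<delta>"
  shows "\<bar>x\<bar> * \<bar>arsinh (x / \<delta>)\<bar> \<le> yw \<delta> x + \<bar>x\<bar>"
proof -
  have "\<bar>x\<bar> * \<bar>arsinh (x / \<delta>)\<bar> = \<bar>x\<bar> * arsinh (\<bar>x\<bar> / \<delta>)"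
    using assms by (simp add: arsinh_real_abs abs_divide)
  also have "\<dots> \<le> yw \<delta> \<bar>x\<bar> + \<bar>x\<bar>"
    using sqrt_sum_sq_le[OF assms, of "\<bar>x\<bar>"] unfolding yw_def by simp
  finally show ?thesis using yw_abs[OF assms] by simp
qed

section \<open>Comparison of recursions by Yamada-Watanabe functions\<close>

lemma yw_measurable [measurable]: "0 < \<delta> \<Longrightarrow> yw \<delta> \<in> borel_measurable borel"
  by (intro borel_measurable_continuous_onI continuous_at_imp_continuous_on ballI DERIV_isCont[OF yw_deriv])

lemma arsinh_measurable [measurable]: "arsinh \<in> borel_measurable (borel :: real measure)"
  by (intro borel_measurable_continuous_onI continuous_on_arsinh)

lemma power_le_one_plus_power4:
  fixes w :: real assumes "0 \<le> w" "i \<le> 4" shows "w ^ i \<le> 1 + w ^ 4"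
proof (cases "w \<le> 1")
  case True
  then show ?thesis using power_le_one[of w i] assms zero_le_power[of w 4] by linarith
next
  case False
  then show ?thesis using power_increasing[of i 4 w] assms by linarith
qed

context noise begin

text \<open>Abstract difference of two schemes driven by the same noise. The remainder
  \<open>r\<close> collects what separates the arguments of the coefficients beyond
  \<open>D\<close>, namely residual and delay. The linear bound on the square of
  \<open>\<alpha>\<close> is the square-root modulus; \<rho> bounds \<open>r\<close> in L2 and
  \<open>B\<close> bounds the fourth moment of the weight.\<close>

definition yw_system :: "real \<Rightarrow> real \<Rightarrow> real \<Rightarrow> (nat \<Rightarrow> 'a \<Rightarrow> real) \<Rightarrow> (nat \<Rightarrow> 'a \<Rightarrow> real) \<Rightarrow>
    (nat \<Rightarrow> 'a \<Rightarrow> real) \<Rightarrow> (nat \<Rightarrow> 'a \<Rightarrow> real) \<Rightarrow> (nat \<Rightarrow> 'a \<Rightarrow> real) \<Rightarrow> bool" where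
  "yw_system C B \<rho> D \<alpha> \<beta> w r \<longleftrightarrow> driven D \<alpha> \<beta> w \<and> (\<forall>\<omega>. D 0 \<omega> = 0) \<and>
     (\<forall>k<n. (\<forall>\<omega>\<in>space P. \<bar>\<beta> k \<omega>\<bar> \<le> C * (\<bar>D k \<omega>\<bar> + r k \<omega>) \<and> (\<alpha> k \<omega>)\<^sup>2 \<le> C * (\<bar>D k \<omega>\<bar> + r k \<omega>) \<and> 0 \<le> r k \<omega>) \<and>
        integrable P (\<lambda>\<omega>. w k \<omega> ^ 4) \<and> expectation (\<lambda>\<omega>. w k \<omega> ^ 4) \<le> B \<and>
        r k \<in> borel_measurable P \<and>
        integrable P (\<lambda>\<omega>. (r k \<omega>)\<^sup>2) \<and> expectation (\<lambda>\<omega>. (r k \<omega>)\<^sup>2) \<le> \<rho>\<^sup>2)"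

lemma yw_systemD:
  assumes "yw_system C B \<rho> D \<alpha> \<beta> w r"
  shows "driven D \<alpha> \<beta> w" "D 0 \<omega> = 0"
    "k < n \<Longrightarrow> integrable P (\<lambda>\<omega>. w k \<omega> ^ 4)" "k < n \<Longrightarrow> expectation (\<lambda>\<omega>. w k \<omega> ^ 4) \<le> B"
    "k < n \<Longrightarrow> r k \<in> borel_measurable P" "k < n \<Longrightarrow> integrable P (\<lambda>\<omega>. (r k \<omega>)\<^sup>2)"
    "k < n \<Longrightarrow> expectation (\<lambda>\<omega>. (r k \<omega>)\<^sup>2) \<le> \<rho>\<^sup>2"
    "k < n \<Longrightarrow> \<omega> \<in> space P \<Longrightarrow> \<bar>\<beta> k \<omega>\<bar> \<le> C * (\<bar>D k \<omega>\<bar> + r k \<omega>)"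
    "k < n \<Longrightarrow> \<omega> \<in> space P \<Longrightarrow> (\<alpha> k \<omega>)\<^sup>2 \<le> C * (\<bar>D k \<omega>\<bar> + r k \<omega>)"
    "k < n \<Longrightarrow> \<omega> \<in> space P \<Longrightarrow> 0 \<le> r k \<omega>"
  using assms unfolding yw_system_def by blast+

text \<open>\<open>S\<close> bounds the moments of |D| up to order four. The summands are, in order:
  what drift and diffusion cause through |D|; what they cause through \<open>r\<close>, divided by
  \<delta> because the first two derivatives are only bounded by |x|/\<delta> and 1/\<delta>; the
  Taylor remainder together with the squared drift.\<close>

definition yw_source :: "real \<Rightarrow> real \<Rightarrow> real \<Rightarrow> real \<Rightarrow> real" where
  "yw_source C B \<rho> \<delta> = (let S = 1 + exp (step_const c 2) * B in
     2 * C * S + 2 * C * S * \<rho> / \<delta> + (1 + B) * (1 + 8 * (1 + c 3)) / (\<delta>\<^sup>2 * sqrt n))"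

text \<open>The second derivative \<open>H\<close> is at most 1/|D| and at most 1/\<delta>, hence H
  \<alpha>^2 \<le> C (H |D| + H r) \<le> C (1 + r/\<delta>): the singularity at 0 costs nothing
  except through the remainder. The first-order noise term has mean zero.\<close>

lemma yw_system_step:
  assumes sys: "yw_system C B \<rho> D \<alpha> \<beta> w r" and C: "0 < C" and \<rho>: "0 < \<rho>" and \<delta>: "0 < \<delta>" "\<delta> \<le> 1"
    and k: "k < n"
  shows "integrable P (\<lambda>\<omega>. yw \<delta> (D k \<omega>))" "integrable P (\<lambda>\<omega>. yw \<delta> (D (Suc k) \<omega>))"
    "expectation (\<lambda>\<omega>. yw \<delta> (D (Suc k) \<omega>)) \<le> expectation (\<lambda>\<omega>. yw \<delta> (D k \<omega>))
       + (C * expectation (\<lambda>\<omega>. yw \<delta> (D k \<omega>)) + yw_source C B \<rho> \<delta>) / n"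
proof -
  note Y = yw_systemD[OF sys]
  note dr = Y(1) and iw4 = Y(3) and Ew4 = Y(4) and bd = Y(8-10)[OF k] and r = Y(5-7)[OF k]
  note d = drivenD[OF dr k]
  define S where "S = 1 + exp (step_const c 2) * B"
  have B: "0 \<le> B"
  proof -
    have "0 \<le> expectation (\<lambda>\<omega>. w k \<omega> ^ 4)" by (intro integral_nonneg_AE) simp
    then show ?thesis using Ew4[OF k] by linarith
  qed
  have S: "1 \<le> S" using B by (simp add: S_def)
  \<comment> \<open>As \<open>D\<close> starts at 0, its fourth moment is the moment of an increment
    over at most n steps.\<close>
  have D4: "integrable P (\<lambda>\<omega>. D m \<omega> ^ 4) \<and> expectation (\<lambda>\<omega>. D m \<omega> ^ 4) \<le> exp (step_const c 2) * B" if "m \<le> n" for m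
  proof (cases m)
    case 0
    then show ?thesis using Y(2) B by simp
  next
    case (Suc i)
    have i: "integrable P (\<lambda>\<omega>. (D m \<omega> - D 0 \<omega>) ^ (2 * 2))"
      "expectation (\<lambda>\<omega>. (D m \<omega> - D 0 \<omega>) ^ (2 * 2)) \<le> exp (step_const c 2) * B * ((real m - real 0) / n) ^ 2"
      using driven_increment_moment[OF dr, of 0 m 2 B] iw4 Ew4 Suc that by auto
    have "((real m - real 0) / n) ^ 2 \<le> 1" using that n_pos by (intro power_le_one) auto
    then have "exp (step_const c 2) * B * ((real m - real 0) / n) ^ 2 \<le> exp (step_const c 2) * B * 1"
      using B by (intro mult_left_mono) auto
    then show ?thesis using i(1) order_trans[OF i(2)] by (simp add: Y(2))
  qed
  have kn: "k \<le> n" using k by simp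
  have DG: "D k \<in> borel_measurable (G k)" by (rule driven_adapted[OF dr kn])
  have DP: "D m \<in> borel_measurable P" if "m \<le> n" for m using driven_adapted[OF dr that] meas_P that by blast
  note DPk = DP[OF kn]
  have wP: "w k \<in> borel_measurable P" by (rule meas_P[OF kn d(4)])
  have \<alpha>P: "\<alpha> k \<in> borel_measurable P" by (rule meas_P[OF kn d(2)])
  have \<beta>P: "\<beta> k \<in> borel_measurable P" by (rule meas_P[OF kn d(3)])
  have \<xi>P: "\<xi> k \<in> borel_measurable P" by (rule noise_meas_P[OF k])
  have w0: "0 \<le> w k \<omega>" if "\<omega> \<in> space P" for \<omega> using d(5)[OF that] by linarith
  have iDp: "integrable P (\<lambda>\<omega>. \<bar>D m \<omega>\<bar> ^ i)" if "i \<le> 4" "m \<le> n" for i m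
  proof (rule Bochner_Integration.integrable_bound)
    show "integrable P (\<lambda>\<omega>. 1 + D m \<omega> ^ 4)" using D4[OF that(2)] by auto
    show "(\<lambda>\<omega>. \<bar>D m \<omega>\<bar> ^ i) \<in> borel_measurable P" using DP[OF that(2)] by measurable
    show "AE \<omega> in P. norm (\<bar>D m \<omega>\<bar> ^ i) \<le> norm (1 + D m \<omega> ^ 4)"
      using power_le_one_plus_power4[of "\<bar>D m _\<bar>" i] that by (intro AE_I2) simp
  qed
  have EDp: "expectation (\<lambda>\<omega>. \<bar>D k \<omega>\<bar> ^ i) \<le> S" if "i \<le> 4" for i
  proof -
    have "expectation (\<lambda>\<omega>. \<bar>D k \<omega>\<bar> ^ i) \<le> expectation (\<lambda>\<omega>. 1 + D k \<omega> ^ 4)"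
      using iDp[OF that kn] D4[OF kn] power_le_one_plus_power4[of "\<bar>D k _\<bar>" i] that
      by (intro integral_mono) auto
    also have "\<dots> \<le> S" using D4[OF kn] by (simp add: S_def prob_space)
    finally show ?thesis .
  qed
  have iwp: "integrable P (\<lambda>\<omega>. w k \<omega> ^ i)" if "i \<le> 4" for i
  proof (rule Bochner_Integration.integrable_bound)
    show "integrable P (\<lambda>\<omega>. 1 + w k \<omega> ^ 4)" using iw4[OF k] by auto
    show "(\<lambda>\<omega>. w k \<omega> ^ i) \<in> borel_measurable P" using wP by measurable
    show "AE \<omega> in P. norm (w k \<omega> ^ i) \<le> norm (1 + w k \<omega> ^ 4)"
      using power_le_one_plus_power4[of "w k _" i] that w0 by (intro AE_I2) simp
  qed
  have Ewp: "expectation (\<lambda>\<omega>. w k \<omega> ^ i) \<le> 1 + B" if "i \<le> 4" for i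
  proof -
    have "expectation (\<lambda>\<omega>. w k \<omega> ^ i) \<le> expectation (\<lambda>\<omega>. 1 + w k \<omega> ^ 4)"
      using iwp[OF that] iw4[OF k] power_le_one_plus_power4[of "w k _" i] that w0
      by (intro integral_mono) auto
    also have "\<dots> \<le> 1 + B" using iw4[OF k] Ew4[OF k] by (simp add: prob_space)
    finally show ?thesis .
  qed
  have iyw: "integrable P (\<lambda>\<omega>. yw \<delta> (D m \<omega>))" if "m \<le> n" for m
  proof (rule Bochner_Integration.integrable_bound)
    show "integrable P (\<lambda>\<omega>. \<bar>D m \<omega>\<bar> ^ 2 / \<delta>)" using iDp[OF _ that, of 2] by simp
    show "(\<lambda>\<omega>. yw \<delta> (D m \<omega>)) \<in> borel_measurable P" using DP[OF that] yw_measurable[OF \<delta>(1)] by measurable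
    show "AE \<omega> in P. norm (yw \<delta> (D m \<omega>)) \<le> norm (\<bar>D m \<omega>\<bar> ^ 2 / \<delta>)"
      using yw_upper[OF \<delta>(1)] yw_nonneg[OF \<delta>(1)] \<delta>(1) by (intro AE_I2) (simp add: abs_of_nonneg)
  qed
  show "integrable P (\<lambda>\<omega>. yw \<delta> (D k \<omega>))" "integrable P (\<lambda>\<omega>. yw \<delta> (D (Suc k) \<omega>))"
    using iyw k by auto
  define A where "A \<omega> = arsinh (D k \<omega> / \<delta>)" for \<omega>
  define H where "H \<omega> = 1 / sqrt ((D k \<omega>)\<^sup>2 + \<delta>\<^sup>2)" for \<omega>
  have AG: "A \<in> borel_measurable (G k)" unfolding A_def using DG by measurable
  have HG: "H \<in> borel_measurable (G k)" unfolding H_def using DG by measurable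
  have AP: "A \<in> borel_measurable P" by (rule meas_P[OF kn AG])
  have HP: "H \<in> borel_measurable P" by (rule meas_P[OF kn HG])
  have Ab: "\<bar>A \<omega>\<bar> \<le> \<bar>D k \<omega>\<bar> / \<delta>" for \<omega>
    unfolding A_def using arsinh_real_abs_le[of "D k \<omega> / \<delta>"] \<delta> by (simp add: abs_divide)
  have Hb: "0 \<le> H \<omega>" "H \<omega> \<le> 1 / \<delta>" "H \<omega> * \<bar>D k \<omega>\<bar> \<le> 1" for \<omega>
  proof -
    have p: "0 < sqrt ((D k \<omega>)\<^sup>2 + \<delta>\<^sup>2)" using sum_sq_pos[OF \<delta>(1)] by simp
    show "0 \<le> H \<omega>" using p by (simp add: H_def)
    have "\<delta> \<le> sqrt ((D k \<omega>)\<^sup>2 + \<delta>\<^sup>2)" by (rule real_le_rsqrt) simp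
    then show "H \<omega> \<le> 1 / \<delta>" unfolding H_def using \<delta> by (intro frac_le) auto
    show "H \<omega> * \<bar>D k \<omega>\<bar> \<le> 1" unfolding H_def using abs_le_sqrt_sum[of "D k \<omega>" \<delta>] p by (simp add: divide_le_eq)
  qed
  have iA: "integrable P (\<lambda>\<omega>. A \<omega> * \<gamma> \<omega>)"
    if \<gamma>: "\<gamma> \<in> borel_measurable P" "\<And>\<omega>. \<omega> \<in> space P \<Longrightarrow> \<bar>\<gamma> \<omega>\<bar> \<le> w k \<omega>" for \<gamma>
  proof (rule Bochner_Integration.integrable_bound)
    show "integrable P (\<lambda>\<omega>. (\<bar>D k \<omega>\<bar> ^ 2 + w k \<omega> ^ 2) / \<delta>)" using iDp[OF _ kn, of 2] iwp[of 2] by simp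
    show "(\<lambda>\<omega>. A \<omega> * \<gamma> \<omega>) \<in> borel_measurable P" using AP \<gamma>(1) by measurable
    show "AE \<omega> in P. norm (A \<omega> * \<gamma> \<omega>) \<le> norm ((\<bar>D k \<omega>\<bar> ^ 2 + w k \<omega> ^ 2) / \<delta>)"
    proof (rule AE_I2)
      fix \<omega> assume \<omega>: "\<omega> \<in> space P"
      have "norm (A \<omega> * \<gamma> \<omega>) \<le> \<bar>D k \<omega>\<bar> / \<delta> * w k \<omega>"
        unfolding norm_mult using Ab[of \<omega>] \<gamma>(2)[OF \<omega>] \<delta> by (intro mult_mono) auto
      also have "\<dots> = (\<bar>D k \<omega>\<bar> * w k \<omega>) / \<delta>" by simp
      also have "\<dots> \<le> (\<bar>D k \<omega>\<bar> ^ 2 + w k \<omega> ^ 2) / \<delta>"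
        using mult_powers_le[of "\<bar>D k \<omega>\<bar>" "w k \<omega>" 1 2] w0[OF \<omega>] \<delta> by (intro divide_right_mono) auto
      finally show "norm (A \<omega> * \<gamma> \<omega>) \<le> norm ((\<bar>D k \<omega>\<bar> ^ 2 + w k \<omega> ^ 2) / \<delta>)" using \<delta>(1) by simp
    qed
  qed
  note i\<alpha> = iA[OF \<alpha>P d(5)] and i\<beta> = iA[OF \<beta>P d(6)]
  have iH: "integrable P (\<lambda>\<omega>. H \<omega> * (\<gamma> \<omega>)\<^sup>2)"
    if \<gamma>: "\<gamma> \<in> borel_measurable P" "\<And>\<omega>. \<omega> \<in> space P \<Longrightarrow> \<bar>\<gamma> \<omega>\<bar> \<le> w k \<omega>" for \<gamma>
  proof (rule Bochner_Integration.integrable_bound)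
    show "integrable P (\<lambda>\<omega>. 1 / \<delta> * w k \<omega> ^ 2)" using iwp[of 2] by simp
    show "(\<lambda>\<omega>. H \<omega> * (\<gamma> \<omega>)\<^sup>2) \<in> borel_measurable P" using HP \<gamma>(1) by measurable
    show "AE \<omega> in P. norm (H \<omega> * (\<gamma> \<omega>)\<^sup>2) \<le> norm (1 / \<delta> * w k \<omega> ^ 2)"
    proof (rule AE_I2)
      fix \<omega> assume \<omega>: "\<omega> \<in> space P"
      have "(\<gamma> \<omega>)\<^sup>2 \<le> (w k \<omega>)\<^sup>2" using \<gamma>(2)[OF \<omega>] w0[OF \<omega>] by (simp add: abs_le_square_iff[symmetric])
      then have "H \<omega> * (\<gamma> \<omega>)\<^sup>2 \<le> 1 / \<delta> * w k \<omega> ^ 2" using Hb[of \<omega>] \<delta> by (intro mult_mono) auto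
      then show "norm (H \<omega> * (\<gamma> \<omega>)\<^sup>2) \<le> norm (1 / \<delta> * w k \<omega> ^ 2)" using Hb(1)[of \<omega>] \<delta> by simp
    qed
  qed
  note iH\<alpha> = iH[OF \<alpha>P d(5)] and iH\<beta> = iH[OF \<beta>P d(6)]
  have n1: "integrable P (\<xi> k)" using noise_int[OF k, of 1] integrable_abs_iff[OF noise_meas_P[OF k]] by simp
  have n2: "integrable P (\<lambda>\<omega>. (\<xi> k \<omega>)\<^sup>2)" using noise_int[OF k, of 2] by simp
  have AG\<alpha>: "(\<lambda>\<omega>. A \<omega> * \<alpha> k \<omega>) \<in> borel_measurable (G k)" using AG d(2) by measurable
  have mart: "integrable P (\<lambda>\<omega>. A \<omega> * \<alpha> k \<omega> * \<xi> k \<omega>)"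
     "expectation (\<lambda>\<omega>. A \<omega> * \<alpha> k \<omega> * \<xi> k \<omega>) = 0"
    using expectation_past_mult[OF k AG\<alpha>, of "\<lambda>x. x"] i\<alpha> n1 noise_mean[OF k] by auto
  have HG\<alpha>: "(\<lambda>\<omega>. H \<omega> * (\<alpha> k \<omega>)\<^sup>2) \<in> borel_measurable (G k)" using HG d(2) by measurable
  have quad: "integrable P (\<lambda>\<omega>. H \<omega> * (\<alpha> k \<omega>)\<^sup>2 * (\<xi> k \<omega>)\<^sup>2)"
     "expectation (\<lambda>\<omega>. H \<omega> * (\<alpha> k \<omega>)\<^sup>2 * (\<xi> k \<omega>)\<^sup>2) = expectation (\<lambda>\<omega>. H \<omega> * (\<alpha> k \<omega>)\<^sup>2)"
    using expectation_past_mult[OF k HG\<alpha>, of "\<lambda>x. x\<^sup>2"] iH\<alpha> n2 noise_var[OF k] by auto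
  have w3: "(\<lambda>\<omega>. w k \<omega> ^ 3) \<in> borel_measurable (G k)" using d(4) by measurable
  have cub: "integrable P (\<lambda>\<omega>. w k \<omega> ^ 3 * (1 + \<bar>\<xi> k \<omega>\<bar>) ^ 3)"
     "expectation (\<lambda>\<omega>. w k \<omega> ^ 3 * (1 + \<bar>\<xi> k \<omega>\<bar>) ^ 3) \<le> (1 + B) * (8 * (1 + c 3))"
  proof -
    note e = expectation_past_mult[OF k w3, of "\<lambda>x. (1 + \<bar>x\<bar>) ^ 3", OF _ iwp integrable_one_plus_noise[OF k]]
    show "integrable P (\<lambda>\<omega>. w k \<omega> ^ 3 * (1 + \<bar>\<xi> k \<omega>\<bar>) ^ 3)" using e(1) by simp
    have "expectation (\<lambda>\<omega>. w k \<omega> ^ 3 * (1 + \<bar>\<xi> k \<omega>\<bar>) ^ 3) = expectation (\<lambda>\<omega>. w k \<omega> ^ 3) * expectation (\<lambda>\<omega>. (1 + \<bar>\<xi> k \<omega>\<bar>) ^ 3)"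
      using e(2) by simp
    also have "\<dots> \<le> (1 + B) * (8 * (1 + c 3))"
      using Ewp[of 3] expectation_one_plus_noise[OF k, of 3] B
      by (intro mult_mono integral_nonneg_AE) auto
    finally show "expectation (\<lambda>\<omega>. w k \<omega> ^ 3 * (1 + \<bar>\<xi> k \<omega>\<bar>) ^ 3) \<le> (1 + B) * (8 * (1 + c 3))" .
  qed
  have sn: "0 < sqrt n" "sqrt n * sqrt n = n" "sqrt n \<le> n" "1 \<le> real n"
  proof -
    show "1 \<le> real n" using n_pos by simp
    then show "sqrt n \<le> n" by (simp add: real_le_lsqrt power2_eq_square)
  qed (use n_pos in auto)
  define U where "U \<omega> = yw \<delta> (D k \<omega>) + (1 / n) * (A \<omega> * \<beta> k \<omega>) + (1 / sqrt n) * (A \<omega> * \<alpha> k \<omega> * \<xi> k \<omega>)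
     + (1 / (real n)\<^sup>2) * (H \<omega> * (\<beta> k \<omega>)\<^sup>2) + (1 / n) * (H \<omega> * (\<alpha> k \<omega>)\<^sup>2 * (\<xi> k \<omega>)\<^sup>2)
     + (1 / (\<delta>\<^sup>2 * sqrt n * n)) * (w k \<omega> ^ 3 * (1 + \<bar>\<xi> k \<omega>\<bar>) ^ 3)" for \<omega>
  have DU: "yw \<delta> (D (Suc k) \<omega>) \<le> U \<omega>" if \<omega>: "\<omega> \<in> space P" for \<omega>
  proof -
    define h where "h = \<beta> k \<omega> / n + \<alpha> k \<omega> * \<xi> k \<omega> / sqrt n"
    have e: "D (Suc k) \<omega> = D k \<omega> + h" using d(1) by (simp add: h_def)
    have 1: "A \<omega> * h = (1 / n) * (A \<omega> * \<beta> k \<omega>) + (1 / sqrt n) * (A \<omega> * \<alpha> k \<omega> * \<xi> k \<omega>)"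
      by (simp add: h_def algebra_simps)
    have "h\<^sup>2 / 2 \<le> (\<beta> k \<omega> / n)\<^sup>2 + (\<alpha> k \<omega> * \<xi> k \<omega> / sqrt n)\<^sup>2"
      unfolding h_def using sum_squares_bound[of "\<beta> k \<omega> / n" "\<alpha> k \<omega> * \<xi> k \<omega> / sqrt n"]
      by (simp add: power2_sum)
    also have "\<dots> = (1 / (real n)\<^sup>2) * (\<beta> k \<omega>)\<^sup>2 + (1 / n) * ((\<alpha> k \<omega>)\<^sup>2 * (\<xi> k \<omega>)\<^sup>2)"
      by (simp add: power_divide power_mult_distrib)
    finally have "H \<omega> * (h\<^sup>2 / 2) \<le> H \<omega> * ((1 / (real n)\<^sup>2) * (\<beta> k \<omega>)\<^sup>2 + (1 / n) * ((\<alpha> k \<omega>)\<^sup>2 * (\<xi> k \<omega>)\<^sup>2))"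
      using Hb(1)[of \<omega>] by (intro mult_left_mono)
    then have 2: "H \<omega> * h\<^sup>2 / 2 \<le> (1 / (real n)\<^sup>2) * (H \<omega> * (\<beta> k \<omega>)\<^sup>2) + (1 / n) * (H \<omega> * (\<alpha> k \<omega>)\<^sup>2 * (\<xi> k \<omega>)\<^sup>2)"
      by (simp add: algebra_simps)
    have "\<bar>h\<bar> \<le> \<bar>\<beta> k \<omega>\<bar> / n + \<bar>\<alpha> k \<omega>\<bar> * \<bar>\<xi> k \<omega>\<bar> / sqrt n"
      unfolding h_def by (intro order_trans[OF abs_triangle_ineq]) (simp add: abs_mult)
    also have "\<dots> \<le> w k \<omega> / sqrt n + w k \<omega> * \<bar>\<xi> k \<omega>\<bar> / sqrt n"
      using d(5,6)[OF \<omega>] w0[OF \<omega>] sn by (intro add_mono frac_le divide_right_mono mult_right_mono) auto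
    also have "\<dots> = w k \<omega> * (1 + \<bar>\<xi> k \<omega>\<bar>) / sqrt n" by (simp add: algebra_simps add_divide_distrib)
    finally have "\<bar>h\<bar> ^ 3 \<le> (w k \<omega> * (1 + \<bar>\<xi> k \<omega>\<bar>) / sqrt n) ^ 3" by (intro power_mono) auto
    also have "\<dots> = (w k \<omega> ^ 3 * (1 + \<bar>\<xi> k \<omega>\<bar>) ^ 3) / (sqrt n * n)"
    proof -
      have "sqrt n ^ 3 = sqrt n * n" by (simp add: power3_eq_cube)
      then show ?thesis by (simp add: power_divide power_mult_distrib)
    qed
    finally have "\<bar>h\<bar> ^ 3 / \<delta>\<^sup>2 \<le> (w k \<omega> ^ 3 * (1 + \<bar>\<xi> k \<omega>\<bar>) ^ 3) / (sqrt n * n) / \<delta>\<^sup>2"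
      by (rule divide_right_mono) simp
    also have "\<dots> = (1 / (\<delta>\<^sup>2 * sqrt n * n)) * (w k \<omega> ^ 3 * (1 + \<bar>\<xi> k \<omega>\<bar>) ^ 3)"
      by (simp add: field_simps)
    finally have 3: "\<bar>h\<bar> ^ 3 / \<delta>\<^sup>2 \<le> (1 / (\<delta>\<^sup>2 * sqrt n * n)) * (w k \<omega> ^ 3 * (1 + \<bar>\<xi> k \<omega>\<bar>) ^ 3)" .
    have "yw \<delta> (D k \<omega> + h) \<le> yw \<delta> (D k \<omega>) + A \<omega> * h + H \<omega> * h\<^sup>2 / 2 + \<bar>h\<bar> ^ 3 / \<delta>\<^sup>2"
      using yw_taylor[OF \<delta>(1), of "D k \<omega>" h] by (simp add: A_def H_def)
    with 1 2 3 show ?thesis unfolding e U_def by linarith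
  qed
  have ir: "integrable P (r k)" using square_integrable_imp_integrable[OF r(1) r(2)] .
  have iDr: "integrable P (\<lambda>\<omega>. \<bar>D k \<omega>\<bar> * r k \<omega>)"
  proof (rule Bochner_Integration.integrable_bound)
    show "integrable P (\<lambda>\<omega>. \<bar>D k \<omega>\<bar> ^ 2 + (r k \<omega>)\<^sup>2)" using iDp[OF _ kn, of 2] r(2) by simp
    show "(\<lambda>\<omega>. \<bar>D k \<omega>\<bar> * r k \<omega>) \<in> borel_measurable P" using DPk r(1) by measurable
    show "AE \<omega> in P. norm (\<bar>D k \<omega>\<bar> * r k \<omega>) \<le> norm (\<bar>D k \<omega>\<bar> ^ 2 + (r k \<omega>)\<^sup>2)"
    proof (rule AE_I2)
      fix \<omega> assume \<omega>: "\<omega> \<in> space P"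
      show "norm (\<bar>D k \<omega>\<bar> * r k \<omega>) \<le> norm (\<bar>D k \<omega>\<bar> ^ 2 + (r k \<omega>)\<^sup>2)"
        using mult_powers_le[of "\<bar>D k \<omega>\<bar>" "r k \<omega>" 1 2] bd(3)[OF \<omega>] by (simp add: abs_mult)
    qed
  qed
  \<comment> \<open>Weighted so that both halves are of size \<rho> when the second moment of b is
    at most \<rho>^2.\<close>
  have young: "a * b \<le> \<rho> / 2 * a\<^sup>2 + 1 / (2 * \<rho>) * b\<^sup>2" for a b :: real
  proof -
    have "0 \<le> (\<rho> * a - b)\<^sup>2 / (2 * \<rho>)" using \<rho> by simp
    also have "\<dots> = \<rho> / 2 * a\<^sup>2 + 1 / (2 * \<rho>) * b\<^sup>2 - a * b"
      using \<rho> by (simp add: power2_eq_square field_simps)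
    finally show ?thesis by simp
  qed
  have half: "1 / (2 * \<rho>) * expectation (\<lambda>\<omega>. (r k \<omega>)\<^sup>2) \<le> \<rho> / 2"
  proof -
    have "1 / (2 * \<rho>) * expectation (\<lambda>\<omega>. (r k \<omega>)\<^sup>2) \<le> 1 / (2 * \<rho>) * \<rho>\<^sup>2" using r(3) \<rho> by (intro mult_left_mono) auto
    also have "\<dots> = \<rho> / 2" using \<rho> by (simp add: power2_eq_square)
    finally show ?thesis .
  qed
  have Er: "expectation (r k) \<le> \<rho>"
  proof -
    have "expectation (r k) \<le> expectation (\<lambda>\<omega>. \<rho> / 2 + 1 / (2 * \<rho>) * (r k \<omega>)\<^sup>2)"
    proof (rule integral_mono)
      show "r k \<omega> \<le> \<rho> / 2 + 1 / (2 * \<rho>) * (r k \<omega>)\<^sup>2" for \<omega> using young[of 1 "r k \<omega>"] by simp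
    qed (use ir r(2) in auto)
    also have "\<dots> = \<rho> / 2 + 1 / (2 * \<rho>) * expectation (\<lambda>\<omega>. (r k \<omega>)\<^sup>2)" using r(2) by (simp add: prob_space)
    finally show ?thesis using half by simp
  qed
  have EDr: "expectation (\<lambda>\<omega>. \<bar>D k \<omega>\<bar> * r k \<omega>) \<le> \<rho> * S"
  proof -
    have "expectation (\<lambda>\<omega>. \<bar>D k \<omega>\<bar> * r k \<omega>) \<le> expectation (\<lambda>\<omega>. \<rho> / 2 * \<bar>D k \<omega>\<bar>\<^sup>2 + 1 / (2 * \<rho>) * (r k \<omega>)\<^sup>2)"
      using iDr r(2) iDp[OF _ kn, of 2] by (intro integral_mono young) auto
    also have "\<dots> = \<rho> / 2 * expectation (\<lambda>\<omega>. \<bar>D k \<omega>\<bar>\<^sup>2) + 1 / (2 * \<rho>) * expectation (\<lambda>\<omega>. (r k \<omega>)\<^sup>2)"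
      using r(2) iDp[OF _ kn, of 2] by simp
    also have "\<dots> \<le> \<rho> / 2 * S + \<rho> / 2"
      using half EDp[of 2] \<rho> by (intro add_mono mult_left_mono) auto
    also have "\<dots> \<le> \<rho> / 2 * S + \<rho> / 2 * S" 
    proof -
      have "\<rho> / 2 * 1 \<le> \<rho> / 2 * S" using S \<rho> by (intro mult_left_mono) auto
      then show ?thesis by linarith
    qed
    also have "\<dots> = \<rho> * S" by simp
    finally show ?thesis .
  qed
  define E where "E = expectation (\<lambda>\<omega>. yw \<delta> (D k \<omega>))"
  have drift: "expectation (\<lambda>\<omega>. A \<omega> * \<beta> k \<omega>) \<le> C * E + C * S + C * S * \<rho> / \<delta>"
  proof -
    have "A \<omega> * \<beta> k \<omega> \<le> C * (yw \<delta> (D k \<omega>) + \<bar>D k \<omega>\<bar> ^ 1 + 1 / \<delta> * (\<bar>D k \<omega>\<bar> * r k \<omega>))"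
      if \<omega>: "\<omega> \<in> space P" for \<omega>
    proof -
      have "A \<omega> * \<beta> k \<omega> \<le> \<bar>A \<omega>\<bar> * \<bar>\<beta> k \<omega>\<bar>"
        using abs_ge_self[of "A \<omega> * \<beta> k \<omega>"] unfolding abs_mult .
      also have "\<dots> \<le> \<bar>A \<omega>\<bar> * (C * (\<bar>D k \<omega>\<bar> + r k \<omega>))" using bd(1)[OF \<omega>] by (intro mult_left_mono) auto
      also have "\<dots> = C * (\<bar>D k \<omega>\<bar> * \<bar>A \<omega>\<bar> + \<bar>A \<omega>\<bar> * r k \<omega>)" by (simp add: algebra_simps)
      also have "\<dots> \<le> C * (yw \<delta> (D k \<omega>) + \<bar>D k \<omega>\<bar> + \<bar>D k \<omega>\<bar> / \<delta> * r k \<omega>)"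
        using yw_drift[OF \<delta>(1), of "D k \<omega>"] Ab[of \<omega>] bd(3)[OF \<omega>] C
        by (intro mult_left_mono add_mono mult_right_mono) (auto simp: A_def)
      finally show ?thesis by simp
    qed
    then have "expectation (\<lambda>\<omega>. A \<omega> * \<beta> k \<omega>) \<le> expectation (\<lambda>\<omega>. C * (yw \<delta> (D k \<omega>) + \<bar>D k \<omega>\<bar> ^ 1 + 1 / \<delta> * (\<bar>D k \<omega>\<bar> * r k \<omega>)))"
      using i\<beta> iyw[OF kn] iDp[OF _ kn, of 1] iDr by (intro integral_mono) auto
    also have "\<dots> = C * (E + expectation (\<lambda>\<omega>. \<bar>D k \<omega>\<bar> ^ 1) + 1 / \<delta> * expectation (\<lambda>\<omega>. \<bar>D k \<omega>\<bar> * r k \<omega>))"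
      using iyw[OF kn] iDp[OF _ kn, of 1] iDr by (simp add: E_def)
    also have "\<dots> \<le> C * (E + S + 1 / \<delta> * (\<rho> * S))"
      using EDp[of 1] EDr C \<delta> by (intro mult_left_mono add_mono) auto
    finally show ?thesis by (simp add: algebra_simps)
  qed
  have diff: "expectation (\<lambda>\<omega>. H \<omega> * (\<alpha> k \<omega>)\<^sup>2) \<le> C * S + C * S * \<rho> / \<delta>"
  proof -
    have "H \<omega> * (\<alpha> k \<omega>)\<^sup>2 \<le> C * (1 + 1 / \<delta> * r k \<omega>)" if \<omega>: "\<omega> \<in> space P" for \<omega>
    proof -
      have "H \<omega> * (\<alpha> k \<omega>)\<^sup>2 \<le> H \<omega> * (C * (\<bar>D k \<omega>\<bar> + r k \<omega>))"
        using bd(2)[OF \<omega>] Hb(1)[of \<omega>] by (intro mult_left_mono) auto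
      also have "\<dots> = C * (H \<omega> * \<bar>D k \<omega>\<bar> + H \<omega> * r k \<omega>)" by (simp add: algebra_simps)
      also have "\<dots> \<le> C * (1 + 1 / \<delta> * r k \<omega>)"
        using Hb[of \<omega>] bd(3)[OF \<omega>] C by (intro mult_left_mono add_mono mult_right_mono) auto
      finally show ?thesis .
    qed
    then have "expectation (\<lambda>\<omega>. H \<omega> * (\<alpha> k \<omega>)\<^sup>2) \<le> expectation (\<lambda>\<omega>. C * (1 + 1 / \<delta> * r k \<omega>))"
      using iH\<alpha> ir by (intro integral_mono) auto
    also have "\<dots> = C * (1 + 1 / \<delta> * expectation (r k))" using ir by (simp add: prob_space)
    also have "\<dots> \<le> C * (S + 1 / \<delta> * (\<rho> * S))"
    proof -
      have "expectation (r k) \<le> \<rho> * S" 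
        using Er S \<rho> mult_left_mono[of 1 S \<rho>] by linarith
      then show ?thesis using S C \<delta> by (intro mult_left_mono add_mono) auto
    qed
    finally show ?thesis by (simp add: algebra_simps)
  qed
  have bsq: "expectation (\<lambda>\<omega>. H \<omega> * (\<beta> k \<omega>)\<^sup>2) \<le> (1 + B) / \<delta>"
  proof -
    have "H \<omega> * (\<beta> k \<omega>)\<^sup>2 \<le> 1 / \<delta> * w k \<omega> ^ 2" if \<omega>: "\<omega> \<in> space P" for \<omega>
    proof -
      have "(\<beta> k \<omega>)\<^sup>2 \<le> (w k \<omega>)\<^sup>2" using d(6)[OF \<omega>] w0[OF \<omega>] by (simp add: abs_le_square_iff[symmetric])
      then show ?thesis using Hb[of \<omega>] \<delta> by (intro mult_mono) auto
    qed
    then have "expectation (\<lambda>\<omega>. H \<omega> * (\<beta> k \<omega>)\<^sup>2) \<le> expectation (\<lambda>\<omega>. 1 / \<delta> * w k \<omega> ^ 2)"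
      using iH\<beta> iwp[of 2] by (intro integral_mono) auto
    also have "\<dots> = 1 / \<delta> * expectation (\<lambda>\<omega>. w k \<omega> ^ 2)" using iwp[of 2] by simp
    also have "\<dots> \<le> 1 / \<delta> * (1 + B)" using Ewp[of 2] \<delta> by (intro mult_left_mono) auto
    finally show ?thesis by simp
  qed
  have iU: "integrable P U" unfolding U_def using iyw[OF kn] i\<beta> mart(1) iH\<beta> quad(1) cub(1) by auto
  have "expectation (\<lambda>\<omega>. yw \<delta> (D (Suc k) \<omega>)) \<le> expectation U"
    using DU iU iyw[of "Suc k"] k by (intro integral_mono) auto
  also have "\<dots> = E + (1 / n) * expectation (\<lambda>\<omega>. A \<omega> * \<beta> k \<omega>) + (1 / (real n)\<^sup>2) * expectation (\<lambda>\<omega>. H \<omega> * (\<beta> k \<omega>)\<^sup>2)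
     + (1 / n) * expectation (\<lambda>\<omega>. H \<omega> * (\<alpha> k \<omega>)\<^sup>2) + (1 / (\<delta>\<^sup>2 * sqrt n * n)) * expectation (\<lambda>\<omega>. w k \<omega> ^ 3 * (1 + \<bar>\<xi> k \<omega>\<bar>) ^ 3)"
    unfolding U_def using iyw[OF kn] i\<beta> mart iH\<beta> quad cub(1) by (simp add: E_def)
  also have "\<dots> \<le> E + (1 / n) * (C * E + C * S + C * S * \<rho> / \<delta>) + (1 / (real n)\<^sup>2) * ((1 + B) / \<delta>)
     + (1 / n) * (C * S + C * S * \<rho> / \<delta>) + (1 / (\<delta>\<^sup>2 * sqrt n * n)) * ((1 + B) * (8 * (1 + c 3)))"
    using drift diff bsq cub(2) sn \<delta> by (intro add_mono mult_left_mono) auto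
  \<comment> \<open>The squared drift is of order n^(-2) and is absorbed into the remainder of order
    n^(-3/2); \<delta> \<le> 1 is used here.\<close>
  also have "(1 / (real n)\<^sup>2) * ((1 + B) / \<delta>) \<le> (1 / (\<delta>\<^sup>2 * sqrt n * n)) * (1 + B)"
  proof -
    have "\<delta>\<^sup>2 * sqrt n * n \<le> \<delta> * n * n"
      using sn \<delta> by (intro mult_mono) (auto simp: power2_eq_square)
    then have "1 / (\<delta> * n * n) \<le> 1 / (\<delta>\<^sup>2 * sqrt n * n)"
      using sn \<delta> by (intro frac_le) auto
    then have "1 / (\<delta> * n * n) * (1 + B) \<le> 1 / (\<delta>\<^sup>2 * sqrt n * n) * (1 + B)"
      using B by (intro mult_right_mono) auto
    then show ?thesis by (simp add: power2_eq_square mult_ac)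
  qed
  also have "E + (1 / n) * (C * E + C * S + C * S * \<rho> / \<delta>) + (1 / (\<delta>\<^sup>2 * sqrt n * n)) * (1 + B)
     + (1 / n) * (C * S + C * S * \<rho> / \<delta>) + (1 / (\<delta>\<^sup>2 * sqrt n * n)) * ((1 + B) * (8 * (1 + c 3)))
     = E + (C * E + yw_source C B \<rho> \<delta>) / n"
  proof -
    define z where "z = 1 / (\<delta>\<^sup>2 * sqrt n)"
    have z: "1 / (\<delta>\<^sup>2 * sqrt n * n) = z * (1 / n)" "(1 + B) * (1 + 8 * (1 + c 3)) / (\<delta>\<^sup>2 * sqrt n) = (1 + B) * (1 + 8 * (1 + c 3)) * z"
      by (simp_all add: z_def)
    show ?thesis unfolding yw_source_def S_def[symmetric] Let_def z
      by (simp add: algebra_simps add_divide_distrib)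
  qed
  finally show "expectation (\<lambda>\<omega>. yw \<delta> (D (Suc k) \<omega>)) \<le> expectation (\<lambda>\<omega>. yw \<delta> (D k \<omega>))
       + (C * expectation (\<lambda>\<omega>. yw \<delta> (D k \<omega>)) + yw_source C B \<rho> \<delta>) / n"
    unfolding E_def by simp
qed

text \<open>Discrete Gronwall from D = 0: with T the source term, ((1 + C/n)^i - 1) T/C solves the
  one-step recursion exactly.\<close>

lemma yw_system_expectation:
  assumes sys: "yw_system C B \<rho> D \<alpha> \<beta> w r" and C: "0 < C" and \<rho>: "0 < \<rho>" and \<delta>: "0 < \<delta>" "\<delta> \<le> 1"
    and k: "k \<le> n"
  shows "integrable P (\<lambda>\<omega>. yw \<delta> (D k \<omega>))"
    "expectation (\<lambda>\<omega>. yw \<delta> (D k \<omega>)) \<le> exp C * yw_source C B \<rho> \<delta> / C"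
proof -
  define T where "T = yw_source C B \<rho> \<delta>"
  have st: "integrable P (\<lambda>\<omega>. yw \<delta> (D i \<omega>)) \<and> expectation (\<lambda>\<omega>. yw \<delta> (D i \<omega>)) \<le> ((1 + C / n) ^ i - 1) * (T / C)"
    if "i \<le> n" for i using that
  proof (induction i)
    case 0
    then show ?case using yw_systemD(2)[OF sys] \<delta> by (simp add: yw_def)
  next
    case (Suc i)
    then have i: "i < n" by simp
    note s = yw_system_step[OF sys C \<rho> \<delta> i, folded T_def]
    let ?E = "expectation (\<lambda>\<omega>. yw \<delta> (D i \<omega>))"
    have "?E + (C * ?E + T) / n = (1 + C / n) * ?E + T / n" by (simp add: algebra_simps add_divide_distrib)
    also have "\<dots> \<le> (1 + C / n) * (((1 + C / n) ^ i - 1) * (T / C)) + T / n"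
      using Suc C by (intro add_mono mult_left_mono) auto
    also have "\<dots> = ((1 + C / n) ^ Suc i - 1) * (T / C)" using C n_pos by (simp add: field_simps)
    finally show ?case using s by auto
  qed
  show "integrable P (\<lambda>\<omega>. yw \<delta> (D k \<omega>))" using st[OF k] by simp
  have T: "0 \<le> T"
  proof -
    have "0 \<le> expectation (\<lambda>\<omega>. w 0 \<omega> ^ 4)" by (intro integral_nonneg_AE) (simp add: zero_le_power_eq)
    then have B: "0 \<le> B" using yw_systemD(4)[OF sys n_pos] by linarith
    show ?thesis unfolding T_def yw_source_def Let_def using B C \<rho> \<delta> c_nonneg by (auto intro!: add_nonneg_nonneg)
  qed
  have "(1 + C / n) ^ k \<le> (1 + C / n) ^ n" using C k by (intro power_increasing) auto
  also have "\<dots> \<le> exp (C / n) ^ n" using C exp_ge_add_one_self[of "C / n"] by (intro power_mono) auto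
  also have "\<dots> = exp C" using n_pos by (simp flip: exp_of_nat_mult)
  finally have "((1 + C / n) ^ k - 1) * (T / C) \<le> exp C * (T / C)" using T C by (intro mult_right_mono) auto
  then show "expectation (\<lambda>\<omega>. yw \<delta> (D k \<omega>)) \<le> exp C * yw_source C B \<rho> \<delta> / C"
    using st[OF k] unfolding T_def by simp
qed

end

text \<open>The order of the choices matters. \<delta> makes \<epsilon>
  \<open>yw \<delta> \<theta>\<close> exceed a bound that is free of \<delta>; \<rho> = \<delta>
  turns the quotient \<rho>/\<delta> into 1; n0 pushes the Taylor remainder below 1. None of them
  sees the probability space or the noise beyond the moment bounds \<open>c\<close>.\<close>

lemma yw_system_small:
  fixes c :: "nat \<Rightarrow> real"
  assumes C: "0 < C" and B: "0 \<le> B" and \<theta>: "0 < \<theta>" and \<epsilon>: "0 < \<epsilon>"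
  shows "\<exists>\<rho>>0. \<exists>n0. \<forall>(P :: 'a measure) G \<xi> n D \<alpha> \<beta> w r. noise P G \<xi> c n \<longrightarrow> n0 \<le> n \<longrightarrow>
    noise.yw_system P G \<xi> n C B \<rho> D \<alpha> \<beta> w r \<longrightarrow>
    (\<forall>k\<le>n. measure P {\<omega>\<in>space P. \<theta> \<le> \<bar>D k \<omega>\<bar>} < \<epsilon>)"
proof -
  define S where "S = 1 + exp (step_const c 2) * B"
  define Q where "Q = (1 + B) * (1 + 8 * (1 + \<bar>c 3\<bar>))"
  \<comment> \<open>Bound for \<open>yw_source\<close> once \<rho> = \<delta> and the remainder is
    at most 1; it does not contain \<delta>.\<close>
  define T where "T = 2 * C * S + 2 * C * S + 1"
  have S: "1 \<le> S" using B by (simp add: S_def)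
  have Q: "0 < Q" using B by (simp add: Q_def add_nonneg_pos)
  have "filterlim (\<lambda>x. arsinh (\<theta> * x)) at_top at_top"
    by (rule filterlim_compose[OF arsinh_real_at_top])
       (use \<theta> in \<open>auto intro!: filterlim_tendsto_pos_mult_at_top[OF tendsto_const] filterlim_ident\<close>)
  then have "eventually (\<lambda>x. 1 + exp C * T / C / (\<epsilon> * \<theta>) < arsinh (\<theta> * x)) at_top"
    by (simp add: filterlim_at_top_dense)
  then obtain N where N: "1 + exp C * T / C / (\<epsilon> * \<theta>) < arsinh (\<theta> * x)" if "N \<le> x" for x
    by (auto simp: eventually_at_top_linorder)
  define x where "x = max 1 N"
  have x: "1 \<le> x" "1 + exp C * T / C / (\<epsilon> * \<theta>) < arsinh (\<theta> * x)"
    using N[of x] by (auto simp: x_def)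
  define \<delta> where "\<delta> = 1 / x"
  have \<delta>: "0 < \<delta>" "\<delta> \<le> 1" using x by (auto simp: \<delta>_def)
  have big: "exp C * T / C < \<epsilon> * yw \<delta> \<theta>"
  proof -
    have "exp C * T / C / (\<epsilon> * \<theta>) < arsinh (\<theta> / \<delta>) - 1" using x by (simp add: \<delta>_def)
    then have "exp C * T / C < (arsinh (\<theta> / \<delta>) - 1) * (\<epsilon> * \<theta>)"
      using pos_divide_less_eq[of "\<epsilon> * \<theta>" "exp C * T / C"] mult_pos_pos[OF \<epsilon> \<theta>] by blast
    also have "\<dots> = \<epsilon> * (\<theta> * (arsinh (\<theta> / \<delta>) - 1))" by simp
    also have "\<dots> \<le> \<epsilon> * yw \<delta> \<theta>" using yw_lower[OF \<delta>(1), of \<theta>] \<theta> \<epsilon> by (intro mult_left_mono) auto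
    finally show ?thesis .
  qed
  \<comment> \<open>Squared because the remainder is Q / (\<delta>^2 sqrt n).\<close>
  obtain n0 :: nat where n0: "(Q / \<delta>\<^sup>2)\<^sup>2 < n0" using reals_Archimedean2 by blast
  show ?thesis
  proof (intro exI[of _ \<delta>] exI[of _ n0] conjI \<delta>(1) allI impI)
    fix P :: "'a measure" and G \<xi> n D \<alpha> \<beta> w r k
    assume N: "noise P G \<xi> c n" and n: "n0 \<le> n" and sys: "noise.yw_system P G \<xi> n C B \<delta> D \<alpha> \<beta> w r" and k: "k \<le> n"
    interpret noise P G \<xi> c n by fact
    note e = yw_system_expectation[OF sys C \<delta>(1) \<delta> k]
    have src: "yw_source C B \<delta> \<delta> \<le> T"
    proof -
      have "Q / \<delta>\<^sup>2 \<le> sqrt n" using n n0 by (intro real_le_rsqrt) auto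
      then have "Q / (\<delta>\<^sup>2 * sqrt n) \<le> 1" using \<delta> n_pos by (simp add: divide_simps mult_ac)
      moreover have "\<bar>c 3\<bar> = c 3" using c_nonneg by simp
      ultimately show ?thesis unfolding yw_source_def Let_def S_def[symmetric] T_def using \<delta> by (simp add: Q_def)
    qed
    have dr: "driven D \<alpha> \<beta> w" by (rule yw_systemD(1)[OF sys])
    have DP: "D k \<in> borel_measurable P" using driven_adapted[OF dr k] meas_P k by blast
    have "measure P {\<omega>\<in>space P. yw \<delta> \<theta> \<le> yw \<delta> (D k \<omega>)} \<le> expectation (\<lambda>\<omega>. yw \<delta> (D k \<omega>)) / yw \<delta> \<theta>"
    proof (rule integral_Markov_inequality_measure[OF e(1), of "{}"])
      have "0 \<le> exp C * T / C" using S C by (simp add: T_def)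
      then have "0 < \<epsilon> * yw \<delta> \<theta>" using big by linarith
      then show "0 < yw \<delta> \<theta>" using \<epsilon> by (simp add: zero_less_mult_iff)
    qed (use yw_nonneg \<delta> in auto)
    moreover have "{\<omega>\<in>space P. \<theta> \<le> \<bar>D k \<omega>\<bar>} \<subseteq> {\<omega>\<in>space P. yw \<delta> \<theta> \<le> yw \<delta> (D k \<omega>)}"
      using yw_mono[OF \<delta>(1), of \<theta>] yw_abs[OF \<delta>(1)] \<theta> by (smt (verit) Collect_mono)
    then have "measure P {\<omega>\<in>space P. \<theta> \<le> \<bar>D k \<omega>\<bar>} \<le> measure P {\<omega>\<in>space P. yw \<delta> \<theta> \<le> yw \<delta> (D k \<omega>)}"
      using DP \<delta>(1) by (intro finite_measure_mono) measurable
    moreover have "expectation (\<lambda>\<omega>. yw \<delta> (D k \<omega>)) / yw \<delta> \<theta> < \<epsilon>"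
    proof -
      have "0 \<le> exp C * T / C" using S C by (simp add: T_def)
      then have p: "0 < yw \<delta> \<theta>" using big \<epsilon> by (smt (verit) zero_less_mult_pos)
      have "exp C * yw_source C B \<delta> \<delta> / C \<le> exp C * T / C"
        using src C by (intro divide_right_mono mult_left_mono) auto
      then have "expectation (\<lambda>\<omega>. yw \<delta> (D k \<omega>)) < \<epsilon> * yw \<delta> \<theta>" using e(2) big by linarith
      then show ?thesis using p by (simp add: divide_less_eq)
    qed
    ultimately show "measure P {\<omega>\<in>space P. \<theta> \<le> \<bar>D k \<omega>\<bar>} < \<epsilon>" by linarith
  qed
qed

section \<open>Euler schemes with delayed coefficients\<close>

text \<open>The coefficients are evaluated at the index \<kappa> k: the identity gives the ordinary
  Euler scheme, \<open>l * (k div l)\<close> freezes them at the beginning of each block of length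
  l. The minimum with k makes the recursion well-founded for every \<kappa>.\<close>

function delayed_euler :: "(real \<Rightarrow> real) \<Rightarrow> (real \<Rightarrow> real) \<Rightarrow> real \<Rightarrow> nat \<Rightarrow> (nat \<Rightarrow> 'a \<Rightarrow> real) \<Rightarrow>
    (nat \<Rightarrow> nat) \<Rightarrow> nat \<Rightarrow> 'a \<Rightarrow> real" where
  "delayed_euler a b y0 n \<xi> \<kappa> 0 \<omega> = y0"
| "delayed_euler a b y0 n \<xi> \<kappa> (Suc k) \<omega> = delayed_euler a b y0 n \<xi> \<kappa> k \<omega>
     + b (delayed_euler a b y0 n \<xi> \<kappa> (min k (\<kappa> k)) \<omega>) / n
     + a (delayed_euler a b y0 n \<xi> \<kappa> (min k (\<kappa> k)) \<omega>) * \<xi> k \<omega> / sqrt n"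
  by pat_completeness auto
termination
  by (relation "Wellfounded.measure (\<lambda>(a, b, y0, n, \<xi>, \<kappa>, k, \<omega>). k)") auto

locale sde_coeffs =
  fixes a b :: "real \<Rightarrow> real" and Ca Cb y0 :: real
  assumes Cb: "0 < Cb" and b_lip: "\<And>x y. \<bar>b x - b y\<bar> \<le> Cb * \<bar>x - y\<bar>"
    and Ca: "0 < Ca" and a_hol: "\<And>x y. \<bar>a x - a y\<bar> \<le> Ca * sqrt \<bar>x - y\<bar>"
begin

definition "K = \<bar>a 0\<bar> + \<bar>b 0\<bar> + Ca + Cb + 1"

lemma K: "1 \<le> K" using Ca Cb by (simp add: K_def)

text \<open>Comparison with the value at 0; sqrt |x| \<le> 1 + |x| turns the square-root modulus of
  \<open>a\<close> into linear growth.\<close>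

lemma growth: "\<bar>a x\<bar> \<le> K * (1 + \<bar>x\<bar>)" "\<bar>b x\<bar> \<le> K * (1 + \<bar>x\<bar>)"
proof -
  have s: "sqrt \<bar>x\<bar> \<le> 1 + \<bar>x\<bar>"
    by (rule real_le_lsqrt) (auto simp: power2_eq_square algebra_simps)
  have "\<bar>a x\<bar> \<le> \<bar>a 0\<bar> + Ca * sqrt \<bar>x\<bar>" using a_hol[of x 0] by simp
  also have "\<dots> \<le> \<bar>a 0\<bar> * (1 + \<bar>x\<bar>) + Ca * (1 + \<bar>x\<bar>)"
    using s Ca by (intro add_mono mult_left_mono) (auto simp: algebra_simps)
  also have "\<dots> = (\<bar>a 0\<bar> + Ca) * (1 + \<bar>x\<bar>)" by (simp add: algebra_simps)
  also have "\<dots> \<le> K * (1 + \<bar>x\<bar>)" using Cb by (intro mult_right_mono) (auto simp: K_def)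
  finally show "\<bar>a x\<bar> \<le> K * (1 + \<bar>x\<bar>)" .
  have "\<bar>b x\<bar> \<le> \<bar>b 0\<bar> + Cb * \<bar>x\<bar>" using b_lip[of x 0] by simp
  also have "\<dots> \<le> \<bar>b 0\<bar> * (1 + \<bar>x\<bar>) + Cb * (1 + \<bar>x\<bar>)"
    using Cb by (intro add_mono mult_left_mono) (auto simp: algebra_simps)
  also have "\<dots> = (\<bar>b 0\<bar> + Cb) * (1 + \<bar>x\<bar>)" by (simp add: algebra_simps)
  also have "\<dots> \<le> K * (1 + \<bar>x\<bar>)" using Ca by (intro mult_right_mono) (auto simp: K_def)
  finally show "\<bar>b x\<bar> \<le> K * (1 + \<bar>x\<bar>)" .
qed

lemma b_cont: "continuous_on UNIV b"
proof (rule continuous_on_iff[THEN iffD2], intro ballI allI impI)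
  fix x e :: real assume "0 < e"
  then show "\<exists>d>0. \<forall>x'\<in>UNIV. dist x' x < d \<longrightarrow> dist (b x') (b x) < e"
    using Cb b_lip[of _ x]
    by (intro exI[of _ "e / Cb"]) (auto simp: dist_real_def pos_less_divide_eq mult.commute intro: le_less_trans)
qed

lemma a_cont: "continuous_on UNIV a"
proof (rule continuous_on_iff[THEN iffD2], intro ballI allI impI)
  fix x e :: real assume e: "0 < e"
  show "\<exists>d>0. \<forall>x'\<in>UNIV. dist x' x < d \<longrightarrow> dist (a x') (a x) < e"
  proof (intro exI[of _ "(e / Ca)\<^sup>2"] conjI ballI impI)
    fix x' assume "dist x' x < (e / Ca)\<^sup>2"
    then have "sqrt \<bar>x' - x\<bar> < e / Ca"
      using e Ca by (intro real_less_lsqrt) (auto simp: dist_real_def)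
    then have "Ca * sqrt \<bar>x' - x\<bar> < e" using Ca by (simp add: pos_less_divide_eq mult.commute)
    then show "dist (a x') (a x) < e" using a_hol[of x' x] by (simp add: dist_real_def)
  qed (use e Ca in auto)
qed

lemma a_meas [measurable]: "a \<in> borel_measurable borel" by (rule borel_measurable_continuous_onI[OF a_cont])
lemma b_meas [measurable]: "b \<in> borel_measurable borel" by (rule borel_measurable_continuous_onI[OF b_cont])

lemma a_hol_sq: "(a x - a y)\<^sup>2 \<le> Ca\<^sup>2 * \<bar>x - y\<bar>"
proof -
  have "(a x - a y)\<^sup>2 = \<bar>a x - a y\<bar>\<^sup>2" by simp
  also have "\<dots> \<le> (Ca * sqrt \<bar>x - y\<bar>)\<^sup>2" using a_hol[of x y] by (intro power_mono) auto
  finally show ?thesis by (simp add: power_mult_distrib)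
qed

end

locale euler_setting = noise P G \<xi> c n + sde_coeffs a b Ca Cb y0
  for P :: "'a measure" and G \<xi> c n a b Ca Cb y0
begin

abbreviation "Z \<equiv> delayed_euler a b y0 n \<xi>"

text \<open>\<open>mom\<close> and \<open>inc\<close> are built from \<open>c\<close>, the
  coefficients and \<open>y0\<close> alone. They contain neither n nor the delay, which makes all
  estimates for the schemes uniform in both.\<close>

definition "mom p = (2 * K) ^ (2 * p) * (1 + growth_const p K y0)"
definition "inc p = exp (step_const c p) * mom p"

lemma Z_adapted: "k \<le> n \<Longrightarrow> Z \<kappa> k \<in> borel_measurable (G k)"
proof (induction k rule: less_induct)
  case (less k)
  show ?case
  proof (cases k)
    case 0
    then show ?thesis by simp
  next
    case (Suc i)
    then have i: "i < n" "i < k" "min i (\<kappa> i) < k" using less by auto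
    have 1: "Z \<kappa> i \<in> borel_measurable (G k)" using meas_mono[OF _ less.prems less.IH[OF i(2)]] i by simp
    have 2: "Z \<kappa> (min i (\<kappa> i)) \<in> borel_measurable (G k)" using meas_mono[OF _ less.prems less.IH[OF i(3)]] i by simp
    have 3: "\<xi> i \<in> borel_measurable (G k)" using noise_meas[OF i(1)] Suc by simp
    have e: "Z \<kappa> k = (\<lambda>\<omega>. Z \<kappa> i \<omega> + b (Z \<kappa> (min i (\<kappa> i)) \<omega>) / n + a (Z \<kappa> (min i (\<kappa> i)) \<omega>) * \<xi> i \<omega> / sqrt n)"
      unfolding Suc by (rule ext) (rule delayed_euler.simps)
    show ?thesis unfolding e using 1 2 3 by measurable
  qed
qed

lemma Z_delayed: "k \<le> n \<Longrightarrow> Z \<kappa> (min k (\<kappa> k)) \<in> borel_measurable (G k)"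
  by (rule meas_mono[OF _ _ Z_adapted]) auto

lemma Z_driven: "driven (Z \<kappa>) (\<lambda>k \<omega>. a (Z \<kappa> (min k (\<kappa> k)) \<omega>)) (\<lambda>k \<omega>. b (Z \<kappa> (min k (\<kappa> k)) \<omega>))
   (\<lambda>k \<omega>. K * (1 + \<bar>Z \<kappa> (min k (\<kappa> k)) \<omega>\<bar>))"
  unfolding driven_def
proof (intro conjI allI impI ballI)
  show "Z \<kappa> 0 \<in> borel_measurable (G 0)" by (rule Z_adapted) simp
  fix k assume "k < n"
  then have [measurable]: "Z \<kappa> (min k (\<kappa> k)) \<in> borel_measurable (G k)" by (intro Z_delayed) simp
  show "(\<lambda>\<omega>. a (Z \<kappa> (min k (\<kappa> k)) \<omega>)) \<in> borel_measurable (G k)" by measurable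
  show "(\<lambda>\<omega>. b (Z \<kappa> (min k (\<kappa> k)) \<omega>)) \<in> borel_measurable (G k)" by measurable
  show "(\<lambda>\<omega>. K * (1 + \<bar>Z \<kappa> (min k (\<kappa> k)) \<omega>\<bar>)) \<in> borel_measurable (G k)" by measurable
qed (rule delayed_euler.simps growth)+

lemma Z_moment:
  assumes k: "k \<le> n" and p: "1 \<le> p"
  shows "integrable P (\<lambda>\<omega>. Z \<kappa> k \<omega> ^ (2 * p))"
    and "expectation (\<lambda>\<omega>. Z \<kappa> k \<omega> ^ (2 * p)) \<le> growth_const p K y0"
  using driven_moment[where x="Z \<kappa>" and \<kappa>="\<lambda>k. min k (\<kappa> k)", OF Z_driven _ _ _ k p, of y0] K by simp_all

lemma growth_weight:
  assumes k: "k \<le> n" and p: "1 \<le> p"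
  shows "integrable P (\<lambda>\<omega>. (K * (1 + \<bar>Z \<kappa> k \<omega>\<bar>)) ^ (2 * p))"
    and "expectation (\<lambda>\<omega>. (K * (1 + \<bar>Z \<kappa> k \<omega>\<bar>)) ^ (2 * p)) \<le> mom p"
proof -
  have m: "Z \<kappa> k \<in> borel_measurable P" by (rule meas_P[OF k Z_adapted[OF k]])
  note z = Z_moment[OF k p, of \<kappa>]
  have wb: "(K * (1 + \<bar>Z \<kappa> k \<omega>\<bar>)) ^ (2 * p) \<le> (2 * K) ^ (2 * p) * (1 + Z \<kappa> k \<omega> ^ (2 * p))" for \<omega>
  proof -
    have "(K * (1 + \<bar>Z \<kappa> k \<omega>\<bar>)) ^ (2 * p) \<le> K ^ (2 * p) * (2 ^ (2 * p) * (1 + \<bar>Z \<kappa> k \<omega>\<bar> ^ (2 * p)))"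
      unfolding power_mult_distrib using power_add_le_split[of 1 "\<bar>Z \<kappa> k \<omega>\<bar>" "2 * p"] K
      by (intro mult_left_mono) auto
    then show ?thesis by (simp add: power_mult_distrib power_even_abs mult_ac)
  qed
  show i: "integrable P (\<lambda>\<omega>. (K * (1 + \<bar>Z \<kappa> k \<omega>\<bar>)) ^ (2 * p))"
  proof (rule Bochner_Integration.integrable_bound)
    show "integrable P (\<lambda>\<omega>. (2 * K) ^ (2 * p) * (1 + Z \<kappa> k \<omega> ^ (2 * p)))" using z by auto
    show "(\<lambda>\<omega>. (K * (1 + \<bar>Z \<kappa> k \<omega>\<bar>)) ^ (2 * p)) \<in> borel_measurable P" using m by measurable
    show "AE \<omega> in P. norm ((K * (1 + \<bar>Z \<kappa> k \<omega>\<bar>)) ^ (2 * p)) \<le> norm ((2 * K) ^ (2 * p) * (1 + Z \<kappa> k \<omega> ^ (2 * p)))"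
      by (rule AE_I2) (smt (verit) wb real_norm_def even_mult_iff even_numeral zero_le_even_power)
  qed
  have "expectation (\<lambda>\<omega>. (K * (1 + \<bar>Z \<kappa> k \<omega>\<bar>)) ^ (2 * p)) \<le> expectation (\<lambda>\<omega>. (2 * K) ^ (2 * p) * (1 + Z \<kappa> k \<omega> ^ (2 * p)))"
    using z(1) by (intro integral_mono i wb) auto
  also have "\<dots> = (2 * K) ^ (2 * p) * (1 + expectation (\<lambda>\<omega>. Z \<kappa> k \<omega> ^ (2 * p)))"
    using z by (simp add: prob_space)
  also have "\<dots> \<le> mom p" unfolding mom_def using z(2) K by (intro mult_left_mono add_mono) auto
  finally show "expectation (\<lambda>\<omega>. (K * (1 + \<bar>Z \<kappa> k \<omega>\<bar>)) ^ (2 * p)) \<le> mom p" .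
qed

lemma mom_nonneg: "1 \<le> p \<Longrightarrow> 0 \<le> mom p"
proof -
  assume p: "1 \<le> p"
  have "0 \<le> expectation (\<lambda>\<omega>. (K * (1 + \<bar>Z id 0 \<omega>\<bar>)) ^ (2 * p))"
    using K by (intro integral_nonneg_AE) simp
  then show ?thesis using growth_weight(2)[OF _ p, of 0 id] by linarith
qed

lemma inc_nonneg: "1 \<le> p \<Longrightarrow> 0 \<le> inc p"
  using mom_nonneg by (simp add: inc_def)

lemma Z_increment:
  assumes jm: "j \<le> m" "m \<le> n" and p: "1 \<le> p"
  shows "integrable P (\<lambda>\<omega>. (Z \<kappa> m \<omega> - Z \<kappa> j \<omega>) ^ (2 * p))"
    and "expectation (\<lambda>\<omega>. (Z \<kappa> m \<omega> - Z \<kappa> j \<omega>) ^ (2 * p)) \<le> inc p * ((real m - real j) / n) ^ p"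
proof -
  have "integrable P (\<lambda>\<omega>. (Z \<kappa> m \<omega> - Z \<kappa> j \<omega>) ^ (2 * p)) \<and>
    expectation (\<lambda>\<omega>. (Z \<kappa> m \<omega> - Z \<kappa> j \<omega>) ^ (2 * p)) \<le> inc p * ((real m - real j) / n) ^ p"
  proof (cases "j = m")
    case True
    then show ?thesis using p by (simp add: power_0_left)
  next
    case False
    then have "j < m" using jm by simp
    note * = driven_increment_moment[OF Z_driven this jm(2) p growth_weight[OF _ p]]
    show ?thesis using *[of \<kappa>] by (simp add: inc_def mult.assoc)
  qed
  then show "integrable P (\<lambda>\<omega>. (Z \<kappa> m \<omega> - Z \<kappa> j \<omega>) ^ (2 * p))"
    "expectation (\<lambda>\<omega>. (Z \<kappa> m \<omega> - Z \<kappa> j \<omega>) ^ (2 * p)) \<le> inc p * ((real m - real j) / n) ^ p" by auto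
qed

text \<open>Covers both the fine Euler scheme (where \<open>U\<close> equals its Euler functional) and the solution
  of the equation stopped at a bounded level.\<close>

definition euler_functional :: "(nat \<Rightarrow> 'a \<Rightarrow> real) \<Rightarrow> nat \<Rightarrow> 'a \<Rightarrow> real" where
  "euler_functional U k \<omega> = y0 + (\<Sum>j<k. b (U j \<omega>) / n + a (U j \<omega>) * \<xi> j \<omega> / sqrt n)"

text \<open>The events \<open>E k\<close> decrease and \<open>E k\<close> is known at time k, so
  restricting to them does the work of stopping at an exit time. Smallness of the residual is
  required on \<open>E k\<close> only, and \<rho>^2/4 leaves room for the delay error.\<close>

definition approx_solution :: "real \<Rightarrow> real \<Rightarrow> (nat \<Rightarrow> 'a set) \<Rightarrow> (nat \<Rightarrow> 'a \<Rightarrow> real) \<Rightarrow> bool" where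
  "approx_solution BU \<rho> E U \<longleftrightarrow> (\<forall>k\<le>n. E k \<in> sets (G k) \<and> U k \<in> borel_measurable (G k) \<and>
     (\<forall>j\<le>k. E k \<subseteq> E j) \<and>
     integrable P (\<lambda>\<omega>. indicator (E k) \<omega> * (U k \<omega>) ^ 4) \<and>
     expectation (\<lambda>\<omega>. indicator (E k) \<omega> * (U k \<omega>) ^ 4) \<le> BU \<and>
     integrable P (\<lambda>\<omega>. indicator (E k) \<omega> * (U k \<omega> - euler_functional U k \<omega>)\<^sup>2) \<and>
     expectation (\<lambda>\<omega>. indicator (E k) \<omega> * (U k \<omega> - euler_functional U k \<omega>)\<^sup>2) \<le> \<rho>\<^sup>2 / 4)"

lemma approx_solutionD:
  assumes "approx_solution BU \<rho> E U" "k \<le> n"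
  shows "E k \<in> sets (G k)" "U k \<in> borel_measurable (G k)" "j \<le> k \<Longrightarrow> E k \<subseteq> E j"
     "integrable P (\<lambda>\<omega>. indicator (E k) \<omega> * (U k \<omega>) ^ 4)"
     "expectation (\<lambda>\<omega>. indicator (E k) \<omega> * (U k \<omega>) ^ 4) \<le> BU"
     "integrable P (\<lambda>\<omega>. indicator (E k) \<omega> * (U k \<omega> - euler_functional U k \<omega>)\<^sup>2)"
     "expectation (\<lambda>\<omega>. indicator (E k) \<omega> * (U k \<omega> - euler_functional U k \<omega>)\<^sup>2) \<le> \<rho>\<^sup>2 / 4"
  using assms unfolding approx_solution_def by blast+

text \<open>\<open>D\<close> accumulates the coefficient differences multiplied by the indicator of
  \<open>E k\<close>. This keeps it an adapted recursion on the whole space; as the events decrease,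
  all earlier indicators equal 1 on \<open>E k\<close>, where \<open>D\<close> is therefore the true
  difference.\<close>

lemma approx_solution_yw_system:
  assumes ap: "approx_solution BU \<rho> E U" and \<kappa>: "\<And>k. \<kappa> k \<le> k" "\<And>k. k - \<kappa> k \<le> l"
    and l: "inc 1 * (real l / n) \<le> \<rho>\<^sup>2 / 4" and \<rho>: "0 < \<rho>"
  shows "\<exists>D \<alpha> \<beta> w r. yw_system (Cb + Ca\<^sup>2) (K ^ 4 * 256 * (1 + BU + growth_const 2 K y0)) \<rho> D \<alpha> \<beta> w r \<and>
     (\<forall>k\<le>n. \<forall>\<omega>\<in>E k. D k \<omega> = euler_functional U k \<omega> - Z \<kappa> k \<omega>)"
proof -
  note A = approx_solutionD[OF ap]
  define \<eta> where "\<eta> k \<omega> = (indicator (E k) \<omega> :: real)" for k \<omega>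
  have \<eta>01: "\<eta> k \<omega> = 0 \<or> \<eta> k \<omega> = 1" for k \<omega> by (auto simp: \<eta>_def indicator_def)
  define V where "V k = Z \<kappa> (\<kappa> k)" for k
  have V: "Z \<kappa> (min k (\<kappa> k)) = V k" for k using \<kappa>(1)[of k] by (simp add: V_def min_def)
  define \<alpha> where "\<alpha> k \<omega> = \<eta> k \<omega> * (a (U k \<omega>) - a (V k \<omega>))" for k \<omega>
  define \<beta> where "\<beta> k \<omega> = \<eta> k \<omega> * (b (U k \<omega>) - b (V k \<omega>))" for k \<omega>
  define D where "D k \<omega> = (\<Sum>j<k. \<beta> j \<omega> / n + \<alpha> j \<omega> * \<xi> j \<omega> / sqrt n)" for k \<omega>
  define w where "w k \<omega> = K * (2 + \<eta> k \<omega> * \<bar>U k \<omega>\<bar> + \<bar>V k \<omega>\<bar>)" for k \<omega>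
  \<comment> \<open>U - V is the sum of U minus its Euler functional, the functional minus Z, and Z
    - V. On \<open>E k\<close> the middle part is \<open>D\<close>; the two others make up
    \<open>r\<close>.\<close>
  define r where "r k \<omega> = \<eta> k \<omega> * \<bar>U k \<omega> - euler_functional U k \<omega>\<bar> + \<bar>Z \<kappa> k \<omega> - V k \<omega>\<bar>" for k \<omega>
  have \<eta>G: "\<eta> k \<in> borel_measurable (G k)" if "k \<le> n" for k
    unfolding \<eta>_def[abs_def] using A(1)[OF that] by (rule borel_measurable_indicator)
  have VG: "V k \<in> borel_measurable (G k)" if "k \<le> n" for k using Z_delayed[OF that, of \<kappa>] unfolding V .
  have Vm: "V k \<in> borel_measurable P" if "k \<le> n" for k by (rule meas_P[OF that VG[OF that]])
  have Um: "U k \<in> borel_measurable P" if "k \<le> n" for k by (rule meas_P[OF that A(2)[OF that]])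
  have \<eta>m: "\<eta> k \<in> borel_measurable P" if "k \<le> n" for k by (rule meas_P[OF that \<eta>G[OF that]])
  have eq: "D k \<omega> = euler_functional U k \<omega> - Z \<kappa> k \<omega>" if k: "k \<le> n" and \<omega>: "\<omega> \<in> E k" for k \<omega>
  proof -
    have one: "\<eta> j \<omega> = 1" if "j < k" for j using A(3)[OF k, of j] \<omega> that by (auto simp: \<eta>_def)
    have "Z \<kappa> i \<omega> = y0 + (\<Sum>j<i. b (V j \<omega>) / n + a (V j \<omega>) * \<xi> j \<omega> / sqrt n)" for i
      by (induction i) (simp_all add: V)
    moreover have "D k \<omega> = (\<Sum>j<k. (b (U j \<omega>) / n + a (U j \<omega>) * \<xi> j \<omega> / sqrt n) - (b (V j \<omega>) / n + a (V j \<omega>) * \<xi> j \<omega> / sqrt n))"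
      unfolding D_def using one by (intro sum.cong) (auto simp: \<alpha>_def \<beta>_def algebra_simps diff_divide_distrib)
    ultimately show ?thesis by (simp add: euler_functional_def sum_subtractf)
  qed
  have w_bd: "\<bar>\<alpha> k \<omega>\<bar> \<le> w k \<omega>" "\<bar>\<beta> k \<omega>\<bar> \<le> w k \<omega>" for k \<omega>
  proof -
    have *: "\<bar>\<eta> k \<omega> * (x - y)\<bar> \<le> w k \<omega>" if "\<bar>x\<bar> \<le> K * (1 + \<bar>U k \<omega>\<bar>)" "\<bar>y\<bar> \<le> K * (1 + \<bar>V k \<omega>\<bar>)" for x y
    proof (cases "\<eta> k \<omega> = 0")
      case True
      then show ?thesis using K by (simp add: w_def)
    next
      case False
      then have 1: "\<eta> k \<omega> = 1" using \<eta>01 by blast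
      have "\<bar>x - y\<bar> \<le> K * (1 + \<bar>U k \<omega>\<bar>) + K * (1 + \<bar>V k \<omega>\<bar>)" using that by linarith
      also have "\<dots> = w k \<omega>" unfolding w_def 1 by (simp add: algebra_simps)
      finally show ?thesis using 1 by simp
    qed
    show "\<bar>\<alpha> k \<omega>\<bar> \<le> w k \<omega>" "\<bar>\<beta> k \<omega>\<bar> \<le> w k \<omega>"
      unfolding \<alpha>_def \<beta>_def by (rule *; rule growth)+
  qed
  have dr: "driven D \<alpha> \<beta> w"
    unfolding driven_def
  proof (intro conjI allI impI ballI)
    show "D 0 \<in> borel_measurable (G 0)" by (simp add: D_def[abs_def])
    fix k assume "k < n"
    then have k: "k \<le> n" by simp
    have [measurable]: "U k \<in> borel_measurable (G k)" "V k \<in> borel_measurable (G k)" "\<eta> k \<in> borel_measurable (G k)"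
      by (rule A(2)[OF k], rule VG[OF k], rule \<eta>G[OF k])
    show "\<alpha> k \<in> borel_measurable (G k)" unfolding \<alpha>_def[abs_def] by measurable
    show "\<beta> k \<in> borel_measurable (G k)" unfolding \<beta>_def[abs_def] by measurable
    show "w k \<in> borel_measurable (G k)" unfolding w_def[abs_def] by measurable
    show "D (Suc k) \<omega> = D k \<omega> + \<beta> k \<omega> / n + \<alpha> k \<omega> * \<xi> k \<omega> / sqrt n" for \<omega> by (simp add: D_def)
  qed (rule w_bd)+
  have close: "\<eta> k \<omega> * \<bar>U k \<omega> - V k \<omega>\<bar> \<le> \<bar>D k \<omega>\<bar> + r k \<omega>" "0 \<le> r k \<omega>" if k: "k < n" for k \<omega>
  proof -
    show "0 \<le> r k \<omega>" using \<eta>01[of k \<omega>] by (auto simp: r_def)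
    show "\<eta> k \<omega> * \<bar>U k \<omega> - V k \<omega>\<bar> \<le> \<bar>D k \<omega>\<bar> + r k \<omega>"
    proof (cases "\<omega> \<in> E k")
      case True
      then have "D k \<omega> = euler_functional U k \<omega> - Z \<kappa> k \<omega>" "\<eta> k \<omega> = 1" using eq[of k \<omega>] k by (auto simp: \<eta>_def)
      then show ?thesis by (simp add: r_def)
    qed (simp add: \<eta>_def r_def)
  qed
  have coeff: "\<bar>\<beta> k \<omega>\<bar> \<le> (Cb + Ca\<^sup>2) * (\<bar>D k \<omega>\<bar> + r k \<omega>)" "(\<alpha> k \<omega>)\<^sup>2 \<le> (Cb + Ca\<^sup>2) * (\<bar>D k \<omega>\<bar> + r k \<omega>)" if k: "k < n" for k \<omega>
  proof -
    have \<eta>0: "0 \<le> \<eta> k \<omega>" using \<eta>01[of k \<omega>] by auto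
    have "\<bar>\<beta> k \<omega>\<bar> \<le> Cb * (\<eta> k \<omega> * \<bar>U k \<omega> - V k \<omega>\<bar>)"
      unfolding \<beta>_def abs_mult using mult_left_mono[OF b_lip \<eta>0, of "U k \<omega>" "V k \<omega>"] \<eta>0 by (simp add: mult_ac)
    also have "\<dots> \<le> (Cb + Ca\<^sup>2) * (\<bar>D k \<omega>\<bar> + r k \<omega>)"
      using close[OF k, of \<omega>] Cb \<eta>0 by (intro mult_mono) auto
    finally show "\<bar>\<beta> k \<omega>\<bar> \<le> (Cb + Ca\<^sup>2) * (\<bar>D k \<omega>\<bar> + r k \<omega>)" .
    have "(\<alpha> k \<omega>)\<^sup>2 = \<eta> k \<omega> * (a (U k \<omega>) - a (V k \<omega>))\<^sup>2" using \<eta>01[of k \<omega>] by (auto simp: \<alpha>_def)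
    also have "\<dots> \<le> \<eta> k \<omega> * (Ca\<^sup>2 * \<bar>U k \<omega> - V k \<omega>\<bar>)" by (rule mult_left_mono[OF a_hol_sq \<eta>0])
    also have "\<dots> = Ca\<^sup>2 * (\<eta> k \<omega> * \<bar>U k \<omega> - V k \<omega>\<bar>)" by simp
    also have "\<dots> \<le> (Cb + Ca\<^sup>2) * (\<bar>D k \<omega>\<bar> + r k \<omega>)"
      using close[OF k, of \<omega>] Cb \<eta>0 by (intro mult_mono) auto
    finally show "(\<alpha> k \<omega>)\<^sup>2 \<le> (Cb + Ca\<^sup>2) * (\<bar>D k \<omega>\<bar> + r k \<omega>)" .
  qed
  have wint: "integrable P (\<lambda>\<omega>. w k \<omega> ^ 4) \<and> expectation (\<lambda>\<omega>. w k \<omega> ^ 4) \<le> K ^ 4 * 256 * (1 + BU + growth_const 2 K y0)"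
    if "k < n" for k
  proof -
    have k: "k \<le> n" "\<kappa> k \<le> n" using that \<kappa>(1)[of k] by auto
    \<comment> \<open>256 = 16 * 16: a sum of three terms is split by two applications of
      \<open>power_add_le_split\<close> with exponent 4.\<close>
    define W where "W \<omega> = K ^ 4 * 256 * (1 + indicator (E k) \<omega> * U k \<omega> ^ 4 + V k \<omega> ^ 4)" for \<omega>
    have iV: "integrable P (\<lambda>\<omega>. V k \<omega> ^ 4)" "expectation (\<lambda>\<omega>. V k \<omega> ^ 4) \<le> growth_const 2 K y0"
      using Z_moment[OF k(2), of 2 \<kappa>] by (simp_all add: V_def)
    have b: "0 \<le> w k \<omega> ^ 4" "w k \<omega> ^ 4 \<le> W \<omega>" for \<omega>
    proof -
      let ?u = "\<eta> k \<omega> * \<bar>U k \<omega>\<bar>" and ?v = "\<bar>V k \<omega>\<bar>"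
      have u: "0 \<le> ?u" using \<eta>01[of k \<omega>] by auto
      have "(2 + (?u + ?v)) ^ 4 \<le> 2 ^ 4 * (2 ^ 4 + (?u + ?v) ^ 4)" using u by (intro power_add_le_split) auto
      also have "(?u + ?v) ^ 4 \<le> 2 ^ 4 * (?u ^ 4 + ?v ^ 4)" using u by (intro power_add_le_split) auto
      also have "?u ^ 4 = indicator (E k) \<omega> * U k \<omega> ^ 4" by (auto simp: \<eta>_def indicator_def)
      finally have "(2 + (?u + ?v)) ^ 4 \<le> 256 * (1 + indicator (E k) \<omega> * U k \<omega> ^ 4 + V k \<omega> ^ 4)" by simp
      then have "K ^ 4 * (2 + (?u + ?v)) ^ 4 \<le> K ^ 4 * (256 * (1 + indicator (E k) \<omega> * U k \<omega> ^ 4 + V k \<omega> ^ 4))"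
        by (rule mult_left_mono) simp
      then show "w k \<omega> ^ 4 \<le> W \<omega>" by (simp add: w_def W_def power_mult_distrib mult.assoc add.assoc)
      show "0 \<le> w k \<omega> ^ 4" by simp
    qed
    have iW: "integrable P W" unfolding W_def[abs_def] using A(4)[OF k(1)] iV by auto
    have wm: "w k \<in> borel_measurable P" using drivenD(4)[OF dr that] meas_P[OF k(1)] by blast
    have iw: "integrable P (\<lambda>\<omega>. w k \<omega> ^ 4)"
    proof (rule Bochner_Integration.integrable_bound[OF iW])
      show "(\<lambda>\<omega>. w k \<omega> ^ 4) \<in> borel_measurable P" using wm by measurable
      show "AE \<omega> in P. norm (w k \<omega> ^ 4) \<le> norm (W \<omega>)" by (rule AE_I2) (smt (verit) b real_norm_def)
    qed
    have "expectation (\<lambda>\<omega>. w k \<omega> ^ 4) \<le> expectation W" by (rule integral_mono[OF iw iW b(2)])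
    also have "\<dots> = K ^ 4 * 256 * (1 + expectation (\<lambda>\<omega>. indicator (E k) \<omega> * U k \<omega> ^ 4) + expectation (\<lambda>\<omega>. V k \<omega> ^ 4))"
      unfolding W_def[abs_def] using A(4)[OF k(1)] iV by (simp add: prob_space)
    also have "\<dots> \<le> K ^ 4 * 256 * (1 + BU + growth_const 2 K y0)"
      using A(5)[OF k(1)] iV(2) K by (intro mult_left_mono add_mono) auto
    finally show ?thesis using iw by simp
  qed
  have rint: "r k \<in> borel_measurable P \<and> integrable P (\<lambda>\<omega>. (r k \<omega>)\<^sup>2) \<and> expectation (\<lambda>\<omega>. (r k \<omega>)\<^sup>2) \<le> \<rho>\<^sup>2" if kn: "k < n" for k
  proof -
    have k: "k \<le> n" "\<kappa> k \<le> n" using kn \<kappa>(1)[of k] by auto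
    have em: "euler_functional U k \<in> borel_measurable P"
      unfolding euler_functional_def[abs_def]
    proof (intro borel_measurable_add borel_measurable_sum borel_measurable_const)
      fix j assume "j \<in> {..<k}"
      then have j: "j < n" "j \<le> n" using kn by auto
      show "(\<lambda>\<omega>. b (U j \<omega>) / real n) \<in> borel_measurable P" using Um[OF j(2)] by measurable
      show "(\<lambda>\<omega>. a (U j \<omega>) * \<xi> j \<omega> / sqrt n) \<in> borel_measurable P" using Um[OF j(2)] noise_meas_P[OF j(1)] by measurable
    qed
    have zm: "Z \<kappa> k \<in> borel_measurable P" by (rule meas_P[OF k(1) Z_adapted[OF k(1)]])
    have rm: "r k \<in> borel_measurable P" unfolding r_def[abs_def] using em zm Vm[OF k(1)] Um[OF k(1)] \<eta>m[OF k(1)] by measurable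
    \<comment> \<open>Squaring the sum doubles each of its two parts, and each part has mean at most
      \<rho>^2/4.\<close>
    define R where "R \<omega> = 2 * (indicator (E k) \<omega> * (U k \<omega> - euler_functional U k \<omega>)\<^sup>2) + 2 * (Z \<kappa> k \<omega> - V k \<omega>)\<^sup>2" for \<omega>
    have iZ: "integrable P (\<lambda>\<omega>. (Z \<kappa> k \<omega> - V k \<omega>)\<^sup>2)" "expectation (\<lambda>\<omega>. (Z \<kappa> k \<omega> - V k \<omega>)\<^sup>2) \<le> inc 1 * ((real k - real (\<kappa> k)) / n)"
      using Z_increment[OF \<kappa>(1)[of k] k(1), of 1 \<kappa>] by (simp_all add: V_def)
    have "real k - real (\<kappa> k) \<le> l" using \<kappa>(1,2)[of k] by linarith
    then have "inc 1 * ((real k - real (\<kappa> k)) / n) \<le> inc 1 * (real l / n)"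
      using inc_nonneg[of 1] by (intro mult_left_mono divide_right_mono) auto
    then have EZ: "expectation (\<lambda>\<omega>. (Z \<kappa> k \<omega> - V k \<omega>)\<^sup>2) \<le> \<rho>\<^sup>2 / 4" using iZ(2) l by linarith
    have b: "(r k \<omega>)\<^sup>2 \<le> R \<omega>" for \<omega>
    proof -
      let ?x = "\<eta> k \<omega> * \<bar>U k \<omega> - euler_functional U k \<omega>\<bar>" and ?y = "\<bar>Z \<kappa> k \<omega> - V k \<omega>\<bar>"
      have "(?x + ?y)\<^sup>2 \<le> 2 * ?x\<^sup>2 + 2 * ?y\<^sup>2" using sum_squares_bound[of ?x ?y] by (simp add: power2_sum)
      moreover have "?x\<^sup>2 = indicator (E k) \<omega> * (U k \<omega> - euler_functional U k \<omega>)\<^sup>2" by (auto simp: \<eta>_def indicator_def)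
      ultimately show ?thesis by (simp add: r_def R_def)
    qed
    have iR: "integrable P R" unfolding R_def[abs_def] using A(6)[OF k(1)] iZ(1) by auto
    have ir: "integrable P (\<lambda>\<omega>. (r k \<omega>)\<^sup>2)"
    proof (rule Bochner_Integration.integrable_bound[OF iR])
      show "(\<lambda>\<omega>. (r k \<omega>)\<^sup>2) \<in> borel_measurable P" using rm by measurable
      show "AE \<omega> in P. norm ((r k \<omega>)\<^sup>2) \<le> norm (R \<omega>)" by (rule AE_I2) (smt (verit) b real_norm_def zero_le_power2)
    qed
    have "expectation (\<lambda>\<omega>. (r k \<omega>)\<^sup>2) \<le> expectation R" by (rule integral_mono[OF ir iR b])
    also have "\<dots> = 2 * expectation (\<lambda>\<omega>. indicator (E k) \<omega> * (U k \<omega> - euler_functional U k \<omega>)\<^sup>2)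
       + 2 * expectation (\<lambda>\<omega>. (Z \<kappa> k \<omega> - V k \<omega>)\<^sup>2)"
      unfolding R_def[abs_def] using A(6)[OF k(1)] iZ(1) by simp
    also have "\<dots> \<le> \<rho>\<^sup>2" using A(7)[OF k(1)] EZ by linarith
    finally show ?thesis using rm ir by simp
  qed
  have "yw_system (Cb + Ca\<^sup>2) (K ^ 4 * 256 * (1 + BU + growth_const 2 K y0)) \<rho> D \<alpha> \<beta> w r"
    unfolding yw_system_def
  proof (intro conjI allI impI ballI)
    show "D 0 \<omega> = 0" for \<omega> by (simp add: D_def)
  qed (use dr coeff close(2) wint rint in blast)+
  then show ?thesis using eq by blast
qed

end

text \<open>\<rho> and n0 are fixed before the space, the noise, the events and the delay, so that
  one statement serves both drivers. The condition on \<open>inc\<close> says that blocks are short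
  enough for the delay error to be of size \<rho>.\<close>

lemma approx_solution_close:
  fixes c :: "nat \<Rightarrow> real"
  assumes co: "sde_coeffs a b Ca Cb" and \<theta>: "0 < \<theta>" and \<epsilon>: "0 < \<epsilon>"
  shows "\<exists>\<rho>>0. \<exists>n0. \<forall>(P :: 'a measure) G \<xi> n E U \<kappa> l. noise P G \<xi> c n \<longrightarrow> n0 \<le> n \<longrightarrow>
    euler_setting.approx_solution P G \<xi> n a b y0 BU \<rho> E U \<longrightarrow>
    (\<forall>k. \<kappa> k \<le> k \<and> k - \<kappa> k \<le> l) \<longrightarrow> euler_setting.inc c a b Ca Cb y0 1 * (real l / n) \<le> \<rho>\<^sup>2 / 4 \<longrightarrow>
    (\<forall>k\<le>n. measure P {\<omega>\<in>E k. \<theta> \<le> \<bar>euler_setting.euler_functional \<xi> n a b y0 U k \<omega> - delayed_euler a b y0 n \<xi> \<kappa> k \<omega>\<bar>} < \<epsilon>)"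
proof -
  interpret sde_coeffs a b Ca Cb y0 by fact
  \<comment> \<open>\<open>BU\<close> is arbitrary here, so positivity is enforced by the maximum;
    \<open>yw_system\<close> is monotone in this bound.\<close>
  define B where "B = max 0 (K ^ 4 * 256 * (1 + BU + noise.growth_const c 2 K y0))"
  have C: "0 < Cb + Ca\<^sup>2" using Cb by (simp add: add_pos_nonneg)
  have "0 \<le> B" by (simp add: B_def)
  from yw_system_small[OF C this \<theta> \<epsilon>, of c, where ?'a='a] show ?thesis
  proof (elim exE conjE)
  fix \<rho> n0
  assume \<rho>: "\<rho> > 0" and main: "\<forall>(P :: 'a measure) G \<xi> n D \<alpha> \<beta> w r. noise P G \<xi> c n \<longrightarrow> n0 \<le> n \<longrightarrow>
      noise.yw_system P G \<xi> n (Cb + Ca\<^sup>2) B \<rho> D \<alpha> \<beta> w r \<longrightarrow> (\<forall>k\<le>n. measure P {\<omega>\<in>space P. \<theta> \<le> \<bar>D k \<omega>\<bar>} < \<epsilon>)"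
  show ?thesis
  proof (intro exI[of _ \<rho>] exI[of _ n0] conjI \<rho> allI impI)
    fix P :: "'a measure" and G \<xi> n E U \<kappa> l k
    assume N: "noise P G \<xi> c n" and n0: "n0 \<le> n" and ap: "euler_setting.approx_solution P G \<xi> n a b y0 BU \<rho> E U"
      and \<kappa>: "\<forall>k. \<kappa> k \<le> k \<and> k - \<kappa> k \<le> l" and l: "euler_setting.inc c a b Ca Cb y0 1 * (real l / n) \<le> \<rho>\<^sup>2 / 4"
      and k: "k \<le> n"
    interpret noise P G \<xi> c n by fact
    interpret euler_setting P G \<xi> c n a b Ca Cb y0 by unfold_locales
    obtain D \<alpha> \<beta> w r where sys: "yw_system (Cb + Ca\<^sup>2) (K ^ 4 * 256 * (1 + BU + growth_const 2 K y0)) \<rho> D \<alpha> \<beta> w r"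
      and eq: "\<And>k \<omega>. k \<le> n \<Longrightarrow> \<omega> \<in> E k \<Longrightarrow> D k \<omega> = euler_functional U k \<omega> - Z \<kappa> k \<omega>"
      using approx_solution_yw_system[OF ap _ _ l \<rho>, of \<kappa>] \<kappa> by blast
    have "yw_system (Cb + Ca\<^sup>2) B \<rho> D \<alpha> \<beta> w r"
      using sys unfolding yw_system_def B_def by (auto intro: max.coboundedI2)
    from main[rule_format, OF N n0 this k] have m: "measure P {\<omega>\<in>space P. \<theta> \<le> \<bar>D k \<omega>\<bar>} < \<epsilon>" .
    have Ek: "E k \<subseteq> space P" using sets.sets_into_space[OF approx_solutionD(1)[OF ap k]] space_G[OF k] by simp
    have Dm: "D k \<in> borel_measurable P" using driven_adapted[OF yw_systemD(1)[OF sys] k] meas_P[OF k] by blast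
    have "measure P {\<omega>\<in>E k. \<theta> \<le> \<bar>euler_functional U k \<omega> - Z \<kappa> k \<omega>\<bar>} \<le> measure P {\<omega>\<in>space P. \<theta> \<le> \<bar>D k \<omega>\<bar>}"
    proof (rule finite_measure_mono)
      show "{\<omega>\<in>E k. \<theta> \<le> \<bar>euler_functional U k \<omega> - Z \<kappa> k \<omega>\<bar>} \<subseteq> {\<omega>\<in>space P. \<theta> \<le> \<bar>D k \<omega>\<bar>}"
        using eq[OF k] Ek by auto
      show "{\<omega>\<in>space P. \<theta> \<le> \<bar>D k \<omega>\<bar>} \<in> events" using Dm by measurable
    qed
    then show "measure P {\<omega>\<in>E k. \<theta> \<le> \<bar>euler_functional U k \<omega> - Z \<kappa> k \<omega>\<bar>} < \<epsilon>" using m by linarith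
  qed
  qed
qed

text \<open>The ordinary scheme is its own Euler functional, so the residual vanishes and the events
  can be the whole space. Only the delay within blocks of length \<open>n div m\<close> remains,
  with mean square at most \<open>inc\<close>/m; m is chosen before n.\<close>

lemma fine_vs_coarse:
  fixes c :: "nat \<Rightarrow> real"
  assumes co: "sde_coeffs a b Ca Cb" and \<theta>: "0 < \<theta>" and \<epsilon>: "0 < \<epsilon>"
  shows "\<exists>m0. \<forall>m\<ge>m0. \<exists>n0. \<forall>(P :: 'a measure) G \<xi> n. noise P G \<xi> c n \<longrightarrow> n0 \<le> n \<longrightarrow>
    (\<forall>k\<le>n. measure P {\<omega>\<in>space P. \<theta> \<le> \<bar>delayed_euler a b y0 n \<xi> id k \<omega> -
       delayed_euler a b y0 n \<xi> (\<lambda>k. (n div m) * (k div (n div m))) k \<omega>\<bar>} < \<epsilon>)"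
proof -
  interpret sde_coeffs a b Ca Cb y0 by fact
  define I where "I = euler_setting.inc c a b Ca Cb y0 1"
  define BU where "BU = noise.growth_const c 2 K y0"
  from approx_solution_close[OF co \<theta> \<epsilon>, of c y0 BU, where ?'a='a] show ?thesis
  proof (elim exE conjE)
    fix \<rho> :: real and n0
    assume \<rho>: "\<rho> > 0" and main: "\<forall>(P :: 'a measure) G \<xi> n E U \<kappa> l. noise P G \<xi> c n \<longrightarrow> n0 \<le> n \<longrightarrow>
    euler_setting.approx_solution P G \<xi> n a b y0 BU \<rho> E U \<longrightarrow>
    (\<forall>k. \<kappa> k \<le> k \<and> k - \<kappa> k \<le> l) \<longrightarrow> euler_setting.inc c a b Ca Cb y0 1 * (real l / n) \<le> \<rho>\<^sup>2 / 4 \<longrightarrow>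
    (\<forall>k\<le>n. measure P {\<omega>\<in>E k. \<theta> \<le> \<bar>euler_setting.euler_functional \<xi> n a b y0 U k \<omega> - delayed_euler a b y0 n \<xi> \<kappa> k \<omega>\<bar>} < \<epsilon>)"
    \<comment> \<open>From m1 on, |I|/m \<le> \<rho>^2/4.\<close>
    obtain m1 :: nat where m1: "\<bar>I\<bar> * 4 / \<rho>\<^sup>2 < m1" using reals_Archimedean2 by blast
    show ?thesis
    proof (rule exI[of _ "max 1 m1"], intro allI impI)
      fix m assume m: "max 1 m1 \<le> m"
      show "\<exists>n0. \<forall>(P :: 'a measure) G \<xi> n. noise P G \<xi> c n \<longrightarrow> n0 \<le> n \<longrightarrow>
    (\<forall>k\<le>n. measure P {\<omega>\<in>space P. \<theta> \<le> \<bar>delayed_euler a b y0 n \<xi> id k \<omega> -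
       delayed_euler a b y0 n \<xi> (\<lambda>k. (n div m) * (k div (n div m))) k \<omega>\<bar>} < \<epsilon>)"
      \<comment> \<open>n \<ge> m keeps the block length positive.\<close>
      proof (intro exI[of _ "max n0 m"] allI impI)
        fix P :: "'a measure" and G \<xi> n k
        assume N: "noise P G \<xi> c n" and n: "max n0 m \<le> n" and k: "k \<le> n"
        interpret noise P G \<xi> c n by fact
        interpret euler_setting P G \<xi> c n a b Ca Cb y0 by unfold_locales
        define l where "l = n div m"
        have l1: "1 \<le> l" using n m by (simp add: l_def div_greater_zero_iff Suc_leI)
        have fn: "euler_functional (Z id) i = Z id i" for i
        proof
          show "euler_functional (Z id) i \<omega> = Z id i \<omega>" for \<omega>
            by (induction i) (simp_all add: euler_functional_def)
        qed
        have ap: "approx_solution BU \<rho> (\<lambda>_. space P) (Z id)"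
          unfolding approx_solution_def
        proof (intro allI impI conjI)
          fix i assume i: "i \<le> n"
          show "space P \<in> sets (G i)" using space_G[OF i] sets.top[of "G i"] by simp
          show "Z id i \<in> borel_measurable (G i)" by (rule Z_adapted[OF i])
          have e: "expectation (\<lambda>\<omega>. indicator (space P) \<omega> * Z id i \<omega> ^ 4) = expectation (\<lambda>\<omega>. Z id i \<omega> ^ 4)"
            by (intro Bochner_Integration.integral_cong) auto
          show "integrable P (\<lambda>\<omega>. indicator (space P) \<omega> * Z id i \<omega> ^ 4)"
            using Z_moment(1)[OF i, of 2 id] by (subst Bochner_Integration.integrable_cong[OF refl, where g="\<lambda>\<omega>. Z id i \<omega> ^ 4"]) auto
          show "expectation (\<lambda>\<omega>. indicator (space P) \<omega> * Z id i \<omega> ^ 4) \<le> BU"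
            using Z_moment(2)[OF i, of 2 id] unfolding e BU_def by simp
        qed (use \<rho> in \<open>simp_all add: fn\<close>)
        have ml: "l * m \<le> n" by (simp add: l_def)
        have "\<forall>i. l * (i div l) \<le> i \<and> i - l * (i div l) \<le> l"
        proof (intro allI conjI)
          fix i
          show "l * (i div l) \<le> i" by simp
          have "i - l * (i div l) = i mod l" by (simp add: minus_mult_div_eq_mod)
          also have "\<dots> < l" using l1 by simp
          finally show "i - l * (i div l) \<le> l" by simp
        qed
        moreover have "inc 1 * (real l / n) \<le> \<rho>\<^sup>2 / 4"
        proof -
          have m0: "0 < real m" using m by simp
          have "real l * real m \<le> real n" using ml by (metis of_nat_le_iff of_nat_mult)
          then have "real l / n \<le> 1 / m" using n_pos m0 by (simp add: divide_simps)
          then have "inc 1 * (real l / n) \<le> \<bar>I\<bar> * (1 / m)"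
            using inc_nonneg[of 1] unfolding I_def by (intro mult_mono) auto
          also have "\<dots> \<le> \<rho>\<^sup>2 / 4"
          proof -
            have "\<bar>I\<bar> * 4 / \<rho>\<^sup>2 < m" using m1 m by linarith
            then have "\<bar>I\<bar> * 4 < m * \<rho>\<^sup>2" using \<rho> pos_divide_less_eq[of "\<rho>\<^sup>2" "\<bar>I\<bar> * 4" m] by simp
            then show ?thesis using m0 by (simp add: divide_simps mult.commute)
          qed
          finally show ?thesis .
        qed
        ultimately have "measure P {\<omega>\<in>space P. \<theta> \<le> \<bar>euler_functional (Z id) k \<omega> - Z (\<lambda>k. l * (k div l)) k \<omega>\<bar>} < \<epsilon>"
          using main[rule_format, OF N _ ap _ _ k, of "\<lambda>k. l * (k div l)" l] n by simp
        then show "measure P {\<omega>\<in>space P. \<theta> \<le> \<bar>Z id k \<omega> - Z (\<lambda>k. (n div m) * (k div (n div m))) k \<omega>\<bar>} < \<epsilon>"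
          unfolding fn l_def .
      qed
    qed
  qed
qed

section \<open>Brownian increments and scaled iid variables as noise\<close>

locale bm = prob_space M for M :: "'a measure" +
  fixes F :: "real \<Rightarrow> 'a set set" and W :: "real \<Rightarrow> 'a \<Rightarrow> real"
  assumes brownian: "brownian_motion M F W"
begin

text \<open>The filtration comes as bare families of sets. Turning each into a measure space makes
  adaptedness a \<open>borel_measurable\<close> statement; for times in [0,1] the family is already
  a sigma-algebra, so \<open>sigma\<close> returns it unchanged.\<close>

definition "Fm t = sigma (space M) (F t)"

lemma space_Fm [simp]: "space (Fm t) = space M"
  by (simp add: Fm_def space_measure_of_conv)

lemma sets_Fm: "0 \<le> t \<Longrightarrow> t \<le> 1 \<Longrightarrow> sets (Fm t) = F t"
  using brownian unfolding brownian_motion_def Fm_def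
  by (intro sigma_algebra.sets_measure_of_eq) auto

lemma Fm_subalgebra: "0 \<le> t \<Longrightarrow> t \<le> 1 \<Longrightarrow> subalgebra M (Fm t)"
  using brownian unfolding brownian_motion_def subalgebra_def by (auto simp: sets_Fm)

lemma Fm_mono: "0 \<le> s \<Longrightarrow> s \<le> t \<Longrightarrow> t \<le> 1 \<Longrightarrow> sets (Fm s) \<subseteq> sets (Fm t)"
  using brownian unfolding brownian_motion_def by (simp add: sets_Fm)

lemma Fm_meas_mono: "0 \<le> s \<Longrightarrow> s \<le> t \<Longrightarrow> t \<le> 1 \<Longrightarrow> X \<in> borel_measurable (Fm s) \<Longrightarrow> X \<in> borel_measurable (Fm t)"
  using Fm_mono[of s t] unfolding measurable_def by auto

lemma Fm_meas_M: "0 \<le> t \<Longrightarrow> t \<le> 1 \<Longrightarrow> X \<in> borel_measurable (Fm t) \<Longrightarrow> X \<in> borel_measurable M"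
  using measurable_from_subalg[OF Fm_subalgebra] by blast

lemma adapted_measI:
  fixes X :: "'a \<Rightarrow> real"
  assumes "0 \<le> t" "t \<le> 1" "\<And>B. B \<in> sets borel \<Longrightarrow> {\<omega>\<in>space M. X \<omega> \<in> B} \<in> F t"
  shows "X \<in> borel_measurable (Fm t)"
proof (rule measurableI)
  fix B :: "real set" assume "B \<in> sets borel"
  then show "X -` B \<inter> space (Fm t) \<in> sets (Fm t)"
    using assms by (simp add: sets_Fm vimage_def Int_def conj_commute)
qed simp

lemma W_adapted: "0 \<le> t \<Longrightarrow> t \<le> 1 \<Longrightarrow> W t \<in> borel_measurable (Fm t)"
  using brownian unfolding brownian_motion_def by (intro adapted_measI) auto

lemma W_increment_dist:
  assumes "0 \<le> s" "s < t" "t \<le> 1"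
  shows "distributed M lborel (\<lambda>\<omega>. (W t \<omega> - W s \<omega>) / sqrt (t - s)) (\<lambda>x. ennreal (std_normal_density x))"
proof -
  have "distributed M lborel (\<lambda>\<omega>. W t \<omega> - W s \<omega>) (\<lambda>x. ennreal (normal_density 0 (sqrt (t - s)) x))"
    using brownian assms unfolding brownian_motion_def by blast
  then show ?thesis using normal_standard_normal_convert[of "sqrt (t - s)" "\<lambda>\<omega>. W t \<omega> - W s \<omega>" 0] assms by simp
qed

lemma W_increment_indep:
  assumes "0 \<le> s" "s < t" "t \<le> 1" "A \<in> sets (Fm s)" "B \<in> sets borel"
  shows "prob (A \<inter> {\<omega>\<in>space M. W t \<omega> - W s \<omega> \<in> B}) = prob A * prob {\<omega>\<in>space M. W t \<omega> - W s \<omega> \<in> B}"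
proof -
  have "A \<in> F s" using assms by (simp add: sets_Fm)
  then show ?thesis using brownian assms(1,2,3,5) unfolding brownian_motion_def by blast
qed

definition normal_abs_moment :: "nat \<Rightarrow> real" where
  "normal_abs_moment q = (\<integral>x. std_normal_density x * \<bar>x\<bar> ^ q \<partial>lborel)"

definition "bm_noise (n :: nat) k \<omega> = (W (real (Suc k) / n) \<omega> - W (real k / n) \<omega>) * sqrt n"

text \<open>The factor sqrt n makes grid increments standard normal, so their moment bounds do not
  depend on n.\<close>

lemma bm_noise:
  assumes n: "0 < n"
  shows "noise M (\<lambda>k. Fm (real k / n)) (bm_noise n) normal_abs_moment n"
proof -
  have dist: "distributed M lborel (bm_noise n k) (\<lambda>x. ennreal (std_normal_density x))" if "k < n" for k
  proof -
    have k: "0 \<le> real k / n" "real k / n < real (Suc k) / n" "real (Suc k) / n \<le> 1" using that n by (auto simp: field_simps)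
    have e: "real (Suc k) / n - real k / n = 1 / n" by (simp add: diff_divide_distrib[symmetric])
    have "bm_noise n k = (\<lambda>\<omega>. (W (real (Suc k) / n) \<omega> - W (real k / n) \<omega>) / sqrt (real (Suc k) / n - real k / n))"
      unfolding bm_noise_def[abs_def] e by (simp add: real_sqrt_divide)
    then show ?thesis using W_increment_dist[OF k] by simp
  qed
  show ?thesis
  proof unfold_locales
    show "0 < n" by fact
    show "subalgebra M (Fm (real k / n))" if "k \<le> n" for k using that n by (intro Fm_subalgebra) auto
    show "sets (Fm (real j / n)) \<subseteq> sets (Fm (real k / n))" if "j \<le> k" "k \<le> n" for j k
      using that n by (intro Fm_mono divide_right_mono) auto
    show "bm_noise n k \<in> borel_measurable (Fm (real (Suc k) / n))" if k: "k < n" for k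
    proof -
      have [measurable]: "W (real (Suc k) / n) \<in> borel_measurable (Fm (real (Suc k) / n))"
        using k n by (intro W_adapted) auto
      have [measurable]: "W (real k / n) \<in> borel_measurable (Fm (real (Suc k) / n))"
        using k n by (intro Fm_meas_mono[OF _ _ _ W_adapted] divide_right_mono) auto
      show ?thesis unfolding bm_noise_def[abs_def] by measurable
    qed
    show "prob (A \<inter> (bm_noise n k -` B \<inter> space M)) = prob A * prob (bm_noise n k -` B \<inter> space M)"
      if k: "k < n" and A: "A \<in> sets (Fm (real k / n))" and B: "B \<in> sets borel" for k A B
    proof -
      let ?B = "(\<lambda>x. x * sqrt n) -` B \<inter> space borel"
      have "(\<lambda>x. x * sqrt n) \<in> borel_measurable borel" by measurable
      then have B': "?B \<in> sets borel" using B by (rule measurable_sets)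
      have e: "bm_noise n k -` B \<inter> space M = {\<omega>\<in>space M. W (real (Suc k) / n) \<omega> - W (real k / n) \<omega> \<in> ?B}"
        by (auto simp: bm_noise_def)
      have l: "0 \<le> real k / n" "real k / n < real (Suc k) / n" "real (Suc k) / n \<le> 1" using k n by (auto simp: field_simps)
      show ?thesis unfolding e by (rule W_increment_indep[OF l A B'])
    qed
    fix k q assume k: "k < n"
    show "integrable M (\<lambda>\<omega>. \<bar>bm_noise n k \<omega>\<bar> ^ q)"
      using distributed_integrable[OF dist[OF k], of "\<lambda>x. \<bar>x\<bar> ^ q"] integrable_std_normal_moment_abs[of q] by simp
    show "expectation (\<lambda>\<omega>. \<bar>bm_noise n k \<omega>\<bar> ^ q) \<le> normal_abs_moment q"
      using distributed_integral[OF dist[OF k], of "\<lambda>x. \<bar>x\<bar> ^ q"] by (simp add: normal_abs_moment_def)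
    show "expectation (bm_noise n k) = 0"
      using distributed_integral[OF dist[OF k], of "\<lambda>x. x"] integral_std_normal_moment_odd[of 0] by simp
    show "expectation (\<lambda>\<omega>. (bm_noise n k \<omega>)\<^sup>2) = 1"
      using distributed_integral[OF dist[OF k], of "\<lambda>x. x\<^sup>2"] integral_std_normal_moment_even[of 1] by simp
  qed
qed

end

locale iid_noise = prob_space N for N :: "'b measure" +
  fixes \<zeta> :: "nat \<Rightarrow> 'b \<Rightarrow> real" and \<sigma> :: real
  assumes rv: "\<And>i. i \<ge> 1 \<Longrightarrow> \<zeta> i \<in> borel_measurable N"
    and indep: "indep_vars (\<lambda>_. borel) \<zeta> {1::nat..}"
    and ident: "\<And>i. i \<ge> 1 \<Longrightarrow> distr N borel (\<zeta> i) = distr N borel (\<zeta> 1)"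
    and moments: "\<And>p::nat. integrable N (\<lambda>\<omega>. \<bar>\<zeta> 1 \<omega>\<bar> ^ p)"
    and mean: "expectation (\<zeta> 1) = 0"
    and var: "expectation (\<lambda>\<omega>. (\<zeta> 1 \<omega>)\<^sup>2) = \<sigma>\<^sup>2" and \<sigma>: "0 < \<sigma>"
begin

text \<open>As a preimage algebra: an event of the past is literally a preimage under the tuple of
  the first k variables, to which independence of disjoint index sets applies.\<close>

definition "past k = vimage_algebra (space N) (\<lambda>\<omega>. \<lambda>i\<in>{1..k}. \<zeta> i \<omega>) (Pi\<^sub>M {1..k} (\<lambda>_. borel :: real measure))"

text \<open>The index is shifted, since noise is counted from 0 and the given variables from
  1.\<close>

definition "iid k \<omega> = \<zeta> (Suc k) \<omega> / \<sigma>"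

lemma tuple_space: "(\<lambda>\<omega>. \<lambda>i\<in>{1..k}. \<zeta> i \<omega>) \<in> space N \<rightarrow> space (Pi\<^sub>M {1..k} (\<lambda>_. borel :: real measure))"
  by (auto simp: space_PiM)

lemma space_past [simp]: "space (past k) = space N" by (simp add: past_def)

lemma meas_past: "1 \<le> i \<Longrightarrow> i \<le> k \<Longrightarrow> \<zeta> i \<in> borel_measurable (past k)"
proof -
  assume i: "1 \<le> i" "i \<le> k"
  have "(\<lambda>\<omega>. (\<lambda>i\<in>{1..k}. \<zeta> i \<omega>) i) \<in> borel_measurable (past k)"
    unfolding past_def using i
    by (intro measurable_compose[OF measurable_vimage_algebra1[OF tuple_space] measurable_component_singleton]) auto
  then show ?thesis using i by simp
qed

lemma integral_transfer:
  fixes f :: "real \<Rightarrow> real"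
  assumes i: "1 \<le> i" and f: "f \<in> borel_measurable borel"
  shows "integrable N (\<lambda>\<omega>. f (\<zeta> i \<omega>)) \<longleftrightarrow> integrable N (\<lambda>\<omega>. f (\<zeta> 1 \<omega>))"
    "expectation (\<lambda>\<omega>. f (\<zeta> i \<omega>)) = expectation (\<lambda>\<omega>. f (\<zeta> 1 \<omega>))"
  using integrable_distr_eq[OF rv[OF i] f] integrable_distr_eq[OF rv[of 1] f] ident[OF i]
    integral_distr[OF rv[OF i] f] integral_distr[OF rv[of 1] f] by simp_all

lemma iid_noise: "0 < n \<Longrightarrow> noise N past iid (\<lambda>q. expectation (\<lambda>\<omega>. \<bar>\<zeta> 1 \<omega> / \<sigma>\<bar> ^ q)) n"
proof unfold_locales
  show "0 < n" if "0 < n" using that .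
  have tup: "(\<lambda>\<omega>. \<lambda>i\<in>{1..j}. \<zeta> i \<omega>) \<in> measurable (past k) (Pi\<^sub>M {1..j} (\<lambda>_. borel))" if "j \<le> k" for j k
    using that by (intro measurable_restrict meas_past) auto
  have tupN: "(\<lambda>\<omega>. \<lambda>i\<in>{1..j}. \<zeta> i \<omega>) \<in> measurable N (Pi\<^sub>M {1..j} (\<lambda>_. borel))" for j
    by (intro measurable_restrict rv) auto
  have past_sets: "sets (past k) = {(\<lambda>\<omega>. \<lambda>i\<in>{1..k}. \<zeta> i \<omega>) -` A \<inter> space N |A. A \<in> sets (Pi\<^sub>M {1..k} (\<lambda>_. borel))}" for k
    unfolding past_def by (rule sets_vimage_algebra2[OF tuple_space])
  show "subalgebra N (past k)" for k
    unfolding subalgebra_def past_sets using measurable_sets[OF tupN] by auto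
  show "sets (past j) \<subseteq> sets (past k)" if "j \<le> k" for j k
    using measurable_sets[OF tup[OF that]] by (auto simp: past_sets[of j])
  show "iid k \<in> borel_measurable (past (Suc k))" for k
    unfolding iid_def[abs_def] using meas_past[of "Suc k" "Suc k"] by simp
  show "prob (A \<inter> (iid k -` B \<inter> space N)) = prob A * prob (iid k -` B \<inter> space N)"
    if A: "A \<in> sets (past k)" and B: "B \<in> sets borel" for k A B
  proof -
    obtain S where S: "S \<in> sets (Pi\<^sub>M {1..k} (\<lambda>_. borel :: real measure))" "A = (\<lambda>\<omega>. \<lambda>i\<in>{1..k}. \<zeta> i \<omega>) -` S \<inter> space N"
      using A by (auto simp: past_sets)
    have "indep_var (Pi\<^sub>M {1..k} (\<lambda>_. borel)) (\<lambda>\<omega>. \<lambda>i\<in>{1..k}. \<zeta> i \<omega>) (Pi\<^sub>M {Suc k} (\<lambda>_. borel)) (\<lambda>\<omega>. \<lambda>i\<in>{Suc k}. \<zeta> i \<omega>)"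
      by (rule indep_var_restrict[OF indep]) auto
    note i = this
    let ?B = "(\<lambda>f. f (Suc k) / \<sigma>) -` B \<inter> space (Pi\<^sub>M {Suc k} (\<lambda>_. borel :: real measure))"
    have "(\<lambda>f. f (Suc k) / \<sigma>) \<in> borel_measurable (Pi\<^sub>M {Suc k} (\<lambda>_. borel))" by measurable
    from indep_varD[OF i S(1) measurable_sets[OF this B]]
    have "prob ((\<lambda>\<omega>. (\<lambda>i\<in>{1..k}. \<zeta> i \<omega>, \<lambda>i\<in>{Suc k}. \<zeta> i \<omega>)) -` (S \<times> ?B) \<inter> space N)
        = prob A * prob ((\<lambda>\<omega>. \<lambda>i\<in>{Suc k}. \<zeta> i \<omega>) -` ?B \<inter> space N)"
      unfolding S(2) .
    moreover have e: "(\<lambda>\<omega>. \<lambda>i\<in>{Suc k}. \<zeta> i \<omega>) -` ?B \<inter> space N = iid k -` B \<inter> space N"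
      by (auto simp: iid_def space_PiM)
    moreover have "(\<lambda>\<omega>. (\<lambda>i\<in>{1..k}. \<zeta> i \<omega>, \<lambda>i\<in>{Suc k}. \<zeta> i \<omega>)) -` (S \<times> ?B) \<inter> space N = A \<inter> (iid k -` B \<inter> space N)"
      unfolding S(2) e[symmetric] by auto
    ultimately show ?thesis by simp
  qed
  fix k q
  have m: "(\<lambda>x. \<bar>x / \<sigma>\<bar> ^ q) \<in> borel_measurable borel" by measurable
  have "integrable N (\<lambda>\<omega>. \<bar>\<zeta> 1 \<omega> / \<sigma>\<bar> ^ q)"
    using moments[of q] by (simp add: abs_divide power_divide)
  then show "integrable N (\<lambda>\<omega>. \<bar>iid k \<omega>\<bar> ^ q)"
    unfolding iid_def using integral_transfer(1)[OF _ m, of "Suc k"] by simp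
  show "expectation (\<lambda>\<omega>. \<bar>iid k \<omega>\<bar> ^ q) \<le> expectation (\<lambda>\<omega>. \<bar>\<zeta> 1 \<omega> / \<sigma>\<bar> ^ q)"
    unfolding iid_def using integral_transfer(2)[OF _ m, of "Suc k"] by simp
  show "expectation (iid k) = 0"
    unfolding iid_def[abs_def] using integral_transfer(2)[of "Suc k" "\<lambda>x. x / \<sigma>"] mean by auto
  show "expectation (\<lambda>\<omega>. (iid k \<omega>)\<^sup>2) = 1"
    unfolding iid_def[abs_def] using integral_transfer(2)[of "Suc k" "\<lambda>x. (x / \<sigma>)\<^sup>2"] var \<sigma> by (simp add: power_divide)
qed

lemma euler_pts_delayed: "euler_pts a b \<sigma> \<zeta> y0 n k \<omega> = delayed_euler a b y0 n iid id k \<omega>"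
  by (induction k) (simp_all add: iid_def)

end

section \<open>The stochastic differential equation\<close>

text \<open>A countable dense set of times: path events are stated over it to be measurable and
  extended to all times by continuity.\<close>

definition "unit_dyadics = {real i / 2 ^ m | i m. i \<le> 2 ^ m}"

lemma countable_unit_dyadics: "countable unit_dyadics"
proof -
  have "unit_dyadics \<subseteq> (\<lambda>(i, m). real i / 2 ^ m) ` UNIV" by (auto simp:  unit_dyadics_def)
  then show ?thesis by (rule countable_subset) (intro countable_image countableI_type)
qed

lemma unit_dyadics_bounds: "d \<in> unit_dyadics \<Longrightarrow> 0 \<le> d \<and> d \<le> 1"
  by (auto simp:  unit_dyadics_def divide_le_eq_1)

definition "dyadic_floor m (t :: real) = real (nat \<lfloor>2 ^ m * t\<rfloor>) / 2 ^ m"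

lemma dyadic_floor:
  assumes "0 \<le> t" "t \<le> 1"
  shows "dyadic_floor m t \<in> unit_dyadics" "dyadic_floor m t \<le> t" "t < dyadic_floor m t + 1 / 2 ^ m"
proof -
  have f: "real (nat \<lfloor>2 ^ m * t\<rfloor>) = of_int \<lfloor>2 ^ m * t\<rfloor>" using assms by simp
  have "2 ^ m * t \<le> 2 ^ m * 1" using assms by (intro mult_left_mono) auto
  then have "real (nat \<lfloor>2 ^ m * t\<rfloor>) \<le> 2 ^ m" unfolding f by linarith
  then have "nat \<lfloor>2 ^ m * t\<rfloor> \<le> 2 ^ m" by (metis of_nat_le_iff of_nat_numeral of_nat_power)
  then show "dyadic_floor m t \<in> unit_dyadics" unfolding dyadic_floor_def unit_dyadics_def by blast
  have "real (nat \<lfloor>2 ^ m * t\<rfloor>) \<le> 2 ^ m * t" "2 ^ m * t < real (nat \<lfloor>2 ^ m * t\<rfloor>) + 1" unfolding f by linarith+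
  then show "dyadic_floor m t \<le> t" "t < dyadic_floor m t + 1 / 2 ^ m"
    by (simp_all add: dyadic_floor_def field_simps)
qed

lemma dyadic_floor_tendsto:
  assumes "0 \<le> t" "t \<le> 1"
  shows "(\<lambda>m. dyadic_floor m t) \<longlonglongrightarrow> t"
proof (rule tendsto_sandwich[of "\<lambda>m. t - 1 / 2 ^ m" _ _ "\<lambda>_. t"])
  show "\<forall>\<^sub>F m in sequentially. t - 1 / 2 ^ m \<le> dyadic_floor m t" using dyadic_floor(3)[OF assms] by (auto intro!: always_eventually less_imp_le simp: diff_le_eq)
  show "\<forall>\<^sub>F m in sequentially. dyadic_floor m t \<le> t" using dyadic_floor(2)[OF assms] by auto
  have "(\<lambda>m. t - (1 / 2) ^ m) \<longlonglongrightarrow> t - 0" by (intro tendsto_intros LIMSEQ_power_zero) auto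
  then show "(\<lambda>m. t - 1 / 2 ^ m) \<longlonglongrightarrow> t" by (simp add: power_one_over)
qed auto

lemma dyadic_floor_image_tendsto:
  assumes "continuous_on {0..1} f" "0 \<le> t" "t \<le> 1"
  shows "(\<lambda>m. f (dyadic_floor m t)) \<longlonglongrightarrow> f t"
proof (rule continuous_on_tendsto_compose[OF assms(1) dyadic_floor_tendsto[OF assms(2,3)]])
  show "\<forall>\<^sub>F m in sequentially. dyadic_floor m t \<in> {0..1}"
    using dyadic_floor(1)[OF assms(2,3)] unit_dyadics_bounds by auto
qed (use assms in auto)

locale sde = bm M F W + sde_coeffs a b Ca Cb y0
  for M :: "'a measure" and F W a b Ca Cb y0 +
  fixes Y :: "real \<Rightarrow> 'a \<Rightarrow> real"
  assumes sol: "strong_solution M F W a b y0 Y"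
begin

lemma Y_adapted: "0 \<le> t \<Longrightarrow> t \<le> 1 \<Longrightarrow> Y t \<in> borel_measurable (Fm t)"
  using sol unfolding strong_solution_def by (intro adapted_measI) auto

lemma Y_meas: "0 \<le> t \<Longrightarrow> t \<le> 1 \<Longrightarrow> Y t \<in> borel_measurable M"
  using Fm_meas_M[OF _ _ Y_adapted] .

lemma Y_cont: "\<omega> \<in> space M \<Longrightarrow> continuous_on {0..1} (\<lambda>t. Y t \<omega>)"
  using sol unfolding strong_solution_def by blast

text \<open>By continuity this means |Y| \<le> R on all of [0,s]. Scaling the dyadics by s makes the
  event known at time s and includes the endpoint, so it can replace an exit time.\<close>

definition "bounded_until R s = {\<omega>\<in>space M. \<forall>d\<in>unit_dyadics. \<bar>Y (s * d) \<omega>\<bar> \<le> R}"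

lemma bounded_until_sets: "0 \<le> s \<Longrightarrow> s \<le> 1 \<Longrightarrow> bounded_until R s \<in> sets (Fm s)"
proof -
  assume s: "0 \<le> s" "s \<le> 1"
  have [measurable]: "countable unit_dyadics" by (rule countable_unit_dyadics)
  have m: "Y (s * d) \<in> borel_measurable (Fm s)" if "d \<in> unit_dyadics" for d
    using unit_dyadics_bounds[OF that] s by (intro Fm_meas_mono[OF _ _ _ Y_adapted]) (auto intro: mult_left_le mult_le_one)
  have "bounded_until R s = (\<Inter>d\<in>unit_dyadics. {\<omega>\<in>space (Fm s). \<bar>Y (s * d) \<omega>\<bar> \<le> R})"
    using dyadic_floor(1)[of 0] by (auto simp: bounded_until_def)
  also have "\<dots> \<in> sets (Fm s)"
  proof (intro sets.countable_INT'[OF countable_unit_dyadics] image_subsetI)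
    show "unit_dyadics \<noteq> {}" using dyadic_floor(1)[of 0] by auto
    fix d assume d: "d \<in> unit_dyadics"
    have [measurable]: "Y (s * d) \<in> borel_measurable (Fm s)" by (rule m[OF d])
    show "{\<omega>\<in>space (Fm s). \<bar>Y (s * d) \<omega>\<bar> \<le> R} \<in> sets (Fm s)" by measurable
  qed
  finally show ?thesis .
qed

lemma bounded_untilD:
  assumes "\<omega> \<in> bounded_until R s" "0 \<le> s" "s \<le> 1" "0 \<le> u" "u \<le> s"
  shows "\<bar>Y u \<omega>\<bar> \<le> R"
proof (cases "s = 0")
  case True
  have "dyadic_floor 0 0 \<in> unit_dyadics" using dyadic_floor(1)[of 0 0] by simp
  then show ?thesis using assms True by (auto simp: bounded_until_def)
next
  case False
  have u: "0 \<le> u / s" "u / s \<le> 1" using assms False by auto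
  have "continuous_on {0..1} (\<lambda>d. Y (s * d) \<omega>)"
    by (rule continuous_on_compose2[OF Y_cont])
       (use assms in \<open>auto intro!: continuous_intros mult_le_one simp: bounded_until_def\<close>)
  from dyadic_floor_image_tendsto[OF this u] have "(\<lambda>m. \<bar>Y (s * dyadic_floor m (u / s)) \<omega>\<bar>) \<longlonglongrightarrow> \<bar>Y (s * (u / s)) \<omega>\<bar>"
    by (rule tendsto_rabs)
  then have "\<bar>Y (s * (u / s)) \<omega>\<bar> \<le> R"
    by (rule LIMSEQ_le_const2) (use assms(1) dyadic_floor(1)[OF u] in \<open>auto simp: bounded_until_def\<close>)
  then show ?thesis using False by simp
qed

lemma bounded_until_mono:
  assumes "0 \<le> s" "s \<le> t" "t \<le> 1"
  shows "bounded_until R t \<subseteq> bounded_until R s"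
proof
  fix \<omega> assume \<omega>: "\<omega> \<in> bounded_until R t"
  then have "\<bar>Y (s * d) \<omega>\<bar> \<le> R" if "d \<in> unit_dyadics" for d
    using unit_dyadics_bounds[OF that] assms mult_left_le[of d s] by (intro bounded_untilD[OF \<omega>]) auto
  then show "\<omega> \<in> bounded_until R s" using \<omega> by (auto simp: bounded_until_def)
qed

lemma bounded_until_M: "0 \<le> s \<Longrightarrow> s \<le> 1 \<Longrightarrow> bounded_until R s \<in> events"
  using bounded_until_sets Fm_subalgebra by (auto simp: subalgebra_def)

text \<open>Every continuous path is bounded on [0,1], so these events increase to the whole space
  with R.\<close>

lemma bounded_until_prob: "0 < \<epsilon> \<Longrightarrow> \<exists>R\<ge>1. 1 - \<epsilon> < prob (bounded_until R 1)"
proof -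
  assume e: "0 < \<epsilon>"
  have "(\<lambda>i. prob (bounded_until (real i) 1)) \<longlonglongrightarrow> prob (\<Union>i. bounded_until (real i) 1)"
  proof (rule finite_Lim_measure_incseq)
    show "range (\<lambda>i. bounded_until (real i) 1) \<subseteq> events" using bounded_until_M by auto
    show "incseq (\<lambda>i. bounded_until (real i) 1)"
      unfolding incseq_def bounded_until_def by (auto intro: order_trans)
  qed
  moreover have "(\<Union>i. bounded_until (real i) 1) = space M"
  proof (intro equalityI subsetI)
    fix \<omega> assume \<omega>: "\<omega> \<in> space M"
    have "bounded ((\<lambda>t. Y t \<omega>) ` {0..1})"
      using compact_continuous_image[OF Y_cont[OF \<omega>]] compact_imp_bounded by auto
    then obtain B where B: "\<And>t. t \<in> {0..1} \<Longrightarrow> \<bar>Y t \<omega>\<bar> \<le> B" unfolding bounded_iff by force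
    obtain i :: nat where "B \<le> i" using real_arch_simple by blast
    then have "\<omega> \<in> bounded_until (real i) 1"
      using B unit_dyadics_bounds \<omega> unfolding bounded_until_def by (auto intro: order_trans)
    then show "\<omega> \<in> (\<Union>i. bounded_until (real i) 1)" by blast
  qed (auto simp: bounded_until_def)
  ultimately have "(\<lambda>i. prob (bounded_until (real i) 1)) \<longlonglongrightarrow> 1" by (simp add: prob_space)
  then have "\<forall>\<^sub>F i in sequentially. 1 - \<epsilon> < prob (bounded_until (real i) 1)"
    by (rule order_tendstoD) (use e in simp)
  then obtain N where "\<And>i. N \<le> i \<Longrightarrow> 1 - \<epsilon> < prob (bounded_until (real i) 1)" by (auto simp: eventually_sequentially)
  from this[of "max 1 N"] show ?thesis by (intro exI[of _ "real (max 1 N)"]) auto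
qed

text \<open>The modulus of continuity at scale h exceeds \<eta>, stated over dyadic times for
  measurability.\<close>

definition "oscillates h \<eta> = {\<omega>\<in>space M. \<exists>p\<in>unit_dyadics. \<exists>q\<in>unit_dyadics. \<bar>p - q\<bar> < h \<and> \<eta> < \<bar>Y p \<omega> - Y q \<omega>\<bar>}"

lemma oscillates_sets: "oscillates h \<eta> \<in> events"
proof -
  have "oscillates h \<eta> = (\<Union>p\<in>unit_dyadics. \<Union>q\<in>unit_dyadics. {\<omega>\<in>space M. \<bar>p - q\<bar> < h \<and> \<eta> < \<bar>Y p \<omega> - Y q \<omega>\<bar>})"
    by (auto simp: oscillates_def)
  also have "\<dots> \<in> events"
  proof (intro sets.countable_UN''[OF countable_unit_dyadics])
    fix p q assume "p \<in> unit_dyadics" "q \<in> unit_dyadics"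
    then have [measurable]: "Y p \<in> borel_measurable M" "Y q \<in> borel_measurable M"
      using unit_dyadics_bounds Y_meas by auto
    show "{\<omega>\<in>space M. \<bar>p - q\<bar> < h \<and> \<eta> < \<bar>Y p \<omega> - Y q \<omega>\<bar>} \<in> events" by measurable
  qed
  finally show ?thesis .
qed

lemma oscillatesD:
  assumes "\<omega> \<in> space M" "\<omega> \<notin> oscillates h \<eta>" "0 \<le> s" "s \<le> 1" "0 \<le> u" "u \<le> 1" "\<bar>s - u\<bar> < h"
  shows "\<bar>Y s \<omega> - Y u \<omega>\<bar> \<le> \<eta>"
proof -
  note f = dyadic_floor_image_tendsto[OF Y_cont[OF assms(1)]]
  have l: "(\<lambda>m. \<bar>Y (dyadic_floor m s) \<omega> - Y (dyadic_floor m u) \<omega>\<bar>) \<longlonglongrightarrow> \<bar>Y s \<omega> - Y u \<omega>\<bar>"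
    using assms by (intro tendsto_intros f)
  have "(\<lambda>m. \<bar>dyadic_floor m s - dyadic_floor m u\<bar>) \<longlonglongrightarrow> \<bar>s - u\<bar>"
    using assms by (intro tendsto_intros dyadic_floor_tendsto)
  then have "\<forall>\<^sub>F m in sequentially. \<bar>dyadic_floor m s - dyadic_floor m u\<bar> < h" by (rule order_tendstoD) fact
  then have "\<forall>\<^sub>F m in sequentially. \<bar>Y (dyadic_floor m s) \<omega> - Y (dyadic_floor m u) \<omega>\<bar> \<le> \<eta>"
  proof eventually_elim
    case (elim m)
    have "\<omega> \<in> oscillates h \<eta>" if "\<eta> < \<bar>Y (dyadic_floor m s) \<omega> - Y (dyadic_floor m u) \<omega>\<bar>"
      unfolding oscillates_def using assms(1) dyadic_floor(1)[OF assms(3,4)] dyadic_floor(1)[OF assms(5,6)] elim that by blast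
    then show ?case using assms(2) by force
  qed
  then show ?thesis using l by (intro tendsto_upperbound[OF l]) auto
qed

text \<open>Each path is uniformly continuous, so the decreasing events for h = 1/(i+1) have empty
  intersection.\<close>

lemma oscillates_prob: "0 < \<eta> \<Longrightarrow> 0 < \<epsilon> \<Longrightarrow> \<exists>h>0. prob (oscillates h \<eta>) < \<epsilon>"
proof -
  assume \<eta>: "0 < \<eta>" and e: "0 < \<epsilon>"
  let ?h = "\<lambda>i. 1 / real (Suc i)"
  have "(\<lambda>i. prob (oscillates (?h i) \<eta>)) \<longlonglongrightarrow> prob (\<Inter>i. oscillates (?h i) \<eta>)"
  proof (rule finite_Lim_measure_decseq)
    show "range (\<lambda>i. oscillates (?h i) \<eta>) \<subseteq> events" using oscillates_sets by auto
    show "decseq (\<lambda>i. oscillates (?h i) \<eta>)"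
      unfolding decseq_def
    proof (intro allI impI)
      fix i j :: nat assume "i \<le> j"
      then have "?h j \<le> ?h i" by (intro frac_le) auto
      then show "oscillates (?h j) \<eta> \<subseteq> oscillates (?h i) \<eta>"
        unfolding oscillates_def by (auto intro: less_le_trans)
    qed
  qed
  moreover have "(\<Inter>i. oscillates (?h i) \<eta>) = {}"
  proof (rule ccontr)
    assume "(\<Inter>i. oscillates (?h i) \<eta>) \<noteq> {}"
    then obtain \<omega> where \<omega>: "\<omega> \<in> oscillates (?h i) \<eta>" for i by blast
    then have "\<omega> \<in> space M" by (auto simp: oscillates_def)
    then have "uniformly_continuous_on {0..1} (\<lambda>t. Y t \<omega>)"
      by (intro compact_uniformly_continuous Y_cont) auto
    then obtain d where d: "0 < d" "\<And>s t. s \<in> {0..1} \<Longrightarrow> t \<in> {0..1} \<Longrightarrow> dist s t < d \<Longrightarrow> dist (Y s \<omega>) (Y t \<omega>) < \<eta>"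
      unfolding uniformly_continuous_on_def using \<eta> by metis
    obtain i where i: "?h i < d" using d(1) nat_approx_posE by blast
    obtain p q where "p \<in> unit_dyadics" "q \<in> unit_dyadics" "\<bar>p - q\<bar> < ?h i" "\<eta> < \<bar>Y p \<omega> - Y q \<omega>\<bar>"
      using \<omega>[of i] by (auto simp: oscillates_def)
    then show False using d(2)[of p q] unit_dyadics_bounds[of p] unit_dyadics_bounds[of q] i by (auto simp: dist_real_def)
  qed
  ultimately have "(\<lambda>i. prob (oscillates (?h i) \<eta>)) \<longlonglongrightarrow> 0" by simp
  then have "\<forall>\<^sub>F i in sequentially. prob (oscillates (?h i) \<eta>) < \<epsilon>" by (rule order_tendstoD) fact
  then obtain i where "prob (oscillates (?h i) \<eta>) < \<epsilon>" by (auto simp: eventually_sequentially)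
  then show ?thesis by (intro exI[of _ "?h i"]) auto
qed

text \<open>Outside the oscillation event the integrand moves by at most Cb \<eta> within a cell,
  and the k cells have total length k/n.\<close>

lemma drift_riemann:
  assumes \<omega>: "\<omega> \<in> space M" "\<omega> \<notin> oscillates h \<eta>" and n: "0 < n" "1 / real n < h" and k: "k \<le> n"
  shows "\<bar>integral {0..real k / n} (\<lambda>s. b (Y s \<omega>)) - (\<Sum>j<k. b (Y (real j / n) \<omega>) / n)\<bar> \<le> Cb * \<eta> * (real k / n)"
  using k
proof (induction k)
  case (Suc k)
  let ?f = "\<lambda>s. b (Y s \<omega>)"
  let ?s = "real k / n" and ?t = "real (Suc k) / n"
  have st: "0 \<le> ?s" "?s \<le> ?t" "?t \<le> 1" "?t - ?s = 1 / n" using Suc.prems n(1) by (auto simp: field_simps)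
  have cf: "continuous_on {0..1} ?f"
    by (rule continuous_on_compose2[OF b_cont Y_cont[OF \<omega>(1)]]) auto
  have int: "?f integrable_on {u..v}" if "0 \<le> u" "v \<le> 1" for u v
    by (intro integrable_continuous_real continuous_on_subset[OF cf]) (use that in auto)
  have comb: "integral {0..?t} ?f = integral {0..?s} ?f + integral {?s..?t} ?f"
    using Henstock_Kurzweil_Integration.integral_combine[OF st(1,2) int[of 0 ?t]] st by simp
  have "integral {?s..?t} ?f - ?f ?s / n = integral {?s..?t} (\<lambda>s. ?f s - ?f ?s)"
    using Henstock_Kurzweil_Integration.integral_diff[OF int[of ?s ?t] integrable_const_ivl] st by simp
  moreover have "norm (integral {?s..?t} (\<lambda>s. ?f s - ?f ?s)) \<le> Cb * \<eta> * (?t - ?s)"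
  proof (rule integral_bound[OF st(2)])
    show "continuous_on {?s..?t} (\<lambda>s. ?f s - ?f ?s)"
      using continuous_on_subset[OF cf, of "{?s..?t}"] st by (intro continuous_intros) auto
    fix u assume u: "u \<in> {?s..?t}"
    have "\<bar>u - ?s\<bar> < h" "0 \<le> u" "u \<le> 1" "?s \<le> 1"
      using u st n by (auto intro: order_trans[OF st(1)] order_trans[OF _ st(3)])
    then have "\<bar>Y u \<omega> - Y ?s \<omega>\<bar> \<le> \<eta>" using st(1) by (intro oscillatesD[OF \<omega>])
    then have "Cb * \<bar>Y u \<omega> - Y ?s \<omega>\<bar> \<le> Cb * \<eta>" using Cb by simp
    then show "norm (?f u - ?f ?s) \<le> Cb * \<eta>" using b_lip[of "Y u \<omega>" "Y ?s \<omega>"] by simp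
  qed
  ultimately have "\<bar>integral {?s..?t} ?f - ?f ?s / n\<bar> \<le> Cb * \<eta> * (1 / n)" using st(4) by simp
  moreover have "\<bar>integral {0..?s} ?f - (\<Sum>j<k. ?f (real j / n) / n)\<bar> \<le> Cb * \<eta> * (real k / n)" using Suc by simp
  moreover have "Cb * \<eta> * (real k / n) + Cb * \<eta> * (1 / n) = Cb * \<eta> * ?t" by (simp add: algebra_simps add_divide_distrib)
  ultimately show ?case unfolding comb sum.lessThan_Suc by linarith
qed simp

text \<open>A left-point sum with step q/N becomes a sum with step 1/N and a frozen integrand; sums
  along partitions with different steps can then be subtracted term by term.\<close>

lemma riemann_sum_refine:
  fixes w H :: "real \<Rightarrow> real" and N :: nat
  assumes q: "0 < q" and N: "0 < N"
  shows "(\<Sum>i<p. H (real (q * i) / N) * (w (real (q * Suc i) / N) - w (real (q * i) / N)))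
     = (\<Sum>l<p * q. H (real (q * (l div q)) / N) * (w (real (Suc l) / N) - w (real l / N)))"
proof -
  have "(\<Sum>l<p * q. H (real (q * (l div q)) / N) * (w (real (Suc l) / N) - w (real l / N)))
    = (\<Sum>i<p. \<Sum>l\<in>{i * q..<i * q + q}. H (real (q * (l div q)) / N) * (w (real (Suc l) / N) - w (real l / N)))"
    by (rule sum.nat_group[symmetric])
  also have "\<dots> = (\<Sum>i<p. H (real (q * i) / N) * (\<Sum>l\<in>{i * q..<i * q + q}. w (real (Suc l) / N) - w (real l / N)))"
  proof (intro sum.cong refl)
    fix i
    have "l div q = i" if "l \<in> {i * q..<i * q + q}" for l
      using that by (intro div_nat_eqI) (auto simp: algebra_simps)
    then show "(\<Sum>l\<in>{i * q..<i * q + q}. H (real (q * (l div q)) / N) * (w (real (Suc l) / N) - w (real l / N)))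
      = H (real (q * i) / N) * (\<Sum>l\<in>{i * q..<i * q + q}. w (real (Suc l) / N) - w (real l / N))"
      unfolding sum_distrib_left by (intro sum.cong refl) auto
  qed
  also have "\<dots> = (\<Sum>i<p. H (real (q * i) / N) * (w (real (q * Suc i) / N) - w (real (q * i) / N)))"
  proof (intro sum.cong refl arg_cong2[where f="(*)"])
    fix i
    have "(\<Sum>l\<in>{i * q..<i * q + q}. w (real (Suc l) / N) - w (real l / N)) = w (real (i * q + q) / N) - w (real (i * q) / N)"
      by (rule sum_Suc_diff'[of _ _ "\<lambda>l. w (real l / N)"]) simp
    then show "(\<Sum>l\<in>{i * q..<i * q + q}. w (real (Suc l) / N) - w (real l / N)) = w (real (q * Suc i) / N) - w (real (q * i) / N)"
      by (simp add: algebra_simps)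
  qed
  finally show ?thesis by simp
qed

text \<open>For N = n 2^m the dyadic sum over [0, k/n] has step k/N and the grid sum has step 2^m/N.
  On the common refinement their difference is a discrete stochastic integral, and the case p = 1 of
  the increment estimate bounds its second moment. The bound contains neither m nor k.\<close>

lemma ito_sum_close:
  assumes R: "0 \<le> R" and \<eta>: "0 < \<eta>" and n: "0 < n" "1 / real n < h" and k: "k \<le> n" and m: "n \<le> 2 ^ m" and e: "0 < e"
  shows "prob {\<omega>\<in>bounded_until R (real k / n). e \<le> \<bar>ito_riemann_sum W (\<lambda>s \<omega>. a (Y s \<omega>)) (real k / n) m \<omega>
      - (\<Sum>j<k. a (Y (real j / n) \<omega>) * (W (real (Suc j) / n) \<omega> - W (real j / n) \<omega>))\<bar>}
     \<le> exp (step_const normal_abs_moment 1) * (Ca\<^sup>2 * (\<eta> + 2 * R * prob (oscillates h \<eta>))) / e\<^sup>2"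
proof (cases "k = 0")
  case True
  have "0 \<le> exp (step_const normal_abs_moment 1) * (Ca\<^sup>2 * (\<eta> + 2 * R * prob (oscillates h \<eta>))) / e\<^sup>2"
    using R \<eta> by (intro divide_nonneg_nonneg mult_nonneg_nonneg add_nonneg_nonneg) auto
  moreover have e0: "{\<omega>\<in>bounded_until R (real k / n). e \<le> \<bar>ito_riemann_sum W (\<lambda>s \<omega>. a (Y s \<omega>)) (real k / n) m \<omega>
      - (\<Sum>j<k. a (Y (real j / n) \<omega>) * (W (real (Suc j) / n) \<omega> - W (real j / n) \<omega>))\<bar>} = {}"
    using True e by (auto simp: ito_riemann_sum_def)
  ultimately show ?thesis by (simp only: e0 measure_empty)
next
  case False
  define N where "N = n * 2 ^ m"
  have N: "0 < N" using n by (simp add: N_def)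
  define L where "L = k * 2 ^ m"
  have L: "0 < L" "L \<le> N" using False k by (auto simp: L_def N_def)
  interpret noise M "\<lambda>k. Fm (real k / N)" "bm_noise N" normal_abs_moment N by (rule bm_noise[OF N])
  \<comment> \<open>\<open>s l\<close> and \<open>u l\<close> are the left endpoints of the dyadic
    cell and of the grid cell containing l/N.\<close>
  define s where "s l = real (k * (l div k)) / N" for l
  define u where "u l = real (2 ^ m * (l div 2 ^ m)) / N" for l
  define E where "E l = bounded_until R (real l / N)" for l
  define \<alpha> where "\<alpha> l \<omega> = indicator (E l) \<omega> * (a (Y (s l) \<omega>) - a (Y (u l) \<omega>))" for l \<omega>
  define X where "X l \<omega> = (\<Sum>i<l. \<alpha> i \<omega> * bm_noise N i \<omega> / sqrt N)" for l \<omega>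
  have Nn: "real N = real n * 2 ^ m" by (simp add: N_def)
  \<comment> \<open>k \<le> n \<le> 2^m, so both endpoints lag behind l/N by at most 2^m/N = 1/n <
    h.\<close>
  have tm: "0 \<le> s l" "s l \<le> real l / N" "real l / N - s l < h" "0 \<le> u l" "u l \<le> real l / N" "real l / N - u l < h" for l
  proof -
    have a: "k * (l div k) \<le> l" "l - k * (l div k) < k" "2 ^ m * (l div 2 ^ m) \<le> l" "l - 2 ^ m * (l div 2 ^ m) < 2 ^ m"
      using False by (simp_all add: minus_mult_div_eq_mod)
    show "0 \<le> s l" "0 \<le> u l" by (simp_all add: s_def u_def)
    show "s l \<le> real l / N" "u l \<le> real l / N" unfolding s_def u_def using a by (intro divide_right_mono of_nat_mono; simp)+
    have "real (l - k * (l div k)) / N \<le> real (2 ^ m) / N" using a(2) k m by (intro divide_right_mono of_nat_mono) auto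
    moreover have "real (l - 2 ^ m * (l div 2 ^ m)) / N \<le> real (2 ^ m) / N" using a(4) by (intro divide_right_mono of_nat_mono) auto
    moreover have "real (2 ^ m) / N = 1 / n" unfolding Nn using n by simp
    ultimately show "real l / N - s l < h" "real l / N - u l < h"
      unfolding s_def u_def using n(2) a(1,3) by (simp_all add: of_nat_diff diff_divide_distrib)
  qed
  have le1: "real l / N \<le> 1" if "l \<le> N" for l using that N by simp
  have Em: "E l \<in> sets (Fm (real l / N))" if "l \<le> N" for l
    unfolding E_def using le1[OF that] by (intro bounded_until_sets) auto
  have \<alpha>G: "\<alpha> l \<in> borel_measurable (Fm (real l / N))" if "l \<le> N" for l
  proof -
    have [measurable]: "Y (s l) \<in> borel_measurable (Fm (real l / N))" "Y (u l) \<in> borel_measurable (Fm (real l / N))"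
      "E l \<in> sets (Fm (real l / N))"
      using tm[of l] le1[OF that] Em[OF that] by (auto intro!: Fm_meas_mono[OF _ _ _ Y_adapted])
    show ?thesis unfolding \<alpha>_def[abs_def] by measurable
  qed
  have dr: "driven X \<alpha> (\<lambda>_ _. 0) (\<lambda>l \<omega>. \<bar>\<alpha> l \<omega>\<bar>)"
    unfolding driven_def
  proof (intro conjI allI impI ballI)
    show "X 0 \<in> borel_measurable (Fm (real 0 / N))" by (simp add: X_def[abs_def])
    fix l assume l: "l < N"
    have [measurable]: "\<alpha> l \<in> borel_measurable (Fm (real l / N))" using \<alpha>G[of l] l by simp
    show "\<alpha> l \<in> borel_measurable (Fm (real l / N))" "(\<lambda>\<omega>. \<bar>\<alpha> l \<omega>\<bar>) \<in> borel_measurable (Fm (real l / N))" by measurable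
  qed (auto simp: X_def)
  define B where "B = Ca\<^sup>2 * (\<eta> + 2 * R * prob (oscillates h \<eta>))"
  \<comment> \<open>Off the oscillation event the two values differ by at most \<eta>; on it only
    the crude bound 2R is left, paid for by the small probability of the event.\<close>
  have \<alpha>2: "\<bar>\<alpha> l \<omega>\<bar> ^ (2 * 1) \<le> Ca\<^sup>2 * (\<eta> + 2 * R * indicator (oscillates h \<eta>) \<omega>)"
    if l: "l \<le> N" and \<omega>: "\<omega> \<in> space M" for l \<omega>
  proof (cases "\<omega> \<in> E l")
    case True
    have "\<bar>Y (s l) \<omega> - Y (u l) \<omega>\<bar> \<le> \<eta> + 2 * R * indicator (oscillates h \<eta>) \<omega>"
    proof (cases "\<omega> \<in> oscillates h \<eta>")
      case osc: True
      have "\<bar>Y (s l) \<omega>\<bar> \<le> R" "\<bar>Y (u l) \<omega>\<bar> \<le> R"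
        using tm[of l] le1[OF l] True unfolding E_def by (intro bounded_untilD[of _ R "real l / N"]; simp)+
      then show ?thesis using osc \<eta> by simp
    next
      case False
      have "\<bar>Y (s l) \<omega> - Y (u l) \<omega>\<bar> \<le> \<eta>"
        using tm[of l] le1[OF l] by (intro oscillatesD[OF \<omega> False]) auto
      then show ?thesis using False by simp
    qed
    then have "Ca\<^sup>2 * \<bar>Y (s l) \<omega> - Y (u l) \<omega>\<bar> \<le> Ca\<^sup>2 * (\<eta> + 2 * R * indicator (oscillates h \<eta>) \<omega>)"
      by (rule mult_left_mono) simp
    then show ?thesis using a_hol_sq[of "Y (s l) \<omega>" "Y (u l) \<omega>"] True by (simp add: \<alpha>_def)
  next
    case False
    then show ?thesis using R \<eta> by (simp add: \<alpha>_def)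
  qed
  have iO: "integrable M (\<lambda>\<omega>. Ca\<^sup>2 * (\<eta> + 2 * R * indicator (oscillates h \<eta>) \<omega>))"
    using oscillates_sets by (auto intro!: integrable_real_indicator simp: emeasure_eq_measure)
  have i\<alpha>: "integrable M (\<lambda>\<omega>. \<bar>\<alpha> l \<omega>\<bar> ^ (2 * 1))" if "l < N" for l
  proof (rule Bochner_Integration.integrable_bound[OF iO])
    show "(\<lambda>\<omega>. \<bar>\<alpha> l \<omega>\<bar> ^ (2 * 1)) \<in> borel_measurable M" using meas_P[OF _ \<alpha>G[of l]] that by simp
    show "AE \<omega> in M. norm (\<bar>\<alpha> l \<omega>\<bar> ^ (2 * 1)) \<le> norm (Ca\<^sup>2 * (\<eta> + 2 * R * indicator (oscillates h \<eta>) \<omega>))"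
    proof (rule AE_I2)
      fix \<omega> assume "\<omega> \<in> space M"
      then show "norm (\<bar>\<alpha> l \<omega>\<bar> ^ (2 * 1)) \<le> norm (Ca\<^sup>2 * (\<eta> + 2 * R * indicator (oscillates h \<eta>) \<omega>))"
        using order_trans[OF \<alpha>2[of l \<omega>] abs_ge_self] that by simp
    qed
  qed
  have E\<alpha>: "expectation (\<lambda>\<omega>. \<bar>\<alpha> l \<omega>\<bar> ^ (2 * 1)) \<le> B" if "l < N" for l
  proof -
    have "expectation (\<lambda>\<omega>. \<bar>\<alpha> l \<omega>\<bar> ^ (2 * 1)) \<le> expectation (\<lambda>\<omega>. Ca\<^sup>2 * (\<eta> + 2 * R * indicator (oscillates h \<eta>) \<omega>))"
      using that by (intro integral_mono i\<alpha> iO \<alpha>2) auto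
    also have "\<dots> = B" using oscillates_sets unfolding B_def
      by (subst Bochner_Integration.integral_mult_right_zero, subst Bochner_Integration.integral_add)
         (auto intro!: integrable_real_indicator simp: emeasure_eq_measure prob_space)
    finally show ?thesis .
  qed
  have B0: "0 \<le> B" unfolding B_def using R \<eta> by (intro mult_nonneg_nonneg add_nonneg_nonneg) auto
  note inc = driven_increment_moment[OF dr L(1,2), of 1 B, OF _ i\<alpha> E\<alpha>]
  have X2: "integrable M (\<lambda>\<omega>. (X L \<omega>)\<^sup>2)" "expectation (\<lambda>\<omega>. (X L \<omega>)\<^sup>2) \<le> exp (step_const normal_abs_moment 1) * B"
  proof -
    show "integrable M (\<lambda>\<omega>. (X L \<omega>)\<^sup>2)" using inc(1) by (simp add: X_def)
    have "expectation (\<lambda>\<omega>. (X L \<omega>)\<^sup>2) \<le> exp (step_const normal_abs_moment 1) * B * ((real L - real 0) / N) ^ 1"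
      using inc(2) by (simp add: X_def)
    also have "\<dots> \<le> exp (step_const normal_abs_moment 1) * B * 1"
      using L N B0 by (intro mult_left_mono) auto
    finally show "expectation (\<lambda>\<omega>. (X L \<omega>)\<^sup>2) \<le> exp (step_const normal_abs_moment 1) * B" by simp
  qed
  have eq: "X L \<omega> = ito_riemann_sum W (\<lambda>s \<omega>. a (Y s \<omega>)) (real k / n) m \<omega>
      - (\<Sum>j<k. a (Y (real j / n) \<omega>) * (W (real (Suc j) / n) \<omega> - W (real j / n) \<omega>))"
    if \<omega>: "\<omega> \<in> bounded_until R (real k / n)" for \<omega>
  proof -
    have kL: "real k / n = real L / N" by (simp add: L_def Nn)
    have e: "real k / n * real j / 2 ^ m = real (k * j) / N" for j by (simp add: Nn)
    have 1: "ito_riemann_sum W (\<lambda>s \<omega>. a (Y s \<omega>)) (real k / n) m \<omega>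
      = (\<Sum>i<2 ^ m. a (Y (real (k * i) / N) \<omega>) * (W (real (k * Suc i) / N) \<omega> - W (real (k * i) / N) \<omega>))"
      unfolding ito_riemann_sum_def e ..
    also have "\<dots> = (\<Sum>l<2 ^ m * k. a (Y (s l) \<omega>) * (W (real (Suc l) / N) \<omega> - W (real l / N) \<omega>))"
      unfolding s_def using False by (intro riemann_sum_refine[where H="\<lambda>t. a (Y t \<omega>)" and w="\<lambda>t. W t \<omega>"] N) simp
    finally have 1: "ito_riemann_sum W (\<lambda>s \<omega>. a (Y s \<omega>)) (real k / n) m \<omega> =
       (\<Sum>l<L. a (Y (s l) \<omega>) * (W (real (Suc l) / N) \<omega> - W (real l / N) \<omega>))" by (simp add: L_def mult.commute)
    have "(\<Sum>j<k. a (Y (real j / n) \<omega>) * (W (real (Suc j) / n) \<omega> - W (real j / n) \<omega>))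
      = (\<Sum>j<k. a (Y (real (2 ^ m * j) / N) \<omega>) * (W (real (2 ^ m * Suc j) / N) \<omega> - W (real (2 ^ m * j) / N) \<omega>))"
    proof -
      have "real (2 ^ m * j) / N = real j / n" for j by (simp add: Nn)
      then show ?thesis by (simp only:)
    qed
    also have "\<dots> = (\<Sum>l<k * 2 ^ m. a (Y (u l) \<omega>) * (W (real (Suc l) / N) \<omega> - W (real l / N) \<omega>))"
      unfolding u_def by (intro riemann_sum_refine[where H="\<lambda>t. a (Y t \<omega>)" and w="\<lambda>t. W t \<omega>"] N) simp
    finally have 2: "(\<Sum>j<k. a (Y (real j / n) \<omega>) * (W (real (Suc j) / n) \<omega> - W (real j / n) \<omega>))
      = (\<Sum>l<L. a (Y (u l) \<omega>) * (W (real (Suc l) / N) \<omega> - W (real l / N) \<omega>))" by (simp add: L_def)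
    have "X L \<omega> = (\<Sum>l<L. (a (Y (s l) \<omega>) - a (Y (u l) \<omega>)) * (W (real (Suc l) / N) \<omega> - W (real l / N) \<omega>))"
      unfolding X_def
    proof (intro sum.cong refl)
      fix l assume "l \<in> {..<L}"
      then have "bounded_until R (real k / n) \<subseteq> bounded_until R (real l / N)"
        unfolding kL using L N by (intro bounded_until_mono divide_right_mono) auto
      then have "\<omega> \<in> E l" using \<omega> by (auto simp: E_def)
      then show "\<alpha> l \<omega> * bm_noise N l \<omega> / sqrt N = (a (Y (s l) \<omega>) - a (Y (u l) \<omega>)) * (W (real (Suc l) / N) \<omega> - W (real l / N) \<omega>)"
        using N by (simp add: \<alpha>_def bm_noise_def)
    qed
    then show ?thesis unfolding 1 2 by (simp add: left_diff_distrib sum_subtractf)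
  qed
  have Xm: "X L \<in> borel_measurable M" using driven_adapted[OF dr L(2)] meas_P[OF L(2)] by blast
  have "prob {\<omega>\<in>bounded_until R (real k / n). e \<le> \<bar>ito_riemann_sum W (\<lambda>s \<omega>. a (Y s \<omega>)) (real k / n) m \<omega>
      - (\<Sum>j<k. a (Y (real j / n) \<omega>) * (W (real (Suc j) / n) \<omega> - W (real j / n) \<omega>))\<bar>}
    \<le> prob {\<omega>\<in>space M. e\<^sup>2 \<le> (X L \<omega>)\<^sup>2}"
  proof (rule finite_measure_mono)
    show "{\<omega>\<in>space M. e\<^sup>2 \<le> (X L \<omega>)\<^sup>2} \<in> events" using Xm by measurable
    have "\<omega> \<in> space M \<and> e\<^sup>2 \<le> (X L \<omega>)\<^sup>2" if "\<omega> \<in> bounded_until R (real k / n)" "e \<le> \<bar>X L \<omega>\<bar>" for \<omega>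
    proof -
      have "\<bar>e\<bar> \<le> \<bar>X L \<omega>\<bar>" using that e by simp
      then show ?thesis using that(1) by (simp only: abs_le_square_iff) (simp add: bounded_until_def)
    qed
    then show "{\<omega>\<in>bounded_until R (real k / n). e \<le> \<bar>ito_riemann_sum W (\<lambda>s \<omega>. a (Y s \<omega>)) (real k / n) m \<omega>
      - (\<Sum>j<k. a (Y (real j / n) \<omega>) * (W (real (Suc j) / n) \<omega> - W (real j / n) \<omega>))\<bar>} \<subseteq> {\<omega>\<in>space M. e\<^sup>2 \<le> (X L \<omega>)\<^sup>2}"
      using eq by force
  qed
  also have "\<dots> \<le> expectation (\<lambda>\<omega>. (X L \<omega>)\<^sup>2) / e\<^sup>2"
    by (rule integral_Markov_inequality_measure[OF X2(1), of "{}"]) (use e in auto)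
  also have "\<dots> \<le> exp (step_const normal_abs_moment 1) * B / e\<^sup>2" using X2(2) by (rule divide_right_mono) simp
  finally show ?thesis unfolding B_def .
qed

end

context sde begin

lemma euler_functional_bm:
  assumes "0 < n"
  shows "euler_setting.euler_functional (bm_noise n) n a b y0 (\<lambda>k. Y (real k / n)) k \<omega> = y0 + (\<Sum>j<k. b (Y (real j / n) \<omega>) / n)
    + (\<Sum>j<k. a (Y (real j / n) \<omega>) * (W (real (Suc j) / n) \<omega> - W (real j / n) \<omega>))"
proof -
  interpret noise M "\<lambda>k. Fm (real k / n)" "bm_noise n" normal_abs_moment n by (rule bm_noise[OF assms])
  interpret euler_setting M "\<lambda>k. Fm (real k / n)" "bm_noise n" normal_abs_moment n a b Ca Cb y0 by unfold_locales
  show ?thesis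
    unfolding euler_functional_def sum.distrib using assms by (simp add: bm_noise_def)
qed

text \<open>Solution minus Euler functional is the Riemann error of the drift plus the Riemann error
  of the Ito integral. The latter passes through a dyadic sum, which is close to the integral in
  probability by definition and to the grid sum by \<open>ito_sum_close\<close>.\<close>

lemma euler_residual_prob:
  assumes R: "0 \<le> R" and e: "0 < e" and \<epsilon>: "0 < \<epsilon>"
  shows "\<exists>n0>0. \<forall>n\<ge>n0. \<forall>k\<le>n. prob {\<omega>\<in>bounded_until R (real k / n).
    e \<le> \<bar>Y (real k / n) \<omega> - euler_setting.euler_functional (bm_noise n) n a b y0 (\<lambda>k. Y (real k / n)) k \<omega>\<bar>} < \<epsilon>"
proof -
  define c0 where "c0 = exp (step_const normal_abs_moment 1) * Ca\<^sup>2 / (e / 4)\<^sup>2"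
  have c0: "0 < c0" using Ca e by (simp add: c0_def)
  \<comment> \<open>Makes the drift error at most e/2 and the first part of the martingale bound at
    most \<epsilon>/4; \<epsilon>' below does the latter for the part with the oscillation
    probability.\<close>
  define \<eta> where "\<eta> = min (e / (2 * Cb)) (\<epsilon> / (4 * c0))"
  have \<eta>: "0 < \<eta>" "Cb * \<eta> \<le> e / 2" "c0 * \<eta> \<le> \<epsilon> / 4"
  proof -
    show "0 < \<eta>" using e \<epsilon> c0 Cb by (simp add: \<eta>_def)
    have "\<eta> \<le> e / (2 * Cb)" "\<eta> \<le> \<epsilon> / (4 * c0)" by (auto simp: \<eta>_def)
    then show "Cb * \<eta> \<le> e / 2" "c0 * \<eta> \<le> \<epsilon> / 4" using Cb c0 by (simp_all add: field_simps)
  qed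
  define \<epsilon>' where "\<epsilon>' = min (\<epsilon> / 4) (\<epsilon> / (4 * (c0 * (2 * R) + 1)))"
  have cR: "0 \<le> c0 * (2 * R)" using c0 R by simp
  have \<epsilon>': "0 < \<epsilon>'" "\<epsilon>' \<le> \<epsilon> / 4" "c0 * (2 * R) * \<epsilon>' \<le> \<epsilon> / 4"
  proof -
    have "0 < 4 * (c0 * (2 * R) + 1)" using cR by (intro mult_pos_pos add_nonneg_pos) auto
    then have "0 < \<epsilon> / (4 * (c0 * (2 * R) + 1))" using \<epsilon> by (rule divide_pos_pos[rotated])
    then show "0 < \<epsilon>'" using \<epsilon> unfolding \<epsilon>'_def by simp
    show "\<epsilon>' \<le> \<epsilon> / 4" unfolding \<epsilon>'_def by (rule min.cobounded1)
    have "c0 * (2 * R) * \<epsilon>' \<le> (c0 * (2 * R) + 1) * (\<epsilon> / (4 * (c0 * (2 * R) + 1)))"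
      using cR \<epsilon> by (intro mult_mono) (auto simp: \<epsilon>'_def)
    also have "\<dots> = \<epsilon> / 4" using cR by (simp add: field_simps)
    finally show "c0 * (2 * R) * \<epsilon>' \<le> \<epsilon> / 4" .
  qed
  obtain h where h: "0 < h" "prob (oscillates h \<eta>) < \<epsilon>'" using oscillates_prob[OF \<eta>(1) \<epsilon>'(1)] by blast
  obtain n0 :: nat where n0: "1 / h < n0" using reals_Archimedean2 by blast
  have n0p: "0 < n0" using n0 h by (auto intro!: gr0I dest: order_less_trans[rotated])
  show ?thesis
  proof (rule exI[of _ n0], intro conjI allI impI n0p)
    fix n k assume n: "n0 \<le> n" and k: "k \<le> n"
    have np: "0 < n" using n n0p by simp
    have nh: "1 / real n < h"
    proof -
      have "1 / h < n" using n0 n by linarith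
      then show ?thesis using h np by (simp add: field_simps)
    qed
    define t where "t = real k / n"
    have t: "0 \<le> t" "t \<le> 1" using k np by (auto simp: t_def)
    define S where "S \<omega> = (\<Sum>j<k. a (Y (real j / n) \<omega>) * (W (real (Suc j) / n) \<omega> - W (real j / n) \<omega>))" for \<omega>
    define A where "A m \<omega> = ito_riemann_sum W (\<lambda>s \<omega>. a (Y s \<omega>)) t m \<omega>" for m \<omega>
    obtain I where I: "ito_integral M W (\<lambda>s \<omega>. a (Y s \<omega>)) t I"
      and ae: "AE \<omega> in M. Y t \<omega> = y0 + integral {0..t} (\<lambda>s. b (Y s \<omega>)) + I \<omega>"
    proof -
      have "t \<in> {0..1}" using t by simp
      then show ?thesis using sol that unfolding strong_solution_def by blast
    qed
    have Im: "I \<in> borel_measurable M" using I by (simp add: ito_integral_def)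
    have "(\<lambda>m. prob {\<omega>\<in>space M. \<bar>A m \<omega> - I \<omega>\<bar> > e / 8}) \<longlonglongrightarrow> 0"
    proof -
      have "0 < e / 8" using e by simp
      then show ?thesis using I unfolding ito_integral_def A_def by blast
    qed
    then have "\<forall>\<^sub>F m in sequentially. prob {\<omega>\<in>space M. \<bar>A m \<omega> - I \<omega>\<bar> > e / 8} < \<epsilon> / 4"
      by (rule order_tendstoD) (use \<epsilon> in simp)
    then obtain m0 where m0: "\<And>m. m0 \<le> m \<Longrightarrow> prob {\<omega>\<in>space M. \<bar>A m \<omega> - I \<omega>\<bar> > e / 8} < \<epsilon> / 4"
      by (auto simp: eventually_sequentially)
    \<comment> \<open>The level m may depend on n and k, since convergence to the Ito integral is
      known for each time separately. The bound on \<open>B3\<close> is uniform in m, so n0 is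
      unaffected.\<close>
    define m where "m = max m0 n"
    have "n \<le> m" by (simp add: m_def)
    moreover have "m < 2 ^ m" by (rule less_exp)
    ultimately have m2: "n \<le> 2 ^ m" by linarith
    define B1 where "B1 = oscillates h \<eta>"
    define B2 where "B2 = {\<omega>\<in>space M. \<bar>A m \<omega> - I \<omega>\<bar> > e / 8}"
    define B3 where "B3 = {\<omega>\<in>bounded_until R t. e / 4 \<le> \<bar>A m \<omega> - S \<omega>\<bar>}"
    have P3: "prob B3 \<le> \<epsilon> / 2"
    proof -
      have "prob B3 \<le> exp (step_const normal_abs_moment 1) * (Ca\<^sup>2 * (\<eta> + 2 * R * prob (oscillates h \<eta>))) / (e / 4)\<^sup>2"
        unfolding B3_def A_def S_def t_def
        by (rule ito_sum_close[OF R \<eta>(1) np nh k m2]) (use e in simp)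
      also have "\<dots> = c0 * \<eta> + c0 * (2 * R) * prob (oscillates h \<eta>)"
        by (simp add: c0_def algebra_simps add_divide_distrib)
      also have "\<dots> \<le> \<epsilon> / 4 + c0 * (2 * R) * \<epsilon>'"
        using \<eta>(3) cR h(2) by (intro add_mono mult_left_mono) auto
      also have "\<dots> \<le> \<epsilon> / 2" using \<epsilon>'(3) by linarith
      finally show ?thesis .
    qed
    have Wm: "W u \<in> borel_measurable M" if "0 \<le> u" "u \<le> 1" for u
      by (rule Fm_meas_M[OF that W_adapted[OF that]])
    have Ym: "(\<lambda>\<omega>. a (Y u \<omega>)) \<in> borel_measurable M" if "0 \<le> u" "u \<le> 1" for u
      using Y_meas[OF that] by measurable
    have Am: "A m \<in> borel_measurable M"
      unfolding A_def[abs_def] ito_riemann_sum_def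
    proof (intro borel_measurable_sum borel_measurable_times borel_measurable_diff)
      fix i assume "i \<in> {..<(2::nat) ^ m}"
      then have i: "real (Suc i) \<le> 2 ^ m" by (metis lessThan_iff Suc_leI of_nat_le_iff of_nat_numeral of_nat_power)
      have u: "0 \<le> t * real j / 2 ^ m \<and> t * real j / 2 ^ m \<le> 1" if "real j \<le> 2 ^ m" for j
      proof -
        have "t * real j \<le> 1 * 2 ^ m" using t that by (intro mult_mono) auto
        then show ?thesis using t by (simp add: divide_le_eq_1)
      qed
      have "real i \<le> 2 ^ m" using i by linarith
      note 1 = conjunct1[OF u[OF this]] conjunct2[OF u[OF this]] and 2 = conjunct1[OF u[OF i]] conjunct2[OF u[OF i]]
      show "(\<lambda>\<omega>. a (Y (t * real i / 2 ^ m) \<omega>)) \<in> borel_measurable M" "W (t * real (Suc i) / 2 ^ m) \<in> borel_measurable M"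
        "W (t * real i / 2 ^ m) \<in> borel_measurable M"
        by (rule Ym[OF 1], rule Wm[OF 2], rule Wm[OF 1])
    qed
    have Sm: "S \<in> borel_measurable M"
      unfolding S_def[abs_def]
    proof (intro borel_measurable_sum borel_measurable_times borel_measurable_diff)
      fix j assume "j \<in> {..<k}"
      then have 1: "0 \<le> real j / n" "real j / n \<le> 1" "0 \<le> real (Suc j) / n" "real (Suc j) / n \<le> 1" using k np by auto
      show "(\<lambda>\<omega>. a (Y (real j / n) \<omega>)) \<in> borel_measurable M" "W (real (Suc j) / n) \<in> borel_measurable M"
        "W (real j / n) \<in> borel_measurable M"
        by (rule Ym[OF 1(1,2)], rule Wm[OF 1(3,4)], rule Wm[OF 1(1,2)])
    qed
    have B: "B1 \<in> events" "B2 \<in> events" "B3 \<in> events"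
    proof -
      show "B1 \<in> events" unfolding B1_def by (rule oscillates_sets)
      show "B2 \<in> events" unfolding B2_def using Am Im by measurable
      have "B3 = bounded_until R t \<inter> {\<omega>\<in>space M. e / 4 \<le> \<bar>A m \<omega> - S \<omega>\<bar>}"
        by (auto simp: B3_def bounded_until_def)
      moreover have "{\<omega>\<in>space M. e / 4 \<le> \<bar>A m \<omega> - S \<omega>\<bar>} \<in> events" using Am Sm by measurable
      ultimately show "B3 \<in> events" using bounded_until_M[OF t] by simp
    qed
    have "prob {\<omega>\<in>bounded_until R (real k / n). e \<le> \<bar>Y (real k / n) \<omega> - euler_setting.euler_functional (bm_noise n) n a b y0 (\<lambda>k. Y (real k / n)) k \<omega>\<bar>}
       \<le> prob (B1 \<union> B2 \<union> B3)"
    proof (rule finite_measure_mono_AE)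
      show "B1 \<union> B2 \<union> B3 \<in> events" using B by auto
      show "AE \<omega> in M. \<omega> \<in> {\<omega>\<in>bounded_until R (real k / n). e \<le> \<bar>Y (real k / n) \<omega> - euler_setting.euler_functional (bm_noise n) n a b y0 (\<lambda>k. Y (real k / n)) k \<omega>\<bar>}
         \<longrightarrow> \<omega> \<in> B1 \<union> B2 \<union> B3"
        using ae
      proof (eventually_elim, intro impI, elim CollectE conjE)
        fix \<omega> assume eq: "Y t \<omega> = y0 + integral {0..t} (\<lambda>s. b (Y s \<omega>)) + I \<omega>"
          and bu: "\<omega> \<in> bounded_until R (real k / n)"
          and big: "e \<le> \<bar>Y (real k / n) \<omega> - euler_setting.euler_functional (bm_noise n) n a b y0 (\<lambda>k. Y (real k / n)) k \<omega>\<bar>"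
        have \<omega>: "\<omega> \<in> space M" using bu by (simp add: bounded_until_def)
        show "\<omega> \<in> B1 \<union> B2 \<union> B3"
        proof (cases "\<omega> \<in> B1")
          case False
          define J where "J = integral {0..t} (\<lambda>s. b (Y s \<omega>)) - (\<Sum>j<k. b (Y (real j / n) \<omega>) / n)"
          have "\<bar>J\<bar> \<le> Cb * \<eta> * (real k / n)"
            unfolding J_def t_def using False by (intro drift_riemann[OF \<omega> _ np nh k]) (simp add: B1_def)
          also have "\<dots> \<le> Cb * \<eta> * 1" using k np Cb \<eta>(1) by (intro mult_left_mono) auto
          finally have "\<bar>J\<bar> \<le> e / 2" using \<eta>(2) by simp
          moreover have "e \<le> \<bar>J + (I \<omega> - S \<omega>)\<bar>"
            using big eq unfolding euler_functional_bm[OF np] J_def S_def t_def by (simp add: algebra_simps)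
          ultimately have "e / 2 \<le> \<bar>I \<omega> - S \<omega>\<bar>" by linarith
          then have "e / 4 \<le> \<bar>A m \<omega> - S \<omega>\<bar> \<or> e / 8 < \<bar>A m \<omega> - I \<omega>\<bar>" using e by linarith
          then show ?thesis using \<omega> bu unfolding B2_def B3_def t_def by blast
        qed simp
      qed
    qed
    also have "\<dots> \<le> prob B1 + prob B2 + prob B3"
      using measure_Un_le[of "B1 \<union> B2" M B3] measure_Un_le[of B1 M B2] B by simp
    also have "\<dots> < \<epsilon> / 4 + \<epsilon> / 4 + \<epsilon> / 2"
      using h(2) \<epsilon>'(2) m0[of m] P3 unfolding B1_def B2_def by (simp add: m_def)
    finally show "prob {\<omega>\<in>bounded_until R (real k / n). e \<le> \<bar>Y (real k / n) \<omega> - euler_setting.euler_functional (bm_noise n) n a b y0 (\<lambda>k. Y (real k / n)) k \<omega>\<bar>} < \<epsilon>"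
      by simp
  qed
qed

text \<open>Smallness in probability is upgraded to smallness in L2, because on the localising
  events the residual has a fourth moment bounded independently of n.\<close>

lemma solution_approx_solution:
  assumes R: "0 \<le> R" and \<rho>: "0 < \<rho>"
  shows "\<exists>n0>0. \<forall>n\<ge>n0. euler_setting.approx_solution M (\<lambda>k. Fm (real k / n)) (bm_noise n) n a b y0 (R ^ 4) \<rho>
     (\<lambda>k. bounded_until R (real k / n)) (\<lambda>k. Y (real k / n))"
proof -
  \<comment> \<open>Dominates the fourth moment of the localised residual: the solution is bounded
    by R there, and the localised sums have coefficients at most K (1 + R). The leading 1 makes Q
    positive.\<close>
  define Q where "Q = 1 + 16 * ((R + \<bar>y0\<bar>) ^ 4 + exp (step_const normal_abs_moment 2) * (K * (1 + R)) ^ 4)"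
  have Q: "0 < Q" using R by (simp add: Q_def add_pos_nonneg)
  \<comment> \<open>Truncation level, chosen such that each of the three parts of the bound
    \<open>Z2\<close> has mean at most \<rho>^2/16.\<close>
  define L where "L = 16 * Q / \<rho>\<^sup>2"
  have L: "0 < L" "Q / L = \<rho>\<^sup>2 / 16" using Q \<rho> by (auto simp: L_def)
  have "0 < \<rho> / 4" "0 < \<rho>\<^sup>2 / (16 * L)" using \<rho> L by auto
  from euler_residual_prob[OF R this] obtain n0 where n0: "0 < n0"
    and main: "\<And>n k. n0 \<le> n \<Longrightarrow> k \<le> n \<Longrightarrow> prob {\<omega>\<in>bounded_until R (real k / n).
    \<rho> / 4 \<le> \<bar>Y (real k / n) \<omega> - euler_setting.euler_functional (bm_noise n) n a b y0 (\<lambda>k. Y (real k / n)) k \<omega>\<bar>} < \<rho>\<^sup>2 / (16 * L)"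
    by blast
  show ?thesis
  proof (rule exI[of _ n0], intro conjI allI impI n0)
    fix n assume n: "n0 \<le> n"
    have np: "0 < n" using n n0 by simp
    interpret noise M "\<lambda>k. Fm (real k / n)" "bm_noise n" normal_abs_moment n by (rule bm_noise[OF np])
    interpret euler_setting M "\<lambda>k. Fm (real k / n)" "bm_noise n" normal_abs_moment n a b Ca Cb y0 by unfold_locales
    define E where "E k = bounded_until R (real k / n)" for k
    define U where "U k = Y (real k / n)" for k :: nat
    have t: "0 \<le> real k / n" "real k / n \<le> 1" if "k \<le> n" for k using that np by auto
    have EG: "E k \<in> sets (Fm (real k / n))" if "k \<le> n" for k
      unfolding E_def by (rule bounded_until_sets[OF t[OF that]])
    have EM: "E k \<in> events" if "k \<le> n" for k unfolding E_def by (rule bounded_until_M[OF t[OF that]])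
    have UG: "U k \<in> borel_measurable (Fm (real k / n))" if "k \<le> n" for k
      unfolding U_def by (rule Y_adapted[OF t[OF that]])
    have UM: "U k \<in> borel_measurable M" if "k \<le> n" for k by (rule meas_P[OF that UG[OF that]])
    have EE: "E k \<subseteq> E j" if "j \<le> k" "k \<le> n" for j k
      unfolding E_def using that t by (intro bounded_until_mono divide_right_mono) auto
    have UR: "\<bar>U k \<omega>\<bar> \<le> R" if "k \<le> n" "\<omega> \<in> E k" for k \<omega>
      using that t[OF that(1)] unfolding E_def U_def by (intro bounded_untilD[of _ R "real k / n"]) auto
    define \<alpha> where "\<alpha> k \<omega> = indicator (E k) \<omega> * a (U k \<omega>)" for k \<omega>
    define \<beta> where "\<beta> k \<omega> = indicator (E k) \<omega> * b (U k \<omega>)" for k \<omega>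
    define X where "X k \<omega> = (\<Sum>j<k. \<beta> j \<omega> / n + \<alpha> j \<omega> * bm_noise n j \<omega> / sqrt n)" for k \<omega>
    define w where "w = K * (1 + R)"
    have w: "0 \<le> w" using R K by (simp add: w_def)
    have bd: "\<bar>\<alpha> k \<omega>\<bar> \<le> w" "\<bar>\<beta> k \<omega>\<bar> \<le> w" if "k \<le> n" for k \<omega>
    proof -
      have "K * (1 + \<bar>U k \<omega>\<bar>) \<le> w" if "\<omega> \<in> E k"
        unfolding w_def using UR[OF \<open>k \<le> n\<close> that] K by (intro mult_left_mono) auto
      then show "\<bar>\<alpha> k \<omega>\<bar> \<le> w" "\<bar>\<beta> k \<omega>\<bar> \<le> w"
        using growth[of "U k \<omega>"] w by (auto simp: \<alpha>_def \<beta>_def indicator_def intro: order_trans)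
    qed
    have dr: "driven X \<alpha> \<beta> (\<lambda>_ _. w)"
      unfolding driven_def
    proof (intro conjI allI impI ballI)
      show "X 0 \<in> borel_measurable (Fm (real 0 / n))" by (simp add: X_def[abs_def])
      fix k assume "k < n"
      then have k: "k \<le> n" by simp
      have [measurable]: "U k \<in> borel_measurable (Fm (real k / n))" "E k \<in> sets (Fm (real k / n))" by (rule UG[OF k], rule EG[OF k])
      show "\<alpha> k \<in> borel_measurable (Fm (real k / n))" unfolding \<alpha>_def[abs_def] by measurable
      show "\<beta> k \<in> borel_measurable (Fm (real k / n))" unfolding \<beta>_def[abs_def] by measurable
      show "X (Suc k) \<omega> = X k \<omega> + \<beta> k \<omega> / n + \<alpha> k \<omega> * bm_noise n k \<omega> / sqrt n" for \<omega> by (simp add: X_def)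
      show "\<bar>\<alpha> k \<omega>\<bar> \<le> w" "\<bar>\<beta> k \<omega>\<bar> \<le> w" for \<omega> using bd[OF k] by auto
    qed auto
    have X4: "integrable M (\<lambda>\<omega>. X k \<omega> ^ 4) \<and> expectation (\<lambda>\<omega>. X k \<omega> ^ 4) \<le> exp (step_const normal_abs_moment 2) * w ^ 4" if k: "k \<le> n" for k
    proof (cases "k = 0")
      case True
      then show ?thesis using w by (simp add: X_def)
    next
      case False
      then have k0: "0 < k" by simp
      note i = driven_increment_moment[OF dr k0 k, of 2 "w ^ 4"]
      have "((real k - real 0) / n) ^ 2 \<le> 1" using k np by (intro power_le_one) auto
      then have "exp (step_const normal_abs_moment 2) * w ^ 4 * ((real k - real 0) / n) ^ 2 \<le> exp (step_const normal_abs_moment 2) * w ^ 4 * 1"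
        using w by (intro mult_left_mono) auto
      then show ?thesis using i(1) order_trans[OF i(2)] by (simp add: X_def prob_space)
    qed
    have XE: "euler_functional U k \<omega> = y0 + X k \<omega>" if "k \<le> n" "\<omega> \<in> E k" for k \<omega>
    proof -
      have "\<omega> \<in> E j" if "j < k" for j using EE[of j k] \<open>k \<le> n\<close> \<open>\<omega> \<in> E k\<close> that by auto
      then show ?thesis unfolding euler_functional_def X_def \<alpha>_def \<beta>_def by simp
    qed
    show "approx_solution (R ^ 4) \<rho> (\<lambda>k. bounded_until R (real k / n)) (\<lambda>k. Y (real k / n))"
      unfolding approx_solution_def E_def[symmetric] U_def[symmetric]
    proof (intro allI impI)
      fix k assume k: "k \<le> n"
      note [measurable] = EM[OF k] UM[OF k]
      have Xm [measurable]: "X k \<in> borel_measurable M" using driven_adapted[OF dr k] meas_P[OF k] by blast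
      have i4: "integrable M (\<lambda>\<omega>. indicator (E k) \<omega> * U k \<omega> ^ 4)"
        "expectation (\<lambda>\<omega>. indicator (E k) \<omega> * U k \<omega> ^ 4) \<le> R ^ 4"
      proof -
        have b: "\<bar>indicator (E k) \<omega> * U k \<omega> ^ 4\<bar> \<le> R ^ 4" for \<omega>
          using power_mono[OF UR[OF k], of \<omega> 4] R by (auto simp: indicator_def)
        show i: "integrable M (\<lambda>\<omega>. indicator (E k) \<omega> * U k \<omega> ^ 4)"
          by (rule integrable_const_bound[of _ "R ^ 4"]) (use b in auto)
        have "expectation (\<lambda>\<omega>. indicator (E k) \<omega> * U k \<omega> ^ 4) \<le> expectation (\<lambda>\<omega>. R ^ 4)"
          using b by (intro integral_mono i) (auto simp: abs_le_iff)
        then show "expectation (\<lambda>\<omega>. indicator (E k) \<omega> * U k \<omega> ^ 4) \<le> R ^ 4" by (simp add: prob_space)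
      qed
      define z where "z \<omega> = indicator (E k) \<omega> * (U k \<omega> - (y0 + X k \<omega>))" for \<omega>
      have zm [measurable]: "z \<in> borel_measurable M" unfolding z_def[abs_def] by measurable
      have ze: "indicator (E k) \<omega> * (U k \<omega> - euler_functional U k \<omega>)\<^sup>2 = (z \<omega>)\<^sup>2" for \<omega>
        using XE[OF k, of \<omega>] by (auto simp: z_def indicator_def)
      define B where "B = {\<omega>\<in>space M. \<rho> / 4 \<le> \<bar>z \<omega>\<bar>}"
      have Bm [measurable]: "B \<in> events" unfolding B_def by measurable
      have B': "B = {\<omega>\<in>E k. \<rho> / 4 \<le> \<bar>U k \<omega> - euler_functional U k \<omega>\<bar>}"
        using XE[OF k] \<rho> sets.sets_into_space[OF EM[OF k]] by (auto simp: B_def z_def indicator_def split: if_splits)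
      have PB: "prob B \<le> \<rho>\<^sup>2 / (16 * L)" using main[OF n k] unfolding B' E_def U_def by simp
      define T where "T \<omega> = 16 * ((R + \<bar>y0\<bar>) ^ 4 + X k \<omega> ^ 4)" for \<omega>
      define Z2 where "Z2 \<omega> = \<rho>\<^sup>2 / 16 + L * indicator B \<omega> + T \<omega> / L" for \<omega>
      have z4: "z \<omega> ^ 4 \<le> T \<omega>" for \<omega>
      proof -
        have "\<bar>z \<omega>\<bar> \<le> (R + \<bar>y0\<bar>) + \<bar>X k \<omega>\<bar>" using UR[OF k, of \<omega>] R by (auto simp: z_def indicator_def)
        then have "\<bar>z \<omega>\<bar> ^ 4 \<le> ((R + \<bar>y0\<bar>) + \<bar>X k \<omega>\<bar>) ^ 4" by (intro power_mono) auto
        also have "\<dots> \<le> 2 ^ 4 * ((R + \<bar>y0\<bar>) ^ 4 + \<bar>X k \<omega>\<bar> ^ 4)" using R by (intro power_add_le_split) auto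
        finally show ?thesis by (simp add: T_def)
      qed
      have z2: "(z \<omega>)\<^sup>2 \<le> Z2 \<omega>" if \<omega>: "\<omega> \<in> space M" for \<omega>
      proof -
        have T0: "0 \<le> T \<omega> / L" using L by (simp add: T_def)
        show ?thesis
        proof (cases "\<omega> \<in> B")
          case False
          then have "\<bar>z \<omega>\<bar> \<le> \<rho> / 4" using \<omega> by (simp add: B_def)
          then have "\<bar>z \<omega>\<bar>\<^sup>2 \<le> (\<rho> / 4)\<^sup>2" by (intro power_mono) auto
          then have "(z \<omega>)\<^sup>2 \<le> \<rho>\<^sup>2 / 16" by (simp add: power_divide)
          then show ?thesis using False T0 by (simp add: Z2_def)
        next
          case True
          \<comment> \<open>Either z^2 \<le> L, or z^2 > L and then z^2 \<le> z^4/L.\<close>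
          have "(z \<omega>)\<^sup>2 \<le> L + z \<omega> ^ 4 / L"
          proof (cases "(z \<omega>)\<^sup>2 \<le> L")
            case True
            moreover have "0 \<le> z \<omega> ^ 4 / L" using L by simp
            ultimately show ?thesis by linarith
          next
            case False
            then have "L * (z \<omega>)\<^sup>2 \<le> (z \<omega>)\<^sup>2 * (z \<omega>)\<^sup>2" by (intro mult_right_mono) auto
            then have "(z \<omega>)\<^sup>2 \<le> z \<omega> ^ 4 / L" using L by (simp add: pos_le_divide_eq mult.commute power4_eq_xxxx power2_eq_square mult.assoc)
            then show ?thesis using L by simp
          qed
          also have "\<dots> \<le> L + T \<omega> / L" using z4[of \<omega>] L by (intro add_left_mono divide_right_mono) auto
          also have "\<dots> \<le> Z2 \<omega>" using True by (simp add: Z2_def)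
          finally show ?thesis .
        qed
      qed
      have iZ: "integrable M Z2"
        unfolding Z2_def[abs_def] T_def using X4[OF k] Bm
        by (auto intro!: integrable_real_indicator simp: emeasure_eq_measure)
      have iz: "integrable M (\<lambda>\<omega>. (z \<omega>)\<^sup>2)"
      proof (rule Bochner_Integration.integrable_bound[OF iZ])
        show "AE \<omega> in M. norm ((z \<omega>)\<^sup>2) \<le> norm (Z2 \<omega>)"
        proof (rule AE_I2)
          fix \<omega> assume "\<omega> \<in> space M"
          then show "norm ((z \<omega>)\<^sup>2) \<le> norm (Z2 \<omega>)" using order_trans[OF z2 abs_ge_self] by simp
        qed
      qed measurable
      have "expectation (\<lambda>\<omega>. (z \<omega>)\<^sup>2) \<le> expectation Z2" using z2 by (intro integral_mono iz iZ)
      also have "\<dots> = \<rho>\<^sup>2 / 16 + L * prob B + 16 * ((R + \<bar>y0\<bar>) ^ 4 + expectation (\<lambda>\<omega>. X k \<omega> ^ 4)) / L"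
        unfolding Z2_def[abs_def] T_def using X4[OF k] Bm
        by (simp add: integrable_real_indicator emeasure_eq_measure prob_space)
      also have "\<dots> \<le> \<rho>\<^sup>2 / 16 + L * (\<rho>\<^sup>2 / (16 * L)) + Q / L"
      proof -
        have "16 * ((R + \<bar>y0\<bar>) ^ 4 + expectation (\<lambda>\<omega>. X k \<omega> ^ 4)) \<le> Q" using X4[OF k] unfolding Q_def w_def by simp
        then show ?thesis using PB L by (intro add_mono mult_left_mono divide_right_mono) auto
      qed
      also have "\<dots> = 3 * (\<rho>\<^sup>2 / 16)" using L by simp
      also have "\<dots> \<le> \<rho>\<^sup>2 / 4" by simp
      finally have Ez: "expectation (\<lambda>\<omega>. (z \<omega>)\<^sup>2) \<le> \<rho>\<^sup>2 / 4" .
      show "E k \<in> sets (Fm (real k / n)) \<and> U k \<in> borel_measurable (Fm (real k / n)) \<and> (\<forall>j\<le>k. E k \<subseteq> E j) \<and>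
         integrable M (\<lambda>\<omega>. indicator (E k) \<omega> * U k \<omega> ^ 4) \<and> expectation (\<lambda>\<omega>. indicator (E k) \<omega> * U k \<omega> ^ 4) \<le> R ^ 4 \<and>
         integrable M (\<lambda>\<omega>. indicator (E k) \<omega> * (U k \<omega> - euler_functional U k \<omega>)\<^sup>2) \<and>
         expectation (\<lambda>\<omega>. indicator (E k) \<omega> * (U k \<omega> - euler_functional U k \<omega>)\<^sup>2) \<le> \<rho>\<^sup>2 / 4"
        unfolding ze using EG[OF k] UG[OF k] EE[OF _ k] i4 iz Ez by blast
    qed
  qed
qed

text \<open>Three errors of probability \<epsilon>/3 each: the path leaves [-R, R], the solution
  differs from its Euler functional, the functional differs from the coarse scheme. The number of
  steps is an exact multiple m l, so blocks end at multiples of 1/m; existence of one l suffices,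
  since on the Brownian side the block-end values do not change with l.\<close>

lemma solution_vs_coarse:
  assumes \<theta>: "0 < \<theta>" and \<epsilon>: "0 < \<epsilon>"
  shows "\<exists>m0. \<forall>m\<ge>m0. \<exists>l>0. \<forall>k\<le>m * l. prob {\<omega>\<in>space M. \<theta> \<le> \<bar>Y (real k / (m * l)) \<omega> -
     delayed_euler a b y0 (m * l) (bm_noise (m * l)) (\<lambda>k. l * (k div l)) k \<omega>\<bar>} < \<epsilon>"
proof -
  have co: "sde_coeffs a b Ca Cb" by unfold_locales
  obtain R where R: "1 \<le> R" "1 - \<epsilon> / 3 < prob (bounded_until R 1)" using bounded_until_prob[of "\<epsilon> / 3"] \<epsilon> by auto
  define I where "I = euler_setting.inc normal_abs_moment a b Ca Cb y0 1"
  from approx_solution_close[OF co, of "\<theta> / 2" "\<epsilon> / 3" normal_abs_moment y0 "R ^ 4", where ?'a='a] \<theta> \<epsilon>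
  have "\<exists>\<rho>>0. \<exists>n0. \<forall>(P :: 'a measure) G \<xi> n E U \<kappa> l. noise P G \<xi> normal_abs_moment n \<longrightarrow> n0 \<le> n \<longrightarrow>
    euler_setting.approx_solution P G \<xi> n a b y0 (R ^ 4) \<rho> E U \<longrightarrow>
    (\<forall>k. \<kappa> k \<le> k \<and> k - \<kappa> k \<le> l) \<longrightarrow> euler_setting.inc normal_abs_moment a b Ca Cb y0 1 * (real l / n) \<le> \<rho>\<^sup>2 / 4 \<longrightarrow>
    (\<forall>k\<le>n. measure P {\<omega>\<in>E k. \<theta> / 2 \<le> \<bar>euler_setting.euler_functional \<xi> n a b y0 U k \<omega> - delayed_euler a b y0 n \<xi> \<kappa> k \<omega>\<bar>} < \<epsilon> / 3)"
    by simp
  then show ?thesis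
  proof (elim exE conjE)
    fix \<rho> :: real and n0
    assume \<rho>: "\<rho> > 0" and main: "\<forall>(P :: 'a measure) G \<xi> n E U \<kappa> l. noise P G \<xi> normal_abs_moment n \<longrightarrow> n0 \<le> n \<longrightarrow>
    euler_setting.approx_solution P G \<xi> n a b y0 (R ^ 4) \<rho> E U \<longrightarrow>
    (\<forall>k. \<kappa> k \<le> k \<and> k - \<kappa> k \<le> l) \<longrightarrow> euler_setting.inc normal_abs_moment a b Ca Cb y0 1 * (real l / n) \<le> \<rho>\<^sup>2 / 4 \<longrightarrow>
    (\<forall>k\<le>n. measure P {\<omega>\<in>E k. \<theta> / 2 \<le> \<bar>euler_setting.euler_functional \<xi> n a b y0 U k \<omega> - delayed_euler a b y0 n \<xi> \<kappa> k \<omega>\<bar>} < \<epsilon> / 3)"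
    obtain n1 where n1: "0 < n1" and ap: "\<And>n. n1 \<le> n \<Longrightarrow> euler_setting.approx_solution M (\<lambda>k. Fm (real k / n)) (bm_noise n) n a b y0 (R ^ 4) \<rho>
     (\<lambda>k. bounded_until R (real k / n)) (\<lambda>k. Y (real k / n))"
      using solution_approx_solution[of R \<rho>] R \<rho> by auto
    obtain n2 where n2: "0 < n2" and res: "\<And>n k. n2 \<le> n \<Longrightarrow> k \<le> n \<Longrightarrow> prob {\<omega>\<in>bounded_until R (real k / n).
    \<theta> / 2 \<le> \<bar>Y (real k / n) \<omega> - euler_setting.euler_functional (bm_noise n) n a b y0 (\<lambda>k. Y (real k / n)) k \<omega>\<bar>} < \<epsilon> / 3"
      using euler_residual_prob[of R "\<theta> / 2" "\<epsilon> / 3"] R \<theta> \<epsilon> by auto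
    obtain m1 :: nat where m1: "\<bar>I\<bar> * 4 / \<rho>\<^sup>2 < m1" using reals_Archimedean2 by blast
    show ?thesis
    proof (rule exI[of _ "max 1 m1"], intro allI impI)
      fix m assume m: "max 1 m1 \<le> m"
      \<comment> \<open>A sum of thresholds, so that n = m l \<ge> l passes all of them;
        \<open>n1\<close> makes it positive.\<close>
      define l where "l = n0 + n1 + n2"
      have l: "0 < l" using n1 by (simp add: l_def)
      define n where "n = m * l"
      have n: "l \<le> n" using m by (simp add: n_def)
      then have n012: "n0 \<le> n" "n1 \<le> n" "n2 \<le> n" "0 < n" using l by (auto simp: l_def)
      interpret noise M "\<lambda>k. Fm (real k / n)" "bm_noise n" normal_abs_moment n by (rule bm_noise[OF n012(4)])
      interpret euler_setting M "\<lambda>k. Fm (real k / n)" "bm_noise n" normal_abs_moment n a b Ca Cb y0 by unfold_locales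
      have \<kappa>: "\<forall>i. l * (i div l) \<le> i \<and> i - l * (i div l) \<le> l"
      proof (intro allI conjI)
        fix i
        have "i - l * (i div l) = i mod l" by (simp add: minus_mult_div_eq_mod)
        also have "\<dots> < l" using l by simp
        finally show "i - l * (i div l) \<le> l" by simp
      qed simp
      have inc: "inc 1 * (real l / n) \<le> \<rho>\<^sup>2 / 4"
      proof -
        have m0: "0 < real m" using m by simp
        have "inc 1 * (real l / n) = I * (1 / m)" using l by (simp add: n_def I_def)
        also have "\<dots> \<le> \<bar>I\<bar> * (1 / m)" by (intro mult_right_mono) auto
        also have "\<dots> \<le> \<rho>\<^sup>2 / 4"
        proof -
          have "\<bar>I\<bar> * 4 / \<rho>\<^sup>2 < m" using m1 m by linarith
          then have "\<bar>I\<bar> * 4 < m * \<rho>\<^sup>2" using \<rho> pos_divide_less_eq[of "\<rho>\<^sup>2" "\<bar>I\<bar> * 4" m] by simp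
          then show ?thesis using m0 by (simp add: divide_simps mult.commute)
        qed
        finally show ?thesis .
      qed
      have "\<forall>k\<le>n. prob {\<omega>\<in>space M. \<theta> \<le> \<bar>Y (real k / n) \<omega> - Z (\<lambda>k. l * (k div l)) k \<omega>\<bar>} < \<epsilon>"
      proof (intro allI impI)
        fix k assume k: "k \<le> n"
        have t: "0 \<le> real k / n" "real k / n \<le> 1" using k n012 by auto
        define U where "U k = Y (real k / n)" for k :: nat
        have Um: "U j \<in> borel_measurable M" if "j \<le> n" for j unfolding U_def using that n012 by (intro Y_meas) auto
        have em: "euler_functional U k \<in> borel_measurable M"
          unfolding euler_functional_def[abs_def]
        proof (intro borel_measurable_add borel_measurable_sum borel_measurable_const)
          fix j assume "j \<in> {..<k}"
          then have j: "j < n" "j \<le> n" using k by auto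
          show "(\<lambda>\<omega>. b (U j \<omega>) / real n) \<in> borel_measurable M" using Um[OF j(2)] by measurable
          show "(\<lambda>\<omega>. a (U j \<omega>) * bm_noise n j \<omega> / sqrt n) \<in> borel_measurable M" using Um[OF j(2)] noise_meas_P[OF j(1)] by measurable
        qed
        have zm: "Z (\<lambda>k. l * (k div l)) k \<in> borel_measurable M" by (rule meas_P[OF k Z_adapted[OF k]])
        define E where "E = bounded_until R (real k / n)"
        have Em: "E \<in> events" unfolding E_def by (rule bounded_until_M[OF t])
        have ES: "E \<subseteq> space M" using sets.sets_into_space[OF Em] .
        define B1 where "B1 = {\<omega>\<in>E. \<theta> / 2 \<le> \<bar>euler_functional U k \<omega> - Z (\<lambda>k. l * (k div l)) k \<omega>\<bar>}"
        define B2 where "B2 = {\<omega>\<in>E. \<theta> / 2 \<le> \<bar>U k \<omega> - euler_functional U k \<omega>\<bar>}"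
        have "B1 = E \<inter> {\<omega>\<in>space M. \<theta> / 2 \<le> \<bar>euler_functional U k \<omega> - Z (\<lambda>k. l * (k div l)) k \<omega>\<bar>}"
          "B2 = E \<inter> {\<omega>\<in>space M. \<theta> / 2 \<le> \<bar>U k \<omega> - euler_functional U k \<omega>\<bar>}"
          using ES by (auto simp: B1_def B2_def)
        moreover have "{\<omega>\<in>space M. \<theta> / 2 \<le> \<bar>euler_functional U k \<omega> - Z (\<lambda>k. l * (k div l)) k \<omega>\<bar>} \<in> events"
          using em zm by measurable
        moreover have "{\<omega>\<in>space M. \<theta> / 2 \<le> \<bar>U k \<omega> - euler_functional U k \<omega>\<bar>} \<in> events" using em Um[OF k] by measurable
        ultimately have Bm: "B1 \<in> events" "B2 \<in> events" using Em by auto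
        have P1: "prob B1 < \<epsilon> / 3" unfolding B1_def E_def U_def[abs_def]
          using main[rule_format, OF bm_noise[OF n012(4)] n012(1) ap[OF n012(2)] _ _ k, of "\<lambda>k. l * (k div l)" l] \<kappa> inc by simp
        have P2: "prob B2 < \<epsilon> / 3" unfolding B2_def E_def U_def[abs_def] by (rule res[OF n012(3) k])
        have "prob E \<ge> prob (bounded_until R 1)"
          unfolding E_def using t by (intro finite_measure_mono bounded_until_mono bounded_until_M) auto
        then have P3: "prob (space M - E) < \<epsilon> / 3" using R(2) prob_compl[OF Em] by simp
        have "prob {\<omega>\<in>space M. \<theta> \<le> \<bar>Y (real k / n) \<omega> - Z (\<lambda>k. l * (k div l)) k \<omega>\<bar>} \<le> prob (B1 \<union> B2 \<union> (space M - E))"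
        proof (rule finite_measure_mono)
          show "{\<omega>\<in>space M. \<theta> \<le> \<bar>Y (real k / n) \<omega> - Z (\<lambda>k. l * (k div l)) k \<omega>\<bar>} \<subseteq> B1 \<union> B2 \<union> (space M - E)"
          proof
            fix \<omega> assume "\<omega> \<in> {\<omega>\<in>space M. \<theta> \<le> \<bar>Y (real k / n) \<omega> - Z (\<lambda>k. l * (k div l)) k \<omega>\<bar>}"
            then have \<omega>: "\<omega> \<in> space M" "\<theta> \<le> \<bar>U k \<omega> - Z (\<lambda>k. l * (k div l)) k \<omega>\<bar>" by (auto simp: U_def)
            then have "\<theta> / 2 \<le> \<bar>euler_functional U k \<omega> - Z (\<lambda>k. l * (k div l)) k \<omega>\<bar> \<or> \<theta> / 2 \<le> \<bar>U k \<omega> - euler_functional U k \<omega>\<bar>"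
              by linarith
            then show "\<omega> \<in> B1 \<union> B2 \<union> (space M - E)" using \<omega>(1) by (auto simp: B1_def B2_def)
          qed
        qed (use Bm Em in auto)
        also have "\<dots> \<le> prob B1 + prob B2 + prob (space M - E)"
          using measure_Un_le[of "B1 \<union> B2" M "space M - E"] measure_Un_le[of B1 M B2] Bm Em by simp
        finally show "prob {\<omega>\<in>space M. \<theta> \<le> \<bar>Y (real k / n) \<omega> - Z (\<lambda>k. l * (k div l)) k \<omega>\<bar>} < \<epsilon>"
          using P1 P2 P3 by linarith
      qed
      then show "\<exists>l>0. \<forall>k\<le>m * l. prob {\<omega>\<in>space M. \<theta> \<le> \<bar>Y (real k / (m * l)) \<omega> -
        delayed_euler a b y0 (m * l) (bm_noise (m * l)) (\<lambda>k. l * (k div l)) k \<omega>\<bar>} < \<epsilon>"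
        using l unfolding n_def by blast
    qed
  qed
qed

end

section \<open>Limit law of the coarse scheme\<close>

text \<open>A deterministic map from block increments \<open>s\<close> to coarse iterates; it
  isolates the only way in which the noise enters the coarse scheme.\<close>

fun coarse_euler :: "(real \<Rightarrow> real) \<Rightarrow> (real \<Rightarrow> real) \<Rightarrow> real \<Rightarrow> real \<Rightarrow> (nat \<Rightarrow> real) \<Rightarrow> nat \<Rightarrow> real" where
  "coarse_euler a b y0 h s 0 = y0"
| "coarse_euler a b y0 h s (Suc j) = coarse_euler a b y0 h s j + b (coarse_euler a b y0 h s j) * h + a (coarse_euler a b y0 h s j) * s j"

lemma coarse_euler_cong: "(\<And>i. i < j \<Longrightarrow> s i = s' i) \<Longrightarrow> coarse_euler a b y0 h s j = coarse_euler a b y0 h s' j"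
  by (induction j) auto

text \<open>With frozen coefficients the scheme is affine, inside a block, in the number of elapsed
  steps and in the partial sum of the noise.\<close>

lemma delayed_euler_block:
  assumes l: "0 < l"
  shows "r \<le> l \<Longrightarrow> delayed_euler a b y0 n \<xi> (\<lambda>k. l * (k div l)) (j * l + r) \<omega> =
     delayed_euler a b y0 n \<xi> (\<lambda>k. l * (k div l)) (j * l) \<omega>
      + b (delayed_euler a b y0 n \<xi> (\<lambda>k. l * (k div l)) (j * l) \<omega>) * (r / n)
      + a (delayed_euler a b y0 n \<xi> (\<lambda>k. l * (k div l)) (j * l) \<omega>) * ((\<Sum>i\<in>{j * l..<j * l + r}. \<xi> i \<omega>) / sqrt n)"
proof (induction r)
  case (Suc r)
  have "(j * l + r) div l = j" using Suc.prems by (intro div_nat_eqI) (auto simp: algebra_simps)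
  then have k: "min (j * l + r) (l * ((j * l + r) div l)) = j * l" by (simp add: mult.commute)
  have "delayed_euler a b y0 n \<xi> (\<lambda>k. l * (k div l)) (j * l + Suc r) \<omega> = delayed_euler a b y0 n \<xi> (\<lambda>k. l * (k div l)) (j * l + r) \<omega>
     + b (delayed_euler a b y0 n \<xi> (\<lambda>k. l * (k div l)) (j * l) \<omega>) / n
     + a (delayed_euler a b y0 n \<xi> (\<lambda>k. l * (k div l)) (j * l) \<omega>) * \<xi> (j * l + r) \<omega> / sqrt n"
    by (simp only: add_Suc_right delayed_euler.simps k)
  moreover have "(\<Sum>i\<in>{j * l..<j * l + Suc r}. \<xi> i \<omega>) = (\<Sum>i\<in>{j * l..<j * l + r}. \<xi> i \<omega>) + \<xi> (j * l + r) \<omega>" by simp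
  moreover have "b x * (r / n) + b x / n = b x * (Suc r / n)" for x by (simp add: field_simps add_divide_distrib)
  ultimately show ?case using Suc by (simp add: algebra_simps add_divide_distrib)
qed simp

lemma delayed_euler_coarse:
  assumes l: "0 < l"
  shows "delayed_euler a b y0 n \<xi> (\<lambda>k. l * (k div l)) (j * l) \<omega> =
     coarse_euler a b y0 (l / n) (\<lambda>j. (\<Sum>i\<in>{j * l..<j * l + l}. \<xi> i \<omega>) / sqrt n) j"
proof (induction j)
  case (Suc j)
  have "Suc j * l = j * l + l" by simp
  then show ?case using delayed_euler_block[OF l order.refl, of a b y0 n \<xi> j \<omega>] Suc
    by (simp add: add.commute[of l])
qed simp

context sde_coeffs begin

lemma coarse_euler_tendsto:
  assumes "h \<longlonglongrightarrow> h0" "\<And>i. i < j \<Longrightarrow> (\<lambda>n. s n i) \<longlonglongrightarrow> s0 i"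
  shows "(\<lambda>n. coarse_euler a b y (h n) (s n) j) \<longlonglongrightarrow> coarse_euler a b y h0 s0 j"
  using assms(2)
proof (induction j)
  case (Suc j)
  have c: "(\<lambda>n. coarse_euler a b y (h n) (s n) j) \<longlonglongrightarrow> coarse_euler a b y h0 s0 j" using Suc by simp
  have "isCont a x" "isCont b x" for x using a_cont b_cont by (auto simp: continuous_on_eq_continuous_at)
  note ab = isCont_tendsto_compose[OF this(1) c] isCont_tendsto_compose[OF this(2) c]
  show ?case unfolding coarse_euler.simps
    by (intro tendsto_add tendsto_mult c ab assms(1) Suc.prems) simp
qed simp

lemma coarse_euler_measurable: "(\<And>i. i < j \<Longrightarrow> (\<lambda>x. s x i) \<in> borel_measurable A) \<Longrightarrow> (\<lambda>x. coarse_euler a b y h (s x) j) \<in> borel_measurable A"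
proof (induction j)
  case (Suc j)
  then have [measurable]: "(\<lambda>x. coarse_euler a b y h (s x) j) \<in> borel_measurable A" "(\<lambda>x. s x j) \<in> borel_measurable A" by auto
  show ?case unfolding coarse_euler.simps by measurable
qed simp

end

text \<open>Splitting off the last variable, which is independent of its past, gives the product
  formula by induction: the event \<open>C k\<close> on the first k variables belongs to
  \<open>G k\<close>.\<close>

lemma (in noise) noise_indep_vars: "indep_vars (\<lambda>_. borel) \<xi> {..<n}"
proof -
  have rv: "\<xi> i \<in> borel_measurable P" if "i \<in> {..<n}" for i using noise_meas_P that by simp
  have "indep_vars (\<lambda>_. borel) \<xi> {..<n} \<longleftrightarrow>
    (\<forall>A\<in>(\<Pi> i\<in>{..<n}. sets borel). prob (\<Inter>j\<in>{..<n}. \<xi> j -` A j \<inter> space P) = (\<Prod>j\<in>{..<n}. prob (\<xi> j -` A j \<inter> space P)))"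
    using n_pos rv sets.space_closed[of "borel :: real measure"]
    by (intro indep_vars_finite) (auto simp: sets.sigma_sets_eq[of borel, simplified] Int_stable_def)
  moreover have "prob (\<Inter>j\<in>{..<n}. \<xi> j -` A j \<inter> space P) = (\<Prod>j\<in>{..<n}. prob (\<xi> j -` A j \<inter> space P))"
    if A: "A \<in> (\<Pi> i\<in>{..<n}. sets (borel :: real measure))" for A
  proof -
    define C where "C k = {\<omega>\<in>space P. \<forall>j<k. \<xi> j \<omega> \<in> A j}" for k
    have "C k \<in> sets (G k) \<and> prob (C k) = (\<Prod>j<k. prob (\<xi> j -` A j \<inter> space P))" if "k \<le> n" for k
      using that
    proof (induction k)
      case 0
      then show ?case using sets.top[of "G 0"] by (simp add: C_def space_G prob_space)
    next
      case (Suc k)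
      then have k: "k < n" "k \<le> n" by auto
      have Ak: "A k \<in> sets borel" using A k by auto
      have e: "C (Suc k) = C k \<inter> (\<xi> k -` A k \<inter> space P)" by (auto simp: C_def less_Suc_eq)
      have "\<xi> k -` A k \<inter> space P \<in> sets (G (Suc k))"
        using measurable_sets[OF noise_meas[OF k(1)] Ak] space_G[of "Suc k"] Suc.prems by simp
      moreover have "C k \<in> sets (G (Suc k))" using Suc.IH[OF k(2)] filt_mono[of k "Suc k"] Suc.prems by auto
      ultimately have "C (Suc k) \<in> sets (G (Suc k))" unfolding e by blast
      moreover have "prob (C (Suc k)) = prob (C k) * prob (\<xi> k -` A k \<inter> space P)"
        unfolding e using Suc.IH[OF k(2)] by (intro noise_indep k Ak) auto
      ultimately show ?case using Suc.IH[OF k(2)] by simp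
    qed
    from this[of n] have "prob (C n) = (\<Prod>j<n. prob (\<xi> j -` A j \<inter> space P))" by simp
    moreover have "(\<Inter>j\<in>{..<n}. \<xi> j -` A j \<inter> space P) = C n" using n_pos by (auto simp: C_def)
    ultimately show ?thesis by simp
  qed
  ultimately show ?thesis by blast
qed

text \<open>The tuple of coordinates is the identity map, whose law is the product of the coordinate
  laws; this is the product criterion for independence.\<close>

lemma coordinates_indep:
  assumes "prob_space \<Omega>" "I \<noteq> {}"
  shows "prob_space.indep_vars (PiM I (\<lambda>_. \<Omega>)) (\<lambda>_. \<Omega>) (\<lambda>i x. x i) I"
proof -
  interpret P: prob_space "PiM I (\<lambda>_. \<Omega>)" by (rule prob_space_PiM[OF assms(1)])
  have "distr (PiM I (\<lambda>_. \<Omega>)) (PiM I (\<lambda>_. \<Omega>)) (\<lambda>x. \<lambda>i\<in>I. x i) = distr (PiM I (\<lambda>_. \<Omega>)) (PiM I (\<lambda>_. \<Omega>)) (\<lambda>x. x)"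
    by (intro distr_cong refl) (auto simp: space_PiM PiE_def extensional_restrict)
  also have "\<dots> = PiM I (\<lambda>_. \<Omega>)" by (rule distr_id)
  also have "\<dots> = PiM I (\<lambda>i. distr (PiM I (\<lambda>_. \<Omega>)) \<Omega> (\<lambda>x. x i))"
  proof (intro PiM_cong refl)
    fix i assume "i \<in> I"
    then show "\<Omega> = distr (PiM I (\<lambda>_. \<Omega>)) \<Omega> (\<lambda>x. x i)"
      using distr_PiM_component[of I "\<lambda>_. \<Omega>" i] assms by simp
  qed
  finally show ?thesis using assms by (subst P.indep_vars_iff_distr_eq_PiM') auto
qed

text \<open>The joint law of independent variables is the product of their marginals, so
  expectations can be moved from one probability space to another without a coupling.\<close>

lemma indep_vars_same_law_integral:
  fixes X :: "'i \<Rightarrow> 'a \<Rightarrow> real" and X' :: "'i \<Rightarrow> 'b \<Rightarrow> real" and g :: "('i \<Rightarrow> real) \<Rightarrow> real"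
  assumes "prob_space A" "prob_space B" and I: "I \<noteq> {}"
    and ind: "prob_space.indep_vars A (\<lambda>_. borel) X I" "prob_space.indep_vars B (\<lambda>_. borel) X' I"
    and law: "\<And>i. i \<in> I \<Longrightarrow> distr A borel (X i) = distr B borel (X' i)"
    and g: "g \<in> borel_measurable (PiM I (\<lambda>_. borel))"
  shows "(\<integral>\<omega>. g (\<lambda>i\<in>I. X i \<omega>) \<partial>A) = (\<integral>\<omega>. g (\<lambda>i\<in>I. X' i \<omega>) \<partial>B)"
proof -
  interpret A: prob_space A by fact
  interpret B: prob_space B by fact
  have rv: "X i \<in> borel_measurable A" "X' i \<in> borel_measurable B" if "i \<in> I" for i
    using ind that unfolding A.indep_vars_def B.indep_vars_def by auto
  have m: "(\<lambda>\<omega>. \<lambda>i\<in>I. X i \<omega>) \<in> measurable A (PiM I (\<lambda>_. borel))" "(\<lambda>\<omega>. \<lambda>i\<in>I. X' i \<omega>) \<in> measurable B (PiM I (\<lambda>_. borel))"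
    using rv by (auto intro!: measurable_restrict)
  have "distr A (PiM I (\<lambda>_. borel)) (\<lambda>\<omega>. \<lambda>i\<in>I. X i \<omega>) = PiM I (\<lambda>i. distr A borel (X i))"
    using A.indep_vars_iff_distr_eq_PiM'[OF I, where M'="\<lambda>_. borel" and X=X] ind(1) rv(1) by simp
  also have "\<dots> = PiM I (\<lambda>i. distr B borel (X' i))" by (intro PiM_cong law refl)
  also have "\<dots> = distr B (PiM I (\<lambda>_. borel)) (\<lambda>\<omega>. \<lambda>i\<in>I. X' i \<omega>)"
    using B.indep_vars_iff_distr_eq_PiM'[OF I, where M'="\<lambda>_. borel" and X=X'] ind(2) rv(2) by simp
  finally have "(\<integral>s. g s \<partial>distr A (PiM I (\<lambda>_. borel)) (\<lambda>\<omega>. \<lambda>i\<in>I. X i \<omega>)) = (\<integral>s. g s \<partial>distr B (PiM I (\<lambda>_. borel)) (\<lambda>\<omega>. \<lambda>i\<in>I. X' i \<omega>))"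
    by simp
  then show ?thesis using integral_distr[OF m(1) g] integral_distr[OF m(2) g] by simp
qed

context iid_noise begin

lemma iid_rv: "iid i \<in> borel_measurable N"
  unfolding iid_def[abs_def] using rv[of "Suc i"] by simp

lemma iid_indep: "indep_vars (\<lambda>_. borel) iid UNIV"
proof -
  have "indep_vars (\<lambda>j. PiM {Suc j} (\<lambda>_. borel)) (\<lambda>j \<omega>. restrict (\<lambda>i. \<zeta> i \<omega>) {Suc j}) UNIV"
    by (rule indep_vars_restrict[OF indep]) (auto simp: disjoint_family_on_def)
  then have "indep_vars (\<lambda>_. borel) (\<lambda>j \<omega>. (\<lambda>x. x (Suc j) / \<sigma>) (restrict (\<lambda>i. \<zeta> i \<omega>) {Suc j})) UNIV"
    by (rule indep_vars_compose2) measurable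
  then show ?thesis by (simp add: iid_def[abs_def])
qed

definition "block l j \<omega> = (\<Sum>i\<in>{j * l..<j * l + l}. iid i \<omega>)"

lemma block_indep: "indep_vars (\<lambda>_. borel) (block l) UNIV"
proof -
  have "disjoint_family_on (\<lambda>j. {j * l..<j * l + l}) UNIV"
    unfolding disjoint_family_on_def
  proof (intro ballI impI)
    fix i j :: nat assume "i \<noteq> j"
    then have "Suc i \<le> j \<or> Suc j \<le> i" by auto
    then have "Suc i * l \<le> j * l \<or> Suc j * l \<le> i * l" by (meson mult_le_mono1)
    then show "{i * l..<i * l + l} \<inter> {j * l..<j * l + l} = {}" by auto
  qed
  then have "indep_vars (\<lambda>j. PiM {j * l..<j * l + l} (\<lambda>_. borel)) (\<lambda>j \<omega>. restrict (\<lambda>i. iid i \<omega>) {j * l..<j * l + l}) UNIV"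
    by (intro indep_vars_restrict[OF iid_indep]) auto
  then have "indep_vars (\<lambda>_. borel) (\<lambda>j \<omega>. (\<lambda>x. \<Sum>i\<in>{j * l..<j * l + l}. x i) (restrict (\<lambda>i. iid i \<omega>) {j * l..<j * l + l})) UNIV"
    by (rule indep_vars_compose2) (intro borel_measurable_sum measurable_component_singleton)
  then show ?thesis by (simp add: block_def[abs_def])
qed

lemma block_rv: "block l j \<in> borel_measurable N"
  unfolding block_def[abs_def] using iid_rv by (intro borel_measurable_sum) auto

lemma iid_law: "distr N borel (iid i) = distr N borel (iid 0)"
proof -
  have "distr N borel (iid i) = distr (distr N borel (\<zeta> (Suc i))) borel (\<lambda>x. x / \<sigma>)" for i
    using rv[of "Suc i"] by (subst distr_distr) (auto simp: comp_def iid_def[abs_def])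
  then show ?thesis using ident[of "Suc i"] by simp
qed

text \<open>Both sums have the l-th power of one characteristic function as characteristic function,
  and Levy's uniqueness theorem applies.\<close>

lemma block_law: "distr N borel (block l j) = distr N borel (\<lambda>\<omega>. \<Sum>i<l. iid i \<omega>)"
proof (rule Levy_uniqueness)
  show "real_distribution (distr N borel (block l j))" using block_rv by (intro real_distribution_distr) auto
  show "real_distribution (distr N borel (\<lambda>\<omega>. \<Sum>i<l. iid i \<omega>))" using iid_rv by (intro real_distribution_distr) auto
  show "char (distr N borel (block l j)) = char (distr N borel (\<lambda>\<omega>. \<Sum>i<l. iid i \<omega>))"
  proof
    fix t
    have "char (distr N borel (block l j)) t = (\<Prod>i\<in>{j * l..<j * l + l}. char (distr N borel (iid i)) t)"
      unfolding block_def[abs_def] by (rule char_distr_sum) (rule indep_vars_subset[OF iid_indep], simp)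
    also have "\<dots> = char (distr N borel (iid 0)) t ^ l" by (subst iid_law) simp
    also have "\<dots> = (\<Prod>i<l. char (distr N borel (iid i)) t)" by (subst (2) iid_law) simp
    also have "\<dots> = char (distr N borel (\<lambda>\<omega>. \<Sum>i<l. iid i \<omega>)) t"
      by (rule char_distr_sum[symmetric]) (rule indep_vars_subset[OF iid_indep], simp)
    finally show "char (distr N borel (block l j)) t = char (distr N borel (\<lambda>\<omega>. \<Sum>i<l. iid i \<omega>)) t" .
  qed
qed

lemma iid_clt: "weak_conv_m (\<lambda>l. distr N borel (\<lambda>\<omega>. (\<Sum>i<l. iid i \<omega>) / sqrt l)) std_normal_distribution"
proof -
  interpret n1: noise N past iid "\<lambda>q. expectation (\<lambda>\<omega>. \<bar>\<zeta> 1 \<omega> / \<sigma>\<bar> ^ q)" "Suc k" for k by (rule iid_noise) simp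
  have m: "expectation (iid k) = 0" "expectation (\<lambda>\<omega>. (iid k \<omega>)\<^sup>2) = 1" "integrable N (\<lambda>\<omega>. \<bar>iid k \<omega>\<bar> ^ 2)" for k
    using n1.noise_mean[of k k] n1.noise_var[of k k] n1.noise_int[of k k 2] by auto
  have "weak_conv_m (\<lambda>n. distr N borel (\<lambda>x. (\<Sum>i<n. iid i x) / sqrt (real n * 1\<^sup>2))) std_normal_distribution"
    by (rule central_limit_theorem_zero_mean[OF iid_indep, where \<mu>="distr N borel (iid 0)"]) (use m iid_law in auto)
  then show ?thesis by simp
qed

text \<open>A multivariate limit theorem is avoided. Skorohod's representation turns the scalar
  central limit theorem into everywhere convergence on a space \<Omega>; the m-fold product of
  \<Omega> supplies independent blocks with the right marginals, and dominated convergence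
  concludes. \<open>min j m\<close> stops the sequence of iterates at index m, so that only m
  increments matter.\<close>

lemma coarse_law_tendsto:
  fixes g :: "(nat \<Rightarrow> real) \<Rightarrow> real" and X :: "nat \<Rightarrow> 'c \<Rightarrow> real"
  assumes co: "sde_coeffs a b Ca Cb" and M: "prob_space M" and m: "0 < m"
    and ind: "prob_space.indep_vars M (\<lambda>_. borel) X {..<m}"
    and law: "\<And>j. j < m \<Longrightarrow> distr M borel (\<lambda>\<omega>. X j \<omega> * sqrt m) = std_normal_distribution"
    and g: "g \<in> borel_measurable borel" and gb: "\<And>v. \<bar>g v\<bar> \<le> B"
    and gc: "\<And>u v. (\<And>i. (\<lambda>n. u n i) \<longlonglongrightarrow> v i) \<Longrightarrow> (\<lambda>n. g (u n)) \<longlonglongrightarrow> g v"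
  shows "(\<lambda>n. expectation (\<lambda>\<omega>. g (\<lambda>j. coarse_euler a b y0 (real (n div m) / n) (\<lambda>j. block (n div m) j \<omega> / sqrt n) (min j m))))
    \<longlonglongrightarrow> (\<integral>\<omega>. g (\<lambda>j. coarse_euler a b y0 (1 / m) (\<lambda>j. X j \<omega>) (min j m)) \<partial>M)"
proof -
  interpret sde_coeffs a b Ca Cb y0 by fact
  interpret M: prob_space M by fact
  define \<nu> where "\<nu> l = distr N borel (\<lambda>\<omega>. (\<Sum>i<l. iid i \<omega>) / sqrt l)" for l :: nat
  have \<nu>: "real_distribution (\<nu> l)" for l unfolding \<nu>_def using iid_rv by (intro real_distribution_distr) auto
  obtain \<Omega> :: "real measure" and Ys :: "nat \<Rightarrow> real \<Rightarrow> real" and Yl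
    where \<Omega>: "prob_space \<Omega>" and Ys: "\<And>l. Ys l \<in> borel_measurable \<Omega>" "\<And>l. distr \<Omega> borel (Ys l) = \<nu> l"
      and Yl': "Yl \<in> measurable \<Omega> lborel" and Yl: "distr \<Omega> borel Yl = std_normal_distribution"
      and lim: "\<And>x. x \<in> space \<Omega> \<Longrightarrow> (\<lambda>l. Ys l x) \<longlonglongrightarrow> Yl x"
    using Skorohod[OF \<nu> real_dist_normal_dist iid_clt[folded \<nu>_def]] by blast
  have Ylm: "Yl \<in> borel_measurable \<Omega>" using Yl' by simp
  define Q where "Q = PiM {..<m} (\<lambda>_. \<Omega>)"
  interpret Q: prob_space Q unfolding Q_def by (rule prob_space_PiM[OF \<Omega>])
  have I: "{..<m} \<noteq> {}" using m by auto
  have coord: "(\<lambda>x. f (x j)) \<in> borel_measurable Q" if "j < m" "f \<in> borel_measurable \<Omega>" for f :: "real \<Rightarrow> real" and j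
    unfolding Q_def using that by (intro measurable_compose[OF measurable_component_singleton]) auto
  have Qind: "Q.indep_vars (\<lambda>_. borel) (\<lambda>j x. f (x j)) {..<m}" if "f \<in> borel_measurable \<Omega>" for f :: "real \<Rightarrow> real"
    unfolding Q_def
    by (rule prob_space.indep_vars_compose2[OF _ coordinates_indep[OF \<Omega> I]]) (use that Q.prob_space_axioms Q_def in auto)
  have Qlaw: "distr Q borel (\<lambda>x. f (x j)) = distr \<Omega> borel f" if "j < m" "f \<in> borel_measurable \<Omega>" for f :: "real \<Rightarrow> real" and j
  proof -
    have "distr Q borel (\<lambda>x. f (x j)) = distr (distr Q \<Omega> (\<lambda>x. x j)) borel f"
      unfolding Q_def using that by (subst distr_distr) (auto simp: comp_def)
    also have "distr Q \<Omega> (\<lambda>x. x j) = \<Omega>" unfolding Q_def using that \<Omega> by (intro distr_PiM_component) auto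
    finally show ?thesis .
  qed
  define \<Phi> where "\<Phi> h s = g (\<lambda>j. coarse_euler a b y0 h s (min j m))" for h s
  have \<Phi>m: "(\<lambda>x. \<Phi> h (s x)) \<in> borel_measurable A" if "\<And>i. i < m \<Longrightarrow> (\<lambda>x. s x i) \<in> borel_measurable A" for h and s :: "'z \<Rightarrow> nat \<Rightarrow> real" and A
    unfolding \<Phi>_def using that
    by (intro measurable_compose[OF _ g] measurable_coordinatewise_then_product coarse_euler_measurable) auto
  have \<Phi>P: "\<Phi> h \<in> borel_measurable (PiM {..<m} (\<lambda>_. borel))" for h
    using \<Phi>m[of "\<lambda>x. x" "PiM {..<m} (\<lambda>_. borel)" h] by (simp add: measurable_component_singleton)
  have \<Phi>r: "\<Phi> h (\<lambda>j\<in>{..<m}. s j) = \<Phi> h s" for h s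
  proof -
    have "coarse_euler a b y0 h (\<lambda>j\<in>{..<m}. s j) (min j m) = coarse_euler a b y0 h s (min j m)" for j
      by (rule coarse_euler_cong) auto
    then show ?thesis by (simp add: \<Phi>_def)
  qed
  \<comment> \<open>A block sum over sqrt n is c n times the sum normalised by the square root of
    its own length; c n tends to 1 / sqrt m.\<close>
  define c where "c n = sqrt (real (n div m) / n)" for n
  define V where "V n x = c n * Ys (n div m) x" for n x
  have Vm: "V n \<in> borel_measurable \<Omega>" for n unfolding V_def[abs_def] using Ys(1) by measurable
  have fin: "expectation (\<lambda>\<omega>. \<Phi> h (\<lambda>j. block (n div m) j \<omega> / sqrt n)) = (\<integral>x. \<Phi> h (\<lambda>j. V n (x j)) \<partial>Q)" for h n
  proof -
    have "expectation (\<lambda>\<omega>. \<Phi> h (\<lambda>j\<in>{..<m}. block (n div m) j \<omega> / sqrt n)) = (\<integral>x. \<Phi> h (\<lambda>j\<in>{..<m}. V n (x j)) \<partial>Q)"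
    proof (rule indep_vars_same_law_integral[OF prob_space_axioms Q.prob_space_axioms I _ Qind[OF Vm] _ \<Phi>P])
      have "indep_vars (\<lambda>_. borel) (\<lambda>j \<omega>. (\<lambda>x. x / sqrt n) (block (n div m) j \<omega>)) UNIV"
        by (rule indep_vars_compose2[OF block_indep]) measurable
      then show "indep_vars (\<lambda>_. borel) (\<lambda>j \<omega>. block (n div m) j \<omega> / sqrt n) {..<m}"
        by (rule indep_vars_subset) simp
    next
      fix j assume "j \<in> {..<m}"
      then have j: "j < m" by simp
      \<comment> \<open>For n < m the block is empty and both sides are 0.\<close>
      have z: "block (n div m) j \<omega> / sqrt n = c n * (block (n div m) j \<omega> / sqrt (n div m))" for \<omega>
        by (cases "n div m = 0") (auto simp: c_def real_sqrt_divide block_def)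
      have "distr N borel (\<lambda>\<omega>. block (n div m) j \<omega> / sqrt n) = distr (distr N borel (block (n div m) j)) borel (\<lambda>x. c n * (x / sqrt (n div m)))"
        unfolding z using block_rv by (subst distr_distr) (auto simp: comp_def)
      also have "\<dots> = distr N borel (\<lambda>\<omega>. c n * ((\<Sum>i<n div m. iid i \<omega>) / sqrt (n div m)))"
        unfolding block_law using iid_rv by (subst distr_distr) (auto simp: comp_def)
      also have "\<dots> = distr (\<nu> (n div m)) borel (\<lambda>x. c n * x)"
        unfolding \<nu>_def using iid_rv by (subst distr_distr) (auto simp: comp_def)
      also have "\<dots> = distr \<Omega> borel (V n)"
        unfolding Ys(2)[symmetric] V_def[abs_def] using Ys(1) by (subst distr_distr) (auto simp: comp_def)
      finally show "distr N borel (\<lambda>\<omega>. block (n div m) j \<omega> / sqrt n) = distr Q borel (\<lambda>x. V n (x j))"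
        using Qlaw[OF j Vm] by simp
    qed
    then show ?thesis unfolding \<Phi>r .
  qed
  have linf: "(\<integral>\<omega>. \<Phi> (1 / m) (\<lambda>j. X j \<omega>) \<partial>M) = (\<integral>x. \<Phi> (1 / m) (\<lambda>j. (1 / sqrt m) * Yl (x j)) \<partial>Q)"
  proof -
    have Yc: "(\<lambda>y. (1 / sqrt m) * Yl y) \<in> borel_measurable \<Omega>" using Ylm by measurable
    have "(\<integral>\<omega>. \<Phi> (1 / m) (\<lambda>j\<in>{..<m}. X j \<omega>) \<partial>M) = (\<integral>x. \<Phi> (1 / m) (\<lambda>j\<in>{..<m}. (1 / sqrt m) * Yl (x j)) \<partial>Q)"
    proof (rule indep_vars_same_law_integral[OF M Q.prob_space_axioms I ind Qind[OF Yc] _ \<Phi>P])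
      fix j assume "j \<in> {..<m}"
      then have j: "j < m" by simp
      have Xm: "X j \<in> borel_measurable M" using ind j unfolding M.indep_vars_def by auto
      have "distr M borel (X j) = distr (distr M borel (\<lambda>\<omega>. X j \<omega> * sqrt m)) borel (\<lambda>x. (1 / sqrt m) * x)"
        using Xm m by (subst distr_distr) (auto simp: comp_def)
      also have "\<dots> = distr \<Omega> borel (\<lambda>y. (1 / sqrt m) * Yl y)"
        unfolding law[OF j] Yl[symmetric] using Ylm by (subst distr_distr) (auto simp: comp_def)
      finally show "distr M borel (X j) = distr Q borel (\<lambda>x. (1 / sqrt m) * Yl (x j))" using Qlaw[OF j Yc] by simp
    qed
    then show ?thesis unfolding \<Phi>r .
  qed
  have hlim: "(\<lambda>n. real (n div m) / n) \<longlonglongrightarrow> 1 / m"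
  proof (rule tendsto_sandwich[of "\<lambda>n. 1 / real m - 1 / real n" _ _ "\<lambda>_. 1 / real m"])
    show "(\<lambda>n. 1 / real m - 1 / real n) \<longlonglongrightarrow> 1 / m" using tendsto_diff[OF tendsto_const lim_1_over_n, of "1 / real m"] by simp
    have b: "1 / m - 1 / n \<le> real (n div m) / n \<and> real (n div m) / n \<le> 1 / m" if "0 < n" for n
    proof -
      have "real (n div m) * m \<le> n" by (metis div_times_less_eq_dividend of_nat_le_iff of_nat_mult)
      moreover have "n \<le> (n div m) * m + m" using m by (metis add_left_mono div_mult_mod_eq less_imp_le mod_less_divisor)
      then have "real n \<le> real (n div m) * m + m" by (metis of_nat_add of_nat_le_iff of_nat_mult)
      ultimately have "real n / m \<le> real (n div m) + 1" "real (n div m) \<le> real n / m"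
        using m by (simp_all add: pos_divide_le_eq pos_le_divide_eq distrib_right)
      then have "real n / m / n \<le> (real (n div m) + 1) / n" "real (n div m) / n \<le> real n / m / n"
        by (intro divide_right_mono; simp)+
      then show ?thesis using that by (simp add: add_divide_distrib)
    qed
    show "\<forall>\<^sub>F n in sequentially. 1 / m - 1 / n \<le> real (n div m) / n"
      "\<forall>\<^sub>F n in sequentially. real (n div m) / n \<le> 1 / m"
      using b by (auto intro!: eventually_sequentiallyI[of 1])
  qed auto
  have clim: "c \<longlonglongrightarrow> 1 / sqrt m" unfolding c_def[abs_def] using tendsto_real_sqrt[OF hlim] by (simp add: real_sqrt_divide)
  have div_top: "filterlim (\<lambda>n. n div m) sequentially sequentially"
    unfolding filterlim_at_top
  proof
    fix Z :: nat
    show "\<forall>\<^sub>F n in sequentially. Z \<le> n div m"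
      using m by (auto intro!: eventually_sequentiallyI[of "Z * m"] simp: less_eq_div_iff_mult_less_eq)
  qed
  have "(\<lambda>n. \<integral>x. \<Phi> (real (n div m) / n) (\<lambda>j. V n (x j)) \<partial>Q) \<longlonglongrightarrow> (\<integral>x. \<Phi> (1 / m) (\<lambda>j. (1 / sqrt m) * Yl (x j)) \<partial>Q)"
  proof (rule integral_dominated_convergence[where w="\<lambda>_. B"])
    show "(\<lambda>x. \<Phi> (1 / m) (\<lambda>j. (1 / sqrt m) * Yl (x j))) \<in> borel_measurable Q"
      using coord[of _ "\<lambda>y. (1 / sqrt m) * Yl y"] Ylm by (intro \<Phi>m) auto
    show "(\<lambda>x. \<Phi> (real (n div m) / n) (\<lambda>j. V n (x j))) \<in> borel_measurable Q" for n
      using coord[OF _ Vm] by (intro \<Phi>m) auto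
    show "integrable Q (\<lambda>_. B)" by simp
    show "AE x in Q. norm (\<Phi> (real (n div m) / n) (\<lambda>j. V n (x j))) \<le> B" for n
      using gb by (simp add: \<Phi>_def)
    show "AE x in Q. (\<lambda>n. \<Phi> (real (n div m) / n) (\<lambda>j. V n (x j))) \<longlonglongrightarrow> \<Phi> (1 / m) (\<lambda>j. (1 / sqrt m) * Yl (x j))"
    proof (rule AE_I2)
      fix x assume x: "x \<in> space Q"
      show "(\<lambda>n. \<Phi> (real (n div m) / n) (\<lambda>j. V n (x j))) \<longlonglongrightarrow> \<Phi> (1 / m) (\<lambda>j. (1 / sqrt m) * Yl (x j))"
        unfolding \<Phi>_def
      proof (intro gc coarse_euler_tendsto hlim)
        fix i j assume "j < min i m"
        then have "x j \<in> space \<Omega>" using x by (auto simp: Q_def space_PiM)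
        then show "(\<lambda>n. V n (x j)) \<longlonglongrightarrow> (1 / sqrt m) * Yl (x j)"
          unfolding V_def by (intro tendsto_mult clim filterlim_compose[OF lim div_top])
      qed
    qed
  qed
  then show ?thesis unfolding fin[symmetric] linf[symmetric] unfolding \<Phi>_def .
qed

end

section \<open>Finite-dimensional distributions\<close>

lemma power_add3_le:
  fixes x y z :: real
  shows "(x + y + z) ^ (2 * p) \<le> 4 ^ (2 * p) * (x ^ (2 * p) + y ^ (2 * p) + z ^ (2 * p))"
proof -
  have "(x + y + z) ^ (2 * p) = \<bar>x + y + z\<bar> ^ (2 * p)" by (simp add: power_even_abs)
  also have "\<dots> \<le> (\<bar>x\<bar> + (\<bar>y\<bar> + \<bar>z\<bar>)) ^ (2 * p)" by (intro power_mono) auto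
  also have "\<dots> \<le> 2 ^ (2 * p) * (\<bar>x\<bar> ^ (2 * p) + (\<bar>y\<bar> + \<bar>z\<bar>) ^ (2 * p))" by (intro power_add_le_split) auto
  also have "\<dots> \<le> 2 ^ (2 * p) * (2 ^ (2 * p) * \<bar>x\<bar> ^ (2 * p) + 2 ^ (2 * p) * (\<bar>y\<bar> ^ (2 * p) + \<bar>z\<bar> ^ (2 * p)))"
  proof (intro mult_left_mono add_mono power_add_le_split)
    have "1 * \<bar>x\<bar> ^ (2 * p) \<le> 2 ^ (2 * p) * \<bar>x\<bar> ^ (2 * p)" by (intro mult_right_mono one_le_power) auto
    then show "\<bar>x\<bar> ^ (2 * p) \<le> 2 ^ (2 * p) * \<bar>x\<bar> ^ (2 * p)" by simp
  qed auto
  also have "\<dots> = (2 ^ (2 * p) * 2 ^ (2 * p)) * (\<bar>x\<bar> ^ (2 * p) + \<bar>y\<bar> ^ (2 * p) + \<bar>z\<bar> ^ (2 * p))" by (simp add: algebra_simps)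
  also have "2 ^ (2 * p) * 2 ^ (2 * p) = (4 :: real) ^ (2 * p)" by (simp flip: power_mult_distrib)
  finally show ?thesis by (simp add: power_even_abs)
qed

text \<open>Cells are closed, and t = 1 is assigned to the last one.\<close>

lemma unit_cell:
  assumes "0 < n" "0 \<le> t" "t \<le> 1"
  shows "\<exists>j<n. real j / n \<le> t \<and> t \<le> real (Suc j) / n"
proof (cases "t = 1")
  case True
  then show ?thesis using assms(1) by (intro exI[of _ "n - 1"]) (auto simp: of_nat_diff)
next
  case False
  define j where "j = nat \<lfloor>n * t\<rfloor>"
  have "real j = of_int \<lfloor>n * t\<rfloor>" using assms by (simp add: j_def)
  then have j: "real j \<le> n * t" "n * t < real j + 1" by linarith+
  have "real n * t < real n * 1" using assms False by (intro mult_strict_left_mono) auto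
  then have "j < n" using j by linarith
  moreover have "real j / n \<le> t" "t \<le> real (Suc j) / n" using j assms(1) by (simp_all add: field_simps)
  ultimately show ?thesis by blast
qed

lemma euler_pts_sum:
  "euler_pts a b \<sigma> \<zeta> y0 n m \<omega> = y0 + (1 / real n) * (\<Sum>k=1..m. b (euler_pts a b \<sigma> \<zeta> y0 n (k - 1) \<omega>))
     + 1 / (\<sigma> * sqrt (real n)) * (\<Sum>k=1..m. a (euler_pts a b \<sigma> \<zeta> y0 n (k - 1) \<omega>) * \<zeta> k \<omega>)"
  by (induction m) (simp_all add: algebra_simps)

text \<open>At the right end of the cell the floor has already jumped to j + 1 while the fractional
  part is 0; both expressions give the next grid value there, so the affine formula holds on the
  closed cell.\<close>

lemma euler_proc_cell:
  assumes n: "0 < n" and t: "real j / n \<le> t" "t \<le> real (Suc j) / n"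
  shows "euler_proc a b \<sigma> \<zeta> y0 n \<omega> t = euler_pts a b \<sigma> \<zeta> y0 n j \<omega>
     + (n * t - j) * (euler_pts a b \<sigma> \<zeta> y0 n (Suc j) \<omega> - euler_pts a b \<sigma> \<zeta> y0 n j \<omega>)"
proof -
  let ?E = "\<lambda>k. euler_pts a b \<sigma> \<zeta> y0 n k \<omega>"
  have val: "euler_proc a b \<sigma> \<zeta> y0 n \<omega> t = ?E m + r * (?E (Suc m) - ?E m)"
    if m: "m = nat \<lfloor>real n * t\<rfloor>" "r = real n * t - of_int \<lfloor>real n * t\<rfloor>" for m r
    unfolding euler_proc_def Let_def m[symmetric]
    using euler_pts_sum[of a b \<sigma> \<zeta> y0 n m \<omega>] by (simp add: algebra_simps)
  show ?thesis
  proof (cases "t = real (Suc j) / n")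
    case True
    then have e: "real n * t = real (Suc j)" using n by simp
    have "nat \<lfloor>real n * t\<rfloor> = Suc j" "real n * t - of_int \<lfloor>real n * t\<rfloor> = 0" unfolding e by simp_all
    then show ?thesis using val[of "Suc j" 0] e by simp
  next
    case False
    then have "t < real (Suc j) / n" using t by simp
    then have "real j \<le> n * t" "n * t < real j + 1" using t n by (simp_all add: field_simps)
    then have f: "\<lfloor>real n * t\<rfloor> = int j" by linarith
    then show ?thesis using val[of j "real n * t - real j"] by simp
  qed
qed

text \<open>Test functions of d + 1 real variables, coded on sequences to avoid a type of vectors:
  bounded, and uniformly continuous near bounded sets. That coordinates beyond d have no influence
  is a consequence of the modulus.\<close>

definition fd_test :: "nat \<Rightarrow> ((nat \<Rightarrow> real) \<Rightarrow> real) \<Rightarrow> bool" where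
  "fd_test d g \<longleftrightarrow> (\<exists>B. \<forall>v. \<bar>g v\<bar> \<le> B) \<and>
     (\<forall>R>0. \<forall>\<epsilon>>0. \<exists>\<delta>>0. \<forall>v w. (\<forall>i\<le>d. \<bar>v i\<bar> \<le> R \<and> \<bar>v i - w i\<bar> < \<delta>) \<longrightarrow> \<bar>g v - g w\<bar> \<le> \<epsilon>)"

lemma fd_testD:
  assumes "fd_test d g" "0 < R" "0 < \<epsilon>"
  shows "\<exists>\<delta>>0. \<forall>v w. (\<forall>i\<le>d. \<bar>v i\<bar> \<le> R \<and> \<bar>v i - w i\<bar> < \<delta>) \<longrightarrow> \<bar>g v - g w\<bar> \<le> \<epsilon>"
  using conjunct2[OF assms(1)[unfolded fd_test_def]] assms(2,3) by simp

text \<open>Sequences that agree up to d are \<delta>-close for every \<delta>, so the values differ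
  by less than any \<epsilon>.\<close>

lemma fd_test_cong:
  assumes "fd_test d g" "\<And>i. i \<le> d \<Longrightarrow> v i = w i"
  shows "g v = g w"
proof -
  define R where "R = 1 + (\<Sum>i\<le>d. \<bar>v i\<bar>)"
  have Rv: "\<bar>v i\<bar> \<le> R" if "i \<le> d" for i
    using member_le_sum[of i "{..d}" "\<lambda>i. \<bar>v i\<bar>"] that by (simp add: R_def)
  have R: "0 < R" unfolding R_def by (intro add_pos_nonneg sum_nonneg) auto
  have "\<bar>g v - g w\<bar> \<le> \<epsilon>" if e: "0 < \<epsilon>" for \<epsilon>
  proof -
    obtain \<delta> where "\<delta> > 0" and \<delta>: "\<forall>v w. (\<forall>i\<le>d. \<bar>v i\<bar> \<le> R \<and> \<bar>v i - w i\<bar> < \<delta>) \<longrightarrow> \<bar>g v - g w\<bar> \<le> \<epsilon>"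
      using fd_testD[OF assms(1) R e] by (elim exE conjE)
    then show ?thesis using Rv assms(2) by simp
  qed
  then have "\<bar>g v - g w\<bar> \<le> 0" by (rule field_le_epsilon[of _ 0, simplified])
  then show ?thesis by simp
qed

lemma fd_test_tendsto:
  assumes g: "fd_test d g" and u: "\<And>i. (\<lambda>n. u n i) \<longlonglongrightarrow> v i"
  shows "(\<lambda>n. g (u n)) \<longlonglongrightarrow> g v"
proof (rule LIMSEQ_I)
  fix \<epsilon> :: real assume "0 < \<epsilon>"
  then have e: "0 < \<epsilon> / 2" by simp
  define R where "R = 1 + (\<Sum>i\<le>d. \<bar>v i\<bar>)"
  have Rv: "\<bar>v i\<bar> \<le> R" if "i \<le> d" for i
    using member_le_sum[of i "{..d}" "\<lambda>i. \<bar>v i\<bar>"] that by (simp add: R_def)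
  have R: "0 < R" unfolding R_def by (intro add_pos_nonneg sum_nonneg) auto
  obtain \<delta> where \<delta>0: "\<delta> > 0" and \<delta>: "\<forall>v w. (\<forall>i\<le>d. \<bar>v i\<bar> \<le> R \<and> \<bar>v i - w i\<bar> < \<delta>) \<longrightarrow> \<bar>g v - g w\<bar> \<le> \<epsilon> / 2"
    using fd_testD[OF g R e] by (elim exE conjE)
  have "\<forall>\<^sub>F n in sequentially. \<forall>i\<in>{..d}. dist (u n i) (v i) < \<delta>"
    by (intro eventually_ball_finite ballI tendstoD[OF u] \<delta>0) simp
  then obtain N where N: "\<And>n i. N \<le> n \<Longrightarrow> i \<le> d \<Longrightarrow> dist (u n i) (v i) < \<delta>" by (auto simp: eventually_sequentially)
  show "\<exists>N. \<forall>n\<ge>N. norm (g (u n) - g v) < \<epsilon>"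
  proof (intro exI[of _ N] allI impI)
    fix n assume "N \<le> n"
    then have "\<forall>i\<le>d. \<bar>v i\<bar> \<le> R \<and> \<bar>v i - u n i\<bar> < \<delta>" using Rv N by (auto simp: dist_real_def abs_minus_commute)
    then have "\<bar>g v - g (u n)\<bar> \<le> \<epsilon> / 2" using \<delta> by blast
    then show "norm (g (u n) - g v) < \<epsilon>" using \<open>0 < \<epsilon>\<close> by (simp add: abs_minus_commute)
  qed
qed

lemma fd_test_measurable:
  assumes g: "fd_test d g"
  shows "g \<in> borel_measurable borel"
proof (rule borel_measurable_continuous_onI, rule continuous_on_sequentiallyI)
  fix u :: "nat \<Rightarrow> nat \<Rightarrow> real" and v assume u: "u \<longlonglongrightarrow> v"
  have "(\<lambda>n. u n i) \<longlonglongrightarrow> v i" for i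
    by (rule continuous_on_tendsto_compose[OF continuous_on_product_coordinates u]) auto
  then show "(\<lambda>n. g (u n)) \<longlonglongrightarrow> g v" by (rule fd_test_tendsto[OF g])
qed

text \<open>Measurability is known up to index d only; later coordinates are replaced by the d-th
  one, which leaves \<open>g\<close> unchanged.\<close>

lemma fd_test_comp_measurable:
  assumes g: "fd_test d g" and U: "\<And>i. i \<le> d \<Longrightarrow> U i \<in> borel_measurable P"
  shows "(\<lambda>\<omega>. g (\<lambda>i. U i \<omega>)) \<in> borel_measurable P"
proof -
  have e: "g (\<lambda>i. U i \<omega>) = g (\<lambda>i. U (min i d) \<omega>)" for \<omega> by (rule fd_test_cong[OF g]) simp
  show ?thesis unfolding e
    by (rule measurable_compose[OF _ fd_test_measurable[OF g]], rule measurable_coordinatewise_then_product) (use U in simp)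
qed

text \<open>The modulus applies where all U i are bounded by R and \<delta>-close to V i. The
  complement is a union of 2 (d + 1) events of probability at most \<eta>, and costs 2B.\<close>

lemma (in prob_space) fd_test_close:
  assumes g: "fd_test d g" and B: "\<And>v. \<bar>g v\<bar> \<le> B"
    and m: "\<And>i. i \<le> d \<Longrightarrow> U i \<in> borel_measurable M" "\<And>i. i \<le> d \<Longrightarrow> V i \<in> borel_measurable M"
    and \<delta>: "\<And>v w. (\<And>i. i \<le> d \<Longrightarrow> \<bar>v i\<bar> \<le> R \<and> \<bar>v i - w i\<bar> < \<delta>) \<Longrightarrow> \<bar>g v - g w\<bar> \<le> \<epsilon>" and \<epsilon>: "0 \<le> \<epsilon>"
    and p: "\<And>i. i \<le> d \<Longrightarrow> prob {\<omega>\<in>space M. R < \<bar>U i \<omega>\<bar>} \<le> \<eta>" "\<And>i. i \<le> d \<Longrightarrow> prob {\<omega>\<in>space M. \<delta> \<le> \<bar>U i \<omega> - V i \<omega>\<bar>} \<le> \<eta>"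
  shows "\<bar>expectation (\<lambda>\<omega>. g (\<lambda>i. U i \<omega>)) - expectation (\<lambda>\<omega>. g (\<lambda>i. V i \<omega>))\<bar> \<le> \<epsilon> + 2 * B * (2 * (real d + 1) * \<eta>)"
proof -
  define A1 where "A1 i = {\<omega>\<in>space M. R < \<bar>U i \<omega>\<bar>}" for i
  define A2 where "A2 i = {\<omega>\<in>space M. \<delta> \<le> \<bar>U i \<omega> - V i \<omega>\<bar>}" for i
  have Am: "A1 i \<in> events" "A2 i \<in> events" if "i \<le> d" for i
  proof -
    note [measurable] = m(1)[OF that] m(2)[OF that]
    show "A1 i \<in> events" "A2 i \<in> events" unfolding A1_def A2_def by measurable
  qed
  define Bad where "Bad = (\<Union>i\<in>{..d}. A1 i \<union> A2 i)"
  have Badm: "Bad \<in> events" unfolding Bad_def using Am by (intro sets.finite_UN) auto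
  have "prob Bad \<le> (\<Sum>i\<in>{..d}. prob (A1 i \<union> A2 i))"
    unfolding Bad_def using Am by (intro finite_measure_subadditive_finite) auto
  also have "\<dots> \<le> (\<Sum>i\<in>{..d}. \<eta> + \<eta>)"
  proof (intro sum_mono)
    fix i assume "i \<in> {..d}"
    then have i: "i \<le> d" by simp
    have "prob (A1 i \<union> A2 i) \<le> prob (A1 i) + prob (A2 i)" using Am[OF i] by (intro measure_Un_le) auto
    then show "prob (A1 i \<union> A2 i) \<le> \<eta> + \<eta>" using p[OF i] unfolding A1_def A2_def by linarith
  qed
  also have "\<dots> = 2 * (real d + 1) * \<eta>" by (simp add: algebra_simps)
  finally have PB: "prob Bad \<le> 2 * (real d + 1) * \<eta>" .
  have B0: "0 \<le> B" using B[of undefined] by linarith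
  have gm: "(\<lambda>\<omega>. g (\<lambda>i. U i \<omega>)) \<in> borel_measurable M" "(\<lambda>\<omega>. g (\<lambda>i. V i \<omega>)) \<in> borel_measurable M"
    using m by (auto intro!: fd_test_comp_measurable[OF g])
  have gi: "integrable M (\<lambda>\<omega>. g (\<lambda>i. U i \<omega>))" "integrable M (\<lambda>\<omega>. g (\<lambda>i. V i \<omega>))"
    using B by (auto intro!: integrable_const_bound[of _ B] gm)
  have "\<bar>expectation (\<lambda>\<omega>. g (\<lambda>i. U i \<omega>)) - expectation (\<lambda>\<omega>. g (\<lambda>i. V i \<omega>))\<bar>
     = \<bar>expectation (\<lambda>\<omega>. g (\<lambda>i. U i \<omega>) - g (\<lambda>i. V i \<omega>))\<bar>" using gi by simp
  also have "\<dots> \<le> expectation (\<lambda>\<omega>. \<bar>g (\<lambda>i. U i \<omega>) - g (\<lambda>i. V i \<omega>)\<bar>)" by (rule integral_abs_bound)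
  also have "\<dots> \<le> expectation (\<lambda>\<omega>. \<epsilon> + 2 * B * indicator Bad \<omega>)"
  proof (rule integral_mono)
    show "integrable M (\<lambda>\<omega>. \<bar>g (\<lambda>i. U i \<omega>) - g (\<lambda>i. V i \<omega>)\<bar>)" using gi by auto
    show "integrable M (\<lambda>\<omega>. \<epsilon> + 2 * B * indicator Bad \<omega>)"
      using Badm by (auto intro!: integrable_real_indicator simp: emeasure_eq_measure)
    fix \<omega> assume \<omega>: "\<omega> \<in> space M"
    show "\<bar>g (\<lambda>i. U i \<omega>) - g (\<lambda>i. V i \<omega>)\<bar> \<le> \<epsilon> + 2 * B * indicator Bad \<omega>"
    proof (cases "\<omega> \<in> Bad")
      case True
      then show ?thesis using B[of "\<lambda>i. U i \<omega>"] B[of "\<lambda>i. V i \<omega>"] \<epsilon> by simp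
    next
      case False
      have "\<bar>g (\<lambda>i. U i \<omega>) - g (\<lambda>i. V i \<omega>)\<bar> \<le> \<epsilon>"
        by (rule \<delta>) (use False \<omega> in \<open>auto simp: Bad_def A1_def A2_def not_less not_le\<close>)
      then show ?thesis using False by simp
    qed
  qed
  also have "\<dots> = \<epsilon> + 2 * B * prob Bad"
    using Badm by (simp add: integrable_real_indicator emeasure_eq_measure prob_space)
  also have "\<dots> \<le> \<epsilon> + 2 * B * (2 * (real d + 1) * \<eta>)" using PB B0 by (intro add_left_mono mult_left_mono) auto
  finally show ?thesis .
qed

lemma (in prob_space) prob_le_second_moment:
  assumes "X \<in> borel_measurable M" "integrable M (\<lambda>\<omega>. (X \<omega>)\<^sup>2)" "expectation (\<lambda>\<omega>. (X \<omega>)\<^sup>2) \<le> c" "0 < r"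
  shows "prob {\<omega>\<in>space M. r \<le> \<bar>X \<omega>\<bar>} \<le> c / r\<^sup>2"
proof -
  have "{\<omega>\<in>space M. r \<le> \<bar>X \<omega>\<bar>} = {\<omega>\<in>space M. r\<^sup>2 \<le> (X \<omega>)\<^sup>2}"
    using assms(4) abs_le_square_iff[of r "X _"] by auto
  then have "prob {\<omega>\<in>space M. r \<le> \<bar>X \<omega>\<bar>} = prob {\<omega>\<in>space M. r\<^sup>2 \<le> (X \<omega>)\<^sup>2}" by simp
  also have "\<dots> \<le> expectation (\<lambda>\<omega>. (X \<omega>)\<^sup>2) / r\<^sup>2"
    by (rule integral_Markov_inequality_measure[OF assms(2), of "{}"]) (use assms(4) in auto)
  also have "\<dots> \<le> c / r\<^sup>2" using assms(3) by (rule divide_right_mono) simp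
  finally show ?thesis .
qed

locale euler_scheme = iid_noise N \<zeta> \<sigma> + sde_coeffs a b Ca Cb y0
  for N :: "'b measure" and \<zeta> \<sigma> a b Ca Cb y0
begin

abbreviation "noise_moment q \<equiv> expectation (\<lambda>\<omega>. \<bar>\<zeta> 1 \<omega> / \<sigma>\<bar> ^ q)"
abbreviation "Yn n t \<omega> \<equiv> euler_proc a b \<sigma> \<zeta> y0 n \<omega> t"

definition "inc_const p = euler_setting.inc noise_moment a b Ca Cb y0 p"

lemma euler_settingI: "0 < n \<Longrightarrow> euler_setting N past iid noise_moment n a b Ca Cb"
  using iid_noise sde_coeffs_axioms by (simp add: euler_setting_def)

lemma euler_pts_measurable: "euler_pts a b \<sigma> \<zeta> y0 n k \<in> borel_measurable N"
proof (induction k)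
  case (Suc k)
  have [measurable]: "euler_pts a b \<sigma> \<zeta> y0 n k \<in> borel_measurable N" "\<zeta> (Suc k) \<in> borel_measurable N" using Suc rv[of "Suc k"] by auto
  show ?case unfolding euler_pts.simps[abs_def] by measurable
qed simp

lemma Yn_measurable: "0 < n \<Longrightarrow> 0 \<le> t \<Longrightarrow> t \<le> 1 \<Longrightarrow> Yn n t \<in> borel_measurable N"
proof -
  assume n: "0 < n" and t: "0 \<le> t" "t \<le> 1"
  obtain j where "j < n" and j: "real j / n \<le> t" "t \<le> real (Suc j) / n" using unit_cell[OF n t] by auto
  note [measurable] = euler_pts_measurable
  show ?thesis unfolding euler_proc_cell[OF n j] by measurable
qed

lemma inc_const_nonneg: "1 \<le> p \<Longrightarrow> 0 \<le> inc_const p"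
proof -
  assume p: "1 \<le> p"
  interpret euler_setting N past iid noise_moment 1 a b Ca Cb y0 by (rule euler_settingI) simp
  show ?thesis unfolding inc_const_def by (rule inc_nonneg[OF p])
qed

lemma pts_increment:
  assumes n: "0 < n" and jk: "j \<le> k" "k \<le> n" and p: "1 \<le> p"
  shows "integrable N (\<lambda>\<omega>. (euler_pts a b \<sigma> \<zeta> y0 n k \<omega> - euler_pts a b \<sigma> \<zeta> y0 n j \<omega>) ^ (2 * p))"
    "expectation (\<lambda>\<omega>. (euler_pts a b \<sigma> \<zeta> y0 n k \<omega> - euler_pts a b \<sigma> \<zeta> y0 n j \<omega>) ^ (2 * p)) \<le> inc_const p * ((real k - real j) / n) ^ p"
proof -
  interpret euler_setting N past iid noise_moment n a b Ca Cb y0 by (rule euler_settingI[OF n])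
  show "integrable N (\<lambda>\<omega>. (euler_pts a b \<sigma> \<zeta> y0 n k \<omega> - euler_pts a b \<sigma> \<zeta> y0 n j \<omega>) ^ (2 * p))"
    "expectation (\<lambda>\<omega>. (euler_pts a b \<sigma> \<zeta> y0 n k \<omega> - euler_pts a b \<sigma> \<zeta> y0 n j \<omega>) ^ (2 * p)) \<le> inc_const p * ((real k - real j) / n) ^ p"
    using Z_increment[OF jk p, of id] unfolding euler_pts_delayed inc_const_def by auto
qed

text \<open>Inside a cell the path is affine. With u = n (t - s) \<le> 1 the bound is a multiple of
  u^(2p) n^(-p) = (t - s)^p u^p, and the surplus factor u^p is at most 1.\<close>

lemma cell_increment:
  assumes n: "0 < n" and j: "j < n" and st: "real j / n \<le> s" "s \<le> t" "t \<le> real (Suc j) / n" and p: "1 \<le> p"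
  shows "integrable N (\<lambda>\<omega>. (Yn n t \<omega> - Yn n s \<omega>) ^ (2 * p))"
    "expectation (\<lambda>\<omega>. (Yn n t \<omega> - Yn n s \<omega>) ^ (2 * p)) \<le> inc_const p * (t - s) ^ p"
proof -
  let ?D = "\<lambda>\<omega>. euler_pts a b \<sigma> \<zeta> y0 n (Suc j) \<omega> - euler_pts a b \<sigma> \<zeta> y0 n j \<omega>"
  have t': "real j / n \<le> t" "s \<le> real (Suc j) / n" using st by auto
  have d: "Yn n t \<omega> - Yn n s \<omega> = n * (t - s) * ?D \<omega>" for \<omega>
    unfolding euler_proc_cell[OF n t'(1) st(3)] euler_proc_cell[OF n st(1) t'(2)] by (simp add: algebra_simps del: euler_pts.simps)
  note i = pts_increment[OF n _ _ p, of j "Suc j"]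
  show "integrable N (\<lambda>\<omega>. (Yn n t \<omega> - Yn n s \<omega>) ^ (2 * p))"
    unfolding d power_mult_distrib using i(1) j by auto
  have u: "0 \<le> n * (t - s)" "n * (t - s) \<le> 1"
  proof -
    show "0 \<le> n * (t - s)" using st by simp
    have "t - s \<le> real (Suc j) / n - real j / n" using st by linarith
    also have "\<dots> = 1 / n" by (simp add: diff_divide_distrib[symmetric])
    finally show "n * (t - s) \<le> 1" using n by (simp add: field_simps)
  qed
  have "expectation (\<lambda>\<omega>. (Yn n t \<omega> - Yn n s \<omega>) ^ (2 * p)) = (n * (t - s)) ^ (2 * p) * expectation (\<lambda>\<omega>. ?D \<omega> ^ (2 * p))"
    unfolding d power_mult_distrib using i(1) j by simp
  also have "\<dots> \<le> (n * (t - s)) ^ (2 * p) * (inc_const p * (1 / n) ^ p)"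
    using i(2) j u by (intro mult_left_mono) auto
  also have "\<dots> = inc_const p * (t - s) ^ p * (n * (t - s)) ^ p"
  proof -
    have "u ^ (2 * p) * v ^ p = (u * v) ^ p * u ^ p" for u v :: real
      by (simp add: power_mult_distrib mult_2 power_add)
    then have "(n * (t - s)) ^ (2 * p) * (1 / n) ^ p = ((n * (t - s)) * (1 / n)) ^ p * (n * (t - s)) ^ p" .
    also have "(n * (t - s)) * (1 / n) = t - s" using n by simp
    finally show ?thesis by (simp add: mult_ac)
  qed
  also have "\<dots> \<le> inc_const p * (t - s) ^ p * 1"
    using u st inc_const_nonneg[OF p] by (intro mult_left_mono power_le_one) auto
  finally show "expectation (\<lambda>\<omega>. (Yn n t \<omega> - Yn n s \<omega>) ^ (2 * p)) \<le> inc_const p * (t - s) ^ p" by simp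
qed

lemma Yn_grid: "0 < n \<Longrightarrow> Yn n (real k / n) \<omega> = euler_pts a b \<sigma> \<zeta> y0 n k \<omega>"
  using euler_proc_cell[of n k "real k / n"] by (simp add: divide_right_mono)

text \<open>If s and t lie in different cells, the interval splits into two end pieces inside cells
  and a middle piece between grid points; 4^(2p) is the price of splitting the power of a sum of
  three.\<close>

lemma Yn_increment:
  assumes n: "0 < n" and st: "0 \<le> s" "s \<le> t" "t \<le> 1" and p: "1 \<le> p"
  shows "integrable N (\<lambda>\<omega>. (Yn n t \<omega> - Yn n s \<omega>) ^ (2 * p))"
    "expectation (\<lambda>\<omega>. (Yn n t \<omega> - Yn n s \<omega>) ^ (2 * p)) \<le> 3 * 4 ^ (2 * p) * inc_const p * (t - s) ^ p"
proof -
  have I: "0 \<le> inc_const p" by (rule inc_const_nonneg[OF p])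
  have one: "inc_const p * x \<le> 3 * 4 ^ (2 * p) * inc_const p * x" if "0 \<le> x" for x
  proof -
    have "(1 :: real) \<le> 4 ^ (2 * p)" by (rule one_le_power) simp
    then have "(1 :: real) \<le> 3 * 4 ^ (2 * p)" by linarith
    then have "1 * (inc_const p * x) \<le> (3 * 4 ^ (2 * p)) * (inc_const p * x)"
      using I that by (intro mult_right_mono mult_nonneg_nonneg)
    then show ?thesis by (simp add: mult.assoc)
  qed
  obtain j where j: "j < n" "real j / n \<le> s" "s \<le> real (Suc j) / n" using unit_cell[OF n st(1)] st by auto
  obtain k where k: "k < n" "real k / n \<le> t" "t \<le> real (Suc k) / n" using unit_cell[OF n, of t] st by auto
  have "integrable N (\<lambda>\<omega>. (Yn n t \<omega> - Yn n s \<omega>) ^ (2 * p)) \<and>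
    expectation (\<lambda>\<omega>. (Yn n t \<omega> - Yn n s \<omega>) ^ (2 * p)) \<le> 3 * 4 ^ (2 * p) * inc_const p * (t - s) ^ p"
  proof (cases "k \<le> j")
    case True
    then have "real (Suc k) / n \<le> real (Suc j) / n" by (intro divide_right_mono) auto
    then have t': "t \<le> real (Suc j) / n" using k by linarith
    show ?thesis using cell_increment[OF n j(1,2) st(2) t' p] one[of "(t - s) ^ p"] st by auto
  next
    case False
    then have jk: "Suc j \<le> k" by simp
    let ?u = "real (Suc j) / n" and ?v = "real k / n"
    have uv: "?u \<le> ?v" using jk by (intro divide_right_mono) auto
    note A = cell_increment[OF n j(1,2,3) order.refl p] and C = cell_increment[OF n k(1) order.refl k(2,3) p]
    note B = pts_increment[OF n jk less_imp_le[OF k(1)] p]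
    define X where "X \<omega> = Yn n t \<omega> - Yn n ?v \<omega>" for \<omega>
    define Y' where "Y' \<omega> = Yn n ?v \<omega> - Yn n ?u \<omega>" for \<omega>
    define Z' where "Z' \<omega> = Yn n ?u \<omega> - Yn n s \<omega>" for \<omega>
    have e: "Yn n t \<omega> - Yn n s \<omega> = X \<omega> + Y' \<omega> + Z' \<omega>" for \<omega> by (simp add: X_def Y'_def Z'_def)
    have Y'e: "Y' \<omega> = euler_pts a b \<sigma> \<zeta> y0 n k \<omega> - euler_pts a b \<sigma> \<zeta> y0 n (Suc j) \<omega>" for \<omega>
      unfolding Y'_def Yn_grid[OF n] ..
    have le: "(t - ?v) ^ p \<le> (t - s) ^ p" "(?v - ?u) ^ p \<le> (t - s) ^ p" "(?u - s) ^ p \<le> (t - s) ^ p"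
      using j k uv by (auto intro!: power_mono)
    have iX: "integrable N (\<lambda>\<omega>. X \<omega> ^ (2 * p))" "expectation (\<lambda>\<omega>. X \<omega> ^ (2 * p)) \<le> inc_const p * (t - s) ^ p"
      using C order_trans[OF C(2) mult_left_mono[OF le(1) I]] by (simp_all add: X_def)
    have iZ: "integrable N (\<lambda>\<omega>. Z' \<omega> ^ (2 * p))" "expectation (\<lambda>\<omega>. Z' \<omega> ^ (2 * p)) \<le> inc_const p * (t - s) ^ p"
      using A order_trans[OF A(2) mult_left_mono[OF le(3) I]] unfolding Z'_def by blast+
    have "(real k - real (Suc j)) / n = ?v - ?u" by (simp add: diff_divide_distrib)
    then have iY: "integrable N (\<lambda>\<omega>. Y' \<omega> ^ (2 * p))" "expectation (\<lambda>\<omega>. Y' \<omega> ^ (2 * p)) \<le> inc_const p * (t - s) ^ p"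
      using B order_trans[OF B(2)] mult_left_mono[OF le(2) I] unfolding Y'e by auto
    define S where "S \<omega> = 4 ^ (2 * p) * (X \<omega> ^ (2 * p) + Y' \<omega> ^ (2 * p) + Z' \<omega> ^ (2 * p))" for \<omega>
    have b: "(Yn n t \<omega> - Yn n s \<omega>) ^ (2 * p) \<le> S \<omega>" for \<omega> unfolding e S_def by (rule power_add3_le)
    have iS: "integrable N S" unfolding S_def[abs_def] using iX iY iZ by auto
    have i: "integrable N (\<lambda>\<omega>. (Yn n t \<omega> - Yn n s \<omega>) ^ (2 * p))"
    proof (rule Bochner_Integration.integrable_bound[OF iS])
      have [measurable]: "Yn n t \<in> borel_measurable N" "Yn n s \<in> borel_measurable N"
        using st by (auto intro!: Yn_measurable[OF n])
      show "(\<lambda>\<omega>. (Yn n t \<omega> - Yn n s \<omega>) ^ (2 * p)) \<in> borel_measurable N" by measurable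
      show "AE \<omega> in N. norm ((Yn n t \<omega> - Yn n s \<omega>) ^ (2 * p)) \<le> norm (S \<omega>)"
      proof (rule AE_I2)
        fix \<omega>
        have "0 \<le> (Yn n t \<omega> - Yn n s \<omega>) ^ (2 * p)" by (simp add: zero_le_power_eq)
        then show "norm ((Yn n t \<omega> - Yn n s \<omega>) ^ (2 * p)) \<le> norm (S \<omega>)" using b[of \<omega>] by simp
      qed
    qed
    have "expectation (\<lambda>\<omega>. (Yn n t \<omega> - Yn n s \<omega>) ^ (2 * p)) \<le> expectation S" by (rule integral_mono[OF i iS b])
    also have "\<dots> = 4 ^ (2 * p) * (expectation (\<lambda>\<omega>. X \<omega> ^ (2 * p)) + expectation (\<lambda>\<omega>. Y' \<omega> ^ (2 * p)) + expectation (\<lambda>\<omega>. Z' \<omega> ^ (2 * p)))"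
      unfolding S_def[abs_def] using iX iY iZ by simp
    also have "\<dots> \<le> 4 ^ (2 * p) * (inc_const p * (t - s) ^ p + inc_const p * (t - s) ^ p + inc_const p * (t - s) ^ p)"
      using iX(2) iY(2) iZ(2) by (intro mult_left_mono add_mono) auto
    also have "\<dots> = 3 * 4 ^ (2 * p) * inc_const p * (t - s) ^ p" by simp
    finally show ?thesis using i by blast
  qed
  then show "integrable N (\<lambda>\<omega>. (Yn n t \<omega> - Yn n s \<omega>) ^ (2 * p))"
    "expectation (\<lambda>\<omega>. (Yn n t \<omega> - Yn n s \<omega>) ^ (2 * p)) \<le> 3 * 4 ^ (2 * p) * inc_const p * (t - s) ^ p" by auto
qed

end

context bm begin

lemma scaled_increment_law:
  assumes "j < m"
  shows "distr M borel (bm_noise m j) = std_normal_distribution"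
proof -
  have k: "0 \<le> real j / m" "real j / m < real (Suc j) / m" "real (Suc j) / m \<le> 1" using assms by (auto simp: field_simps)
  have e: "real (Suc j) / m - real j / m = 1 / m" by (simp add: diff_divide_distrib[symmetric])
  have "bm_noise m j = (\<lambda>\<omega>. (W (real (Suc j) / m) \<omega> - W (real j / m) \<omega>) / sqrt (real (Suc j) / m - real j / m))"
    unfolding bm_noise_def[abs_def] e by (simp add: real_sqrt_divide)
  then have "distributed M lborel (bm_noise m j) (\<lambda>x. ennreal (std_normal_density x))" using W_increment_dist[OF k] by simp
  then have "distr M lborel (bm_noise m j) = std_normal_distribution" by (rule distributed_distr_eq_density)
  moreover have "distr M lborel (bm_noise m j) = distr M borel (bm_noise m j)" by (rule distr_cong) auto
  ultimately show ?thesis by simp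
qed

lemma increments_indep:
  assumes m: "0 < m"
  shows "indep_vars (\<lambda>_. borel) (\<lambda>j \<omega>. bm_noise m j \<omega> / sqrt m) {..<m}"
proof -
  interpret noise M "\<lambda>k. Fm (real k / m)" "bm_noise m" normal_abs_moment m by (rule bm_noise[OF m])
  show ?thesis by (rule indep_vars_compose2[OF noise_indep_vars, where Y="\<lambda>_ x. x / sqrt m"]) measurable
qed

text \<open>Telescoping: Brownian block sums over l fine steps are the increments over length 1/m,
  whatever l is. Hence the coarse scheme on this side depends on m alone.\<close>

lemma bm_noise_block:
  assumes "0 < m" "0 < l"
  shows "(\<Sum>i\<in>{j * l..<j * l + l}. bm_noise (m * l) i \<omega>) / sqrt (m * l) = bm_noise m j \<omega> / sqrt m"
proof -
  have s: "0 < sqrt (real m * real l)" using assms by simp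
  have "(\<Sum>i\<in>{j * l..<j * l + l}. bm_noise (m * l) i \<omega>) / sqrt (m * l)
     = (\<Sum>i\<in>{j * l..<j * l + l}. W (real (Suc i) / (m * l)) \<omega> - W (real i / (m * l)) \<omega>)"
    unfolding bm_noise_def sum_distrib_right[symmetric] using s by simp
  also have "\<dots> = W (real (j * l + l) / (m * l)) \<omega> - W (real (j * l) / (m * l)) \<omega>"
    by (rule sum_Suc_diff'[of _ _ "\<lambda>i. W (real i / (m * l)) \<omega>"]) simp
  also have "real (j * l + l) / (m * l) = real (Suc j) / m"
  proof -
    have "j * l + l = Suc j * l" by simp
    then show ?thesis using assms by (simp only: of_nat_mult) simp
  qed
  also have "real (j * l) / (m * l) = real j / m" using assms by simp
  finally show ?thesis using assms by (simp add: bm_noise_def)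
qed

end

text \<open>The law of the coarse scheme with m normal increments is the link: the solution is
  compared with it on one space, the fine scheme with its iid counterpart on the other, and
  \<open>coarse_law_tendsto\<close> joins them. m is fixed before n goes to infinity.\<close>

theorem fdd_convergence:
  fixes M :: "'a measure" and N :: "'b measure"
  assumes E: "euler_scheme N \<zeta> \<sigma> a b Ca Cb" and S: "sde M F W a b Ca Cb y0 Y"
    and d: "0 < d" and g: "fd_test d g"
  shows "(\<lambda>n. \<integral>\<omega>. g (\<lambda>i. euler_proc a b \<sigma> \<zeta> y0 n \<omega> (real i / d)) \<partial>N)
    \<longlonglongrightarrow> (\<integral>\<omega>. g (\<lambda>i. Y (real i / d) \<omega>) \<partial>M)"
proof (rule LIMSEQ_I)
  fix \<epsilon> :: real assume \<epsilon>: "0 < \<epsilon>"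
  interpret E: euler_scheme N \<zeta> \<sigma> a b Ca Cb y0 by fact
  interpret S: sde M F W a b Ca Cb y0 Y by fact
  obtain B0 where B0: "\<And>v. \<bar>g v\<bar> \<le> B0" using g unfolding fd_test_def by blast
  define B where "B = \<bar>B0\<bar> + 1"
  have B: "0 < B" "\<bar>g v\<bar> \<le> B" for v unfolding B_def using B0[of v] by linarith+
  \<comment> \<open>The total error is 2e + e + 2e = 5 \<epsilon>/6.\<close>
  define e where "e = \<epsilon> / 6"
  have e: "0 < e" using \<epsilon> by (simp add: e_def)
  \<comment> \<open>The exceptional events in \<open>fd_test_close\<close> then cost exactly
    e.\<close>
  define \<eta> where "\<eta> = e / (4 * B * (real d + 1))"
  have \<eta>: "0 < \<eta>" "2 * B * (2 * (real d + 1) * \<eta>) = e"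
  proof -
    define D4 where "D4 = 4 * B * (real d + 1)"
    have D4: "0 < D4" using B(1) unfolding D4_def by (intro mult_pos_pos) auto
    have \<eta>D: "\<eta> = e / D4" by (simp add: \<eta>_def D4_def)
    show "0 < \<eta>" using e D4 by (simp add: \<eta>D)
    have "2 * B * (2 * (real d + 1) * \<eta>) = D4 * \<eta>" by (simp add: D4_def algebra_simps)
    also have "\<dots> = e" using D4 by (simp add: \<eta>D)
    finally show "2 * B * (2 * (real d + 1) * \<eta>) = e" .
  qed
  define C where "C = 3 * 4 ^ (2 * 1) * E.inc_const 1"
  have C: "0 \<le> C" using E.inc_const_nonneg[of 1] by (simp add: C_def)
  have inc: "integrable N (\<lambda>\<omega>. (E.Yn n t \<omega> - E.Yn n s \<omega>)\<^sup>2)" "E.expectation (\<lambda>\<omega>. (E.Yn n t \<omega> - E.Yn n s \<omega>)\<^sup>2) \<le> C * (t - s)"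
    if "0 < n" "0 \<le> s" "s \<le> t" "t \<le> 1" for n s t
    using E.Yn_increment[OF that, of 1] unfolding C_def by simp_all
  obtain R1 where R1: "1 \<le> R1" "1 - \<eta> < S.prob (S.bounded_until R1 1)" using S.bounded_until_prob[OF \<eta>(1)] by blast
  \<comment> \<open>R1 controls the solution; |y0| and sqrt (C/\<eta>) are added to control the
    scheme through Chebyshev's inequality.\<close>
  define R where "R = R1 + \<bar>y0\<bar> + sqrt (C / \<eta>)"
  have sC: "0 \<le> sqrt (C / \<eta>)" using C \<eta> by simp
  have R: "0 < R" "R1 \<le> R" unfolding R_def using R1(1) sC by linarith+
  have t01: "0 \<le> real i / d" "real i / d \<le> 1" if "i \<le> d" for i using that d by auto
  have YR: "S.prob {\<omega>\<in>space M. R < \<bar>Y (real i / d) \<omega>\<bar>} \<le> \<eta>" if i: "i \<le> d" for i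
  proof -
    have bm: "S.bounded_until R1 1 \<in> S.events" by (rule S.bounded_until_M) auto
    have "S.prob {\<omega>\<in>space M. R < \<bar>Y (real i / d) \<omega>\<bar>} \<le> S.prob (space M - S.bounded_until R1 1)"
    proof (rule S.finite_measure_mono)
      show "{\<omega>\<in>space M. R < \<bar>Y (real i / d) \<omega>\<bar>} \<subseteq> space M - S.bounded_until R1 1"
        using S.bounded_untilD[of _ R1 1 "real i / d"] t01[OF i] R by force
    qed (use bm in auto)
    also have "\<dots> = 1 - S.prob (S.bounded_until R1 1)" by (rule S.prob_compl[OF bm])
    finally show ?thesis using R1 by linarith
  qed
  have YnR: "E.prob {\<omega>\<in>space N. R < \<bar>E.Yn n (real i / d) \<omega>\<bar>} \<le> \<eta>" if i: "i \<le> d" and n: "0 < n" for i n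
  proof -
    let ?t = "real i / d"
    have y0: "E.Yn n 0 \<omega> = y0" for \<omega> using E.Yn_grid[OF n, of \<omega> 0] by simp
    have m: "E.Yn n ?t \<in> borel_measurable N" by (rule E.Yn_measurable[OF n t01[OF i]])
    have "C * (?t - 0) \<le> C" using t01[OF i] mult_left_mono[of ?t 1 C] C by simp
    then have i2: "integrable N (\<lambda>\<omega>. (E.Yn n ?t \<omega> - y0)\<^sup>2)" "E.expectation (\<lambda>\<omega>. (E.Yn n ?t \<omega> - y0)\<^sup>2) \<le> C"
      using inc[OF n order.refl t01[OF i]] unfolding y0 by auto
    let ?r = "R1 + sqrt (C / \<eta>)"
    have r: "0 < ?r" using R1 sC by linarith
    have "E.prob {\<omega>\<in>space N. R < \<bar>E.Yn n ?t \<omega>\<bar>} \<le> E.prob {\<omega>\<in>space N. ?r \<le> \<bar>E.Yn n ?t \<omega> - y0\<bar>}"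
    proof (rule E.finite_measure_mono)
      show "{\<omega>\<in>space N. R < \<bar>E.Yn n ?t \<omega>\<bar>} \<subseteq> {\<omega>\<in>space N. ?r \<le> \<bar>E.Yn n ?t \<omega> - y0\<bar>}" by (auto simp: R_def)
      show "{\<omega>\<in>space N. ?r \<le> \<bar>E.Yn n ?t \<omega> - y0\<bar>} \<in> E.events" using m by measurable
    qed
    also have "\<dots> \<le> C / ?r\<^sup>2"
      by (intro E.prob_le_second_moment i2 r borel_measurable_diff m borel_measurable_const)
    also have "\<dots> \<le> \<eta>"
    proof -
      have "C / \<eta> = (sqrt (C / \<eta>))\<^sup>2" using C \<eta> by simp
      also have "\<dots> \<le> ?r\<^sup>2" using sC R1 by (intro power_mono) auto
      finally have "C \<le> ?r\<^sup>2 * \<eta>" using \<eta> by (simp add: pos_divide_le_eq)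
      then show ?thesis using r by (simp add: pos_divide_le_eq mult.commute)
    qed
    finally show ?thesis .
  qed
  obtain \<delta> where \<delta>0: "0 < \<delta>" and \<delta>: "\<forall>v w. (\<forall>i\<le>d. \<bar>v i\<bar> \<le> R \<and> \<bar>v i - w i\<bar> < \<delta>) \<longrightarrow> \<bar>g v - g w\<bar> \<le> e"
    using fd_testD[OF g R(1) e] by (elim exE conjE)
  have co: "sde_coeffs a b Ca Cb" by unfold_locales
  have "0 < \<delta> / 2" "0 < \<eta> / 2" using \<delta>0 \<eta> by auto
  from fine_vs_coarse[OF co this, of E.noise_moment y0, where ?'a='b] obtain m0 where m0: "\<forall>m\<ge>m0. \<exists>n0. \<forall>(P :: 'b measure) G \<xi> n. noise P G \<xi> E.noise_moment n \<longrightarrow> n0 \<le> n \<longrightarrow>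
    (\<forall>k\<le>n. measure P {\<omega>\<in>space P. \<delta> / 2 \<le> \<bar>delayed_euler a b y0 n \<xi> id k \<omega> -
       delayed_euler a b y0 n \<xi> (\<lambda>k. (n div m) * (k div (n div m))) k \<omega>\<bar>} < \<eta> / 2)" by (elim exE)
  obtain m1 where m1: "\<forall>m\<ge>m1. \<exists>l>0. \<forall>k\<le>m * l. S.prob {\<omega>\<in>space M. \<delta> \<le> \<bar>Y (real k / (m * l)) \<omega> -
     delayed_euler a b y0 (m * l) (S.bm_noise (m * l)) (\<lambda>k. l * (k div l)) k \<omega>\<bar>} < \<eta>"
    using S.solution_vs_coarse[OF \<delta>0 \<eta>(1)] by (elim exE)
  define r where "r = m0 + m1 + 1"
  \<comment> \<open>A multiple of d: the time i/d is the coarse grid point with number i r.\<close>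
  define m where "m = d * r"
  have m: "0 < m" "m0 \<le> m" "m1 \<le> m"
  proof -
    have "1 * r \<le> d * r" using d by (intro mult_right_mono) auto
    then show "0 < m" "m0 \<le> m" "m1 \<le> m" by (auto simp: m_def r_def)
  qed
  have ir: "i * r \<le> m" if "i \<le> d" for i using that by (simp add: m_def)
  define X where "X j \<omega> = S.bm_noise m j \<omega> / sqrt m" for j \<omega>
  define G where "G v = g (\<lambda>i. v (i * r))" for v :: "nat \<Rightarrow> real"
  define L where "L = (\<integral>\<omega>. G (\<lambda>j. coarse_euler a b y0 (1 / m) (\<lambda>j. X j \<omega>) (min j m)) \<partial>M)"
  have lim: "(\<lambda>n. E.expectation (\<lambda>\<omega>. G (\<lambda>j. coarse_euler a b y0 (real (n div m) / n) (\<lambda>j. E.block (n div m) j \<omega> / sqrt n) (min j m)))) \<longlonglongrightarrow> L"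
    unfolding L_def
  proof (rule E.coarse_law_tendsto[OF co S.prob_space_axioms m(1)])
    show "S.indep_vars (\<lambda>_. borel) X {..<m}" unfolding X_def[abs_def] by (rule S.increments_indep[OF m(1)])
    show "distr M borel (\<lambda>\<omega>. X j \<omega> * sqrt m) = std_normal_distribution" if "j < m" for j
      using S.scaled_increment_law[OF that] m(1) by (simp add: X_def)
    show "G \<in> borel_measurable borel"
      unfolding G_def[abs_def] by (rule measurable_compose[OF _ fd_test_measurable[OF g]], rule measurable_coordinatewise_then_product) measurable
    show "\<bar>G v\<bar> \<le> B" for v using B(2) by (simp add: G_def)
    show "(\<lambda>n. G (u n)) \<longlonglongrightarrow> G v" if "\<And>i. (\<lambda>n. u n i) \<longlonglongrightarrow> v i" for u v
      unfolding G_def by (rule fd_test_tendsto[OF g]) (rule that)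
  qed
  have Mside: "\<bar>(\<integral>\<omega>. g (\<lambda>i. Y (real i / d) \<omega>) \<partial>M) - L\<bar> \<le> 2 * e"
  proof -
    obtain l where l: "0 < l" and cl: "\<forall>k\<le>m * l. S.prob {\<omega>\<in>space M. \<delta> \<le> \<bar>Y (real k / (m * l)) \<omega> -
       delayed_euler a b y0 (m * l) (S.bm_noise (m * l)) (\<lambda>k. l * (k div l)) k \<omega>\<bar>} < \<eta>"
      using m1[rule_format, OF m(3)] by (elim exE conjE)
    have n: "0 < m * l" using m l by simp
    interpret euler_setting M "\<lambda>k. S.Fm (real k / (m * l))" "S.bm_noise (m * l)" S.normal_abs_moment "m * l" a b Ca Cb y0
      using S.bm_noise[OF n] co by (simp add: euler_setting_def)
    define V where "V i \<omega> = coarse_euler a b y0 (1 / m) (\<lambda>j. X j \<omega>) (i * r)" for i \<omega>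
    have VZ: "V i \<omega> = Z (\<lambda>k. l * (k div l)) (i * r * l) \<omega>" for i \<omega>
    proof -
      have "Z (\<lambda>k. l * (k div l)) (i * r * l) \<omega> = coarse_euler a b y0 (real l / (m * l)) (\<lambda>j. (\<Sum>i\<in>{j * l..<j * l + l}. S.bm_noise (m * l) i \<omega>) / sqrt (m * l)) (i * r)"
        using delayed_euler_coarse[OF l, of a b y0 "m * l" "S.bm_noise (m * l)" "i * r" \<omega>] by simp
      also have "(\<lambda>j. (\<Sum>i\<in>{j * l..<j * l + l}. S.bm_noise (m * l) i \<omega>) / sqrt (m * l)) = (\<lambda>j. X j \<omega>)"
        using S.bm_noise_block[OF m(1) l] by (simp add: X_def)
      also have "real l / (m * l) = 1 / m" using l by simp
      finally show ?thesis by (simp add: V_def)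
    qed
    have k: "i * r * l \<le> m * l" if "i \<le> d" for i using ir[OF that] by (rule mult_right_mono) simp
    have tk: "real (i * r * l) / real (m * l) = real i / d" for i
    proof -
      have "0 < r" by (simp add: r_def)
      then show ?thesis using l by (simp add: m_def)
    qed
    have "\<bar>S.expectation (\<lambda>\<omega>. g (\<lambda>i. Y (real i / d) \<omega>)) - S.expectation (\<lambda>\<omega>. g (\<lambda>i. V i \<omega>))\<bar> \<le> e + 2 * B * (2 * (real d + 1) * \<eta>)"
    proof (rule S.fd_test_close[OF g B(2)])
      fix i assume i: "i \<le> d"
      show "Y (real i / d) \<in> borel_measurable M" by (rule S.Y_meas[OF t01[OF i]])
      show "V i \<in> borel_measurable M"
        unfolding VZ[abs_def] by (rule meas_P[OF k[OF i] Z_adapted[OF k[OF i]]])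
      show "S.prob {\<omega>\<in>space M. R < \<bar>Y (real i / d) \<omega>\<bar>} \<le> \<eta>" by (rule YR[OF i])
      show "S.prob {\<omega>\<in>space M. \<delta> \<le> \<bar>Y (real i / d) \<omega> - V i \<omega>\<bar>} \<le> \<eta>"
        using cl[rule_format, OF k[OF i]] unfolding tk VZ by simp
    next
      fix v w :: "nat \<Rightarrow> real" assume "\<And>i. i \<le> d \<Longrightarrow> \<bar>v i\<bar> \<le> R \<and> \<bar>v i - w i\<bar> < \<delta>"
      then show "\<bar>g v - g w\<bar> \<le> e" using \<delta> by blast
    qed (use e in simp)
    moreover have "L = S.expectation (\<lambda>\<omega>. g (\<lambda>i. V i \<omega>))"
      unfolding L_def G_def V_def
      by (intro Bochner_Integration.integral_cong refl fd_test_cong[OF g]) (simp add: ir min_def)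
    ultimately show ?thesis using \<eta>(2) by simp
  qed
  obtain n0 where n0: "\<forall>(P :: 'b measure) G \<xi> n. noise P G \<xi> E.noise_moment n \<longrightarrow> n0 \<le> n \<longrightarrow>
    (\<forall>k\<le>n. measure P {\<omega>\<in>space P. \<delta> / 2 \<le> \<bar>delayed_euler a b y0 n \<xi> id k \<omega> -
       delayed_euler a b y0 n \<xi> (\<lambda>k. (n div m) * (k div (n div m))) k \<omega>\<bar>} < \<eta> / 2)"
    using m0[rule_format, OF m(2)] by (elim exE)
  define D where "D = C * m / (\<delta> / 2)\<^sup>2"
  obtain n1 :: nat where n1: "D / (\<eta> / 2) < n1" using reals_Archimedean2 by blast
  have Nside: "\<bar>E.expectation (\<lambda>\<omega>. g (\<lambda>i. E.Yn n (real i / d) \<omega>))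
      - E.expectation (\<lambda>\<omega>. G (\<lambda>j. coarse_euler a b y0 (real (n div m) / n) (\<lambda>j. E.block (n div m) j \<omega> / sqrt n) (min j m)))\<bar> \<le> 2 * e"
    if nn: "n0 \<le> n" "n1 \<le> n" "m \<le> n" for n
  proof -
    have n: "0 < n" using nn m by simp
    define l where "l = n div m"
    have l: "0 < l" using nn m by (simp add: l_def div_greater_zero_iff)
    interpret euler_setting N E.past E.iid E.noise_moment n a b Ca Cb y0 by (rule E.euler_settingI[OF n])
    define V where "V i \<omega> = coarse_euler a b y0 (real l / n) (\<lambda>j. E.block l j \<omega> / sqrt n) (i * r)" for i \<omega>
    have VZ: "V i \<omega> = Z (\<lambda>k. l * (k div l)) (i * r * l) \<omega>" for i \<omega>
      unfolding delayed_euler_coarse[OF l] V_def E.block_def ..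
    have ml: "m * l \<le> n" by (simp add: l_def)
    have k: "i * r * l \<le> n" if "i \<le> d" for i
      using order_trans[OF mult_right_mono[OF ir[OF that], of l] ml] by simp
    have "\<bar>E.expectation (\<lambda>\<omega>. g (\<lambda>i. E.Yn n (real i / d) \<omega>)) - E.expectation (\<lambda>\<omega>. g (\<lambda>i. V i \<omega>))\<bar> \<le> e + 2 * B * (2 * (real d + 1) * \<eta>)"
    proof (rule E.fd_test_close[OF g B(2)])
      fix i assume i: "i \<le> d"
      let ?t = "real i / d" and ?s = "real (i * r * l) / n"
      show Ym: "E.Yn n ?t \<in> borel_measurable N" by (rule E.Yn_measurable[OF n t01[OF i]])
      show Vm: "V i \<in> borel_measurable N"
        unfolding VZ[abs_def] by (rule meas_P[OF k[OF i] Z_adapted[OF k[OF i]]])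
      show "E.prob {\<omega>\<in>space N. R < \<bar>E.Yn n ?t \<omega>\<bar>} \<le> \<eta>" by (rule YnR[OF i n])
      \<comment> \<open>n need not be a multiple of m, so block number i r ends at a time ?s
        slightly before i/d. The gap is at most m/n, and its effect vanishes with n by the increment
        bound.\<close>
      have st: "0 \<le> ?s" "?s \<le> ?t" "?t - ?s \<le> m / n"
      proof -
        show "0 \<le> ?s" by simp
        have ts: "?t - ?s = ?t * ((real n - real m * real l) / n)"
          using d n by (simp add: m_def field_simps)
        have mln: "real m * real l \<le> n" using ml by (metis of_nat_le_iff of_nat_mult)
        then have "0 \<le> ?t - ?s" unfolding ts using t01[OF i] by (intro mult_nonneg_nonneg) auto
        then show "?s \<le> ?t" by simp
        have "n \<le> m * l + m" unfolding l_def using m(1) by (metis add_left_mono less_imp_le mod_less_divisor mult_div_mod_eq)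
        then have "real n \<le> real m * real l + real m" by (metis of_nat_add of_nat_le_iff of_nat_mult)
        then have "?t * ((real n - real m * real l) / n) \<le> 1 * (real m / n)"
          using t01[OF i] mln by (intro mult_mono divide_right_mono) auto
        then show "?t - ?s \<le> m / n" unfolding ts by simp
      qed
      have s1: "?s \<le> 1" using st(2) t01[OF i] by linarith
      have Sm: "E.Yn n ?s \<in> borel_measurable N" by (rule E.Yn_measurable[OF n st(1) s1])
      have ev: "{\<omega>\<in>space N. c \<le> \<bar>f \<omega> - h \<omega>\<bar>} \<in> E.events"
        if "f \<in> borel_measurable N" "h \<in> borel_measurable N" for c and f h :: "'b \<Rightarrow> real"
        using that by measurable
      have i2: "E.expectation (\<lambda>\<omega>. (E.Yn n ?t \<omega> - E.Yn n ?s \<omega>)\<^sup>2) \<le> C * (m / n)"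
        using inc(2)[OF n st(1,2) t01(2)[OF i]] mult_left_mono[OF st(3) C] by linarith
      have "E.prob {\<omega>\<in>space N. \<delta> / 2 \<le> \<bar>E.Yn n ?t \<omega> - E.Yn n ?s \<omega>\<bar>} \<le> C * (m / n) / (\<delta> / 2)\<^sup>2"
        using \<delta>0 by (intro E.prob_le_second_moment inc(1)[OF n st(1,2) t01(2)[OF i]] i2 borel_measurable_diff Ym Sm) simp
      also have "\<dots> = D / n" by (simp add: D_def)
      also have "\<dots> \<le> \<eta> / 2"
      proof -
        have "D / (\<eta> / 2) < n" using n1 nn by linarith
        then have "D < n * (\<eta> / 2)" using \<eta> pos_divide_less_eq[of "\<eta> / 2" D n] by simp
        then show ?thesis using n by (simp add: pos_divide_le_eq mult.commute)
      qed
      finally have p1: "E.prob {\<omega>\<in>space N. \<delta> / 2 \<le> \<bar>E.Yn n ?t \<omega> - E.Yn n ?s \<omega>\<bar>} \<le> \<eta> / 2" .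
      have gr: "E.Yn n ?s \<omega> = Z id (i * r * l) \<omega>" for \<omega>
        unfolding E.Yn_grid[OF n] E.euler_pts_delayed ..
      have p2: "E.prob {\<omega>\<in>space N. \<delta> / 2 \<le> \<bar>E.Yn n ?s \<omega> - V i \<omega>\<bar>} < \<eta> / 2"
        using n0[rule_format, OF E.iid_noise[OF n] nn(1) k[OF i]] unfolding gr VZ unfolding l_def .
      have "E.prob {\<omega>\<in>space N. \<delta> \<le> \<bar>E.Yn n ?t \<omega> - V i \<omega>\<bar>}
        \<le> E.prob ({\<omega>\<in>space N. \<delta> / 2 \<le> \<bar>E.Yn n ?t \<omega> - E.Yn n ?s \<omega>\<bar>} \<union> {\<omega>\<in>space N. \<delta> / 2 \<le> \<bar>E.Yn n ?s \<omega> - V i \<omega>\<bar>})"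
      proof (rule E.finite_measure_mono)
        show "{\<omega>\<in>space N. \<delta> / 2 \<le> \<bar>E.Yn n ?t \<omega> - E.Yn n ?s \<omega>\<bar>} \<union> {\<omega>\<in>space N. \<delta> / 2 \<le> \<bar>E.Yn n ?s \<omega> - V i \<omega>\<bar>} \<in> E.events"
          by (intro sets.Un ev Ym Sm Vm)
        show "{\<omega>\<in>space N. \<delta> \<le> \<bar>E.Yn n ?t \<omega> - V i \<omega>\<bar>} \<subseteq> {\<omega>\<in>space N. \<delta> / 2 \<le> \<bar>E.Yn n ?t \<omega> - E.Yn n ?s \<omega>\<bar>} \<union> {\<omega>\<in>space N. \<delta> / 2 \<le> \<bar>E.Yn n ?s \<omega> - V i \<omega>\<bar>}"
        proof
          fix \<omega> assume "\<omega> \<in> {\<omega>\<in>space N. \<delta> \<le> \<bar>E.Yn n ?t \<omega> - V i \<omega>\<bar>}"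
          then have "\<omega> \<in> space N" "\<delta> / 2 \<le> \<bar>E.Yn n ?t \<omega> - E.Yn n ?s \<omega>\<bar> \<or> \<delta> / 2 \<le> \<bar>E.Yn n ?s \<omega> - V i \<omega>\<bar>" by (simp, smt (verit) mem_Collect_eq field_sum_of_halves)
          then show "\<omega> \<in> {\<omega>\<in>space N. \<delta> / 2 \<le> \<bar>E.Yn n ?t \<omega> - E.Yn n ?s \<omega>\<bar>} \<union> {\<omega>\<in>space N. \<delta> / 2 \<le> \<bar>E.Yn n ?s \<omega> - V i \<omega>\<bar>}" by blast
        qed
      qed
      also have "\<dots> \<le> E.prob {\<omega>\<in>space N. \<delta> / 2 \<le> \<bar>E.Yn n ?t \<omega> - E.Yn n ?s \<omega>\<bar>} + E.prob {\<omega>\<in>space N. \<delta> / 2 \<le> \<bar>E.Yn n ?s \<omega> - V i \<omega>\<bar>}"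
        by (intro measure_Un_le ev Ym Sm Vm)
      finally show "E.prob {\<omega>\<in>space N. \<delta> \<le> \<bar>E.Yn n ?t \<omega> - V i \<omega>\<bar>} \<le> \<eta>" using p1 p2 by linarith
    next
      fix v w :: "nat \<Rightarrow> real" assume "\<And>i. i \<le> d \<Longrightarrow> \<bar>v i\<bar> \<le> R \<and> \<bar>v i - w i\<bar> < \<delta>"
      then show "\<bar>g v - g w\<bar> \<le> e" using \<delta> by blast
    qed (use e in simp)
    moreover have "E.expectation (\<lambda>\<omega>. G (\<lambda>j. coarse_euler a b y0 (real (n div m) / n) (\<lambda>j. E.block (n div m) j \<omega> / sqrt n) (min j m)))
       = E.expectation (\<lambda>\<omega>. g (\<lambda>i. V i \<omega>))"
      unfolding G_def V_def l_def
      by (intro Bochner_Integration.integral_cong refl fd_test_cong[OF g]) (simp add: ir min_def)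
    ultimately show ?thesis using \<eta>(2) by simp
  qed
  obtain n2 where n2: "\<And>n. n2 \<le> n \<Longrightarrow> norm (E.expectation (\<lambda>\<omega>. G (\<lambda>j. coarse_euler a b y0 (real (n div m) / n) (\<lambda>j. E.block (n div m) j \<omega> / sqrt n) (min j m))) - L) < e"
    using LIMSEQ_D[OF lim e] by auto
  show "\<exists>no. \<forall>n\<ge>no. norm (E.expectation (\<lambda>\<omega>. g (\<lambda>i. E.Yn n (real i / d) \<omega>)) - (\<integral>\<omega>. g (\<lambda>i. Y (real i / d) \<omega>) \<partial>M)) < \<epsilon>"
  proof (intro exI[of _ "n0 + n1 + m + n2"] allI impI)
    fix n assume n: "n0 + n1 + m + n2 \<le> n"
    have "norm (E.expectation (\<lambda>\<omega>. g (\<lambda>i. E.Yn n (real i / d) \<omega>)) - (\<integral>\<omega>. g (\<lambda>i. Y (real i / d) \<omega>) \<partial>M)) \<le> 2 * e + e + 2 * e"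
    proof -
      have c: "n0 \<le> n" "n1 \<le> n" "m \<le> n" "n2 \<le> n" using n by auto
      show ?thesis using Nside[OF c(1-3)] n2[OF c(4)] Mside unfolding real_norm_def by linarith
    qed
    also have "\<dots> < \<epsilon>" using \<epsilon> by (simp add: e_def)
    finally show "norm (E.expectation (\<lambda>\<omega>. g (\<lambda>i. E.Yn n (real i / d) \<omega>)) - (\<integral>\<omega>. g (\<lambda>i. Y (real i / d) \<omega>) \<partial>M)) < \<epsilon>" .
  qed
qed

section \<open>Tail bounds for increments of the schemes and of the solution\<close>

lemma fd_test_truncated_power:
  assumes "i \<le> d" "j \<le> d" "0 \<le> c"
  shows "fd_test d (\<lambda>v. min ((v j - v i) ^ (2 * p)) c)"
  unfolding fd_test_def
proof (intro conjI allI impI)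
  show "\<exists>B. \<forall>v. \<bar>min ((v j - v i) ^ (2 * p)) c\<bar> \<le> B"
    using assms(3) by (intro exI[of _ c]) (auto simp: min_def abs_le_iff zero_le_power_eq)
  fix R \<epsilon> :: real assume R: "0 < R" and \<epsilon>: "0 < \<epsilon>"
  have "uniformly_continuous_on {- (2 * R + 2)..2 * R + 2} (\<lambda>x :: real. x ^ (2 * p))"
    by (intro compact_uniformly_continuous continuous_intros) auto
  then obtain \<delta>' where \<delta>': "0 < \<delta>'" "\<And>x y :: real. x \<in> {- (2 * R + 2)..2 * R + 2} \<Longrightarrow> y \<in> {- (2 * R + 2)..2 * R + 2} \<Longrightarrow> dist y x < \<delta>' \<Longrightarrow> dist (y ^ (2 * p)) (x ^ (2 * p)) < \<epsilon>"
    using \<epsilon> unfolding uniformly_continuous_on_def by blast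
  show "\<exists>\<delta>>0. \<forall>v w. (\<forall>i\<le>d. \<bar>v i\<bar> \<le> R \<and> \<bar>v i - w i\<bar> < \<delta>) \<longrightarrow> \<bar>min ((v j - v i) ^ (2 * p)) c - min ((w j - w i) ^ (2 * p)) c\<bar> \<le> \<epsilon>"
  proof (intro exI[of _ "min 1 (\<delta>' / 2)"] conjI allI impI)
    fix v w :: "nat \<Rightarrow> real" assume h: "\<forall>i\<le>d. \<bar>v i\<bar> \<le> R \<and> \<bar>v i - w i\<bar> < min 1 (\<delta>' / 2)"
    have b: "\<bar>v i\<bar> \<le> R" "\<bar>v i - w i\<bar> < 1" "\<bar>v i - w i\<bar> < \<delta>' / 2" "\<bar>v j\<bar> \<le> R" "\<bar>v j - w j\<bar> < 1" "\<bar>v j - w j\<bar> < \<delta>' / 2"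
      using h assms by auto
    have "dist ((v j - v i) ^ (2 * p)) ((w j - w i) ^ (2 * p)) < \<epsilon>"
    proof (rule \<delta>'(2))
      show "w j - w i \<in> {- (2 * R + 2)..2 * R + 2}" "v j - v i \<in> {- (2 * R + 2)..2 * R + 2}"
        unfolding atLeastAtMost_iff using b by (intro conjI; linarith)+
      show "dist (v j - v i) (w j - w i) < \<delta>'" unfolding dist_real_def using b by linarith
    qed
    then show "\<bar>min ((v j - v i) ^ (2 * p)) c - min ((w j - w i) ^ (2 * p)) c\<bar> \<le> \<epsilon>"
      by (auto simp: dist_real_def min_def abs_le_iff abs_less_iff)
  qed (use \<delta>'(1) in auto)
qed

lemma (in euler_scheme) Yn_tail:
  assumes n: "0 < n" and st: "0 \<le> s" "s \<le> t" "t \<le> 1" and p: "1 \<le> p" and r: "0 < r"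
  shows "prob {\<omega>\<in>space N. r \<le> \<bar>Yn n t \<omega> - Yn n s \<omega>\<bar>} \<le> 3 * 4 ^ (2 * p) * inc_const p * (t - s) ^ p / r ^ (2 * p)"
proof -
  note i = Yn_increment[OF n st p]
  have [measurable]: "Yn n t \<in> borel_measurable N" "Yn n s \<in> borel_measurable N" using st by (auto intro!: Yn_measurable[OF n])
  have "prob {\<omega>\<in>space N. r \<le> \<bar>Yn n t \<omega> - Yn n s \<omega>\<bar>} \<le> prob {\<omega>\<in>space N. r ^ (2 * p) \<le> (Yn n t \<omega> - Yn n s \<omega>) ^ (2 * p)}"
  proof (rule finite_measure_mono)
    show "{\<omega>\<in>space N. r \<le> \<bar>Yn n t \<omega> - Yn n s \<omega>\<bar>} \<subseteq> {\<omega>\<in>space N. r ^ (2 * p) \<le> (Yn n t \<omega> - Yn n s \<omega>) ^ (2 * p)}"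
    proof
      fix \<omega> assume \<omega>: "\<omega> \<in> {\<omega>\<in>space N. r \<le> \<bar>Yn n t \<omega> - Yn n s \<omega>\<bar>}"
      then have "r ^ (2 * p) \<le> \<bar>Yn n t \<omega> - Yn n s \<omega>\<bar> ^ (2 * p)" using r by (intro power_mono) auto
      then show "\<omega> \<in> {\<omega>\<in>space N. r ^ (2 * p) \<le> (Yn n t \<omega> - Yn n s \<omega>) ^ (2 * p)}" using \<omega> by (simp add: power_even_abs)
    qed
  qed measurable
  also have "\<dots> \<le> expectation (\<lambda>\<omega>. (Yn n t \<omega> - Yn n s \<omega>) ^ (2 * p)) / r ^ (2 * p)"
    by (rule integral_Markov_inequality_measure[OF i(1), of "{}"]) (use r in \<open>auto simp: zero_le_power_eq\<close>)
  also have "\<dots> \<le> 3 * 4 ^ (2 * p) * inc_const p * (t - s) ^ p / r ^ (2 * p)"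
    using i(2) r by (intro divide_right_mono) auto
  finally show ?thesis .
qed

text \<open>Even powers truncated at c = r^(2p) are admissible test functions; their expectations
  under the schemes obey a bound uniform in n, which survives the limit. Markov's inequality at
  level c is not weakened by the truncation.\<close>

lemma solution_tail:
  fixes M :: "'a measure" and N :: "'b measure"
  assumes E: "euler_scheme N \<zeta> \<sigma> a b Ca Cb" and S: "sde M F W a b Ca Cb y0 Y"
    and d: "0 < d" and ij: "i \<le> j" "j \<le> d" and p: "1 \<le> p" and r: "0 < r"
  shows "measure M {\<omega>\<in>space M. r \<le> \<bar>Y (real j / d) \<omega> - Y (real i / d) \<omega>\<bar>}
     \<le> 3 * 4 ^ (2 * p) * euler_scheme.inc_const N \<zeta> \<sigma> a b Ca Cb y0 p * (real j / d - real i / d) ^ p / r ^ (2 * p)"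
proof -
  interpret E: euler_scheme N \<zeta> \<sigma> a b Ca Cb y0 by fact
  interpret S: sde M F W a b Ca Cb y0 Y by fact
  define c where "c = r ^ (2 * p)"
  have c: "0 < c" using r by (simp add: c_def)
  define g :: "(nat \<Rightarrow> real) \<Rightarrow> real" where "g v = min ((v j - v i) ^ (2 * p)) c" for v
  define T where "T = 3 * 4 ^ (2 * p) * E.inc_const p * (real j / d - real i / d) ^ p"
  have g: "fd_test d g" unfolding g_def[abs_def] using ij c by (intro fd_test_truncated_power) auto
  have st: "0 \<le> real i / d" "real i / d \<le> real j / d" "real j / d \<le> 1" using ij d by (auto intro: divide_right_mono)
  have "(\<integral>\<omega>. g (\<lambda>i. Y (real i / d) \<omega>) \<partial>M) \<le> T"
  proof (rule LIMSEQ_le_const2[OF fdd_convergence[OF E S d g]], intro exI[of _ 1] allI impI)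
    fix n :: nat assume "1 \<le> n"
    then have n: "0 < n" by simp
    note inc = E.Yn_increment[OF n st p]
    have "E.expectation (\<lambda>\<omega>. g (\<lambda>i. E.Yn n (real i / d) \<omega>)) \<le> E.expectation (\<lambda>\<omega>. (E.Yn n (real j / d) \<omega> - E.Yn n (real i / d) \<omega>) ^ (2 * p))"
    proof (rule integral_mono)
      show "integrable N (\<lambda>\<omega>. g (\<lambda>i. E.Yn n (real i / d) \<omega>))"
      proof (rule E.integrable_const_bound[of _ c])
        show "AE \<omega> in N. norm (g (\<lambda>i. E.Yn n (real i / d) \<omega>)) \<le> c"
          using c by (intro AE_I2) (auto simp: g_def min_def abs_le_iff zero_le_power_eq)
        show "(\<lambda>\<omega>. g (\<lambda>i. E.Yn n (real i / d) \<omega>)) \<in> borel_measurable N"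
          using d by (intro fd_test_comp_measurable[OF g] E.Yn_measurable[OF n]) auto
      qed
    qed (use inc in \<open>auto simp: g_def\<close>)
    also have "\<dots> \<le> T" using inc(2) by (simp add: T_def)
    finally show "E.expectation (\<lambda>\<omega>. g (\<lambda>i. E.Yn n (real i / d) \<omega>)) \<le> T" .
  qed
  moreover have "S.prob {\<omega>\<in>space M. r \<le> \<bar>Y (real j / d) \<omega> - Y (real i / d) \<omega>\<bar>} \<le> (\<integral>\<omega>. g (\<lambda>i. Y (real i / d) \<omega>) \<partial>M) / c"
  proof -
    have Ym: "Y (real k / d) \<in> borel_measurable M" if "k \<le> d" for k using that d by (intro S.Y_meas) auto
    have gm: "(\<lambda>\<omega>. g (\<lambda>i. Y (real i / d) \<omega>)) \<in> borel_measurable M" by (rule fd_test_comp_measurable[OF g Ym])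
    have gi: "integrable M (\<lambda>\<omega>. g (\<lambda>i. Y (real i / d) \<omega>))"
      by (rule S.integrable_const_bound[of _ c]) (use c gm in \<open>auto simp: g_def min_def abs_le_iff zero_le_power_eq\<close>)
    have "S.prob {\<omega>\<in>space M. r \<le> \<bar>Y (real j / d) \<omega> - Y (real i / d) \<omega>\<bar>} \<le> S.prob {\<omega>\<in>space M. c \<le> g (\<lambda>i. Y (real i / d) \<omega>)}"
    proof (rule S.finite_measure_mono)
      show "{\<omega>\<in>space M. r \<le> \<bar>Y (real j / d) \<omega> - Y (real i / d) \<omega>\<bar>} \<subseteq> {\<omega>\<in>space M. c \<le> g (\<lambda>i. Y (real i / d) \<omega>)}"
      proof
        fix \<omega> assume \<omega>: "\<omega> \<in> {\<omega>\<in>space M. r \<le> \<bar>Y (real j / d) \<omega> - Y (real i / d) \<omega>\<bar>}"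
        then have "r ^ (2 * p) \<le> \<bar>Y (real j / d) \<omega> - Y (real i / d) \<omega>\<bar> ^ (2 * p)" using r by (intro power_mono) auto
        then show "\<omega> \<in> {\<omega>\<in>space M. c \<le> g (\<lambda>i. Y (real i / d) \<omega>)}" using \<omega> by (simp add: power_even_abs g_def c_def)
      qed
      show "{\<omega>\<in>space M. c \<le> g (\<lambda>i. Y (real i / d) \<omega>)} \<in> S.events" using gm by measurable
    qed
    also have "\<dots> \<le> (\<integral>\<omega>. g (\<lambda>i. Y (real i / d) \<omega>) \<partial>M) / c"
      by (rule integral_Markov_inequality_measure[OF gi, of "{}"]) (use c in \<open>auto simp: g_def zero_le_power_eq\<close>)
    finally show ?thesis .
  qed
  ultimately show ?thesis using c unfolding T_def c_def by (meson divide_right_mono less_imp_le order_trans)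
qed

section \<open>Hoelder paths and their interpolation\<close>

text \<open>Bounds the seminorm only; where the size of a path matters, its value at 0 is controlled
  separately.\<close>

definition hoelder_ball :: "real \<Rightarrow> real \<Rightarrow> (real \<Rightarrow> real) set" where
  "hoelder_ball \<beta> H = {f. \<forall>s\<in>{0..1}. \<forall>t\<in>{0..1}. \<bar>f t - f s\<bar> \<le> H * \<bar>t - s\<bar> powr \<beta>}"

lemma hoelder_ballD: "f \<in> hoelder_ball \<beta> H \<Longrightarrow> 0 \<le> s \<Longrightarrow> s \<le> 1 \<Longrightarrow> 0 \<le> t \<Longrightarrow> t \<le> 1 \<Longrightarrow> \<bar>f t - f s\<bar> \<le> H * \<bar>t - s\<bar> powr \<beta>"
  by (auto simp: hoelder_ball_def)

lemma hoelder_ball_mono: "H \<le> H' \<Longrightarrow> f \<in> hoelder_ball \<beta> H \<Longrightarrow> f \<in> hoelder_ball \<beta> H'"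
  unfolding hoelder_ball_def
proof (intro CollectI ballI)
  fix s t :: real
  assume a: "H \<le> H'" "f \<in> {f. \<forall>s\<in>{0..1}. \<forall>t\<in>{0..1}. \<bar>f t - f s\<bar> \<le> H * \<bar>t - s\<bar> powr \<beta>}" "s \<in> {0..1}" "t \<in> {0..1}"
  then have "\<bar>f t - f s\<bar> \<le> H * \<bar>t - s\<bar> powr \<beta>" by blast
  also have "\<dots> \<le> H' * \<bar>t - s\<bar> powr \<beta>" using a(1) by (rule mult_right_mono) simp
  finally show "\<bar>f t - f s\<bar> \<le> H' * \<bar>t - s\<bar> powr \<beta>" .
qed

text \<open>Passing to the next level either keeps the dyadic floor or moves it by one cell of the
  new level.\<close>

lemma dyadic_floor_step:
  fixes f :: "real \<Rightarrow> real"
  assumes f: "\<And>m i. i < 2 ^ m \<Longrightarrow> \<bar>f (real (Suc i) / 2 ^ m) - f (real i / 2 ^ m)\<bar> \<le> R * q ^ m"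
    and R: "0 \<le> R" and q: "0 < q" and t: "0 \<le> t" "t \<le> 1"
  shows "\<bar>f (dyadic_floor (Suc m) t) - f (dyadic_floor m t)\<bar> \<le> R * q ^ Suc m"
proof -
  define i where "i = nat \<lfloor>2 ^ m * t\<rfloor>"
  define k where "k = nat \<lfloor>2 ^ Suc m * t\<rfloor>"
  have i: "real i = of_int \<lfloor>2 ^ m * t\<rfloor>" and k: "real k = of_int \<lfloor>2 ^ Suc m * t\<rfloor>" using t by (auto simp: i_def k_def)
  have i': "real i \<le> 2 ^ m * t" "2 ^ m * t < real i + 1" unfolding i by linarith+
  have k': "real k \<le> 2 ^ Suc m * t" "2 ^ Suc m * t < real k + 1" unfolding k by linarith+
  have "real (2 * i) < real k + 1" "real k < real (2 * i + 2)" using i' k' by simp_all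
  then have "2 * i < k + 1" "k < 2 * i + 2" by linarith+
  then consider "k = 2 * i" | "k = Suc (2 * i)" by linarith
  moreover have fl: "dyadic_floor m t = real i / 2 ^ m" "dyadic_floor (Suc m) t = real k / 2 ^ Suc m"
    by (simp_all only: dyadic_floor_def i_def k_def)
  ultimately show ?thesis
  proof cases
    case 1
    then have "dyadic_floor (Suc m) t = dyadic_floor m t" by (simp add: fl)
    then show ?thesis using R q by simp
  next
    case 2
    have "real k \<le> 2 ^ Suc m * 1" by (rule order_trans[OF k'(1)], rule mult_left_mono[OF t(2)]) simp
    then have "k \<le> 2 ^ Suc m" by (metis mult_1_right of_nat_le_iff of_nat_numeral of_nat_power)
    then have "2 * i < 2 ^ Suc m" using 2 by simp
    moreover have "dyadic_floor m t = real (2 * i) / 2 ^ Suc m" by (simp add: fl)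
    moreover have "dyadic_floor (Suc m) t = real (Suc (2 * i)) / 2 ^ Suc m" unfolding fl 2 ..
    ultimately show ?thesis using f[of "2 * i" "Suc m"] by simp
  qed
qed

text \<open>The steps of the chain of floors from level m down to t form a geometric series, whose
  partial sums are kept in closed form; continuity reaches t itself.\<close>

lemma dyadic_chain:
  fixes f :: "real \<Rightarrow> real"
  assumes f: "\<And>m i. i < 2 ^ m \<Longrightarrow> \<bar>f (real (Suc i) / 2 ^ m) - f (real i / 2 ^ m)\<bar> \<le> R * q ^ m"
    and c: "continuous_on {0..1} f" and R: "0 \<le> R" and q: "0 < q" "q < 1" and t: "0 \<le> t" "t \<le> 1"
  shows "\<bar>f t - f (dyadic_floor m t)\<bar> \<le> R * q ^ m * (1 / (1 - q))"
proof -
  have *: "\<bar>f (dyadic_floor (m + j) t) - f (dyadic_floor m t)\<bar> \<le> R * q ^ Suc m * ((1 - q ^ j) / (1 - q))" for j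
  proof (induction j)
    case (Suc j)
    have st: "\<bar>f (dyadic_floor (Suc (m + j)) t) - f (dyadic_floor (m + j) t)\<bar> \<le> R * q ^ Suc (m + j)"
      by (rule dyadic_floor_step[OF f R q(1) t])
    have "\<bar>f (dyadic_floor (m + Suc j) t) - f (dyadic_floor m t)\<bar> \<le> R * q ^ Suc (m + j) + R * q ^ Suc m * ((1 - q ^ j) / (1 - q))"
      using Suc st unfolding add_Suc_right by linarith
    also have "R * q ^ Suc (m + j) = R * q ^ Suc m * ((1 - q) * q ^ j / (1 - q))" using q by (simp add: power_add)
    also have "R * q ^ Suc m * ((1 - q) * q ^ j / (1 - q)) + R * q ^ Suc m * ((1 - q ^ j) / (1 - q)) = R * q ^ Suc m * (((1 - q) * q ^ j + (1 - q ^ j)) / (1 - q))"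
      by (simp only: distrib_left add_divide_distrib)
    also have "(1 - q) * q ^ j + (1 - q ^ j) = 1 - q ^ Suc j" by (simp add: algebra_simps)
    finally show ?case .
  qed simp
  have b: "\<bar>f (dyadic_floor (m + j) t) - f (dyadic_floor m t)\<bar> \<le> R * q ^ m * (1 / (1 - q))" for j
  proof -
    have "R * q ^ Suc m * ((1 - q ^ j) / (1 - q)) \<le> R * q ^ m * (1 / (1 - q))"
    proof (intro mult_mono divide_right_mono)
      show "q ^ Suc m \<le> q ^ m" using q by (intro power_decreasing) auto
    qed (use q R in \<open>auto simp: power_le_one\<close>)
    then show ?thesis using *[of j] by linarith
  qed
  have "(\<lambda>j. f (dyadic_floor (m + j) t)) \<longlonglongrightarrow> f t"
    using LIMSEQ_ignore_initial_segment[OF dyadic_floor_image_tendsto[OF c t], of m] by (simp add: add.commute)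
  then have "(\<lambda>j. \<bar>f (dyadic_floor (m + j) t) - f (dyadic_floor m t)\<bar>) \<longlonglongrightarrow> \<bar>f t - f (dyadic_floor m t)\<bar>"
    by (intro tendsto_intros)
  then show ?thesis by (rule LIMSEQ_le_const2) (use b in blast)
qed

text \<open>With q = 2^(-\<beta>), the 1 stands for the step between the two floors and 2/(1 - q)
  for the two chains; the outer 2 comes from q^m \<le> 2 (t - s)^\<beta>.\<close>

definition "chain_const \<beta> = 2 * (1 + 2 / (1 - 2 powr (- \<beta>)))"

text \<open>At the level m with 2^(-m-1) < t - s \<le> 2^(-m) the floors of s and t coincide or are
  neighbours, and a chain connects each floor with its point.\<close>

lemma chaining:
  assumes f: "\<And>m i. i < 2 ^ m \<Longrightarrow> \<bar>f (real (Suc i) / 2 ^ m) - f (real i / 2 ^ m)\<bar> \<le> R * (2 powr (- \<beta>)) ^ m"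
    and c: "continuous_on {0..1} f" and R: "0 \<le> R" and \<beta>: "0 < \<beta>" "\<beta> \<le> 1"
  shows "f \<in> hoelder_ball \<beta> (chain_const \<beta> * R)"
proof -
  define q where "q = 2 powr (- \<beta>)"
  have q: "0 < q" "q < 1" using \<beta> by (auto simp: q_def powr_less_one)
  have ordered: "\<bar>f t - f s\<bar> \<le> chain_const \<beta> * R * (t - s) powr \<beta>" if st: "0 \<le> s" "s < t" "t \<le> 1" for s t
  proof -
    have "\<exists>m. (1 / 2 :: real) ^ Suc m < t - s"
    proof -
      obtain m where "(1 / 2 :: real) ^ m < t - s" using real_arch_pow_inv[of "t - s" "1 / 2"] st by auto
      moreover have "(1 / 2 :: real) ^ Suc m \<le> (1 / 2) ^ m" by (intro power_decreasing) auto
      ultimately show ?thesis by (intro exI[of _ m]) linarith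
    qed
    define m where "m = (LEAST m. (1 / 2 :: real) ^ Suc m < t - s)"
    have m1: "(1 / 2 :: real) ^ Suc m < t - s" unfolding m_def by (rule LeastI_ex) fact
    have m2: "t - s \<le> (1 / 2) ^ m"
    proof (cases m)
      case 0
      then show ?thesis using st by simp
    next
      case (Suc k)
      then have "\<not> (1 / 2 :: real) ^ Suc k < t - s" unfolding m_def using not_less_Least[of k] by (metis lessI)
      then show ?thesis using Suc by simp
    qed
    have s1: "0 \<le> s" "s \<le> 1" and t1: "0 \<le> t" "t \<le> 1" using st by auto
    define i where "i = nat \<lfloor>2 ^ m * s\<rfloor>"
    define k where "k = nat \<lfloor>2 ^ m * t\<rfloor>"
    have i: "real i = of_int \<lfloor>2 ^ m * s\<rfloor>" and k: "real k = of_int \<lfloor>2 ^ m * t\<rfloor>" using s1 t1 by (auto simp: i_def k_def)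
    have i': "real i \<le> 2 ^ m * s" "2 ^ m * s < real i + 1" unfolding i by linarith+
    have k': "real k \<le> 2 ^ m * t" "2 ^ m * t < real k + 1" unfolding k by linarith+
    have "2 ^ m * (t - s) \<le> 2 ^ m * (1 / 2) ^ m" using m2 by (intro mult_left_mono) auto
    also have "\<dots> = (1 :: real)" by (simp flip: power_mult_distrib)
    finally have "2 ^ m * t \<le> 2 ^ m * s + 1" by (simp add: algebra_simps)
    moreover have "2 ^ m * s < 2 ^ m * t" using st by simp
    ultimately have "real k < real i + 2" "real i < real k + 1" using i' k' by linarith+
    then have "k < i + 2" "i < k + 1" by linarith+
    then consider "k = i" | "k = Suc i" by linarith
    then have mid: "\<bar>f (dyadic_floor m t) - f (dyadic_floor m s)\<bar> \<le> R * q ^ m"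
    proof cases
      case 1
      then show ?thesis using R q by (simp add: dyadic_floor_def i_def[symmetric] k_def[symmetric])
    next
      case 2
      have "real k \<le> 2 ^ m * 1" by (rule order_trans[OF k'(1)], rule mult_left_mono[OF t1(2)]) simp
      then have "k \<le> 2 ^ m" by (metis mult_1_right of_nat_le_iff of_nat_numeral of_nat_power)
      then show ?thesis using f[of i m] 2 by (simp add: dyadic_floor_def i_def[symmetric] k_def[symmetric] q_def)
    qed
    have ch: "\<bar>f t - f (dyadic_floor m t)\<bar> \<le> R * q ^ m * (1 / (1 - q))" if "0 \<le> t" "t \<le> 1" for m t
      by (rule dyadic_chain[OF f[folded q_def] c R q that])
    have "\<bar>f t - f s\<bar> \<le> R * q ^ m + R * q ^ m * (1 / (1 - q)) + R * q ^ m * (1 / (1 - q))"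
      using mid ch[OF s1, of m] ch[OF t1, of m] by linarith
    also have "\<dots> = q ^ m * R * (1 + 2 / (1 - q))" by (simp add: algebra_simps)
    also have "\<dots> \<le> (2 * (t - s) powr \<beta>) * R * (1 + 2 / (1 - q))"
    proof (intro mult_right_mono)
      have "q ^ m = (2 powr (- \<beta>)) powr real m" unfolding q_def by (subst powr_realpow) auto
      also have "\<dots> = (2 powr (- real m)) powr \<beta>" by (simp add: powr_powr mult.commute)
      also have "2 powr (- real m) = 2 * (1 / 2) ^ Suc m" by (simp add: powr_minus powr_realpow power_one_over inverse_eq_divide)
      also have "(2 * (1 / 2) ^ Suc m) powr \<beta> \<le> (2 * (t - s)) powr \<beta>"
        using m1 \<beta> by (intro powr_mono2) (auto simp del: power_Suc)
      also have "\<dots> = 2 powr \<beta> * (t - s) powr \<beta>" using st by (subst powr_mult) auto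
      also have "\<dots> \<le> 2 powr 1 * (t - s) powr \<beta>" using \<beta> by (intro mult_right_mono powr_mono) auto
      finally show "q ^ m \<le> 2 * (t - s) powr \<beta>" by simp
    qed (use R q in auto)
    also have "\<dots> = chain_const \<beta> * R * (t - s) powr \<beta>"
      unfolding chain_const_def q_def by (simp only: mult_ac)
    finally show ?thesis .
  qed
  show ?thesis
    unfolding hoelder_ball_def
  proof (intro CollectI ballI)
    fix s t :: real assume st: "s \<in> {0..1}" "t \<in> {0..1}"
    then show "\<bar>f t - f s\<bar> \<le> chain_const \<beta> * R * \<bar>t - s\<bar> powr \<beta>"
      using ordered[of s t] ordered[of t s] by (cases s t rule: linorder_cases) (auto simp: abs_minus_commute)
  qed
qed

lemma hoelder_ball_continuous:
  assumes f: "f \<in> hoelder_ball \<beta> H" and \<beta>: "0 < \<beta>" and H: "0 < H"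
  shows "continuous_on {0..1} f"
proof (rule continuous_on_iff[THEN iffD2], intro ballI allI impI)
  fix x e :: real assume x: "x \<in> {0..1}" and e: "0 < e"
  show "\<exists>d>0. \<forall>x'\<in>{0..1}. dist x' x < d \<longrightarrow> dist (f x') (f x) < e"
  proof (intro exI[of _ "(e / H) powr (1 / \<beta>)"] conjI ballI impI)
    show "0 < (e / H) powr (1 / \<beta>)" using e H by simp
    fix x' assume x': "x' \<in> {0..1}" "dist x' x < (e / H) powr (1 / \<beta>)"
    have "\<bar>x' - x\<bar> powr \<beta> < ((e / H) powr (1 / \<beta>)) powr \<beta>" using x'(2) \<beta> by (intro powr_less_mono2) (auto simp: dist_real_def)
    also have "\<dots> = e / H" using e H \<beta> by (simp add: powr_powr)
    finally have "H * \<bar>x' - x\<bar> powr \<beta> < e" using H by (simp add: pos_less_divide_eq mult.commute)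
    then show "dist (f x') (f x) < e" using hoelder_ballD[OF f, of x x'] x x'(1) by (simp add: dist_real_def)
  qed
qed

lemma hoelder_ball_ratio:
  assumes f: "f \<in> hoelder_ball \<beta> H" and l: "l \<le> \<beta>" and H: "0 < H" and x: "x \<in> hoelder_ratios l f"
  shows "x \<le> H"
proof -
  obtain s t where st: "s \<in> {0..1}" "t \<in> {0..1}" "s \<noteq> t" "x = \<bar>f t - f s\<bar> / \<bar>t - s\<bar> powr l"
    using x unfolding hoelder_ratios_def by blast
  have p: "0 < \<bar>t - s\<bar>" "\<bar>t - s\<bar> \<le> 1" using st by auto
  have "\<bar>f t - f s\<bar> \<le> H * \<bar>t - s\<bar> powr \<beta>" using hoelder_ballD[OF f] st by auto
  also have "\<dots> \<le> H * \<bar>t - s\<bar> powr l" using p l H by (intro mult_left_mono powr_mono') auto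
  finally show ?thesis using p st(4) by (simp add: pos_divide_le_eq)
qed

lemma hoelder_ball_space: "f \<in> hoelder_ball \<beta> H \<Longrightarrow> l \<le> \<beta> \<Longrightarrow> 0 < \<beta> \<Longrightarrow> 0 < H \<Longrightarrow> f \<in> hoelder_space l"
  unfolding hoelder_space_def using hoelder_ball_continuous hoelder_ball_ratio[of f \<beta> H l]
  by (auto intro!: bdd_aboveI[of _ H])

text \<open>Interpolation between the uniform norm and a higher Hoelder exponent: pairs at distance
  at most \<tau> profit from the gap \<beta> - l, all other pairs from the uniform bound.\<close>

lemma hoelder_norm_small:
  assumes l: "0 < l" "l < \<beta>" and H: "0 < H" and \<epsilon>: "0 < \<epsilon>"
  shows "\<exists>u>0. \<forall>f. f \<in> hoelder_ball \<beta> H \<longrightarrow> (\<forall>t\<in>{0..1}. \<bar>f t\<bar> \<le> u) \<longrightarrow> hoelder_norm l f < \<epsilon>"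
proof -
  define \<tau> where "\<tau> = (\<epsilon> / (3 * H)) powr (1 / (\<beta> - l))"
  have \<tau>: "0 < \<tau>" "H * \<tau> powr (\<beta> - l) = \<epsilon> / 3" using \<epsilon> H l by (auto simp: \<tau>_def powr_powr)
  \<comment> \<open>Gives 2u \<le> (\<epsilon>/3) \<tau>^l for distant pairs and at most
    \<epsilon>/6 for the maximum; \<tau> itself solves H \<tau>^(\<beta> - l) =
    \<epsilon>/3.\<close>
  define u where "u = min (\<epsilon> / 6) (\<epsilon> * \<tau> powr l / 6)"
  have u: "0 < u" using \<epsilon> \<tau> by (simp add: u_def)
  show ?thesis
  proof (intro exI[of _ u] conjI u allI impI)
    fix f assume f: "f \<in> hoelder_ball \<beta> H" and fu: "\<forall>t\<in>{0..1}. \<bar>f t\<bar> \<le> u"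
    have "Sup (hoelder_ratios l f) \<le> \<epsilon> / 3"
    proof (rule cSup_least)
      have "\<bar>f 1 - f 0\<bar> / \<bar>1 - 0\<bar> powr l \<in> hoelder_ratios l f" unfolding hoelder_ratios_def by fastforce
      then show "hoelder_ratios l f \<noteq> {}" by blast
      fix x assume "x \<in> hoelder_ratios l f"
      then obtain s t where st: "s \<in> {0..1}" "t \<in> {0..1}" "s \<noteq> t" "x = \<bar>f t - f s\<bar> / \<bar>t - s\<bar> powr l"
        unfolding hoelder_ratios_def by blast
      have p: "0 < \<bar>t - s\<bar>" using st by auto
      show "x \<le> \<epsilon> / 3"
      proof (cases "\<bar>t - s\<bar> \<le> \<tau>")
        case True
        have "\<bar>f t - f s\<bar> \<le> H * \<bar>t - s\<bar> powr \<beta>" using hoelder_ballD[OF f] st by auto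
        also have "\<dots> = H * \<bar>t - s\<bar> powr (\<beta> - l) * \<bar>t - s\<bar> powr l" by (simp flip: powr_add)
        also have "\<dots> \<le> H * \<tau> powr (\<beta> - l) * \<bar>t - s\<bar> powr l"
          using True H l by (intro mult_right_mono mult_left_mono powr_mono2) auto
        finally show ?thesis unfolding \<tau>(2) st(4) using p by (simp add: pos_divide_le_eq)
      next
        case False
        have "\<bar>f t - f s\<bar> \<le> 2 * u" using fu st(1,2) by (smt (verit))
        also have "\<dots> \<le> \<epsilon> / 3 * \<tau> powr l" by (simp add: u_def min_def)
        also have "\<dots> \<le> \<epsilon> / 3 * \<bar>t - s\<bar> powr l" using False \<tau>(1) l \<epsilon> by (intro mult_left_mono powr_mono2) auto
        finally show ?thesis unfolding st(4) using p by (simp add: pos_divide_le_eq)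
      qed
    qed
    moreover have "Sup ((\<lambda>t. \<bar>f t\<bar>) ` {0..1}) \<le> \<epsilon> / 6"
      by (rule cSup_least) (use fu in \<open>auto simp: u_def\<close>)
    ultimately show "hoelder_norm l f < \<epsilon>" unfolding hoelder_norm_def using \<epsilon> by linarith
  qed
qed

lemma hoelder_ball_diff: "f \<in> hoelder_ball \<beta> H \<Longrightarrow> g \<in> hoelder_ball \<beta> H' \<Longrightarrow> (\<lambda>t. f t - g t) \<in> hoelder_ball \<beta> (H + H')"
  unfolding hoelder_ball_def
proof (intro CollectI ballI)
  fix s t :: real
  assume a: "f \<in> {f. \<forall>s\<in>{0..1}. \<forall>t\<in>{0..1}. \<bar>f t - f s\<bar> \<le> H * \<bar>t - s\<bar> powr \<beta>}"
    "g \<in> {f. \<forall>s\<in>{0..1}. \<forall>t\<in>{0..1}. \<bar>f t - f s\<bar> \<le> H' * \<bar>t - s\<bar> powr \<beta>}" "s \<in> {0..1}" "t \<in> {0..1}"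
  then have "\<bar>f t - f s\<bar> \<le> H * \<bar>t - s\<bar> powr \<beta>" "\<bar>g t - g s\<bar> \<le> H' * \<bar>t - s\<bar> powr \<beta>" by auto
  then show "\<bar>f t - g t - (f s - g s)\<bar> \<le> (H + H') * \<bar>t - s\<bar> powr \<beta>" by (simp add: distrib_right)
qed

section \<open>Functionals continuous in the Hoelder norm\<close>

locale hoelder_functional =
  fixes \<Phi> :: "(real \<Rightarrow> real) \<Rightarrow> real" and l K :: real
  assumes l: "0 < l" and \<Phi>_bound: "\<And>f. f \<in> hoelder_space l \<Longrightarrow> \<bar>\<Phi> f\<bar> \<le> K"
    and \<Phi>_cont: "\<And>f \<epsilon>. f \<in> hoelder_space l \<Longrightarrow> 0 < \<epsilon> \<Longrightarrow>
      \<exists>\<delta>>0. \<forall>g\<in>hoelder_space l. hoelder_norm l (\<lambda>t. g t - f t) < \<delta> \<longrightarrow> \<bar>\<Phi> g - \<Phi> f\<bar> < \<epsilon>"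
begin

text \<open>Within a ball of exponent \<beta> > l, uniform convergence implies convergence in
  \<open>hoelder_norm l\<close>, so there \<Phi> is continuous for the uniform topology.\<close>

lemma uniform_limit_tendsto:
  assumes b: "l < \<beta>" and H: "0 < H" and h: "\<And>j. h j \<in> hoelder_ball \<beta> H" and \<phi>: "\<phi> \<in> hoelder_ball \<beta> H"
    and lim: "\<And>e. 0 < e \<Longrightarrow> \<exists>J :: nat. \<forall>j\<ge>J. \<forall>t\<in>{0..1}. \<bar>h j t - \<phi> t\<bar> \<le> e"
  shows "(\<lambda>j. \<Phi> (h j)) \<longlonglongrightarrow> \<Phi> \<phi>"
proof (rule LIMSEQ_I)
  fix r :: real assume r: "0 < r"
  have \<beta>0: "0 < \<beta>" using b l by linarith
  have sp: "\<phi> \<in> hoelder_space l" "h j \<in> hoelder_space l" for j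
    using hoelder_ball_space[OF _ less_imp_le[OF b] \<beta>0 H] h \<phi> by auto
  obtain \<delta> where \<delta>: "0 < \<delta>" "\<forall>g\<in>hoelder_space l. hoelder_norm l (\<lambda>t. g t - \<phi> t) < \<delta> \<longrightarrow> \<bar>\<Phi> g - \<Phi> \<phi>\<bar> < r"
    using \<Phi>_cont[OF sp(1) r] by (elim exE conjE)
  have "0 < H + H" using H by simp
  from hoelder_norm_small[OF l b this \<delta>(1)] obtain u where u: "0 < u"
    "\<forall>f. f \<in> hoelder_ball \<beta> (H + H) \<longrightarrow> (\<forall>t\<in>{0..1}. \<bar>f t\<bar> \<le> u) \<longrightarrow> hoelder_norm l f < \<delta>" by (elim exE conjE)
  obtain J where J: "\<forall>j\<ge>J. \<forall>t\<in>{0..1}. \<bar>h j t - \<phi> t\<bar> \<le> u" using lim[OF u(1)] by (elim exE)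
  show "\<exists>no. \<forall>n\<ge>no. norm (\<Phi> (h n) - \<Phi> \<phi>) < r"
  proof (intro exI[of _ J] allI impI)
    fix n assume "J \<le> n"
    then have "hoelder_norm l (\<lambda>t. h n t - \<phi> t) < \<delta>"
      using u(2)[rule_format, OF hoelder_ball_diff[OF h \<phi>]] J by blast
    then show "norm (\<Phi> (h n) - \<Phi> \<phi>) < r" using \<delta>(2) sp(2) by simp
  qed
qed

text \<open>Compactness turns continuity into uniform continuity. In a sequence of counterexamples a
  subsequence of the \<open>f\<close> converges uniformly to some \<phi> in the same ball, the
  \<open>g\<close> follow because their distance to the \<open>f\<close> vanishes, and both values
  of \<Phi> tend to \<Phi> \<phi>.\<close>

lemma uniformly_continuous_hoelder_ball:
  assumes b: "l < \<beta>" "\<beta> \<le> 1" and H: "0 < H" and \<epsilon>: "0 < \<epsilon>"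
  shows "\<exists>u>0. \<forall>f g. f \<in> hoelder_ball \<beta> H \<longrightarrow> g \<in> hoelder_ball \<beta> H \<longrightarrow> \<bar>f 0\<bar> \<le> R \<longrightarrow>
     (\<forall>t\<in>{0..1}. \<bar>f t - g t\<bar> \<le> u) \<longrightarrow> \<bar>\<Phi> f - \<Phi> g\<bar> \<le> \<epsilon>"
proof (rule ccontr)
  assume neg: "\<not> ?thesis"
  have \<beta>0: "0 < \<beta>" using b l by linarith
  have "\<exists>f g. f \<in> hoelder_ball \<beta> H \<and> g \<in> hoelder_ball \<beta> H \<and> \<bar>f 0\<bar> \<le> R \<and>
     (\<forall>t\<in>{0..1}. \<bar>f t - g t\<bar> \<le> 1 / real (Suc j)) \<and> \<epsilon> < \<bar>\<Phi> f - \<Phi> g\<bar>" for j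
  proof (rule ccontr)
    assume "\<not> ?thesis"
    then have "\<forall>f g. f \<in> hoelder_ball \<beta> H \<longrightarrow> g \<in> hoelder_ball \<beta> H \<longrightarrow> \<bar>f 0\<bar> \<le> R \<longrightarrow>
     (\<forall>t\<in>{0..1}. \<bar>f t - g t\<bar> \<le> 1 / real (Suc j)) \<longrightarrow> \<bar>\<Phi> f - \<Phi> g\<bar> \<le> \<epsilon>" by (meson not_le)
    moreover have "0 < 1 / real (Suc j)" by simp
    ultimately show False using neg by blast
  qed
  then obtain f g where fg: "\<And>j. f j \<in> hoelder_ball \<beta> H" "\<And>j. g j \<in> hoelder_ball \<beta> H" "\<And>j. \<bar>f j 0\<bar> \<le> R"
    "\<And>j t. t \<in> {0..1} \<Longrightarrow> \<bar>f j t - g j t\<bar> \<le> 1 / real (Suc j)" "\<And>j. \<epsilon> < \<bar>\<Phi> (f j) - \<Phi> (g j)\<bar>" by metis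
  obtain \<phi> k where \<phi>c: "continuous_on {0..1} \<phi>" and k: "strict_mono (k :: nat \<Rightarrow> nat)"
    and lim: "\<And>e. 0 < e \<Longrightarrow> \<exists>N. \<forall>n x. n \<ge> N \<and> x \<in> {0..1} \<longrightarrow> norm (f (k n) x - \<phi> x) < e"
  proof (rule Arzela_Ascoli[of "{0..1}" f "R + H"])
    fix n x assume x: "x \<in> {0..1 :: real}"
    have "\<bar>f n x - f n 0\<bar> \<le> H * \<bar>x - 0\<bar> powr \<beta>" using hoelder_ballD[OF fg(1), of 0 x] x by simp
    also have "\<dots> \<le> H * 1" using x H \<beta>0 by (intro mult_left_mono powr_le1) auto
    finally show "norm (f n x) \<le> R + H" using fg(3)[of n] by simp
  next
    fix x e :: real assume x: "x \<in> {0..1}" and e: "0 < e"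
    show "\<exists>d>0. \<forall>n y. y \<in> {0..1} \<and> norm (x - y) < d \<longrightarrow> norm (f n x - f n y) < e"
    proof (intro exI[of _ "(e / H) powr (1 / \<beta>)"] conjI allI impI)
      show "0 < (e / H) powr (1 / \<beta>)" using e H by simp
      fix n y assume y: "y \<in> {0..1} \<and> norm (x - y) < (e / H) powr (1 / \<beta>)"
      have "\<bar>x - y\<bar> powr \<beta> < ((e / H) powr (1 / \<beta>)) powr \<beta>" using y \<beta>0 by (intro powr_less_mono2) auto
      also have "\<dots> = e / H" using e H \<beta>0 by (simp add: powr_powr)
      finally have "H * \<bar>x - y\<bar> powr \<beta> < e" using H by (simp add: pos_less_divide_eq mult.commute)
      then show "norm (f n x - f n y) < e" using hoelder_ballD[OF fg(1), of y x n] x y by simp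
    qed
  next
    show "compact {0..1 :: real}" by simp
  next
    fix \<phi> and k :: "nat \<Rightarrow> nat"
    assume "continuous_on {0..1} \<phi>" "strict_mono k"
      "\<And>e. 0 < e \<Longrightarrow> \<exists>N. \<forall>n x. n \<ge> N \<and> x \<in> {0..1} \<longrightarrow> norm (f (k n) x - \<phi> x) < e"
    then show thesis by (rule that)
  qed
  have limf: "\<exists>J. \<forall>j\<ge>J. \<forall>t\<in>{0..1}. \<bar>f (k j) t - \<phi> t\<bar> \<le> e" if e: "0 < e" for e
  proof -
    obtain J where J: "\<forall>n x. n \<ge> J \<and> x \<in> {0..1} \<longrightarrow> norm (f (k n) x - \<phi> x) < e"
      using lim[OF e] by (elim exE)
    have "\<bar>f (k j) t - \<phi> t\<bar> \<le> e" if "J \<le> j" "t \<in> {0..1}" for j t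
      using J[rule_format, OF conjI[OF that]] by simp
    then show ?thesis by blast
  qed
  have pt: "(\<lambda>j. f (k j) t) \<longlonglongrightarrow> \<phi> t" if t: "t \<in> {0..1}" for t
  proof (rule LIMSEQ_I)
    fix e :: real assume e: "0 < e"
    obtain J where J: "\<forall>n x. n \<ge> J \<and> x \<in> {0..1} \<longrightarrow> norm (f (k n) x - \<phi> x) < e"
      using lim[OF e] by (elim exE)
    show "\<exists>no. \<forall>n\<ge>no. norm (f (k n) t - \<phi> t) < e"
      using J[rule_format, OF conjI[OF _ t]] by blast
  qed
  have \<phi>b: "\<phi> \<in> hoelder_ball \<beta> H"
    unfolding hoelder_ball_def
  proof (intro CollectI ballI)
    fix s t :: real assume st: "s \<in> {0..1}" "t \<in> {0..1}"
    have "(\<lambda>j. \<bar>f (k j) t - f (k j) s\<bar>) \<longlonglongrightarrow> \<bar>\<phi> t - \<phi> s\<bar>" by (intro tendsto_intros pt st)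
    then show "\<bar>\<phi> t - \<phi> s\<bar> \<le> H * \<bar>t - s\<bar> powr \<beta>"
      by (rule LIMSEQ_le_const2) (use hoelder_ballD[OF fg(1)] st in auto)
  qed
  have limg: "\<exists>J. \<forall>j\<ge>J. \<forall>t\<in>{0..1}. \<bar>g (k j) t - \<phi> t\<bar> \<le> e" if e: "0 < e" for e
  proof -
    obtain J where J: "\<forall>j\<ge>J. \<forall>t\<in>{0..1}. \<bar>f (k j) t - \<phi> t\<bar> \<le> e / 2" using limf[of "e / 2"] e by auto
    obtain J' :: nat where J': "1 / (e / 2) < J'" using reals_Archimedean2 by blast
    show ?thesis
    proof (intro exI[of _ "max J J'"] allI impI ballI)
      fix j t assume j: "max J J' \<le> j" and t: "t \<in> {0..1 :: real}"
      have "1 / (e / 2) < real (Suc (k j))" using J' j seq_suble[OF k, of j] by linarith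
      then have "1 / real (Suc (k j)) < e / 2" using e by (simp add: field_simps)
      then have "\<bar>f (k j) t - g (k j) t\<bar> \<le> e / 2" using fg(4)[OF t, of "k j"] by linarith
      moreover have "\<bar>f (k j) t - \<phi> t\<bar> \<le> e / 2" using J j t by simp
      ultimately show "\<bar>g (k j) t - \<phi> t\<bar> \<le> e" by linarith
    qed
  qed
  have "(\<lambda>j. \<bar>\<Phi> (f (k j)) - \<Phi> (g (k j))\<bar>) \<longlonglongrightarrow> \<bar>\<Phi> \<phi> - \<Phi> \<phi>\<bar>"
    by (intro tendsto_intros uniform_limit_tendsto[OF b(1) H] fg \<phi>b limf limg)
  then have "\<epsilon> \<le> \<bar>\<Phi> \<phi> - \<Phi> \<phi>\<bar>" by (rule LIMSEQ_le_const) (use fg(5) in \<open>auto intro: less_imp_le\<close>)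
  then show False using \<epsilon> by simp
qed

end

section \<open>Piecewise linear interpolation of grid values\<close>

definition interp :: "nat \<Rightarrow> (nat \<Rightarrow> real) \<Rightarrow> real \<Rightarrow> real" where
  "interp d v t = (let j = min (nat \<lfloor>real d * t\<rfloor>) (d - 1) in v j + (real d * t - real j) * (v (Suc j) - v j))"

text \<open>At inner grid points both adjacent cells give the same value; at t = 1 the floor is d,
  and the cap d - 1 in \<open>interp\<close> selects the last cell.\<close>

lemma interp_cell:
  assumes j: "j < d" and t: "real j / d \<le> t" "t \<le> real (Suc j) / d"
  shows "interp d v t = v j + (d * t - j) * (v (Suc j) - v j)"
proof -
  have d: "0 < real d" using j by simp
  show ?thesis
  proof (cases "t = real (Suc j) / d")
    case True
    then have e: "real d * t = real (Suc j)" using d by simp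
    have f: "nat \<lfloor>real d * t\<rfloor> = Suc j" unfolding e by simp
    show ?thesis
    proof (cases "Suc j < d")
      case True
      then have "min (Suc j) (d - 1) = Suc j" by simp
      then show ?thesis unfolding interp_def f Let_def using e by simp
    next
      case False
      then have "min (Suc j) (d - 1) = j" using j by simp
      then show ?thesis unfolding interp_def f Let_def by simp
    qed
  next
    case False
    then have "t < real (Suc j) / d" using t by simp
    then have "real j \<le> d * t" "d * t < real j + 1" using t d by (simp_all add: field_simps)
    then have "\<lfloor>real d * t\<rfloor> = int j" by linarith
    then have "min (nat \<lfloor>real d * t\<rfloor>) (d - 1) = j" using j by simp
    then show ?thesis unfolding interp_def Let_def by simp
  qed
qed

lemma interp_grid: "0 < d \<Longrightarrow> k \<le> d \<Longrightarrow> interp d v (real k / d) = v k"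
proof (cases "k = d")
  case True
  assume d: "0 < d"
  have "interp d v (real k / d) = v (d - 1) + (d * (real k / d) - (d - 1)) * (v (Suc (d - 1)) - v (d - 1))"
    using d True by (subst interp_cell[of "d - 1"]) (auto simp: of_nat_diff divide_right_mono)
  then show ?thesis using d True by (simp add: of_nat_diff)
next
  case False
  assume "0 < d" "k \<le> d"
  then show ?thesis using False by (subst interp_cell[of k]) (auto simp: divide_right_mono)
qed

text \<open>Factor 3 for two end pieces and a piece between grid points. Inside a cell the linear
  factor u = d (t - s) \<le> 1 is at most u^\<beta>, as \<beta> \<le> 1.\<close>

lemma interp_hoelder:
  assumes d: "0 < d" and \<beta>: "0 < \<beta>" "\<beta> \<le> 1" and H: "0 \<le> H"
    and v: "\<And>j k. j \<le> d \<Longrightarrow> k \<le> d \<Longrightarrow> \<bar>v k - v j\<bar> \<le> H * \<bar>real k / d - real j / d\<bar> powr \<beta>"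
  shows "interp d v \<in> hoelder_ball \<beta> (3 * H)"
proof -
  have cell: "\<bar>interp d v t - interp d v s\<bar> \<le> H * (t - s) powr \<beta>"
    if j: "j < d" and st: "real j / d \<le> s" "s \<le> t" "t \<le> real (Suc j) / d" for s t j
  proof (cases "s = t")
    case False
    have e: "interp d v t - interp d v s = (d * (t - s)) * (v (Suc j) - v j)"
      using st by (subst (1 2) interp_cell[OF j]) (auto simp: algebra_simps)
    have ds: "real (Suc j) / d - real j / d = 1 / d" by (simp add: diff_divide_distrib[symmetric])
    have u: "0 < d * (t - s)" "d * (t - s) \<le> 1"
    proof -
      show "0 < d * (t - s)" using False st d by simp
      have "t - s \<le> 1 / d" using st ds by linarith
      then show "d * (t - s) \<le> 1" using d by (simp add: field_simps)
    qed
    have "\<bar>interp d v t - interp d v s\<bar> = (d * (t - s)) * \<bar>v (Suc j) - v j\<bar>" unfolding e abs_mult using u st by simp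
    also have "\<dots> \<le> (d * (t - s)) powr \<beta> * (H * (1 / d) powr \<beta>)"
    proof (intro mult_mono)
      have "(d * (t - s)) powr 1 \<le> (d * (t - s)) powr \<beta>" using u \<beta> by (intro powr_mono') auto
      then show "d * (t - s) \<le> (d * (t - s)) powr \<beta>" using u by simp
      show "\<bar>v (Suc j) - v j\<bar> \<le> H * (1 / d) powr \<beta>" using v[of j "Suc j"] j unfolding ds by simp
    qed auto
    also have "\<dots> = H * ((d * (t - s)) * (1 / d)) powr \<beta>" using u by (subst powr_mult) auto
    also have "(d * (t - s)) * (1 / d) = t - s" using d by simp
    finally show ?thesis .
  qed simp
  have ordered: "\<bar>interp d v t - interp d v s\<bar> \<le> 3 * H * (t - s) powr \<beta>" if st: "0 \<le> s" "s \<le> t" "t \<le> 1" for s t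
  proof -
    obtain j where j: "j < d" "real j / d \<le> s" "s \<le> real (Suc j) / d" using unit_cell[OF d st(1)] st by auto
    obtain k where k: "k < d" "real k / d \<le> t" "t \<le> real (Suc k) / d" using unit_cell[OF d, of t] st by auto
    show ?thesis
    proof (cases "k \<le> j")
      case True
      then have "real (Suc k) / d \<le> real (Suc j) / d" by (intro divide_right_mono) auto
      then have "\<bar>interp d v t - interp d v s\<bar> \<le> H * (t - s) powr \<beta>" using cell[OF j(1,2) st(2)] k by linarith
      also have "\<dots> \<le> 3 * H * (t - s) powr \<beta>" using H by (intro mult_right_mono) auto
      finally show ?thesis .
    next
      case False
      let ?u = "real (Suc j) / d" and ?w = "real k / d"
      have uw: "?u \<le> ?w" using False by (intro divide_right_mono) auto
      have "\<bar>interp d v t - interp d v ?w\<bar> \<le> H * (t - ?w) powr \<beta>" using cell[OF k(1) order.refl k(2,3)] .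
      moreover have "\<bar>interp d v ?u - interp d v s\<bar> \<le> H * (?u - s) powr \<beta>" using cell[OF j(1,2,3) order.refl] .
      moreover have "\<bar>interp d v ?w - interp d v ?u\<bar> \<le> H * (?w - ?u) powr \<beta>"
        using v[of "Suc j" k] j(1) k(1) uw by (subst (1 2) interp_grid) (auto simp: d)
      moreover have "H * (t - ?w) powr \<beta> \<le> H * (t - s) powr \<beta>" "H * (?u - s) powr \<beta> \<le> H * (t - s) powr \<beta>" "H * (?w - ?u) powr \<beta> \<le> H * (t - s) powr \<beta>"
        using H \<beta> j k uw by (auto intro!: mult_left_mono powr_mono2)
      ultimately show ?thesis by linarith
    qed
  qed
  show ?thesis
    unfolding hoelder_ball_def
  proof (intro CollectI ballI)
    fix s t :: real assume st: "s \<in> {0..1}" "t \<in> {0..1}"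
    then show "\<bar>interp d v t - interp d v s\<bar> \<le> 3 * H * \<bar>t - s\<bar> powr \<beta>"
      using ordered[of s t] ordered[of t s] by (cases "s \<le> t") (auto simp: abs_minus_commute)
  qed
qed

lemma interp_close:
  assumes d: "0 < d" and f: "f \<in> hoelder_ball \<beta> H" and H: "0 \<le> H" and \<beta>: "0 < \<beta>" and t: "0 \<le> t" "t \<le> 1"
  shows "\<bar>f t - interp d (\<lambda>i. f (real i / d)) t\<bar> \<le> 2 * H * (1 / d) powr \<beta>"
proof -
  obtain j where j: "j < d" "real j / d \<le> t" "t \<le> real (Suc j) / d" using unit_cell[OF d t] by auto
  have ds: "real (Suc j) / d - real j / d = 1 / d" by (simp add: diff_divide_distrib[symmetric])
  have j01: "0 \<le> real j / d" "real j / d \<le> 1" "0 \<le> real (Suc j) / d" "real (Suc j) / d \<le> 1" using j(1) by auto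
  have u: "0 \<le> d * t - j" "d * t - j \<le> 1" using j d by (auto simp: field_simps)
  have "\<bar>f (real (Suc j) / d) - f (real j / d)\<bar> \<le> H * (1 / d) powr \<beta>"
    using hoelder_ballD[OF f j01] unfolding ds by simp
  then have "(d * t - j) * \<bar>f (real (Suc j) / d) - f (real j / d)\<bar> \<le> 1 * (H * (1 / d) powr \<beta>)"
    using u by (intro mult_mono) auto
  moreover have "\<bar>f t - f (real j / d)\<bar> \<le> H * (1 / d) powr \<beta>"
  proof -
    have "\<bar>f t - f (real j / d)\<bar> \<le> H * \<bar>t - real j / d\<bar> powr \<beta>" by (rule hoelder_ballD[OF f j01(1,2) t])
    also have "\<dots> \<le> H * (1 / d) powr \<beta>" using j ds H \<beta> by (intro mult_left_mono powr_mono2) auto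
    finally show ?thesis .
  qed
  moreover have "\<bar>f t - interp d (\<lambda>i. f (real i / d)) t\<bar> \<le> \<bar>f t - f (real j / d)\<bar> + (d * t - j) * \<bar>f (real (Suc j) / d) - f (real j / d)\<bar>"
  proof -
    have "\<bar>f t - interp d (\<lambda>i. f (real i / d)) t\<bar> = \<bar>(f t - f (real j / d)) - (d * t - j) * (f (real (Suc j) / d) - f (real j / d))\<bar>"
      by (subst interp_cell[OF j]) simp
    also have "\<dots> \<le> \<bar>f t - f (real j / d)\<bar> + \<bar>(d * t - j) * (f (real (Suc j) / d) - f (real j / d))\<bar>" by (rule abs_triangle_ineq4)
    also have "\<bar>(d * t - j) * (f (real (Suc j) / d) - f (real j / d))\<bar> = (d * t - j) * \<bar>f (real (Suc j) / d) - f (real j / d)\<bar>"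
      unfolding abs_mult using u by simp
    finally show ?thesis .
  qed
  ultimately show ?thesis by linarith
qed

lemma interp_diff_le:
  assumes d: "0 < d" and t: "0 \<le> t" "t \<le> 1" and vw: "\<And>i. i \<le> d \<Longrightarrow> \<bar>v i - w i\<bar> \<le> u"
  shows "\<bar>interp d v t - interp d w t\<bar> \<le> u"
proof -
  obtain j where j: "j < d" "real j / d \<le> t" "t \<le> real (Suc j) / d" using unit_cell[OF d t] by auto
  define \<theta> where "\<theta> = d * t - j"
  have \<theta>: "0 \<le> \<theta>" "\<theta> \<le> 1" using j d by (auto simp: \<theta>_def field_simps)
  have "interp d v t - interp d w t = (1 - \<theta>) * (v j - w j) + \<theta> * (v (Suc j) - w (Suc j))"
    unfolding interp_cell[OF j, of v] interp_cell[OF j, of w] \<theta>_def[symmetric] by (simp add: algebra_simps)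
  also have "\<bar>\<dots>\<bar> \<le> (1 - \<theta>) * \<bar>v j - w j\<bar> + \<theta> * \<bar>v (Suc j) - w (Suc j)\<bar>"
    using \<theta> by (intro order_trans[OF abs_triangle_ineq]) (simp add: abs_mult)
  also have "\<dots> \<le> (1 - \<theta>) * u + \<theta> * u" using vw[of j] vw[of "Suc j"] j \<theta> by (intro add_mono mult_left_mono) auto
  finally show ?thesis by (simp add: algebra_simps)
qed

text \<open>Distinct grid points are at least 1/d apart, so boundedness alone yields a Hoelder
  constant. It grows with d, which does no harm as it is applied for fixed d.\<close>

lemma interp_bounded:
  assumes d: "0 < d" and \<beta>: "0 < \<beta>" "\<beta> \<le> 1" and R: "0 \<le> R" and v: "\<And>i. i \<le> d \<Longrightarrow> \<bar>v i\<bar> \<le> R"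
  shows "interp d v \<in> hoelder_ball \<beta> (3 * (2 * R * real d powr \<beta>))"
proof (rule interp_hoelder[OF d \<beta>])
  show "0 \<le> 2 * R * real d powr \<beta>" using R by simp
  fix j k assume jk: "j \<le> d" "k \<le> d"
  show "\<bar>v k - v j\<bar> \<le> 2 * R * real d powr \<beta> * \<bar>real k / d - real j / d\<bar> powr \<beta>"
  proof (cases "j = k")
    case False
    have "\<bar>real k / d - real j / d\<bar> = \<bar>real k - real j\<bar> / d" by (simp add: diff_divide_distrib[symmetric] abs_divide)
    moreover have "1 \<le> \<bar>real k - real j\<bar>" using False by linarith
    ultimately have g: "1 / d \<le> \<bar>real k / d - real j / d\<bar>" by (simp add: divide_right_mono)
    have "\<bar>v k - v j\<bar> \<le> 2 * R * 1" using v[OF jk(1)] v[OF jk(2)] by linarith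
    also have "(1 :: real) = (real d * (1 / d)) powr \<beta>" using d by simp
    also have "\<dots> = real d powr \<beta> * (1 / d) powr \<beta>" by (subst powr_mult) auto
    also have "2 * R * (real d powr \<beta> * (1 / d) powr \<beta>) = 2 * R * real d powr \<beta> * (1 / d) powr \<beta>" by simp
    also have "\<dots> \<le> 2 * R * real d powr \<beta> * \<bar>real k / d - real j / d\<bar> powr \<beta>"
      using g R \<beta> by (intro mult_left_mono powr_mono2) auto
    finally show ?thesis .
  qed simp
qed

lemma interp_in_hoelder_ball:
  assumes d: "0 < d" and \<beta>: "0 < \<beta>" "\<beta> \<le> 1"
  shows "\<exists>H>0. interp d v \<in> hoelder_ball \<beta> H"
proof -
  define R where "R = 1 + (\<Sum>i\<le>d. \<bar>v i\<bar>)"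
  have Rv: "\<bar>v i\<bar> \<le> R" if "i \<le> d" for i
    using member_le_sum[of i "{..d}" "\<lambda>i. \<bar>v i\<bar>"] that by (simp add: R_def)
  have R: "0 < R" unfolding R_def by (intro add_pos_nonneg sum_nonneg) auto
  have "interp d v \<in> hoelder_ball \<beta> (3 * (2 * R * real d powr \<beta>))"
    by (rule interp_bounded[OF d \<beta> less_imp_le[OF R] Rv])
  then show ?thesis using R d by (intro exI[of _ "3 * (2 * R * real d powr \<beta>)"]) simp
qed

section \<open>Processes with dyadic increment tails\<close>

definition tight_process :: "'a measure \<Rightarrow> (real \<Rightarrow> 'a \<Rightarrow> real) \<Rightarrow> real \<Rightarrow> nat \<Rightarrow> bool" where
  "tight_process P X C p \<longleftrightarrow> prob_space P \<and> (\<forall>t\<in>{0..1}. X t \<in> borel_measurable P) \<and>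
     (\<forall>\<omega>\<in>space P. continuous_on {0..1} (\<lambda>t. X t \<omega>)) \<and>
     (\<forall>m i r. i < 2 ^ m \<longrightarrow> 0 < r \<longrightarrow>
        measure P {\<omega>\<in>space P. r \<le> \<bar>X (real (Suc i) / 2 ^ m) \<omega> - X (real i / 2 ^ m) \<omega>\<bar>} \<le> C * (1 / 2 ^ m) ^ p / r ^ (2 * p))"

text \<open>The event on which the hypothesis of \<open>chaining\<close> holds with constant R; it
  involves countably many conditions and is measurable.\<close>

definition tame :: "'a measure \<Rightarrow> (real \<Rightarrow> 'a \<Rightarrow> real) \<Rightarrow> real \<Rightarrow> real \<Rightarrow> 'a set" where
  "tame P X \<beta> R = {\<omega>\<in>space P. \<forall>m. \<forall>i<2 ^ m. \<bar>X (real (Suc i) / 2 ^ m) \<omega> - X (real i / 2 ^ m) \<omega>\<bar> \<le> R * (2 powr (- \<beta>)) ^ m}"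

lemma dyadic_points_unit: "i < 2 ^ m \<Longrightarrow> real i / 2 ^ m \<in> {0..1} \<and> real (Suc i) / 2 ^ m \<in> {0..1}"
proof -
  assume i: "i < 2 ^ m"
  then have "real (Suc i) \<le> 2 ^ m" by (metis Suc_leI of_nat_le_iff of_nat_numeral of_nat_power)
  moreover have "real i \<le> real (Suc i)" by simp
  ultimately have "real i \<le> 2 ^ m" by linarith
  then show ?thesis using \<open>real (Suc i) \<le> 2 ^ m\<close> by (simp del: of_nat_Suc)
qed

text \<open>The union bound over the 2^m increments of level m gives C / R^(2p) times \<rho>^m with
  \<rho> = 2^(1 - p (1 - 2 \<beta>)). The condition on p says \<rho> < 1, so the sum over all levels
  is finite.\<close>

lemma tame_prob:
  assumes X: "tight_process P X C p" and C: "0 \<le> C" and \<beta>: "1 < real p * (1 - 2 * \<beta>)" and R: "0 < R"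
  shows "tame P X \<beta> R \<in> sets P"
    "measure P (space P - tame P X \<beta> R) \<le> C / R ^ (2 * p) / (1 - 2 powr (1 - real p * (1 - 2 * \<beta>)))"
proof -
  interpret prob_space P using X by (simp add: tight_process_def)
  define q where "q = 2 powr (- \<beta>)"
  have q: "0 < q" by (simp add: q_def)
  define \<rho> where "\<rho> = 2 powr (1 - real p * (1 - 2 * \<beta>))"
  have \<rho>: "0 < \<rho>" "\<rho> < 1" using \<beta> by (auto simp: \<rho>_def powr_less_one)
  have \<rho>': "\<rho> = 2 * (1 / 2) ^ p * (1 / q) ^ (2 * p)"
  proof -
    have "1 / q = 2 powr \<beta>" by (simp add: q_def powr_minus divide_inverse)
    then have "(1 / q) ^ (2 * p) = 2 powr (\<beta> * (2 * real p))" by (simp add: powr_powr flip: powr_realpow)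
    moreover have "(1 / 2 :: real) ^ p = 2 powr (- real p)" by (simp add: powr_minus powr_realpow power_one_over inverse_eq_divide)
    ultimately have "2 * (1 / 2) ^ p * (1 / q) ^ (2 * p) = 2 powr 1 * 2 powr (- real p) * 2 powr (\<beta> * (2 * real p))" by simp
    also have "\<dots> = 2 powr (1 + (- real p) + \<beta> * (2 * real p))" by (simp only: powr_add)
    also have "1 + (- real p) + \<beta> * (2 * real p) = 1 - real p * (1 - 2 * \<beta>)" by (simp add: algebra_simps)
    finally show ?thesis by (simp add: \<rho>_def)
  qed
  define D where "D m i \<omega> = \<bar>X (real (Suc i) / 2 ^ m) \<omega> - X (real i / 2 ^ m) \<omega>\<bar>" for m i \<omega>
  have Dm: "D m i \<in> borel_measurable P" if "i < 2 ^ m" for m i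
  proof -
    have [measurable]: "X (real (Suc i) / 2 ^ m) \<in> borel_measurable P" "X (real i / 2 ^ m) \<in> borel_measurable P"
      using X dyadic_points_unit[OF that] unfolding tight_process_def by blast+
    show ?thesis unfolding D_def[abs_def] by measurable
  qed
  have tail: "prob {\<omega>\<in>space P. r \<le> D m i \<omega>} \<le> C * (1 / 2 ^ m) ^ p / r ^ (2 * p)" if "i < 2 ^ m" "0 < r" for m i r
    using X that unfolding tight_process_def D_def by blast
  define Bad where "Bad m = (\<Union>i\<in>{..<2 ^ m}. {\<omega>\<in>space P. R * q ^ m < D m i \<omega>})" for m
  have Bm: "{\<omega>\<in>space P. c < D m i \<omega>} \<in> events" "{\<omega>\<in>space P. c \<le> D m i \<omega>} \<in> events" if "i < 2 ^ m" for m i c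
    using Dm[OF that] by measurable
  have Badm: "Bad m \<in> events" for m unfolding Bad_def using Bm by (intro sets.finite_UN) auto
  have Badp: "prob (Bad m) \<le> C / R ^ (2 * p) * \<rho> ^ m" for m
  proof -
    have "prob (Bad m) \<le> (\<Sum>i\<in>{..<2 ^ m}. prob {\<omega>\<in>space P. R * q ^ m < D m i \<omega>})"
      unfolding Bad_def using Bm by (intro finite_measure_subadditive_finite) auto
    also have "\<dots> \<le> (\<Sum>i\<in>{..<(2::nat) ^ m}. C * (1 / 2 ^ m) ^ p / (R * q ^ m) ^ (2 * p))"
    proof (rule sum_mono)
      fix i assume "i \<in> {..<(2::nat) ^ m}"
      then have i: "i < 2 ^ m" by simp
      have "prob {\<omega>\<in>space P. R * q ^ m < D m i \<omega>} \<le> prob {\<omega>\<in>space P. R * q ^ m \<le> D m i \<omega>}"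
        by (rule finite_measure_mono) (use Bm[OF i] in auto)
      also have "\<dots> \<le> C * (1 / 2 ^ m) ^ p / (R * q ^ m) ^ (2 * p)" using R q by (intro tail i) simp
      finally show "prob {\<omega>\<in>space P. R * q ^ m < D m i \<omega>} \<le> C * (1 / 2 ^ m) ^ p / (R * q ^ m) ^ (2 * p)" .
    qed
    also have "\<dots> = 2 ^ m * (C * (1 / 2 ^ m) ^ p / (R * q ^ m) ^ (2 * p))" by simp
    also have "\<dots> = C / R ^ (2 * p) * (2 ^ m * ((1 / 2) ^ p) ^ m * ((1 / q) ^ (2 * p)) ^ m)"
    proof -
      have "((1 / 2 :: real) ^ p) ^ m = (1 / 2 ^ m) ^ p" by (metis power_commutes power_mult power_one_over mult.commute)
      moreover have "((1 / q) ^ (2 * p)) ^ m = 1 / (q ^ m) ^ (2 * p)" by (metis power_mult power_one_over mult.commute)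
      ultimately show ?thesis by (simp add: power_mult_distrib)
    qed
    also have "2 ^ m * ((1 / 2) ^ p) ^ m * ((1 / q) ^ (2 * p)) ^ m = \<rho> ^ m" unfolding \<rho>' power_mult_distrib ..
    finally show ?thesis .
  qed
  have eq: "space P - tame P X \<beta> R = (\<Union>m. Bad m)"
  proof (rule set_eqI)
    fix \<omega>
    show "\<omega> \<in> space P - tame P X \<beta> R \<longleftrightarrow> \<omega> \<in> (\<Union>m. Bad m)"
      unfolding tame_def Bad_def D_def q_def by (auto simp: not_le simp del: of_nat_Suc)
  qed
  have "tame P X \<beta> R = space P - (\<Union>m. Bad m)" unfolding eq[symmetric] by (auto simp: tame_def)
  then show "tame P X \<beta> R \<in> events" using Badm by auto
  have sm: "summable (\<lambda>m. C / R ^ (2 * p) * \<rho> ^ m)" using \<rho> by (intro summable_mult summable_geometric) auto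
  have sp: "summable (\<lambda>m. prob (Bad m))" by (rule summable_comparison_test'[OF sm, of 0]) (use Badp in simp)
  have "prob (\<Union>m. Bad m) \<le> (\<Sum>m. prob (Bad m))"
    using Badm by (intro finite_measure_subadditive_countably sp) auto
  also have "\<dots> \<le> (\<Sum>m. C / R ^ (2 * p) * \<rho> ^ m)" by (rule suminf_le[OF Badp sp sm])
  also have "\<dots> = C / R ^ (2 * p) * (1 / (1 - \<rho>))"
    using \<rho> by (subst suminf_mult) (auto intro: summable_geometric simp: suminf_geometric)
  finally show "prob (space P - tame P X \<beta> R) \<le> C / R ^ (2 * p) / (1 - 2 powr (1 - real p * (1 - 2 * \<beta>)))"
    unfolding eq by (simp add: \<rho>_def)
qed

lemma tame_path:
  assumes X: "tight_process P X C p" and \<beta>: "0 < \<beta>" "\<beta> \<le> 1" and R: "0 \<le> R" and \<omega>: "\<omega> \<in> tame P X \<beta> R"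
  shows "(\<lambda>t. X t \<omega>) \<in> hoelder_ball \<beta> (chain_const \<beta> * R)"
proof (rule chaining)
  show "continuous_on {0..1} (\<lambda>t. X t \<omega>)" using X \<omega> unfolding tight_process_def tame_def by blast
  show "\<bar>X (real (Suc i) / 2 ^ m) \<omega> - X (real i / 2 ^ m) \<omega>\<bar> \<le> R * (2 powr (- \<beta>)) ^ m" if "i < 2 ^ m" for m i
    using \<omega> that unfolding tame_def by blast
qed (use \<beta> R in auto)

lemma chain_const_pos: "0 < (\<beta> :: real) \<Longrightarrow> 0 < chain_const \<beta>"
proof -
  assume "0 < \<beta>"
  then have "2 powr (- \<beta>) < 1" by (simp add: powr_less_one)
  then have "0 < 2 / (1 - 2 powr (- \<beta>))" by simp
  then show ?thesis unfolding chain_const_def by (intro mult_pos_pos add_pos_pos) auto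
qed

lemma inverse_powr_small: "0 < \<beta> \<Longrightarrow> 0 < u \<Longrightarrow> \<exists>d0>0. \<forall>d\<ge>d0. c * (1 / real d) powr \<beta> \<le> u"
proof -
  assume \<beta>: "0 < \<beta>" and u: "0 < u"
  have "(\<lambda>d. (1 / real d) powr \<beta>) \<longlonglongrightarrow> 0"
  proof -
    have "filterlim (\<lambda>d. real d) at_top sequentially" by (rule filterlim_real_sequentially)
    then have "(\<lambda>d. real d powr (- \<beta>)) \<longlonglongrightarrow> 0" using \<beta> by (intro tendsto_neg_powr) auto
    moreover have "(1 / real d) powr \<beta> = real d powr (- \<beta>)" for d by (simp add: powr_minus powr_divide inverse_eq_divide)
    ultimately show ?thesis by simp
  qed
  then have "(\<lambda>d. c * (1 / real d) powr \<beta>) \<longlonglongrightarrow> c * 0" by (rule tendsto_mult_left)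
  then have "\<forall>\<^sub>F d in sequentially. c * (1 / real d) powr \<beta> < u" by (rule order_tendstoD) (use u in simp)
  then obtain d0 where d0: "\<And>d. d0 \<le> d \<Longrightarrow> c * (1 / real d) powr \<beta> < u" by (auto simp: eventually_sequentially)
  show ?thesis
  proof (intro exI[of _ "Suc d0"] conjI allI impI)
    fix d assume "Suc d0 \<le> d"
    then show "c * (1 / real d) powr \<beta> \<le> u" using d0[of d] by simp
  qed simp
qed

context hoelder_functional begin

lemma interp_bound:
  assumes d: "0 < d" and l1: "l \<le> 1"
  shows "\<bar>\<Phi> (interp d v)\<bar> \<le> K"
proof -
  obtain H where "0 < H" "interp d v \<in> hoelder_ball 1 H" using interp_in_hoelder_ball[OF d, of 1 v] by auto
  then show ?thesis by (intro \<Phi>_bound hoelder_ball_space[OF _ l1]) auto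
qed

lemma fd_test_interp:
  assumes d: "0 < d" and \<beta>: "l < \<beta>" "\<beta> \<le> 1"
  shows "fd_test d (\<lambda>v. \<Phi> (interp d v))"
  unfolding fd_test_def
proof (intro conjI allI impI)
  have \<beta>0: "0 < \<beta>" using \<beta> l by linarith
  show "\<exists>B. \<forall>v. \<bar>\<Phi> (interp d v)\<bar> \<le> B"
  proof (intro exI[of _ K] allI)
    show "\<bar>\<Phi> (interp d v)\<bar> \<le> K" for v using \<beta> by (intro interp_bound d) simp
  qed
  fix R \<epsilon> :: real assume R: "0 < R" and \<epsilon>: "0 < \<epsilon>"
  define H where "H = 3 * (2 * (R + 1) * real d powr \<beta>)"
  have H: "0 < H" using R d by (simp add: H_def)
  obtain u where u: "0 < u" and uc: "\<forall>f g. f \<in> hoelder_ball \<beta> H \<longrightarrow> g \<in> hoelder_ball \<beta> H \<longrightarrow> \<bar>f 0\<bar> \<le> R \<longrightarrow>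
     (\<forall>t\<in>{0..1}. \<bar>f t - g t\<bar> \<le> u) \<longrightarrow> \<bar>\<Phi> f - \<Phi> g\<bar> \<le> \<epsilon>"
    using uniformly_continuous_hoelder_ball[OF \<beta> H \<epsilon>, of R] by (elim exE conjE)
  show "\<exists>\<delta>>0. \<forall>v w. (\<forall>i\<le>d. \<bar>v i\<bar> \<le> R \<and> \<bar>v i - w i\<bar> < \<delta>) \<longrightarrow> \<bar>\<Phi> (interp d v) - \<Phi> (interp d w)\<bar> \<le> \<epsilon>"
  proof (intro exI[of _ "min u 1"] conjI allI impI)
    show "0 < min u 1" using u by simp
    fix v w :: "nat \<Rightarrow> real" assume h: "\<forall>i\<le>d. \<bar>v i\<bar> \<le> R \<and> \<bar>v i - w i\<bar> < min u 1"
    have vb: "\<bar>v i\<bar> \<le> R + 1" "\<bar>w i\<bar> \<le> R + 1" "\<bar>v i - w i\<bar> \<le> u" if "i \<le> d" for i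
    proof -
      have "\<bar>v i\<bar> \<le> R" "\<bar>v i - w i\<bar> < u" "\<bar>v i - w i\<bar> < 1" using h that by auto
      then show "\<bar>v i\<bar> \<le> R + 1" "\<bar>w i\<bar> \<le> R + 1" "\<bar>v i - w i\<bar> \<le> u" by linarith+
    qed
    have R1: "0 \<le> R + 1" using R by simp
    have "interp d v \<in> hoelder_ball \<beta> H" "interp d w \<in> hoelder_ball \<beta> H"
      unfolding H_def by (rule interp_bounded[OF d \<beta>0 \<beta>(2) R1], erule vb)+
    moreover have "\<bar>interp d v 0\<bar> \<le> R" using interp_grid[OF d, of 0 v] h by simp
    moreover have "\<forall>t\<in>{0..1}. \<bar>interp d v t - interp d w t\<bar> \<le> u" using interp_diff_le[OF d] vb(3) by auto
    ultimately show "\<bar>\<Phi> (interp d v) - \<Phi> (interp d w)\<bar> \<le> \<epsilon>" using uc by blast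
  qed
qed

lemma interp_path:
  assumes f: "f \<in> hoelder_ball \<beta> H" and d: "0 < d" and \<beta>: "0 < \<beta>" "\<beta> \<le> 1" and H: "0 \<le> H"
  shows "interp d (\<lambda>i. f (real i / d)) \<in> hoelder_ball \<beta> (3 * H)"
proof (rule interp_hoelder[OF d \<beta> H])
  fix j k assume "j \<le> d" "k \<le> d"
  then show "\<bar>f (real k / d) - f (real j / d)\<bar> \<le> H * \<bar>real k / d - real j / d\<bar> powr \<beta>"
    using d by (intro hoelder_ballD[OF f]) auto
qed

text \<open>The functional of the path is only measurable for the completion, hence the two measures.\<close>

lemma interp_expectation_close:
  assumes \<beta>: "l < \<beta>" "\<beta> < 1 / 2" and C: "0 \<le> C" and p: "1 < real p * (1 - 2 * \<beta>)" and \<epsilon>: "0 < \<epsilon>" and \<eta>: "0 < \<eta>"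
  shows "\<exists>d0>0. \<forall>d\<ge>d0. \<forall>(P :: 'a measure) X. tight_process P X C p \<longrightarrow> measure P {\<omega>\<in>space P. R0 < \<bar>X 0 \<omega>\<bar>} \<le> \<eta> \<longrightarrow>
    \<bar>(\<integral>\<omega>. \<Phi> (\<lambda>t. X t \<omega>) \<partial>completion P) - (\<integral>\<omega>. \<Phi> (interp d (\<lambda>i. X (real i / d) \<omega>)) \<partial>P)\<bar> \<le> \<epsilon> + 4 * K * \<eta>"
proof -
  have \<beta>0: "0 < \<beta>" "\<beta> \<le> 1" using \<beta> l by auto
  have p1: "1 \<le> p" using p by (cases p) auto
  define \<rho> where "\<rho> = 2 powr (1 - real p * (1 - 2 * \<beta>))"
  have \<rho>: "0 < 1 - \<rho>" using p by (simp add: \<rho>_def powr_less_one)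
  \<comment> \<open>R \<ge> 1 and p \<ge> 1 give R^(2p) \<ge> R, so it is enough that R dominates
    the quotient.\<close>
  define R where "R = max 1 (C / (1 - \<rho>) / \<eta>)"
  have R: "1 \<le> R" "0 < R" by (auto simp: R_def)
  have RC: "C / R ^ (2 * p) / (1 - \<rho>) \<le> \<eta>"
  proof -
    have "C / (1 - \<rho>) / \<eta> \<le> R ^ 1" by (simp add: R_def)
    also have "\<dots> \<le> R ^ (2 * p)" using R p1 by (intro power_increasing) auto
    finally have "C / (1 - \<rho>) \<le> R ^ (2 * p) * \<eta>" by (rule pos_divide_le_eq[OF \<eta>, THEN iffD1])
    then have "C / (1 - \<rho>) / R ^ (2 * p) \<le> \<eta>" using R by (subst pos_divide_le_eq) (auto simp: mult.commute)
    then show ?thesis by (metis divide_divide_eq_left mult.commute)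
  qed
  define H where "H = chain_const \<beta> * R"
  have H: "0 < H" using chain_const_pos[OF \<beta>0(1)] R by (simp add: H_def)
  \<comment> \<open>Interpolation may triple the Hoelder constant, so path and interpolation are
    compared in the ball of radius 3H.\<close>
  have H3: "0 < 3 * H" "H \<le> 3 * H" using H by auto
  obtain u where u: "0 < u" and uc: "\<forall>f g. f \<in> hoelder_ball \<beta> (3 * H) \<longrightarrow> g \<in> hoelder_ball \<beta> (3 * H) \<longrightarrow> \<bar>f 0\<bar> \<le> R0 \<longrightarrow>
     (\<forall>t\<in>{0..1}. \<bar>f t - g t\<bar> \<le> u) \<longrightarrow> \<bar>\<Phi> f - \<Phi> g\<bar> \<le> \<epsilon>"
    using uniformly_continuous_hoelder_ball[OF \<beta>(1) \<beta>0(2) H3(1) \<epsilon>, of R0] by (elim exE conjE)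
  obtain d0 where d0: "0 < d0" and du: "\<forall>d\<ge>d0. 2 * H * (1 / real d) powr \<beta> \<le> u"
    using inverse_powr_small[OF \<beta>0(1) u, of "2 * H"] by (elim exE conjE)
  show ?thesis
  proof (rule exI[of _ d0], intro conjI d0 allI impI)
    fix d and P :: "'a measure" and X
    assume dd: "d0 \<le> d" and X: "tight_process P X C p" and X0: "measure P {\<omega>\<in>space P. R0 < \<bar>X 0 \<omega>\<bar>} \<le> \<eta>"
    interpret prob_space P using X by (simp add: tight_process_def)
    have d: "0 < d" using dd d0 by simp
    have Xm: "X t \<in> borel_measurable P" if "0 \<le> t" "t \<le> 1" for t using X that by (simp add: tight_process_def)
    have tm: "tame P X \<beta> r \<in> events" "prob (space P - tame P X \<beta> r) \<le> C / r ^ (2 * p) / (1 - \<rho>)" if "0 < r" for r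
      using tame_prob[OF X C p that] by (auto simp: \<rho>_def)
    define f where "f d \<omega> = \<Phi> (interp d (\<lambda>i. X (real i / d) \<omega>))" for d \<omega>
    have fm: "f d \<in> borel_measurable P" if "0 < d" for d
      unfolding f_def[abs_def] using that
      by (intro fd_test_comp_measurable[OF fd_test_interp[OF that \<beta>(1) \<beta>0(2)]] Xm) auto
    have fb: "\<bar>f d \<omega>\<bar> \<le> K" if d: "0 < d" for d \<omega>
      unfolding f_def using \<beta> by (intro interp_bound d) simp
    have K: "0 \<le> K" using fb[OF d, of undefined] by linarith
    have path: "(\<lambda>t. X t \<omega>) \<in> hoelder_ball \<beta> (chain_const \<beta> * r)" if "\<omega> \<in> tame P X \<beta> r" "0 < r" for \<omega> r
      using tame_path[OF X \<beta>0 _ that(1)] that(2) by simp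
    have path_sp: "(\<lambda>t. X t \<omega>) \<in> hoelder_space l" if "\<omega> \<in> tame P X \<beta> r" "0 < r" for \<omega> r
      by (rule hoelder_ball_space[OF path[OF that]]) (use \<beta> \<beta>0 chain_const_pos[OF \<beta>0(1)] that in auto)
    \<comment> \<open>Paths that are tame for some constant; letting the constant grow shows that A
      has probability 1. The event for R is added because R need not be an integer.\<close>
    define A where "A = (\<Union>r. tame P X \<beta> (real (Suc r))) \<union> tame P X \<beta> R"
    have Am: "A \<in> events" unfolding A_def using tm(1) R by (intro sets.Un sets.countable_UN) auto
    have Ar: "\<exists>r>0. \<omega> \<in> tame P X \<beta> r" if \<omega>: "\<omega> \<in> A" for \<omega>
    proof -
      consider k where "\<omega> \<in> tame P X \<beta> (real (Suc k))" | "\<omega> \<in> tame P X \<beta> R" using \<omega> unfolding A_def by blast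
      then show ?thesis
      proof cases
        case (1 k)
        then show ?thesis by (intro exI[of _ "real (Suc k)"]) simp
      qed (use R in blast)
    qed
    have Anull: "prob (space P - A) \<le> e" if e: "0 < e" for e
    proof -
      obtain r :: nat where r: "C / (1 - \<rho>) / e < r" using reals_Archimedean2 by blast
      have r': "C / (1 - \<rho>) / e \<le> real (Suc r)" using r by simp
      also have "real (Suc r) = real (Suc r) ^ 1" by simp
      also have "\<dots> \<le> real (Suc r) ^ (2 * p)" using p1 by (intro power_increasing) auto
      finally have "C / (1 - \<rho>) \<le> real (Suc r) ^ (2 * p) * e" by (rule pos_divide_le_eq[OF e, THEN iffD1])
      then have "C / (1 - \<rho>) / real (Suc r) ^ (2 * p) \<le> e" by (subst pos_divide_le_eq) (simp_all only: zero_less_power of_nat_0_less_iff zero_less_Suc mult.commute)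
      then have "C / real (Suc r) ^ (2 * p) / (1 - \<rho>) \<le> e" by (metis divide_divide_eq_left mult.commute)
      moreover have "prob (space P - A) \<le> prob (space P - tame P X \<beta> (real (Suc r)))"
        using tm(1)[of "real (Suc r)"] by (intro finite_measure_mono) (auto simp: A_def)
      ultimately show ?thesis using tm(2)[of "real (Suc r)"] by linarith
    qed
    have "prob (space P - A) \<le> 0" by (rule field_le_epsilon) (use Anull in simp)
    then have "prob A = 1" using prob_compl[OF Am] prob_le_1[of A] by linarith
    then have AEA: "AE \<omega> in P. \<omega> \<in> A" by (rule AE_prob_1)
    \<comment> \<open>A measurable version of the path functional: on A it is the limit of the
      measurable functionals of interpolations, off A it is 0.\<close>
    define F where "F \<omega> = indicator A \<omega> * \<Phi> (\<lambda>t. X t \<omega>)" for \<omega>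
    have flim: "(\<lambda>j. f (Suc j) \<omega>) \<longlonglongrightarrow> \<Phi> (\<lambda>t. X t \<omega>)" if A: "\<omega> \<in> A" for \<omega>
    proof -
      obtain r where r: "0 < r" "\<omega> \<in> tame P X \<beta> r" using Ar[OF A] by (elim exE conjE)
      define H' where "H' = chain_const \<beta> * r"
      have H': "0 < H'" "0 < 3 * H'" "0 \<le> H'" "H' \<le> 3 * H'" using chain_const_pos[OF \<beta>0(1)] r by (auto simp: H'_def)
      note pb = path[OF r(2,1), folded H'_def]
      show ?thesis unfolding f_def
      proof (rule uniform_limit_tendsto[OF \<beta>(1) H'(2) interp_path[OF pb _ \<beta>0 H'(3)] hoelder_ball_mono[OF H'(4) pb]])
        show "0 < Suc j" for j by simp
        fix e :: real assume e: "0 < e"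
        obtain D where D: "\<forall>d\<ge>D. 2 * H' * (1 / real d) powr \<beta> \<le> e"
          using inverse_powr_small[OF \<beta>0(1) e, of "2 * H'"] by (elim exE conjE)
        show "\<exists>J. \<forall>j\<ge>J. \<forall>t\<in>{0..1}. \<bar>interp (Suc j) (\<lambda>i. X (real i / real (Suc j)) \<omega>) t - X t \<omega>\<bar> \<le> e"
        proof (intro exI[of _ D] allI impI ballI)
          fix j and t :: real assume j: "D \<le> j" and t: "t \<in> {0..1}"
          have "\<bar>X t \<omega> - interp (Suc j) (\<lambda>i. X (real i / real (Suc j)) \<omega>) t\<bar> \<le> 2 * H' * (1 / real (Suc j)) powr \<beta>"
            using interp_close[OF _ pb H'(3) \<beta>0(1), of "Suc j" t] t by simp
          also have "\<dots> \<le> e" by (rule D[rule_format]) (use j in simp)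
          finally show "\<bar>interp (Suc j) (\<lambda>i. X (real i / real (Suc j)) \<omega>) t - X t \<omega>\<bar> \<le> e" by (simp add: abs_minus_commute)
        qed
      qed
    qed
    have Fm: "F \<in> borel_measurable P"
    proof (rule borel_measurable_LIMSEQ_real)
      show "(\<lambda>\<omega>. indicator A \<omega> * f (Suc j) \<omega>) \<in> borel_measurable P" for j
        using fm[of "Suc j"] Am by (intro borel_measurable_times borel_measurable_indicator) auto
      show "(\<lambda>j. indicator A \<omega> * f (Suc j) \<omega>) \<longlonglongrightarrow> F \<omega>" for \<omega>
        unfolding F_def using flim[of \<omega>] by (cases "\<omega> \<in> A") auto
    qed
    have Fae: "AE \<omega> in completion P. F \<omega> = \<Phi> (\<lambda>t. X t \<omega>)"
      by (rule AE_completion) (use AEA in \<open>auto simp: F_def\<close>)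
    have Fmc: "F \<in> borel_measurable (completion P)" by (rule measurable_completion[OF Fm])
    have Gm: "(\<lambda>\<omega>. \<Phi> (\<lambda>t. X t \<omega>)) \<in> borel_measurable (completion P)"
    proof (rule measurableI)
      fix B :: "real set" assume B: "B \<in> sets borel"
      show "(\<lambda>\<omega>. \<Phi> (\<lambda>t. X t \<omega>)) -` B \<inter> space (completion P) \<in> sets (completion P)"
      proof (rule completion.in_sets_AE[OF _ measurable_sets[OF Fmc B]])
        show "AE \<omega> in completion P. \<omega> \<in> F -` B \<inter> space (completion P) \<longleftrightarrow> \<omega> \<in> (\<lambda>\<omega>. \<Phi> (\<lambda>t. X t \<omega>)) -` B \<inter> space (completion P)"
          using Fae by eventually_elim simp
      qed auto
    qed simp
    have "(\<integral>\<omega>. \<Phi> (\<lambda>t. X t \<omega>) \<partial>completion P) = (\<integral>\<omega>. F \<omega> \<partial>completion P)"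
      by (rule integral_cong_AE[OF Gm Fmc]) (use Fae in eventually_elim, simp)
    also have "\<dots> = expectation F" by (rule integral_completion[OF Fm])
    finally have FE: "(\<integral>\<omega>. \<Phi> (\<lambda>t. X t \<omega>) \<partial>completion P) = expectation F" .
    have Fb: "\<bar>F \<omega>\<bar> \<le> K" for \<omega>
    proof (cases "\<omega> \<in> A")
      case True
      then obtain r where r: "0 < r" "\<omega> \<in> tame P X \<beta> r" using Ar by blast
      show ?thesis using \<Phi>_bound[OF path_sp[OF r(2,1)]] True by (simp add: F_def)
    qed (simp add: F_def K)
    \<comment> \<open>Good event: being tame and having a moderate initial value each fail with
      probability at most \<eta>, whence 2 \<eta>.\<close>
    define S where "S = tame P X \<beta> R \<inter> {\<omega>\<in>space P. \<bar>X 0 \<omega>\<bar> \<le> R0}"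
    have X0m: "X 0 \<in> borel_measurable P" by (rule Xm) auto
    have X0s: "{\<omega>\<in>space P. \<bar>X 0 \<omega>\<bar> \<le> R0} \<in> events" "{\<omega>\<in>space P. R0 < \<bar>X 0 \<omega>\<bar>} \<in> events"
      using X0m by measurable
    have Sm: "S \<in> events" unfolding S_def using tm(1)[OF R(2)] X0s(1) by (rule sets.Int)
    have PS: "prob (space P - S) \<le> 2 * \<eta>"
    proof -
      have ev: "space P - tame P X \<beta> R \<in> events" "{\<omega>\<in>space P. R0 < \<bar>X 0 \<omega>\<bar>} \<in> events" using tm(1)[OF R(2)] X0s(2) by auto
      have "prob (space P - S) \<le> prob ((space P - tame P X \<beta> R) \<union> {\<omega>\<in>space P. R0 < \<bar>X 0 \<omega>\<bar>})"
        by (rule finite_measure_mono) (use ev in \<open>auto simp: S_def\<close>)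
      also have "\<dots> \<le> prob (space P - tame P X \<beta> R) + prob {\<omega>\<in>space P. R0 < \<bar>X 0 \<omega>\<bar>}"
        by (rule measure_Un_le[OF ev])
      also have "\<dots> \<le> \<eta> + \<eta>" using order_trans[OF tm(2)[OF R(2)] RC] X0 by (rule add_mono)
      finally show ?thesis by simp
    qed
    have close: "\<bar>F \<omega> - f d \<omega>\<bar> \<le> \<epsilon> + 2 * K * indicator (space P - S) \<omega>" if \<omega>: "\<omega> \<in> space P" for \<omega>
    proof (cases "\<omega> \<in> S")
      case True
      then have w: "\<omega> \<in> tame P X \<beta> R" "\<bar>X 0 \<omega>\<bar> \<le> R0" by (auto simp: S_def)
      then have "\<omega> \<in> A" by (simp add: A_def)
      then have F: "F \<omega> = \<Phi> (\<lambda>t. X t \<omega>)" by (simp add: F_def)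
      note pb = path[OF w(1) R(2), folded H_def]
      have "\<bar>X t \<omega> - interp d (\<lambda>i. X (real i / d) \<omega>) t\<bar> \<le> u" if "t \<in> {0..1}" for t
        using interp_close[OF d pb less_imp_le[OF H] \<beta>0(1), of t] du[rule_format, OF dd] that by force
      then have "\<bar>\<Phi> (\<lambda>t. X t \<omega>) - f d \<omega>\<bar> \<le> \<epsilon>"
        unfolding f_def
        using uc[rule_format, OF hoelder_ball_mono[OF H3(2) pb] interp_path[OF pb d \<beta>0 less_imp_le[OF H]] w(2)] by blast
      then show ?thesis unfolding F using True by simp
    next
      case False
      then show ?thesis using Fb[of \<omega>] fb[OF d, of \<omega>] \<epsilon> \<omega> by simp
    qed
    have Fi: "integrable P F" by (rule integrable_const_bound[of _ K]) (use Fb Fm in auto)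
    have fi: "integrable P (f d)" by (rule integrable_const_bound[of _ K]) (use fb[OF d] fm[OF d] in auto)
    have "\<bar>expectation F - expectation (f d)\<bar> = \<bar>expectation (\<lambda>\<omega>. F \<omega> - f d \<omega>)\<bar>" using Fi fi by simp
    also have "\<dots> \<le> expectation (\<lambda>\<omega>. \<bar>F \<omega> - f d \<omega>\<bar>)" by (rule integral_abs_bound)
    also have "\<dots> \<le> expectation (\<lambda>\<omega>. \<epsilon> + 2 * K * indicator (space P - S) \<omega>)"
    proof (rule integral_mono)
      show "integrable P (\<lambda>\<omega>. \<bar>F \<omega> - f d \<omega>\<bar>)" using Fi fi by auto
      show "integrable P (\<lambda>\<omega>. \<epsilon> + 2 * K * indicator (space P - S) \<omega>)"
        using Sm by (auto intro!: integrable_real_indicator simp: emeasure_eq_measure)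
    qed (rule close)
    also have "\<dots> = \<epsilon> + 2 * K * prob (space P - S)"
      using Sm by (simp add: integrable_real_indicator emeasure_eq_measure prob_space)
    also have "\<dots> \<le> \<epsilon> + 2 * K * (2 * \<eta>)" using PS K by (intro add_left_mono mult_left_mono) auto
    finally show "\<bar>(\<integral>\<omega>. \<Phi> (\<lambda>t. X t \<omega>) \<partial>completion P) - (\<integral>\<omega>. \<Phi> (interp d (\<lambda>i. X (real i / d) \<omega>)) \<partial>P)\<bar> \<le> \<epsilon> + 4 * K * \<eta>"
      unfolding FE f_def by simp
  qed
qed

end

section \<open>Tightness of schemes and solution, and weak convergence\<close>

lemma (in euler_scheme) euler_proc_interp:
  assumes n: "0 < n" and t: "0 \<le> t" "t \<le> 1"
  shows "Yn n t \<omega> = interp n (\<lambda>k. euler_pts a b \<sigma> \<zeta> y0 n k \<omega>) t"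
proof -
  obtain j where "j < n" "real j / n \<le> t" "t \<le> real (Suc j) / n" using unit_cell[OF n t] by (elim exE conjE)
  then show ?thesis using euler_proc_cell[OF n] interp_cell by metis
qed

lemma (in euler_scheme) Yn_tight:
  assumes n: "0 < n" and p: "1 \<le> p"
  shows "tight_process N (\<lambda>t \<omega>. Yn n t \<omega>) (3 * 4 ^ (2 * p) * inc_const p) p"
  unfolding tight_process_def
proof (intro conjI ballI allI impI)
  show "prob_space N" by unfold_locales
  show "(\<lambda>\<omega>. Yn n t \<omega>) \<in> borel_measurable N" if "t \<in> {0..1}" for t
    using Yn_measurable[OF n] that by simp
  show "continuous_on {0..1} (\<lambda>t. Yn n t \<omega>)" for \<omega>
  proof -
    obtain H where "0 < H" "interp n (\<lambda>k. euler_pts a b \<sigma> \<zeta> y0 n k \<omega>) \<in> hoelder_ball 1 H"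
      using interp_in_hoelder_ball[OF n, of 1 "\<lambda>k. euler_pts a b \<sigma> \<zeta> y0 n k \<omega>"] by auto
    then have "continuous_on {0..1} (interp n (\<lambda>k. euler_pts a b \<sigma> \<zeta> y0 n k \<omega>))"
      by (intro hoelder_ball_continuous[of _ 1]) auto
    then show ?thesis by (rule continuous_on_eq) (use euler_proc_interp[OF n] in auto)
  qed
  fix m i :: nat and r :: real assume i: "i < 2 ^ m" and r: "0 < r"
  have d: "real (Suc i) / 2 ^ m - real i / 2 ^ m = 1 / 2 ^ m" by (simp add: diff_divide_distrib[symmetric])
  have "real i / 2 ^ m \<le> real (Suc i) / 2 ^ m" by (simp add: divide_right_mono)
  then show "prob {\<omega> \<in> space N. r \<le> \<bar>Yn n (real (Suc i) / 2 ^ m) \<omega> - Yn n (real i / 2 ^ m) \<omega>\<bar>}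
      \<le> 3 * 4 ^ (2 * p) * inc_const p * (1 / 2 ^ m) ^ p / r ^ (2 * p)"
    using Yn_tail[OF n _ _ _ p r, of "real i / 2 ^ m" "real (Suc i) / 2 ^ m", unfolded d] dyadic_points_unit[OF i] by simp
qed

text \<open>Dyadic points of level m are the grid of \<open>solution_tail\<close> with 2^m cells.
  The constant is that of the schemes, so one choice of parameters serves both.\<close>

lemma solution_tight:
  fixes M :: "'a measure" and N :: "'b measure"
  assumes E: "euler_scheme N \<zeta> \<sigma> a b Ca Cb" and S: "sde M F W a b Ca Cb y0 Y" and p: "1 \<le> p"
  shows "tight_process M Y (3 * 4 ^ (2 * p) * euler_scheme.inc_const N \<zeta> \<sigma> a b Ca Cb y0 p) p"
proof -
  interpret S: sde M F W a b Ca Cb y0 Y by (rule S)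
  show ?thesis
    unfolding tight_process_def
  proof (intro conjI ballI allI impI)
    show "prob_space M" by unfold_locales
    show "Y t \<in> borel_measurable M" if "t \<in> {0..1}" for t using S.Y_meas that by simp
    show "continuous_on {0..1} (\<lambda>t. Y t \<omega>)" if "\<omega> \<in> space M" for \<omega> by (rule S.Y_cont[OF that])
    fix m i :: nat and r :: real assume i: "i < 2 ^ m" and r: "0 < r"
    have d: "real (Suc i) / 2 ^ m - real i / 2 ^ m = 1 / 2 ^ m" by (simp add: diff_divide_distrib[symmetric])
    have c: "real (2 ^ m) = 2 ^ m" by simp
    show "S.prob {\<omega> \<in> space M. r \<le> \<bar>Y (real (Suc i) / 2 ^ m) \<omega> - Y (real i / 2 ^ m) \<omega>\<bar>}
      \<le> 3 * 4 ^ (2 * p) * euler_scheme.inc_const N \<zeta> \<sigma> a b Ca Cb y0 p * (1 / 2 ^ m) ^ p / r ^ (2 * p)"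
      by (rule solution_tail[OF E S _ _ _ p r, of "2 ^ m" i "Suc i", unfolded c, unfolded d]) (use i in auto)
  qed
qed

text \<open>On both sides the path is replaced by its interpolation with d nodes at a cost that is
  uniform in n. For fixed d the rest is a finite-dimensional statement, since \<open>\<Phi>\<close>
  of an interpolation is a test function of the node values.\<close>

theorem mainTheorem5:
  fixes M :: "'a measure" and N :: "'b measure"
    and F :: "real \<Rightarrow> 'a set set" and W Y :: "real \<Rightarrow> 'a \<Rightarrow> real"
    and \<zeta> :: "nat \<Rightarrow> 'b \<Rightarrow> real" and a b :: "real \<Rightarrow> real"
    and y0 C\<^sub>a C\<^sub>b lam :: real and \<Phi> :: "(real \<Rightarrow> real) \<Rightarrow> real"
  assumes "prob_space M" and "prob_space N"
    and "C\<^sub>b > 0" and "\<And>x y. \<bar>b x - b y\<bar> \<le> C\<^sub>b * \<bar>x - y\<bar>"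
    and "C\<^sub>a > 0" and "\<And>x y. \<bar>a x - a y\<bar> \<le> C\<^sub>a * sqrt \<bar>x - y\<bar>"
    and "brownian_motion M F W"
    and "strong_solution M F W a b y0 Y"
    and "\<And>i. i \<ge> 1 \<Longrightarrow> \<zeta> i \<in> borel_measurable N"
    and "prob_space.indep_vars N (\<lambda>_. borel) \<zeta> {1::nat..}"
    and "\<And>i. i \<ge> 1 \<Longrightarrow> distr N borel (\<zeta> i) = distr N borel (\<zeta> 1)"
    and "\<And>p::nat. integrable N (\<lambda>\<omega>. \<bar>\<zeta> 1 \<omega>\<bar> ^ p)"
    and "integral\<^sup>L N (\<zeta> 1) = 0"
    and "integral\<^sup>L N (\<lambda>\<omega>. (\<zeta> 1 \<omega>)\<^sup>2) > 0"
    and "0 < lam" and "lam < 1/2"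
    and "\<exists>K. \<forall>f\<in>hoelder_space lam. \<bar>\<Phi> f\<bar> \<le> K"
    and "\<forall>f\<in>hoelder_space lam. \<forall>\<epsilon>>0. \<exists>\<delta>>0. \<forall>g\<in>hoelder_space lam.
           hoelder_norm lam (\<lambda>t. g t - f t) < \<delta> \<longrightarrow> \<bar>\<Phi> g - \<Phi> f\<bar> < \<epsilon>"
  shows "(\<lambda>n. integral\<^sup>L (completion N)
            (\<lambda>\<omega>. \<Phi> (euler_proc a b (sqrt (integral\<^sup>L N (\<lambda>\<omega>. (\<zeta> 1 \<omega>)\<^sup>2))) \<zeta> y0 n \<omega>)))
         \<longlonglongrightarrow> integral\<^sup>L (completion M) (\<lambda>\<omega>. \<Phi> (\<lambda>t. Y t \<omega>))"
proof -
  obtain K where "\<forall>f\<in>hoelder_space lam. \<bar>\<Phi> f\<bar> \<le> K" using assms(17) by (elim exE)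
  then interpret H: hoelder_functional \<Phi> lam K
    by (intro hoelder_functional.intro) (use assms(15,18) in blast)+
  define \<sigma> where "\<sigma> = sqrt (integral\<^sup>L N (\<lambda>\<omega>. (\<zeta> 1 \<omega>)\<^sup>2))"
  have \<sigma>: "0 < \<sigma>" "integral\<^sup>L N (\<lambda>\<omega>. (\<zeta> 1 \<omega>)\<^sup>2) = \<sigma>\<^sup>2" using assms(14) by (auto simp: \<sigma>_def)
  have co: "sde_coeffs a b C\<^sub>a C\<^sub>b" by (rule sde_coeffs.intro[OF assms(3,4,5,6)])
  have E: "euler_scheme N \<zeta> \<sigma> a b C\<^sub>a C\<^sub>b"
    by (intro euler_scheme.intro iid_noise.intro iid_noise_axioms.intro co assms(2) \<sigma> assms(9-13))
  have S: "sde M F W a b C\<^sub>a C\<^sub>b y0 Y"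
    by (intro sde.intro bm.intro bm_axioms.intro sde_axioms.intro co assms(1,7,8))
  interpret E: euler_scheme N \<zeta> \<sigma> a b C\<^sub>a C\<^sub>b y0 by (rule E)
  interpret S: sde M F W a b C\<^sub>a C\<^sub>b y0 Y by (rule S)
  \<comment> \<open>An exponent strictly between lam and 1/2: the gap to lam yields compactness, the
    gap to 1/2 lets the chaining series converge.\<close>
  define \<beta> where "\<beta> = (lam + 1 / 2) / 2"
  have \<beta>: "lam < \<beta>" "\<beta> < 1 / 2" "\<beta> \<le> 1" using assms(16) by (auto simp: \<beta>_def)
  have "0 < 1 - 2 * \<beta>" using \<beta>(2) by simp
  \<comment> \<open>p > 1 / (1 - 2 \<beta>): the closer lam is to 1/2, the higher the moments of the
    noise that enter.\<close>
  then obtain p :: nat where p: "1 < real p * (1 - 2 * \<beta>)" using ex_less_of_nat_mult[of "1 - 2 * \<beta>" 1] by blast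
  have p1: "1 \<le> p" using p by (cases p) auto
  define C where "C = 3 * 4 ^ (2 * p) * E.inc_const p"
  have C: "0 \<le> C" using E.inc_const_nonneg[OF p1] by (simp add: C_def)
  note TN = E.Yn_tight[OF _ p1, folded C_def]
  note TM = solution_tight[OF E S p1, folded C_def]
  have "\<bar>\<Phi> (interp 1 (\<lambda>_. 0))\<bar> \<le> K" by (rule H.interp_bound) (use \<beta> in auto)
  then have K: "0 \<le> K" by linarith
  show ?thesis
    unfolding \<sigma>_def[symmetric]
  proof (rule LIMSEQ_I)
    fix \<epsilon> :: real assume \<epsilon>: "0 < \<epsilon>"
    \<comment> \<open>32 = 4 * 8 makes 4 K \<eta> at most \<epsilon>/8; K + 1 avoids a division by
      0.\<close>
    define \<eta> where "\<eta> = \<epsilon> / (32 * (K + 1))"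
    have \<eta>: "0 < \<eta>" using \<epsilon> K by (simp add: \<eta>_def)
    have \<epsilon>8: "0 < \<epsilon> / 8" using \<epsilon> by simp
    have "4 * K * \<eta> \<le> 4 * (K + 1) * \<eta>" using \<eta> by simp
    also have "\<dots> = \<epsilon> / 8" using K by (simp add: \<eta>_def field_simps)
    finally have K\<eta>: "\<epsilon> / 8 + 4 * K * \<eta> \<le> \<epsilon> / 4" by simp
    obtain R1 where R1: "1 - \<eta> < S.prob (S.bounded_until R1 1)" using S.bounded_until_prob[OF \<eta>] by (elim exE conjE)
    define R0 where "R0 = max R1 \<bar>y0\<bar>"
    have XM: "S.prob {\<omega>\<in>space M. R0 < \<bar>Y 0 \<omega>\<bar>} \<le> \<eta>"
    proof -
      have B: "S.bounded_until R1 1 \<in> S.events" by (rule S.bounded_until_M) auto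
      have "\<bar>Y 0 \<omega>\<bar> \<le> R0" if "\<omega> \<in> S.bounded_until R1 1" for \<omega>
        using S.bounded_untilD[OF that, of 0] by (simp add: R0_def)
      then have "S.prob {\<omega>\<in>space M. R0 < \<bar>Y 0 \<omega>\<bar>} \<le> S.prob (space M - S.bounded_until R1 1)"
        using B by (intro S.finite_measure_mono) (auto simp: not_le[symmetric])
      then show ?thesis using S.prob_compl[OF B] R1 by linarith
    qed
    have XN: "E.prob {\<omega>\<in>space N. R0 < \<bar>E.Yn n 0 \<omega>\<bar>} \<le> \<eta>" if "0 < n" for n
    proof -
      have "E.Yn n 0 \<omega> = y0" for \<omega> using E.Yn_grid[OF that, of \<omega> 0] by simp
      then have e: "{\<omega>\<in>space N. R0 < \<bar>E.Yn n 0 \<omega>\<bar>} = {}" by (auto simp: R0_def)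
      show ?thesis unfolding e using \<eta> by simp
    qed
    \<comment> \<open>Obtained twice, because the statement is tied to one type of sample points and
      the two spaces have different types.\<close>
    obtain d1 where d1: "\<forall>d\<ge>d1. \<forall>(P :: 'b measure) X. tight_process P X C p \<longrightarrow> measure P {\<omega>\<in>space P. R0 < \<bar>X 0 \<omega>\<bar>} \<le> \<eta> \<longrightarrow>
        \<bar>(\<integral>\<omega>. \<Phi> (\<lambda>t. X t \<omega>) \<partial>completion P) - (\<integral>\<omega>. \<Phi> (interp d (\<lambda>i. X (real i / d) \<omega>)) \<partial>P)\<bar> \<le> \<epsilon> / 8 + 4 * K * \<eta>"
      using H.interp_expectation_close[OF \<beta>(1,2) C p \<epsilon>8 \<eta>, of R0] by (elim exE conjE)
    obtain d2 where d2: "0 < d2" "\<forall>d\<ge>d2. \<forall>(P :: 'a measure) X. tight_process P X C p \<longrightarrow> measure P {\<omega>\<in>space P. R0 < \<bar>X 0 \<omega>\<bar>} \<le> \<eta> \<longrightarrow>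
        \<bar>(\<integral>\<omega>. \<Phi> (\<lambda>t. X t \<omega>) \<partial>completion P) - (\<integral>\<omega>. \<Phi> (interp d (\<lambda>i. X (real i / d) \<omega>)) \<partial>P)\<bar> \<le> \<epsilon> / 8 + 4 * K * \<eta>"
      using H.interp_expectation_close[OF \<beta>(1,2) C p \<epsilon>8 \<eta>, of R0] by (elim exE conjE)
    define d where "d = max d1 d2"
    have d: "0 < d" "d1 \<le> d" "d2 \<le> d" using d2(1) by (auto simp: d_def)
    define EN where "EN n = (\<integral>\<omega>. \<Phi> (\<lambda>t. E.Yn n t \<omega>) \<partial>completion N)" for n
    define DN where "DN n = (\<integral>\<omega>. \<Phi> (interp d (\<lambda>i. E.Yn n (real i / d) \<omega>)) \<partial>N)" for n
    define EM where "EM = (\<integral>\<omega>. \<Phi> (\<lambda>t. Y t \<omega>) \<partial>completion M)"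
    define DM where "DM = (\<integral>\<omega>. \<Phi> (interp d (\<lambda>i. Y (real i / d) \<omega>)) \<partial>M)"
    have "DN \<longlonglongrightarrow> DM"
      unfolding DN_def[abs_def] DM_def by (rule fdd_convergence[OF E S d(1) H.fd_test_interp[OF d(1) \<beta>(1,3)]])
    moreover have "0 < \<epsilon> / 4" using \<epsilon> by simp
    ultimately obtain n0 where n0: "\<forall>n\<ge>n0. norm (DN n - DM) < \<epsilon> / 4" using LIMSEQ_D by blast
    have M: "\<bar>EM - DM\<bar> \<le> \<epsilon> / 4"
      unfolding EM_def DM_def by (rule order_trans[OF d2(2)[rule_format, OF d(3) TM XM] K\<eta>])
    show "\<exists>n0. \<forall>n\<ge>n0. norm ((\<integral>\<omega>. \<Phi> (euler_proc a b \<sigma> \<zeta> y0 n \<omega>) \<partial>completion N) - (\<integral>\<omega>. \<Phi> (\<lambda>t. Y t \<omega>) \<partial>completion M)) < \<epsilon>"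
    proof (intro exI[of _ "max n0 1"] allI impI)
      fix n assume "max n0 1 \<le> n"
      then have n: "0 < n" "n0 \<le> n" by auto
      have "\<bar>EN n - DN n\<bar> \<le> \<epsilon> / 4"
        unfolding EN_def DN_def by (rule order_trans[OF d1[rule_format, OF d(2) TN[OF n(1)] XN[OF n(1)]] K\<eta>])
      moreover have "\<bar>DN n - DM\<bar> < \<epsilon> / 4" using n0 n(2) by simp
      ultimately have "\<bar>EN n - EM\<bar> < \<epsilon>" using M \<epsilon> by linarith
      then show "norm ((\<integral>\<omega>. \<Phi> (euler_proc a b \<sigma> \<zeta> y0 n \<omega>) \<partial>completion N) - (\<integral>\<omega>. \<Phi> (\<lambda>t. Y t \<omega>) \<partial>completion M)) < \<epsilon>"
        unfolding EN_def EM_def by simp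
    qed
  qed
qed

end
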